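(* Let $T>0$, $\ell\ge 1$, $u_0\in L^1(\mathbb{R})$, $S\in L^1([0,T]\times\mathbb{R})$, and let $A(v)=|v|^{\ell+1}$ or $A(v)=\operatorname{sgn}(v)|v|^{\ell+1}$. Let $u$ be an entropy solution of $$\partial_t u+\partial_x A(u)=S \ \text{ on } (0,T)\times\mathbb{R},\qquad u(0)=u_0 \ \text{ on } \mathbb{R},$$ with associated kinetic function $f(t,x,v)=\mathbf{1}_{0<v<u(t,x)}-\mathbf{1}_{0>v>u(t,x)}$. Then, for all $\phi\in C_c^\infty(\mathbb{R})$, $$\int_{\mathbb{R}} f(t,x,v)\phi(v)\,dv\in W^{s,1}_{loc}((0,T)\times\mathbb{R})\qquad \text{for all } s<\min\left(\frac13,\frac1{\ell+1}\right).$$ In particular, if in addition $u_0\in L^\infty(\mathbb{R})$ and $S\in L^\infty([0,T]\times\mathbb{R})$, then $$u\in W^{s,1}_{loc}((0,T)\times\mathbb{R})\qquad \text{for all } s<\min\left(\frac13,\frac1{\ell+1}\right).$$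
   Context: Entropy solution (also called kinetic solution) of $\partial_t u+\operatorname{div}A(u)=S$ on $(0,T)\times\mathbb{R}^n$, $u(0)=u_0$ (here with $n=1$), for $u_0\in L^1(\mathbb{R}^n)$, $S\in L^1([0,T]\times\mathbb{R}^n)$: a function $u\in C([0,T];L^1(\mathbb{R}^n))$ such that the kinetic function $f(t,x,v)=\chi(v,u(t,x)):=\mathbf{1}_{0<v<u(t,x)}-\mathbf{1}_{0>v>u(t,x)}$ satisfies, in the sense of distributions in $(t,x,v)$, $$\partial_t f+a(v)\cdot\nabla_x f=\partial_v m+\delta_{u=v}S,\qquad f|_{t=0}=\chi(v,u_0),$$ where $a:=A'$, $\delta_{u=v}S$ is the distribution $\theta\mapsto\int S(t,x)\,\theta(t,x,u(t,x))\,dt\,dx$, and $m$ is a non-negative Radon measure with $\int m(t,x,v)\,dt\,dx\le\mu(v)$ for some $\mu\in L_0^\infty(\mathbb{R})$ (that is, the image of $m$ under $(t,x,v)\mapsto v$ is bounded by $\mu(v)\,dv$). Here $L_0^\infty(\mathbb{R})$ is the space of essentially bounded functions decaying to zero as $|v|\to\infty$. *)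

theory Defs
  imports "HOL-Analysis.Analysis"
begin

text \<open>
  In finite dimension, continuity of the derivative as a map into the linear forms amounts to
  continuity of every directional derivative, so this is the usual class C^k.
\<close>

primrec Ck :: "nat \<Rightarrow> ('a::euclidean_space \<Rightarrow> real) \<Rightarrow> bool" where
  "Ck 0 g \<longleftrightarrow> continuous_on UNIV g"
| "Ck (Suc k) g \<longleftrightarrow>
     g differentiable_on UNIV \<and> (\<forall>h. Ck k (\<lambda>z. frechet_derivative g (at z) h))"

definition test_function :: "'a::euclidean_space set \<Rightarrow> ('a \<Rightarrow> real) \<Rightarrow> bool" where
  "test_function \<Omega> \<theta> \<longleftrightarrow>
     (\<forall>k. Ck k \<theta>) \<and> compact (closure {z. \<theta> z \<noteq> 0}) \<and> closure {z. \<theta> z \<noteq> 0} \<subseteq> \<Omega>"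

text \<open>
  The Sobolev--Slobodeckij space W^(s,1)(V), for 0 \<le> s < 1, with W^(0,1)(V) = L^1(V).
  Integrability is absolute integrability with respect to Lebesgue measure.
\<close>

definition sobolev_W1 :: "real \<Rightarrow> 'a::euclidean_space set \<Rightarrow> ('a \<Rightarrow> real) \<Rightarrow> bool" where
  "sobolev_W1 s V g \<longleftrightarrow>
     g absolutely_integrable_on V \<and>
     (s = 0 \<or>
      (\<lambda>(z, w). \<bar>g z - g w\<bar> / norm (z - w) powr (real DIM('a) + s))
        absolutely_integrable_on (V \<times> V))"

definition sobolev_W1_loc :: "real \<Rightarrow> 'a::euclidean_space set \<Rightarrow> ('a \<Rightarrow> real) \<Rightarrow> bool" where
  "sobolev_W1_loc s \<Omega> g \<longleftrightarrow>
     (\<forall>V. open V \<and> compact (closure V) \<and> closure V \<subseteq> \<Omega> \<longrightarrow> sobolev_W1 s V g)"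

definition ess_bounded_on :: "'a::euclidean_space set \<Rightarrow> ('a \<Rightarrow> real) \<Rightarrow> bool" where
  "ess_bounded_on X g \<longleftrightarrow>
     g \<in> borel_measurable (lebesgue_on X) \<and> (\<exists>C. AE z in lebesgue_on X. \<bar>g z\<bar> \<le> C)"

definition L0_infinity :: "(real \<Rightarrow> real) \<Rightarrow> bool" where
  "L0_infinity \<mu> \<longleftrightarrow>
     ess_bounded_on UNIV \<mu> \<and>
     (\<forall>\<epsilon>>0. \<exists>R. AE v in lebesgue. \<bar>v\<bar> > R \<longrightarrow> \<bar>\<mu> v\<bar> < \<epsilon>)"

text \<open>
  A curve in C([0,T]; L^1(R)) is represented by a function of (t,x) that is jointly measurable
  (every such curve has a representative of this kind).
\<close>

definition continuous_L1 :: "real \<Rightarrow> (real \<Rightarrow> real \<Rightarrow> real) \<Rightarrow> bool" where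
  "continuous_L1 T u \<longleftrightarrow>
     (\<lambda>(t, x). u t x) \<in> borel_measurable (lebesgue_on ({0..T} \<times> UNIV)) \<and>
     (\<forall>t\<in>{0..T}. integrable lebesgue (u t)) \<and>
     (\<forall>t\<in>{0..T}. ((\<lambda>\<tau>. LINT x|lebesgue. \<bar>u \<tau> x - u t x\<bar>) \<longlongrightarrow> 0) (at t within {0..T}))"

definition kin_chi :: "real \<Rightarrow> real \<Rightarrow> real" where
  "kin_chi v w = indicator {0<..<w} v - indicator {w<..<0} v"

text \<open>
  On an open subset of a Euclidean space a Borel measure that is finite on compact sets is
  automatically regular, hence Radon.
\<close>

definition radon_measure_on :: "'a::euclidean_space set \<Rightarrow> 'a measure \<Rightarrow> bool" where
  "radon_measure_on \<Omega> m \<longleftrightarrow>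
     sets m = sets (restrict_space borel \<Omega>) \<and>
     (\<forall>K. compact K \<and> K \<subseteq> \<Omega> \<longrightarrow> emeasure m K < \<infinity>)"

text \<open>
  The condition \<open>\<integral> m(t,x,v) dt dx \<le> \<mu>(v)\<close>: the image of \<open>m\<close> under \<open>(t,x,v) \<mapsto> v\<close> is bounded by
  \<open>\<mu>(v) dv\<close>.
\<close>

definition v_marginal_le :: "(real \<times> real \<times> real) measure \<Rightarrow> (real \<Rightarrow> real) \<Rightarrow> bool" where
  "v_marginal_le m \<mu> \<longleftrightarrow>
     (AE v in lebesgue. 0 \<le> \<mu> v) \<and>
     (\<forall>B\<in>sets borel. emeasure (distr m borel (\<lambda>(t, x, v). v)) B
                     \<le> (\<integral>\<^sup>+v\<in>B. ennreal (\<mu> v) \<partial>lebesgue))"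

text \<open>
  The kinetic equation \<open>\<partial>\<^sub>t f + A'(v) \<partial>\<^sub>x f = \<partial>\<^sub>v m + \<delta>\<^bsub>u=v\<^esub> S\<close> for \<open>f(t,x,v) = \<chi>(v,u(t,x))\<close>, in the sense
  of distributions on \<open>(0,T) \<times> \<real> \<times> \<real>\<close>; all derivatives are moved to the test function.
\<close>

definition kinetic_equation ::
  "real \<Rightarrow> (real \<Rightarrow> real) \<Rightarrow> (real \<times> real \<Rightarrow> real) \<Rightarrow> (real \<Rightarrow> real \<Rightarrow> real)
     \<Rightarrow> (real \<times> real \<times> real) measure \<Rightarrow> bool" where
  "kinetic_equation T A S u m \<longleftrightarrow>
     (\<forall>\<theta>. test_function ({0<..<T} \<times> UNIV \<times> UNIV) \<theta> \<longrightarrow>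
        - (LINT (t, x, v):{0<..<T} \<times> UNIV \<times> UNIV|lebesgue.
             kin_chi v (u t x) *
               (frechet_derivative \<theta> (at (t, x, v)) (1, 0, 0)
                + deriv A v * frechet_derivative \<theta> (at (t, x, v)) (0, 1, 0)))
        = - (LINT p|m. frechet_derivative \<theta> (at p) (0, 0, 1))
          + (LINT (t, x):{0<..<T} \<times> UNIV|lebesgue. S (t, x) * \<theta> (t, x, u t x)))"

text \<open>
  The initial condition \<open>f|\<^bsub>t=0\<^esub> = \<chi>(v,u\<^sub>0)\<close> refers to the value at \<open>t = 0\<close> of the continuous curve
  \<open>t \<mapsto> f(t,\<cdot>,\<cdot>)\<close> in \<open>L\<^sup>1(\<real> \<times> \<real>)\<close>; it is continuous since
  \<open>\<integral> \<bar>\<chi>(v,w) - \<chi>(v,w')\<bar> dv = \<bar>w - w'\<bar>\<close> and \<open>u \<in> C([0,T];L\<^sup>1(\<real>))\<close>.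
\<close>

definition entropy_solution ::
  "real \<Rightarrow> (real \<Rightarrow> real) \<Rightarrow> (real \<times> real \<Rightarrow> real) \<Rightarrow> (real \<Rightarrow> real)
     \<Rightarrow> (real \<Rightarrow> real \<Rightarrow> real) \<Rightarrow> bool" where
  "entropy_solution T A S u\<^sub>0 u \<longleftrightarrow>
     continuous_L1 T u \<and>
     (\<exists>m \<mu>. radon_measure_on ({0<..<T} \<times> UNIV \<times> UNIV) m \<and>
            L0_infinity \<mu> \<and> v_marginal_le m \<mu> \<and>
            kinetic_equation T A S u m) \<and>
     (AE (x, v) in lebesgue. kin_chi v (u 0 x) = kin_chi v (u\<^sub>0 x))"

end

theory Submission
  imports Defs
begin

text \<open>
  Split the kinetic function at \<open>v = 0\<close>. On \<open>v > 0\<close>, and on \<open>v < 0\<close> after reflection, let \<open>F\<close> be the increment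
  of \<open>f = 1\<^bsub>0 < v < u\<^esub>\<close> in \<open>x\<close> by \<open>h\<close>, cut off to \<open>v \<sim> d\<close>. Doubling the variables as in the kinetic interaction
  identity of Golse and Perthame bounds \<open>\<integral>\<integral>\<integral>\<integral> (a(v) - a(w)) sgn(v - w) F(v) F(w) dw dv dx dt\<close> by \<open>C h d\<close>, because one
  factor \<open>F\<close> is an increment tested against a function of bounded variation. The left side controls
  \<open>d\<^bsup>l - 1\<^esup> \<integral>\<integral> D\<^sup>3\<close> for the increment \<open>D\<close> of \<open>u\<close> clamped to \<open>[d, 2d]\<close>, hence
  \<open>\<integral>\<integral> D \<le> \<lambda> |box| + C h d\<^bsup>2 - l\<^esup> / \<lambda>\<^sup>2\<close>. With \<open>\<lambda> = h\<^bsup>1/p\<^esup>\<close>, \<open>p = max 3 (l + 1)\<close>, summation over the dyadic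
  \<open>d \<ge> h\<^bsup>1/(l + 1)\<^esup>\<close> costs only a logarithm, so truncations of \<open>u\<close> have \<open>L\<^sup>1\<close> increments \<open>O(|h|\<^sup>s)\<close> in \<open>x\<close>
  for every \<open>s < 1/p\<close>. The averages \<open>\<integral> f \<phi> dv\<close> and their fluxes are Lipschitz functions of such truncations,
  and the averaged equation turns their regularity in \<open>x\<close> into regularity in \<open>t\<close>. For bounded data, testing with a
  smoothed indicator of \<open>v > C + C't\<close> shows that \<open>u\<close> is bounded, so that \<open>u\<close> itself is such an average.
\<close>

text \<open>The derivative of the flux has size |v|^(l-1) and degenerates at v = 0, so no coercivity
  uniform in v is available: each band v ~ d is treated alone and loses d^(1-l). What makes up for
  it is that every term on the right is small on a band: \<open>m\<close> because its v-marginal is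
  bounded, the source because it meets an integral over w of length O(d). No regularity of f is used
  for the factor h; the only regular object is the step function in y - x. The exponent comes from
  balancing the two terms of the estimate for one band. Points with increment D \<le> lambda cost
  lambda; the others satisfy D \<le> D^3 / lambda^2 and cost h d^(2-l) / lambda^2. If l \<le> 2, the
  latter is worst for d of order 1, and balance means lambda^3 = h; if l \<ge> 2, it is worst on the
  lowest band d = lambda, and balance means lambda^(l+1) = h. Bands below lambda need no estimate,
  because a truncation at that level is itself O(lambda).\<close>

section \<open>Smooth functions and mollifiers\<close>

lemma Ck_SucI:
  fixes g :: "'a::euclidean_space \<Rightarrow> real"
  assumes g: "\<And>z. (g has_derivative g' z) (at z)" and "\<And>h. Ck k (\<lambda>z. g' z h)"
  shows "Ck (Suc k) g"
proof -
  have "frechet_derivative g (at z) = g' z" for z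
    using frechet_derivative_at[OF g] by simp
  then show ?thesis
    using assms by (auto simp: differentiable_on_def differentiable_def)
qed

lemma Ck_SucD: "Ck (Suc k) g \<Longrightarrow> Ck k g"
proof (induction k arbitrary: g)
  case 0
  then show ?case by (auto intro: differentiable_imp_continuous_on)
next
  case (Suc k)
  then show ?case by (metis Ck.simps(2))
qed

lemma Ck_SucE:
  fixes g :: "'a::euclidean_space \<Rightarrow> real"
  assumes "Ck (Suc k) g"
  shows "(g has_derivative frechet_derivative g (at z)) (at z)" "Ck k (\<lambda>z. frechet_derivative g (at z) h)"
  using assms by (auto simp: differentiable_on_def frechet_derivative_works)

lemma Ck_const [simp]: "Ck k (\<lambda>z::'a::euclidean_space. c)"
proof (induction k arbitrary: c)
  case (Suc k)
  show ?case by (rule Ck_SucI[where g' = "\<lambda>z h. 0"]) (auto intro: Suc)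
qed simp

lemma Ck_add:
  fixes f g :: "'a::euclidean_space \<Rightarrow> real"
  shows "Ck k f \<Longrightarrow> Ck k g \<Longrightarrow> Ck k (\<lambda>z. f z + g z)"
proof (induction k arbitrary: f g)
  case 0
  then show ?case by (auto intro: continuous_intros)
next
  case (Suc k)
  show ?case
    by (rule Ck_SucI[where g' = "\<lambda>z h. frechet_derivative f (at z) h + frechet_derivative g (at z) h"])
       (use Suc in \<open>auto intro!: derivative_eq_intros Suc.IH dest: Ck_SucE simp del: Ck.simps\<close>)
qed

lemma Ck_mult:
  fixes f g :: "'a::euclidean_space \<Rightarrow> real"
  shows "Ck k f \<Longrightarrow> Ck k g \<Longrightarrow> Ck k (\<lambda>z. f z * g z)"
proof (induction k arbitrary: f g)
  case 0
  then show ?case by (auto intro: continuous_intros)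
next
  case (Suc k)
  show ?case
    by (rule Ck_SucI[where g' = "\<lambda>z h. f z * frechet_derivative g (at z) h + frechet_derivative f (at z) h * g z"])
       (use Suc in \<open>auto intro!: derivative_eq_intros Suc.IH Ck_add dest: Ck_SucE Ck_SucD simp del: Ck.simps\<close>)
qed

lemma Ck_inverse:
  fixes f :: "'a::euclidean_space \<Rightarrow> real"
  shows "Ck k f \<Longrightarrow> (\<And>z. f z \<noteq> 0) \<Longrightarrow> Ck k (\<lambda>z. inverse (f z))"
proof (induction k)
  case 0
  then show ?case by (auto intro: continuous_intros)
next
  case (Suc k)
  show ?case
  proof (rule Ck_SucI[where g' = "\<lambda>z h. - (inverse (f z) * frechet_derivative f (at z) h * inverse (f z))"])
    fix z
    show "((\<lambda>z. inverse (f z)) has_derivative (\<lambda>h. - (inverse (f z) * frechet_derivative f (at z) h * inverse (f z)))) (at z)"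
      by (intro Deriv.has_derivative_inverse Suc.prems Ck_SucE(1)[OF Suc.prems(1)])
  next
    fix h
    have "Ck k (\<lambda>z. (-1) * (inverse (f z) * frechet_derivative f (at z) h * inverse (f z)))"
      using Suc by (intro Ck_mult Ck_const Suc.IH) (auto dest: Ck_SucE Ck_SucD simp del: Ck.simps)
    then show "Ck k (\<lambda>z. - (inverse (f z) * frechet_derivative f (at z) h * inverse (f z)))"
      by simp
  qed
qed

lemma Ck_compose_affine:
  fixes f :: "'b::euclidean_space \<Rightarrow> real" and L :: "'a::euclidean_space \<Rightarrow> 'b"
  assumes L: "bounded_linear L"
  shows "Ck k f \<Longrightarrow> Ck k (\<lambda>z. f (L z + c))"
proof (induction k arbitrary: f)
  case 0
  then have f: "continuous_on UNIV f" by simp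
  show ?case
    by (auto intro!: continuous_on_compose2[OF f] continuous_intros linear_continuous_on[OF L])
next
  case (Suc k)
  show ?case
  proof (rule Ck_SucI[where g' = "\<lambda>z h. frechet_derivative f (at (L z + c)) (L h)"])
    fix z
    have "((\<lambda>z. L z + c) has_derivative L) (at z)"
      by (auto intro!: derivative_eq_intros bounded_linear_imp_has_derivative L)
    from diff_chain_at[OF this, of f "frechet_derivative f (at (L z + c))"] Ck_SucE(1)[OF Suc.prems]
    show "((\<lambda>z. f (L z + c)) has_derivative (\<lambda>h. frechet_derivative f (at (L z + c)) (L h))) (at z)"
      by (simp add: o_def)
  qed (use Suc in \<open>auto intro: Suc.IH dest: Ck_SucE simp del: Ck.simps\<close>)
qed

definition smooth :: "('a::euclidean_space \<Rightarrow> real) \<Rightarrow> bool" where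
  "smooth g \<longleftrightarrow> (\<forall>k. Ck k g)"

lemma smooth_const [simp]: "smooth (\<lambda>z. c)"
  and smooth_add: "smooth f \<Longrightarrow> smooth g \<Longrightarrow> smooth (\<lambda>z. f z + g z)"
  and smooth_mult: "smooth f \<Longrightarrow> smooth g \<Longrightarrow> smooth (\<lambda>z. f z * g z)"
  and smooth_inverse: "smooth f \<Longrightarrow> (\<And>z. f z \<noteq> 0) \<Longrightarrow> smooth (\<lambda>z. inverse (f z))"
  and smooth_compose_affine: "bounded_linear L \<Longrightarrow> smooth k \<Longrightarrow> smooth (\<lambda>z. k (L z + c))"
  by (auto simp: smooth_def intro: Ck_add Ck_mult Ck_inverse Ck_compose_affine)

lemma smooth_diff: "smooth f \<Longrightarrow> smooth g \<Longrightarrow> smooth (\<lambda>z. f z - g z)"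
  using smooth_add[of f "\<lambda>z. (-1) * g z"] smooth_mult[of "\<lambda>z. -1" g] by simp

lemma smooth_affine_real: "smooth f \<Longrightarrow> smooth (\<lambda>x::real. f (a * x + b))" for f :: "real \<Rightarrow> real"
  using smooth_compose_affine[of "\<lambda>x. a * x" f b] bounded_linear_mult_right by blast

lemma smooth_has_derivative:
  "smooth g \<Longrightarrow> (g has_derivative frechet_derivative g (at z)) (at z)"
  using Ck_SucE[of 0 g] unfolding smooth_def by blast

lemma smooth_continuous_on: "smooth g \<Longrightarrow> continuous_on X g"
  unfolding smooth_def by (metis Ck.simps(1) continuous_on_subset subset_UNIV)

lemma smooth_measurable [measurable_dest]: "smooth g \<Longrightarrow> g \<in> borel_measurable borel"
  by (intro borel_measurable_continuous_onI smooth_continuous_on)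

lemma smooth_frechet: "smooth g \<Longrightarrow> smooth (\<lambda>z. frechet_derivative g (at z) h)"
  unfolding smooth_def by (metis Ck.simps(2))

lemma has_real_derivative_deriv_smooth:
  fixes g :: "real \<Rightarrow> real"
  shows "smooth g \<Longrightarrow> (g has_real_derivative deriv g x) (at x)"
  by (metis DERIV_deriv_iff_real_differentiable differentiable_def smooth_has_derivative)

lemma smooth_deriv: fixes g :: "real \<Rightarrow> real" shows "smooth g \<Longrightarrow> smooth (deriv g)"
proof -
  assume g: "smooth g"
  have "frechet_derivative g (at z) 1 = deriv g z" for z
    using frechet_derivative_at[OF has_real_derivative_deriv_smooth[OF g, of z, unfolded has_field_derivative_def]]
    by (metis mult.right_neutral)
  with smooth_frechet[OF g, of 1] show ?thesis by simp
qed

lemma Ck_Suc_real: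
  fixes g :: "real \<Rightarrow> real"
  assumes "\<And>x. (g has_real_derivative g' x) (at x)" "Ck k g'"
  shows "Ck (Suc k) g"
  by (rule Ck_SucI[where g' = "\<lambda>z h. g' z * h"])
     (use assms in \<open>auto simp: has_field_derivative_def intro: Ck_mult\<close>)

section \<open>The flat exponential, a smooth step and a bump of mass one\<close>

definition flat :: "nat \<Rightarrow> real \<Rightarrow> real" where
  "flat n x = (if 0 < x then (1/x) ^ n * exp (- (1/x)) else 0)"

lemma flat_nonneg: "0 \<le> flat n x" by (simp add: flat_def)
lemma flat_pos: "0 < x \<Longrightarrow> 0 < flat n x" by (simp add: flat_def)
lemma flat_nonpos: "x \<le> 0 \<Longrightarrow> flat n x = 0" by (simp add: flat_def)

lemma flat_tendsto_0: "(flat n \<longlongrightarrow> 0) (at 0)"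
proof -
  have "((\<lambda>x. x ^ n / exp x) \<longlongrightarrow> 0) (at_top :: real filter)"
    by (rule tendsto_power_div_exp_0)
  then have "((\<lambda>x::real. (inverse x) ^ n / exp (inverse x)) \<longlongrightarrow> 0) (at_right 0)"
    by (rule filterlim_compose[OF _ filterlim_inverse_at_top_right])
  moreover have "\<forall>\<^sub>F x in at_right 0. (inverse x) ^ n / exp (inverse x) = flat n (x::real)"
    by (auto simp: eventually_at_filter flat_def exp_minus field_simps)
  ultimately have r: "(flat n \<longlongrightarrow> 0) (at_right 0)" by (rule Lim_transform_eventually)
  have l: "(flat n \<longlongrightarrow> 0) (at_left 0)"
    by (rule tendsto_eventually) (auto simp: eventually_at_filter flat_def)
  show ?thesis using l r by (simp add: filterlim_at_split)
qed

text \<open>Powers of 1/x are built into \<open>flat\<close> so that the derivative of a member of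
  the family is a combination of members; smoothness is then a single induction over the whole
  family. At the origin the difference quotient of \<open>flat n\<close> is
  \<open>flat (Suc n)\<close>, which tends to 0.\<close>

lemma flat_deriv:
  "(flat n has_real_derivative (flat (n+2) x - real n * flat (n+1) x)) (at x)"
proof -
  consider "x > 0" | "x < 0" | "x = 0" by linarith
  then show ?thesis
  proof cases
    case 1
    have n: "real n * (1/x) ^ (n - 1) = real n * (1/x) ^ n * x"
      using 1 by (cases n) auto
    have "((\<lambda>x. (1/x) ^ n * exp (- (1/x))) has_real_derivative
        (real n * (1/x) ^ (n - 1)) * (- (1 / x\<^sup>2)) * exp (- (1/x)) + (1/x) ^ n * (exp (- (1/x)) * (1 / x\<^sup>2))) (at x)"
      using 1 by (auto intro!: derivative_eq_intros simp: power2_eq_square)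
    also have "(real n * (1/x) ^ (n - 1)) * (- (1 / x\<^sup>2)) * exp (- (1/x)) + (1/x) ^ n * (exp (- (1/x)) * (1 / x\<^sup>2))
        = flat (n+2) x - real n * flat (n+1) x"
      unfolding n using 1 by (simp add: flat_def field_simps power2_eq_square)
    finally have "((\<lambda>x. (1/x) ^ n * exp (- (1/x))) has_real_derivative (flat (n+2) x - real n * flat (n+1) x)) (at x)" .
    moreover have "\<forall>\<^sub>F y in nhds x. (1/y) ^ n * exp (- (1/y)) = flat n y"
      using eventually_nhds_in_open[of "{0<..}" x] 1 by (auto elim!: eventually_mono simp: flat_def)
    ultimately show ?thesis
      by (rule DERIV_cong_ev[OF refl _ refl, THEN iffD1, rotated])
  next
    case 2
    have "\<forall>\<^sub>F y in nhds x. 0 = flat n y"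
      using eventually_nhds_in_open[of "{..<0}" x] 2 by (auto elim!: eventually_mono simp: flat_def)
    moreover have "((\<lambda>x. 0) has_real_derivative (flat (n+2) x - real n * flat (n+1) x)) (at x)"
      using 2 by (simp add: flat_def)
    ultimately show ?thesis
      by (rule DERIV_cong_ev[OF refl _ refl, THEN iffD1])
  next
    case 3
    have "flat n h / h = flat (Suc n) h" for h by (simp add: flat_def)
    then have "((\<lambda>h. (flat n (0 + h) - flat n 0) / h) \<longlongrightarrow> 0) (at 0)"
      using flat_tendsto_0[of "Suc n"] by (simp add: flat_nonpos)
    then show ?thesis using 3 by (simp add: DERIV_def flat_nonpos)
  qed
qed

lemma Ck_flat: "Ck k (flat n)"
proof (induction k arbitrary: n)
  case 0
  show ?case using flat_deriv[of n] by (auto intro!: continuous_at_imp_continuous_on DERIV_isCont)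
next
  case (Suc k)
  have "Ck k (\<lambda>x. flat (n+2) x + (- real n) * flat (n+1) x)"
    by (intro Ck_add Ck_mult Ck_const Suc)
  then show ?case by (intro Ck_Suc_real[OF flat_deriv]) simp
qed

text \<open>A smooth version of half the sign function, constant outside (-1, 1). Subtracting 1/2
  makes it odd; the parities of the step and of its derivatives decide which doubled kernels are
  antisymmetric.\<close>

definition stp :: "real \<Rightarrow> real" where
  "stp x = flat 0 (1 + x) * inverse (flat 0 (1 + x) + flat 0 (1 - x)) - 1/2"

definition bmp :: "real \<Rightarrow> real" where "bmp = deriv stp"

lemma flat_sum_pos: "0 < flat 0 (1 + x) + flat 0 (1 - x)" for x :: real
proof (cases "0 < 1 + x")
  case True
  then show ?thesis using flat_pos[of "1+x" 0] flat_nonneg[of 0 "1-x"] by linarith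
next
  case False
  then show ?thesis using flat_pos[of "1-x" 0] flat_nonneg[of 0 "1+x"] by linarith
qed

lemma smooth_flat: "smooth (flat n)" by (simp add: smooth_def Ck_flat)

lemma smooth_stp: "smooth stp"
proof -
  have 1: "smooth (\<lambda>x::real. flat 0 (1 + x))" using smooth_affine_real[OF smooth_flat, of 0 1 1] by (simp add: add.commute)
  have 2: "smooth (\<lambda>x::real. flat 0 (1 - x))" using smooth_affine_real[OF smooth_flat, of 0 "-1" 1] by simp
  have "smooth (\<lambda>x. flat 0 (1 + x) * inverse (flat 0 (1 + x) + flat 0 (1 - x)) - 1/2)"
    by (intro smooth_diff smooth_mult smooth_inverse smooth_add 1 2 smooth_const) (use flat_sum_pos less_irrefl in metis)
  then show ?thesis unfolding stp_def[abs_def] .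
qed

lemma smooth_bmp: "smooth bmp" unfolding bmp_def by (intro smooth_deriv smooth_stp)

lemma stp_deriv: "(stp has_real_derivative bmp x) (at x)"
  unfolding bmp_def by (rule has_real_derivative_deriv_smooth[OF smooth_stp])

lemma stp_odd: "stp (- x) = - stp x"
  using flat_sum_pos[of x] by (simp add: stp_def field_simps)

lemma stp_right: "1 \<le> x \<Longrightarrow> stp x = 1/2"
  using flat_pos[of "1+x" 0] by (simp add: stp_def flat_nonpos)

lemma stp_left: "x \<le> -1 \<Longrightarrow> stp x = -1/2"
  using stp_odd[of x] stp_right[of "-x"] by simp

lemma stp_abs: "\<bar>stp x\<bar> \<le> 1/2"
  using flat_sum_pos[of x] flat_nonneg[of 0 "1+x"] flat_nonneg[of 0 "1-x"]
  by (simp add: stp_def field_simps abs_if)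

text \<open>Both the sign of the bump and its strict positivity inside (-1, 1) are read off this
  formula. The strict positivity later turns a vanishing weighted integral into a bound almost
  everywhere.\<close>

lemma bmp_eq: "bmp x = (flat 2 (1 + x) * flat 0 (1 - x) + flat 0 (1 + x) * flat 2 (1 - x)) / (flat 0 (1 + x) + flat 0 (1 - x))\<^sup>2"
proof -
  let ?a = "flat 0 (1 + x)" and ?b = "flat 0 (1 - x)"
  have f: "(flat 0 has_real_derivative flat 2 y) (at y)" for y using flat_deriv[of 0 y] by (simp add: numeral_2_eq_2)
  have "((\<lambda>x. flat 0 (1 + x)) has_real_derivative flat 2 (1 + x) * 1) (at x)"
    by (intro DERIV_chain2[OF f]) (auto intro!: derivative_eq_intros)
  moreover have "((\<lambda>x. flat 0 (1 - x)) has_real_derivative flat 2 (1 - x) * (-1)) (at x)"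
    by (intro DERIV_chain2[OF f]) (auto intro!: derivative_eq_intros)
  ultimately have g: "((\<lambda>x. flat 0 (1 + x)) has_real_derivative flat 2 (1 + x)) (at x)"
    "((\<lambda>x. flat 0 (1 - x)) has_real_derivative - flat 2 (1 - x)) (at x)"
    by simp_all
  have "(stp has_real_derivative (flat 2 (1 + x) * (?a + ?b) - ?a * (flat 2 (1 + x) + - flat 2 (1 - x))) / ((?a + ?b) * (?a + ?b)) - 0) (at x)"
    unfolding stp_def[abs_def] divide_inverse[symmetric]
    using flat_sum_pos[of x] by (intro DERIV_diff DERIV_divide DERIV_add g DERIV_const) auto
  also have "(flat 2 (1 + x) * (?a + ?b) - ?a * (flat 2 (1 + x) + - flat 2 (1 - x))) / ((?a + ?b) * (?a + ?b)) - 0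
     = (flat 2 (1 + x) * ?b + ?a * flat 2 (1 - x)) / (?a + ?b)\<^sup>2"
    by (simp add: algebra_simps power2_eq_square)
  finally have "(stp has_real_derivative (flat 2 (1 + x) * ?b + ?a * flat 2 (1 - x)) / (?a + ?b)\<^sup>2) (at x)" .
  from DERIV_unique[OF this stp_deriv] show ?thesis by simp
qed

lemma bmp_nonneg: "0 \<le> bmp x"
  unfolding bmp_eq by (intro divide_nonneg_nonneg add_nonneg_nonneg mult_nonneg_nonneg flat_nonneg) auto

lemma bmp_pos: assumes "\<bar>x\<bar> < 1" shows "0 < bmp x"
proof -
  have "0 < flat 2 (1 + x) * flat 0 (1 - x)" using assms by (intro mult_pos_pos flat_pos) auto
  moreover have "0 \<le> flat 0 (1 + x) * flat 2 (1 - x)" by (intro mult_nonneg_nonneg flat_nonneg)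
  moreover have "0 < (flat 0 (1 + x) + flat 0 (1 - x))\<^sup>2" using flat_sum_pos[of x] by simp
  ultimately show ?thesis unfolding bmp_eq by (intro divide_pos_pos add_pos_nonneg)
qed

lemma stp_mono: "x \<le> y \<Longrightarrow> stp x \<le> stp y"
  by (rule DERIV_nonneg_imp_nondecreasing) (use stp_deriv bmp_nonneg in blast)+

lemma bmp_even: "bmp (- x) = bmp x"
proof -
  have "((\<lambda>x. - stp (- x)) has_real_derivative bmp (- x)) (at x)"
    by (rule derivative_eq_intros DERIV_chain2[OF stp_deriv] refl)+ simp
  moreover have "(\<lambda>x. - stp (- x)) = stp" by (simp add: stp_odd)
  ultimately show ?thesis using DERIV_unique stp_deriv by metis
qed

lemma bmp_outside: assumes "1 \<le> \<bar>x\<bar>" shows "bmp x = 0"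
proof -
  have *: "bmp x = 0" if "1 \<le> x" for x
  proof -
    \<comment> \<open>The derivative vanishes at a maximum. This covers the endpoint x = 1, where
      \<open>stp\<close> is not locally constant.\<close>
    have "stp y \<le> stp x" for y
      using stp_abs[of y] stp_right[OF that] by linarith
    then show ?thesis by (intro DERIV_local_max[OF stp_deriv, of 1]) auto
  qed
  show ?thesis using *[of x] *[of "-x"] assms bmp_even[of x] by (auto simp: abs_if split: if_splits)
qed

section \<open>Integrals with respect to products of Lebesgue measure\<close>

text \<open>A non-integrable function has integral 0 by convention, so the bound persists when the
  integral on the left is only a default value.\<close>

lemma abs_integral_leI:
  fixes g :: "'a \<Rightarrow> real"
  assumes "(\<integral>\<^sup>+x. ennreal \<bar>g x\<bar> \<partial>M) \<le> ennreal c" "0 \<le> c"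
  shows "\<bar>integral\<^sup>L M g\<bar> \<le> c"
proof (cases "integrable M g")
  case True
  have "ennreal (norm (integral\<^sup>L M g)) \<le> (\<integral>\<^sup>+x. norm (g x) \<partial>M)"
    by (rule integral_norm_bound_ennreal[OF True])
  also have "\<dots> \<le> ennreal c" using assms by simp
  finally show ?thesis using assms by (simp add: ennreal_le_iff)
next
  case False
  then show ?thesis using assms by (simp add: not_integrable_integral_eq)
qed

lemma integrable_nnI:
  fixes g :: "'a \<Rightarrow> real"
  assumes "g \<in> borel_measurable M" "(\<integral>\<^sup>+x. ennreal \<bar>g x\<bar> \<partial>M) \<le> ennreal c"
  shows "integrable M g"
proof (rule integrableI_bounded)
  have "(\<integral>\<^sup>+x. ennreal (norm (g x)) \<partial>M) \<le> ennreal c" using assms(2) by simp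
  also have "\<dots> < \<infinity>" by simp
  finally show "(\<integral>\<^sup>+x. ennreal (norm (g x)) \<partial>M) < \<infinity>" .
qed fact

lemma integrable_abs_le:
  fixes f g :: "'a \<Rightarrow> real"
  assumes "integrable M f" "g \<in> borel_measurable M" "\<And>x. \<bar>g x\<bar> \<le> K * \<bar>f x\<bar>"
  shows "integrable M g"
proof (rule Bochner_Integration.integrable_bound[of M "\<lambda>x. K * \<bar>f x\<bar>"])
  have "\<bar>g x\<bar> \<le> \<bar>K * \<bar>f x\<bar>\<bar>" for x using assms(3)[of x] by linarith
  then show "AE x in M. norm (g x) \<le> norm (K * \<bar>f x\<bar>)" by simp
qed (use assms in auto)

lemma measurable_lborel2 [simp]: "borel_measurable (lborel \<Otimes>\<^sub>M lborel) = (borel_measurable (borel :: ('a::euclidean_space \<times> 'b::euclidean_space) measure) :: (_ \<Rightarrow> 'c::topological_space) set)"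
  by (simp add: lborel_prod)

lemma borel_fst [measurable]: "fst \<in> borel_measurable (borel :: ('a::second_countable_topology \<times> 'b::second_countable_topology) measure)"
  and borel_snd [measurable]: "snd \<in> borel_measurable (borel :: ('a::second_countable_topology \<times> 'b::second_countable_topology) measure)"
  by (simp_all add: borel_prod[symmetric])

text \<open>Product types carry their Borel sigma-algebra here rather than a product of
  sigma-algebras, so functions given by tuple patterns are resolved through \<open>fst\<close> and
  \<open>snd\<close>.\<close>

lemma measurable_case_prod_proj [measurable (raw)]:
  "(\<lambda>x. f x (fst (g x)) (snd (g x))) \<in> measurable M N \<Longrightarrow> (\<lambda>x. case_prod (f x) (g x)) \<in> measurable M N"
  by (simp add: split_beta)

lemma nn_integral_lborel_prod:
  fixes F :: "'a::euclidean_space \<times> 'b::euclidean_space \<Rightarrow> ennreal"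
  assumes F: "F \<in> borel_measurable borel"
  shows "(\<integral>\<^sup>+p. F p \<partial>lborel) = (\<integral>\<^sup>+x. \<integral>\<^sup>+y. F (x, y) \<partial>lborel \<partial>lborel)"
  by (subst lborel_prod[symmetric], subst lborel.nn_integral_fst[symmetric]) (use F in auto)

lemma nn_integral_lborel_swap:
  fixes F :: "'a::euclidean_space \<Rightarrow> 'b::euclidean_space \<Rightarrow> ennreal"
  assumes F: "case_prod F \<in> borel_measurable borel"
  shows "(\<integral>\<^sup>+x. \<integral>\<^sup>+y. F x y \<partial>lborel \<partial>lborel) = (\<integral>\<^sup>+y. \<integral>\<^sup>+x. F x y \<partial>lborel \<partial>lborel)"
  by (rule lborel_pair.Fubini'[symmetric]) (use F in simp)

lemma nn_integral_lborel3:
  fixes F :: "'a::euclidean_space \<times> 'b::euclidean_space \<times> 'c::euclidean_space \<Rightarrow> ennreal"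
  assumes F[measurable]: "F \<in> borel_measurable borel"
  shows "(\<integral>\<^sup>+p. F p \<partial>lborel) = (\<integral>\<^sup>+t. \<integral>\<^sup>+x. \<integral>\<^sup>+v. F (t, x, v) \<partial>lborel \<partial>lborel \<partial>lborel)"
  by (simp add: nn_integral_lborel_prod)

lemma nn_integral_lborel_split2:
  fixes F :: "'a::euclidean_space \<Rightarrow> 'b::euclidean_space \<Rightarrow> ennreal"
  assumes "(\<lambda>(x, y). F x y) \<in> borel_measurable borel"
  shows "(\<integral>\<^sup>+(x, y). F x y \<partial>lborel) = (\<integral>\<^sup>+x. \<integral>\<^sup>+y. F x y \<partial>lborel \<partial>lborel)"
  unfolding nn_integral_lborel_prod[OF assms] by (simp only: split_conv)

lemma nn_integral_lborel_split3:
  fixes F :: "'a::euclidean_space \<Rightarrow> 'b::euclidean_space \<Rightarrow> 'c::euclidean_space \<Rightarrow> ennreal"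
  assumes "(\<lambda>(x, y, z). F x y z) \<in> borel_measurable borel"
  shows "(\<integral>\<^sup>+(x, y, z). F x y z \<partial>lborel) = (\<integral>\<^sup>+x. \<integral>\<^sup>+y. \<integral>\<^sup>+z. F x y z \<partial>lborel \<partial>lborel \<partial>lborel)"
  unfolding nn_integral_lborel3[OF assms] by (simp only: split_conv)

lemma nn_integral_tensor3:
  fixes \<alpha> :: "'a::euclidean_space \<Rightarrow> ennreal" and \<beta> :: "'b::euclidean_space \<Rightarrow> ennreal" and \<gamma> :: "'c::euclidean_space \<Rightarrow> ennreal"
  assumes [measurable]: "\<alpha> \<in> borel_measurable borel" "\<beta> \<in> borel_measurable borel" "\<gamma> \<in> borel_measurable borel"
  shows "(\<integral>\<^sup>+(t, x, v). \<alpha> t * \<beta> x * \<gamma> v \<partial>lborel) = (\<integral>\<^sup>+t. \<alpha> t \<partial>lborel) * (\<integral>\<^sup>+x. \<beta> x \<partial>lborel) * (\<integral>\<^sup>+v. \<gamma> v \<partial>lborel)"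
  by (subst nn_integral_lborel3) (measurable, simp add: nn_integral_cmult nn_integral_multc mult.assoc)

lemma nn_integral_tensor2:
  fixes \<alpha> :: "'a::euclidean_space \<Rightarrow> ennreal" and \<beta> :: "'b::euclidean_space \<Rightarrow> ennreal"
  assumes [measurable]: "\<alpha> \<in> borel_measurable borel" "\<beta> \<in> borel_measurable borel"
  shows "(\<integral>\<^sup>+(t, x). \<alpha> t * \<beta> x \<partial>lborel) = (\<integral>\<^sup>+t. \<alpha> t \<partial>lborel) * (\<integral>\<^sup>+x. \<beta> x \<partial>lborel)"
  by (subst nn_integral_lborel_prod) (measurable, simp add: nn_integral_cmult nn_integral_multc)

lemma nn_integral_translate:
  fixes g :: "'a::euclidean_space \<Rightarrow> ennreal"
  assumes [measurable]: "g \<in> borel_measurable borel"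
  shows "(\<integral>\<^sup>+x. g (x + c) \<partial>lborel) = (\<integral>\<^sup>+x. g x \<partial>lborel)"
proof -
  have "(\<integral>\<^sup>+x. g x \<partial>lborel) = (\<integral>\<^sup>+x. g x \<partial>distr lborel borel ((+) c))"
    by (simp add: lborel_distr_plus)
  also have "\<dots> = (\<integral>\<^sup>+x. g (c + x) \<partial>lborel)"
    by (subst nn_integral_distr) auto
  finally show ?thesis by (simp add: add.commute)
qed

lemma integral_translate:
  fixes g :: "'a::euclidean_space \<Rightarrow> real"
  assumes [measurable]: "g \<in> borel_measurable borel"
  shows "(\<integral>x. g (x + c) \<partial>lborel) = (\<integral>x. g x \<partial>lborel)"
proof -
  have "(\<integral>x. g x \<partial>lborel) = (\<integral>x. g x \<partial>distr lborel borel ((+) c))"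
    by (simp add: lborel_distr_plus)
  also have "\<dots> = (\<integral>x. g (c + x) \<partial>lborel)"
    by (subst integral_distr) auto
  finally show ?thesis by (simp add: add.commute)
qed

lemma nn_integral_reflect:
  fixes g :: "real \<Rightarrow> ennreal"
  assumes "g \<in> borel_measurable borel"
  shows "(\<integral>\<^sup>+x. g (c - x) \<partial>lborel) = (\<integral>\<^sup>+x. g x \<partial>lborel)"
  using nn_integral_real_affine[OF assms, of "-1" c] by simp

text \<open>A set of finite measure is squeezed between a compact \<open>K\<close> and an open
  \<open>T\<close> with small gaps; a shift shorter than the distance from \<open>K\<close> to the
  complement of \<open>T\<close> changes membership only at points in the gaps. Linear combinations
  and dominated limits then reach all integrable functions.\<close>

lemma L1_translation:
  fixes g :: "'a::euclidean_space \<Rightarrow> real"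
  assumes "integrable lborel g"
  shows "\<forall>e>0. \<exists>d>0. \<forall>z. norm z < d \<longrightarrow> (\<integral>\<^sup>+p. ennreal \<bar>g (p + z) - g p\<bar> \<partial>lborel) \<le> ennreal e"
  using assms
proof (induction rule: integrable_induct)
  case (base A c)
  have A[measurable]: "A \<in> sets borel" using base by simp
  show ?case
  proof (intro allI impI)
    fix e :: real assume e: "0 < e"
    \<comment> \<open>Four gap terms occur below, \<open>A - K\<close> and \<open>T - A\<close>,
      each at p and at p + z; the added 1 covers c = 0.\<close>
    define e' where "e' = e / (4 * (\<bar>c\<bar> + 1))"
    have e': "e' > 0" using e by (simp add: e'_def)
    obtain T where T: "open T" "A \<subseteq> T" "emeasure lborel (T - A) < ennreal e'"
      using outer_regular_lborel[OF A e'] by blast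
    obtain K0 where K0: "closed K0" "K0 \<subseteq> A" "emeasure lebesgue (A - K0) < ennreal (e' / 2)"
    proof (rule sets_lebesgue_inner_closed)
      show "A \<in> sets lebesgue" using A by simp
      show "0 < e' / 2" using e' by simp
    qed
    have "(\<lambda>n. emeasure lborel (A - cball 0 (real n))) \<longlonglongrightarrow> emeasure lborel (\<Inter>n. A - cball 0 (real n))"
    proof (rule Lim_emeasure_decseq)
      show "decseq (\<lambda>n. A - cball 0 (real n))" by (auto simp: decseq_def)
      show "emeasure lborel (A - cball 0 (real i)) \<noteq> \<infinity>" for i
        using base(2) emeasure_mono[of "A - cball 0 (real i)" A lborel] A by (auto simp: top_unique)
    qed auto
    moreover have "(\<Inter>n. A - cball 0 (real n)) = {}"
    proof -
      have "\<exists>n. x \<in> cball 0 (real n)" for x :: 'a using real_arch_simple[of "norm x"] by auto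
      then show ?thesis by auto
    qed
    ultimately have "(\<lambda>n. emeasure lborel (A - cball 0 (real n))) \<longlonglongrightarrow> 0" by (simp only: emeasure_empty)
    then have "\<forall>\<^sub>F n in sequentially. emeasure lborel (A - cball 0 (real n)) < ennreal (e'/2)"
      using e' by (intro order_tendstoD) auto
    then obtain n where n: "emeasure lborel (A - cball 0 (real n)) < ennreal (e'/2)"
      by (auto simp: eventually_sequentially)
    \<comment> \<open>Inner regularity gives a closed set only. Intersecting with a large ball makes
      it compact, which is needed for a positive distance to the complement of
      \<open>T\<close>.\<close>
    define K where "K = K0 \<inter> cball 0 (real n)"
    have K: "compact K" "K \<subseteq> T" "K \<subseteq> A"
      using K0 T by (auto simp: K_def closed_Int_compact)
    have K_meas[measurable]: "K \<in> sets borel" "T \<in> sets borel"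
      using K T by (auto intro: borel_compact)
    have "A - K \<subseteq> (A - K0) \<union> (A - cball 0 (real n))" by (auto simp: K_def)
    then have "emeasure lborel (A - K) \<le> emeasure lborel ((A - K0) \<union> (A - cball 0 (real n)))"
      using K0 by (intro emeasure_mono) auto
    also have "\<dots> \<le> emeasure lborel (A - K0) + emeasure lborel (A - cball 0 (real n))"
      using K0 by (intro emeasure_subadditive) auto
    also have "\<dots> \<le> ennreal (e'/2) + ennreal (e'/2)"
      using K0 n A by (intro add_mono) (auto simp: less_imp_le)
    also have "\<dots> = ennreal e'" using e' by (simp flip: ennreal_plus)
    finally have AK: "emeasure lborel (A - K) \<le> ennreal e'" .
    obtain d where d: "d > 0" "\<And>x y. x \<in> K \<Longrightarrow> y \<in> - T \<Longrightarrow> d \<le> dist x y"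
      using separate_compact_closed[OF K(1), of "- T"] T(1) K(2) by (metis ComplD Compl_disjoint closed_Compl disjoint_iff subsetD)
    have "(\<integral>\<^sup>+p. ennreal \<bar>indicator A (p + z) *\<^sub>R c - indicator A p *\<^sub>R c\<bar> \<partial>lborel) \<le> ennreal e"
      if z: "norm z < d" for z
    proof -
      \<comment> \<open>If exactly one of p and p + z lies in \<open>A\<close>, then one of them
        lies in a gap, because a point of \<open>K\<close> cannot leave \<open>T\<close> by so short
        a shift.\<close>
      have pt: "ennreal \<bar>indicator A (p + z) *\<^sub>R c - indicator A p *\<^sub>R c\<bar>
        \<le> ennreal \<bar>c\<bar> * ((indicator (A - K) (p + z) + indicator (T - A) p) + (indicator (A - K) p + indicator (T - A) (p + z)))" for p
      proof -
        have 1: "p \<in> T" if "p + z \<in> K" using d(2)[OF that, of p] z by (auto simp: dist_norm)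
        have 2: "p + z \<in> T" if "p \<in> K" using d(2)[OF that, of "p + z"] z by (auto simp: dist_norm)
        show ?thesis
        proof (cases "p + z \<in> A \<longleftrightarrow> p \<in> A")
          case True
          then have "indicator A (p + z) *\<^sub>R c - indicator A p *\<^sub>R c = 0" by (auto simp: indicator_def)
          then show ?thesis by (simp only: abs_zero ennreal_0 zero_le)
        next
          case False
          then have "\<bar>indicator A (p + z) *\<^sub>R c - indicator A p *\<^sub>R c\<bar> = \<bar>c\<bar>" by (auto simp: indicator_def)
          moreover have "p + z \<in> A - K \<or> p \<in> T - A \<or> p \<in> A - K \<or> p + z \<in> T - A"
            using False 1 2 by auto
          then have "(1::ennreal) \<le> (indicator (A - K) (p + z) + indicator (T - A) p) + (indicator (A - K) p + indicator (T - A) (p + z))"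
            by (elim disjE) (auto intro!: add_increasing add_increasing2)
          ultimately show ?thesis
            using mult_left_mono[of "1::ennreal" _ "ennreal \<bar>c\<bar>"] by simp
        qed
      qed
      have "(\<integral>\<^sup>+p. ennreal \<bar>indicator A (p + z) *\<^sub>R c - indicator A p *\<^sub>R c\<bar> \<partial>lborel) \<le>
         (\<integral>\<^sup>+p. ennreal \<bar>c\<bar> * ((indicator (A - K) (p + z) + indicator (T - A) p) + (indicator (A - K) p + indicator (T - A) (p + z))) \<partial>lborel)"
        by (intro nn_integral_mono pt)
      also have "\<dots> = ennreal \<bar>c\<bar> * ((emeasure lborel (A - K) + emeasure lborel (T - A)) + (emeasure lborel (A - K) + emeasure lborel (T - A)))"
        by (simp add: nn_integral_cmult nn_integral_add nn_integral_translate[of "indicator (A - K)"]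
            nn_integral_translate[of "indicator (T - A)"])
      also have "\<dots> \<le> ennreal \<bar>c\<bar> * ((ennreal e' + ennreal e') + (ennreal e' + ennreal e'))"
        using AK T(3) by (intro mult_left_mono add_mono) (auto simp: less_imp_le)
      also have "\<dots> = ennreal (\<bar>c\<bar> * (4 * e'))" using e' by (simp add: ennreal_mult'[symmetric] ennreal_plus[symmetric] del: ennreal_plus)
      also have "\<dots> \<le> ennreal e"
      proof -
        have aux: "a * (4 * (e / (4 * k))) = e * (a / k)" if "k > 0" for a k :: real
          using that by (simp add: field_simps)
        have "\<bar>c\<bar> * (4 * e') = e * (\<bar>c\<bar> / (\<bar>c\<bar> + 1))" unfolding e'_def by (rule aux) simp
        also have "\<dots> \<le> e * 1" using e by (intro mult_left_mono) auto
        finally show ?thesis by (simp add: ennreal_leI)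
      qed
      finally show ?thesis .
    qed
    then show "\<exists>d>0. \<forall>z. norm z < d \<longrightarrow> (\<integral>\<^sup>+p. ennreal \<bar>indicator A (p + z) *\<^sub>R c - indicator A p *\<^sub>R c\<bar> \<partial>lborel) \<le> ennreal e"
      using d(1) by blast
  qed
next
  case (add f g)
  have [measurable]: "f \<in> borel_measurable borel" "g \<in> borel_measurable borel"
    using add(1,2) by auto
  show ?case
  proof (intro allI impI)
    fix e :: real assume e: "0 < e"
    obtain d1 where d1: "d1 > 0" "\<And>z. norm z < d1 \<Longrightarrow> (\<integral>\<^sup>+p. ennreal \<bar>f (p + z) - f p\<bar> \<partial>lborel) \<le> ennreal (e/2)"
      using add.IH(1) e by (meson half_gt_zero)
    obtain d2 where d2: "d2 > 0" "\<And>z. norm z < d2 \<Longrightarrow> (\<integral>\<^sup>+p. ennreal \<bar>g (p + z) - g p\<bar> \<partial>lborel) \<le> ennreal (e/2)"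
      using add.IH(2) e by (meson half_gt_zero)
    have "(\<integral>\<^sup>+p. ennreal \<bar>f (p + z) + g (p + z) - (f p + g p)\<bar> \<partial>lborel) \<le> ennreal e" if "norm z < min d1 d2" for z
    proof -
      have "(\<integral>\<^sup>+p. ennreal \<bar>f (p + z) + g (p + z) - (f p + g p)\<bar> \<partial>lborel)
          \<le> (\<integral>\<^sup>+p. ennreal \<bar>f (p + z) - f p\<bar> + ennreal \<bar>g (p + z) - g p\<bar> \<partial>lborel)"
        by (intro nn_integral_mono) (auto simp flip: ennreal_plus intro!: ennreal_leI)
      also have "\<dots> \<le> ennreal (e/2) + ennreal (e/2)"
        using that by (subst nn_integral_add) (auto intro!: add_mono d1 d2)
      also have "\<dots> = ennreal e" using e by (simp flip: ennreal_plus)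
      finally show ?thesis .
    qed
    then show "\<exists>d>0. \<forall>z. norm z < d \<longrightarrow> (\<integral>\<^sup>+p. ennreal \<bar>f (p + z) + g (p + z) - (f p + g p)\<bar> \<partial>lborel) \<le> ennreal e"
      using d1(1) d2(1) by (intro exI[of _ "min d1 d2"]) auto
  qed
next
  case (lim f s)
  have [measurable]: "f \<in> borel_measurable borel" "\<And>i. s i \<in> borel_measurable borel"
    using lim(1,4,5) by auto
  show ?case
  proof (intro allI impI)
    fix e :: real assume e: "0 < e"
    have "(\<lambda>i. (\<integral>\<^sup>+x. norm (f x - s i x) \<partial>lborel)) \<longlonglongrightarrow> 0"
    proof (rule nn_integral_dominated_convergence_norm[where w = "\<lambda>x. 2 * norm (f x)"])
      have "integrable lborel (\<lambda>x. 2 * norm (f x))" using lim by auto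
      then show "(\<integral>\<^sup>+x. ennreal (2 * norm (f x)) \<partial>lborel) < \<infinity>"
        by (subst nn_integral_eq_integral) auto
    qed (use lim in auto)
    then have "\<forall>\<^sub>F i in sequentially. (\<integral>\<^sup>+x. norm (f x - s i x) \<partial>lborel) < ennreal (e/3)"
      using e by (intro order_tendstoD) auto
    then obtain i where i: "(\<integral>\<^sup>+x. ennreal \<bar>f x - s i x\<bar> \<partial>lborel) \<le> ennreal (e/3)"
      by (auto simp: eventually_sequentially intro: less_imp_le)
    obtain d where d: "d > 0" "\<And>z. norm z < d \<Longrightarrow> (\<integral>\<^sup>+p. ennreal \<bar>s i (p + z) - s i p\<bar> \<partial>lborel) \<le> ennreal (e/3)"
      using lim.IH[of i] e by (metis divide_pos_pos zero_less_numeral)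
    have "(\<integral>\<^sup>+p. ennreal \<bar>f (p + z) - f p\<bar> \<partial>lborel) \<le> ennreal e" if "norm z < d" for z
    proof -
      have "(\<integral>\<^sup>+p. ennreal \<bar>f (p + z) - f p\<bar> \<partial>lborel)
          \<le> (\<integral>\<^sup>+p. ennreal \<bar>f (p + z) - s i (p + z)\<bar> + (ennreal \<bar>s i (p + z) - s i p\<bar> + ennreal \<bar>f p - s i p\<bar>) \<partial>lborel)"
        by (intro nn_integral_mono) (auto simp flip: ennreal_plus intro!: ennreal_leI)
      also have "\<dots> = (\<integral>\<^sup>+p. ennreal \<bar>f p - s i p\<bar> \<partial>lborel) + ((\<integral>\<^sup>+p. ennreal \<bar>s i (p + z) - s i p\<bar> \<partial>lborel) + (\<integral>\<^sup>+p. ennreal \<bar>f p - s i p\<bar> \<partial>lborel))"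
        by (simp add: nn_integral_add nn_integral_translate[of "\<lambda>p. ennreal \<bar>f p - s i p\<bar>"])
      also have "\<dots> \<le> ennreal (e/3) + (ennreal (e/3) + ennreal (e/3))"
        by (intro add_mono i d(2) that)
      also have "\<dots> = ennreal e" using e by (simp flip: ennreal_plus)
      finally show ?thesis .
    qed
    then show "\<exists>d>0. \<forall>z. norm z < d \<longrightarrow> (\<integral>\<^sup>+p. ennreal \<bar>f (p + z) - f p\<bar> \<partial>lborel) \<le> ennreal e"
      using d(1) by blast
  qed
qed

lemma nn_integral_bmp: "(\<integral>\<^sup>+x. ennreal (bmp x) \<partial>lborel) = 1"
proof -
  have [measurable]: "bmp \<in> borel_measurable borel" by (rule smooth_measurable[OF smooth_bmp])
  have "(\<integral>\<^sup>+x. ennreal (bmp x) \<partial>lborel) = (\<integral>\<^sup>+x. ennreal (bmp x) * indicator {-1..1} x \<partial>lborel)"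
    by (intro nn_integral_cong) (auto simp: indicator_def bmp_outside)
  also have "\<dots> = ennreal (stp 1 - stp (-1))"
    by (intro nn_integral_FTC_Icc) (auto simp: bmp_nonneg intro: has_field_derivative_at_within[OF stp_deriv])
  also have "\<dots> = 1" by (simp add: stp_right stp_left)
  finally show ?thesis .
qed

lemma smooth_bounded_support:
  fixes g :: "real \<Rightarrow> real"
  assumes "smooth g" "\<And>x. \<bar>x\<bar> > r \<Longrightarrow> g x = 0"
  obtains K where "0 \<le> K" "\<And>x. \<bar>g x\<bar> \<le> K"
proof -
  have "compact (g ` {-r..r})"
    by (intro compact_continuous_image smooth_continuous_on assms compact_Icc)
  then obtain K where K: "\<And>x. x \<in> {-r..r} \<Longrightarrow> \<bar>g x\<bar> \<le> K"
    using compact_imp_bounded by (force simp: bounded_iff)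
  show ?thesis
  proof
    show "\<bar>g x\<bar> \<le> max K 0" for x
    proof (cases "x \<in> {-r..r}")
      case False
      then have "\<bar>x\<bar> > r" by auto
      then show ?thesis using assms(2) by simp
    qed (use K in \<open>auto simp: le_max_iff_disj\<close>)
  qed simp
qed

section \<open>Mollifiers at scale \<open>e\<close>, and the variation of shifted profiles\<close>

definition step_at :: "real \<Rightarrow> real \<Rightarrow> real" where "step_at e x = stp (x / e)"
definition moll :: "real \<Rightarrow> real \<Rightarrow> real" where "moll e x = bmp (x / e) / e"
definition moll' :: "real \<Rightarrow> real \<Rightarrow> real" where "moll' e x = deriv bmp (x / e) / (e * e)"

lemma smooth_step_at: "smooth (step_at e)"
  using smooth_affine_real[OF smooth_stp, of "1/e" 0] by (simp add: step_at_def[abs_def])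

lemma smooth_moll: "smooth (moll e)"
  using smooth_mult[OF smooth_affine_real[OF smooth_bmp, of "1/e" 0] smooth_const[of "1/e"]] by (simp add: moll_def[abs_def])

lemma smooth_moll': "smooth (moll' e)"
  using smooth_mult[OF smooth_affine_real[OF smooth_deriv[OF smooth_bmp], of "1/e" 0] smooth_const[of "1/(e*e)"]] by (simp add: moll'_def[abs_def])

lemma step_at_measurable [measurable]: "step_at e \<in> borel_measurable borel"
  and moll_measurable [measurable]: "moll e \<in> borel_measurable borel"
  and moll'_measurable [measurable]: "moll' e \<in> borel_measurable borel"
  by (auto intro: smooth_measurable smooth_step_at smooth_moll smooth_moll')

lemma step_at_deriv: "e \<noteq> 0 \<Longrightarrow> (step_at e has_real_derivative moll e x) (at x)"
  unfolding step_at_def[abs_def] moll_def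
  by (rule DERIV_cong[OF DERIV_chain2[OF stp_deriv]]) (auto intro!: derivative_eq_intros)

lemma moll_deriv: "e \<noteq> 0 \<Longrightarrow> (moll e has_real_derivative moll' e x) (at x)"
  unfolding moll_def[abs_def] moll'_def
  by (rule DERIV_cong[OF DERIV_cdivide[OF DERIV_chain2[OF has_real_derivative_deriv_smooth[OF smooth_bmp]]]])
     (auto intro!: derivative_eq_intros)

lemma step_at_abs: "\<bar>step_at e x\<bar> \<le> 1/2" unfolding step_at_def by (rule stp_abs)
lemma step_at_odd: "step_at e (- x) = - step_at e x" by (simp add: step_at_def stp_odd)
lemma step_at_right: "0 < e \<Longrightarrow> e \<le> x \<Longrightarrow> step_at e x = 1/2" by (simp add: step_at_def stp_right)
lemma step_at_left: "0 < e \<Longrightarrow> x \<le> - e \<Longrightarrow> step_at e x = -1/2"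
  using step_at_right[of e "-x"] step_at_odd[of e x] by simp
lemma step_at_mono: "0 < e \<Longrightarrow> x \<le> y \<Longrightarrow> step_at e x \<le> step_at e y" by (simp add: step_at_def stp_mono divide_right_mono)
lemma step_at_0: "step_at e 0 = 0" using step_at_odd[of e 0] by simp
lemma moll_nonneg: "0 < e \<Longrightarrow> 0 \<le> moll e x" by (simp add: moll_def bmp_nonneg)
lemma moll_even: "moll e (- x) = moll e x" by (simp add: moll_def bmp_even)
lemma moll_outside: "0 < e \<Longrightarrow> e \<le> \<bar>x\<bar> \<Longrightarrow> moll e x = 0" by (simp add: moll_def bmp_outside)

lemma moll'_odd: assumes "e \<noteq> 0" shows "moll' e (- x) = - moll' e x"
proof -
  have "((\<lambda>x. moll e (- x)) has_real_derivative - moll' e (- x)) (at x)"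
    by (rule DERIV_cong[OF DERIV_chain2[OF moll_deriv[OF assms]]]) (auto intro!: derivative_eq_intros)
  then have "- moll' e (- x) = moll' e x" using DERIV_unique[OF _ moll_deriv[OF assms], of _ x] by (simp add: moll_even)
  then show ?thesis by simp
qed

lemma moll'_outside: assumes "0 < e" "e < \<bar>x\<bar>" shows "moll' e x = 0"
proof -
  have "\<forall>\<^sub>F y in nhds x. 0 = moll e y"
  proof -
    have "open {y::real. e < \<bar>y\<bar>}" by (intro open_Collect_less continuous_intros)
    then have "\<forall>\<^sub>F y in nhds x. y \<in> {y. e < \<bar>y\<bar>}" using assms by (intro eventually_nhds_in_open) auto
    then show ?thesis by eventually_elim (use assms moll_outside in auto)
  qed
  then have "((\<lambda>_. 0) has_real_derivative moll' e x) (at x)"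
    using DERIV_cong_ev[OF refl _ refl, of "\<lambda>_. 0" "moll e" x] moll_deriv[of e x] assms by auto
  then show ?thesis using DERIV_unique[OF _ DERIV_const] by blast
qed

lemma nn_integral_moll: assumes "0 < e" shows "(\<integral>\<^sup>+x. ennreal (moll e x) \<partial>lborel) = 1"
proof -
  have [measurable]: "bmp \<in> borel_measurable borel" by (rule smooth_measurable[OF smooth_bmp])
  have "(\<integral>\<^sup>+x. ennreal (moll e x) \<partial>lborel) = e * (\<integral>\<^sup>+x. ennreal (moll e (e * x)) \<partial>lborel)"
    using nn_integral_real_affine[of "\<lambda>x. ennreal (moll e x)" e 0] assms by simp
  also have "\<dots> = (\<integral>\<^sup>+x. ennreal (bmp x) \<partial>lborel)"
    using assms by (subst nn_integral_cmult[symmetric])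
      (auto simp: moll_def ennreal_mult'[symmetric])
  finally show ?thesis by (simp add: nn_integral_bmp)
qed

lemma nn_integral_moll_diff: "0 < e \<Longrightarrow> (\<integral>\<^sup>+x. ennreal (moll e (c - x)) \<partial>lborel) = 1"
  using nn_integral_reflect[of "\<lambda>x. ennreal (moll e x)" c] by (simp add: nn_integral_moll)

lemma moll_bound: assumes "0 < e" obtains K where "0 \<le> K" "\<And>x. \<bar>moll e x\<bar> \<le> K"
  using smooth_bounded_support[OF smooth_moll, of e] moll_outside[OF assms] by (metis less_imp_le)

lemma moll'_bound: assumes "0 < e" obtains K where "0 \<le> K" "\<And>x. \<bar>moll' e x\<bar> \<le> K"
  using smooth_bounded_support[OF smooth_moll', of e] moll'_outside[OF assms] by metis

text \<open>The increment is the integral of X' over a window of length h; integrating over y first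
  gives the full variation for every position in the window. This is the source of the factor h in
  the whole argument.\<close>

lemma total_variation_shift:
  fixes X X' :: "real \<Rightarrow> real"
  assumes d: "\<And>x. (X has_real_derivative X' x) (at x)" and [measurable]: "X' \<in> borel_measurable borel"
    and h: "0 \<le> h"
  shows "(\<integral>\<^sup>+y. ennreal \<bar>X y - X (y - h)\<bar> \<partial>lborel) \<le> ennreal h * (\<integral>\<^sup>+y. ennreal \<bar>X' y\<bar> \<partial>lborel)"
proof -
  have pt: "ennreal \<bar>X y - X (y - h)\<bar> \<le> (\<integral>\<^sup>+\<theta>. indicator {0..h} \<theta> * ennreal \<bar>X' (y - \<theta>)\<bar> \<partial>lborel)" for y
  proof (cases "(\<integral>\<^sup>+\<theta>. indicator {0..h} \<theta> * ennreal \<bar>X' (y - \<theta>)\<bar> \<partial>lborel) = \<infinity>")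
    \<comment> \<open>An infinite right-hand side is trivial; a finite one makes X' integrable on
      the window, so that the integral of the fundamental theorem is a Lebesgue integral.\<close>
    case False
    have n: "(\<integral>\<^sup>+\<theta>. ennreal (norm (indicator {0..h} \<theta> *\<^sub>R X' (y - \<theta>))) \<partial>lborel) = (\<integral>\<^sup>+\<theta>. indicator {0..h} \<theta> * ennreal \<bar>X' (y - \<theta>)\<bar> \<partial>lborel)"
      by (intro nn_integral_cong) (auto simp: indicator_def)
    have "integrable lborel (\<lambda>\<theta>. indicator {0..h} \<theta> *\<^sub>R X' (y - \<theta>))"
    proof (rule integrableI_bounded)
      show "(\<integral>\<^sup>+\<theta>. ennreal (norm (indicator {0..h} \<theta> *\<^sub>R X' (y - \<theta>))) \<partial>lborel) < \<infinity>"
        using False unfolding n by (simp add: less_top)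
    qed measurable
    then have i: "set_integrable lborel {0..h} (\<lambda>\<theta>. X' (y - \<theta>))" by (simp add: set_integrable_def)
    have "((\<lambda>\<theta>. X' (y - \<theta>)) has_integral (- X (y - h) - - X (y - 0))) {0..h}"
      using h by (intro fundamental_theorem_of_calculus)
        (auto simp: has_real_derivative_iff_has_vector_derivative[symmetric] intro!: derivative_eq_intros DERIV_chain2[OF d])
    moreover have "((\<lambda>\<theta>. X' (y - \<theta>)) has_integral (LINT \<theta>:{0..h}|lborel. X' (y - \<theta>))) {0..h}"
      unfolding set_borel_integral_eq_integral(2)[OF i]
      by (rule integrable_integral[OF set_borel_integral_eq_integral(1)[OF i]])
    ultimately have "X y - X (y - h) = (LINT \<theta>:{0..h}|lborel. X' (y - \<theta>))"
      by (auto dest: has_integral_unique)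
    then have "ennreal \<bar>X y - X (y - h)\<bar> = ennreal (norm (LINT \<theta>|lborel. indicator {0..h} \<theta> *\<^sub>R X' (y - \<theta>)))"
      by (simp add: set_lebesgue_integral_def)
    also have "\<dots> \<le> (\<integral>\<^sup>+\<theta>. ennreal (norm (indicator {0..h} \<theta> *\<^sub>R X' (y - \<theta>))) \<partial>lborel)"
      using i by (intro integral_norm_bound_ennreal) (simp add: set_integrable_def)
    finally show ?thesis unfolding n .
  qed simp
  have "(\<integral>\<^sup>+y. ennreal \<bar>X y - X (y - h)\<bar> \<partial>lborel) \<le> (\<integral>\<^sup>+y. \<integral>\<^sup>+\<theta>. indicator {0..h} \<theta> * ennreal \<bar>X' (y - \<theta>)\<bar> \<partial>lborel \<partial>lborel)"
    by (intro nn_integral_mono pt)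
  also have "\<dots> = (\<integral>\<^sup>+\<theta>. indicator {0..h} \<theta> * (\<integral>\<^sup>+y. ennreal \<bar>X' (y - \<theta>)\<bar> \<partial>lborel) \<partial>lborel)"
    by (subst nn_integral_lborel_swap) (auto simp: nn_integral_cmult)
  also have "\<dots> = (\<integral>\<^sup>+\<theta>. indicator {0..h} \<theta> * (\<integral>\<^sup>+y. ennreal \<bar>X' y\<bar> \<partial>lborel) \<partial>lborel)"
    using nn_integral_translate[of "\<lambda>y. ennreal \<bar>X' y\<bar>" "- \<theta>" for \<theta>] by simp
  also have "\<dots> = ennreal h * (\<integral>\<^sup>+y. ennreal \<bar>X' y\<bar> \<partial>lborel)"
    using h by (simp add: nn_integral_multc)
  finally show ?thesis .
qed

section \<open>Compactly supported cut-offs, tensor products and bounded kernels\<close>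

definition bump_on :: "real \<Rightarrow> real \<Rightarrow> (real \<Rightarrow> real) \<Rightarrow> bool" where
  "bump_on a b g \<longleftrightarrow> smooth g \<and> (\<forall>x. x \<notin> {a..b} \<longrightarrow> g x = 0)"

lemma bump_onD: "bump_on a b g \<Longrightarrow> smooth g" "bump_on a b g \<Longrightarrow> x \<notin> {a..b} \<Longrightarrow> g x = 0"
  by (auto simp: bump_on_def)

lemma bump_on_measurable [measurable_dest]: "bump_on a b g \<Longrightarrow> g \<in> borel_measurable borel"
  by (intro smooth_measurable bump_onD)

lemma bump_on_mult: "bump_on a b g \<Longrightarrow> smooth f \<Longrightarrow> bump_on a b (\<lambda>x. f x * g x)"
  by (auto simp: bump_on_def smooth_mult)

lemma bump_on_DERIV: "bump_on a b g \<Longrightarrow> (g has_real_derivative deriv g x) (at x)"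
  by (intro has_real_derivative_deriv_smooth bump_onD)

lemma bump_on_deriv: assumes "bump_on a b g" shows "bump_on a b (deriv g)"
proof -
  have "deriv g x = 0" if "x \<notin> {a..b}" for x
  proof -
    have "open (- {a..b})" by (simp add: open_Compl)
    then have "\<forall>\<^sub>F y in nhds x. y \<in> - {a..b}" using that by (intro eventually_nhds_in_open) auto
    then have "\<forall>\<^sub>F y in nhds x. 0 = g y" by eventually_elim (use bump_onD[OF assms] in auto)
    then have "((\<lambda>_. 0) has_real_derivative deriv g x) (at x)"
      using DERIV_cong_ev[OF refl _ refl, of "\<lambda>_. 0" g x] bump_on_DERIV[OF assms] by auto
    then show ?thesis using DERIV_unique[OF _ DERIV_const] by blast
  qed
  then show ?thesis using smooth_deriv[OF bump_onD(1)[OF assms]] by (simp add: bump_on_def)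
qed

lemma bump_on_bounded: assumes "bump_on a b g" obtains K where "0 \<le> K" "\<And>x. \<bar>g x\<bar> \<le> K"
proof (rule smooth_bounded_support[of g "max \<bar>a\<bar> \<bar>b\<bar>"])
  show "smooth g" by (rule bump_onD[OF assms])
  fix x :: real assume "max \<bar>a\<bar> \<bar>b\<bar> < \<bar>x\<bar>"
  then have "x \<notin> {a..b}" by auto
  then show "g x = 0" by (rule bump_onD[OF assms])
qed (use that in blast)

lemma bump_on_integrable: assumes "bump_on a b g" shows "integrable lborel g"
proof -
  obtain K where K: "0 \<le> K" "\<And>x. \<bar>g x\<bar> \<le> K" using bump_on_bounded[OF assms] by metis
  have [measurable]: "g \<in> borel_measurable borel" using assms by measurable
  show ?thesis
  proof (rule integrableI_bounded_set[where A = "{a..b}" and B = K])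
    show "AE x in lborel. x \<in> {a..b} \<longrightarrow> norm (g x) \<le> K" using K by auto
    show "emeasure lborel {a..b} < \<infinity>" by (intro emeasure_bounded_finite) auto
  qed (use bump_onD(2)[OF assms] in auto)
qed

lemma integrable_tensor2:
  fixes p q :: "real \<Rightarrow> real"
  assumes "integrable lborel p" "integrable lborel q"
  shows "integrable lborel (\<lambda>(t, x). p t * q x)"
proof (rule integrableI_bounded)
  have [measurable]: "p \<in> borel_measurable borel" "q \<in> borel_measurable borel" using assms by auto
  show "(\<lambda>(t, x). p t * q x) \<in> borel_measurable lborel" by measurable
  have "(\<integral>\<^sup>+z. ennreal (norm (case z of (t, x) \<Rightarrow> p t * q x)) \<partial>lborel) = (\<integral>\<^sup>+(t, x). ennreal \<bar>p t\<bar> * ennreal \<bar>q x\<bar> \<partial>lborel)"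
    by (intro nn_integral_cong) (auto simp: abs_mult ennreal_mult)
  also have "\<dots> = (\<integral>\<^sup>+t. ennreal \<bar>p t\<bar> \<partial>lborel) * (\<integral>\<^sup>+x. ennreal \<bar>q x\<bar> \<partial>lborel)"
    by (rule nn_integral_tensor2) auto
  also have "\<dots> < \<infinity>" using assms by (auto simp: integrable_iff_bounded ennreal_mult_less_top)
  finally show "(\<integral>\<^sup>+z. ennreal (norm (case z of (t, x) \<Rightarrow> p t * q x)) \<partial>lborel) < \<infinity>" .
qed

lemma integrable_tensor3:
  fixes \<alpha> \<beta> \<gamma> :: "real \<Rightarrow> real"
  assumes "integrable lborel \<alpha>" "integrable lborel \<beta>" "integrable lborel \<gamma>"
  shows "integrable lborel (\<lambda>(t, x, v). \<alpha> t * \<beta> x * \<gamma> v)"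
proof (rule integrableI_bounded)
  have [measurable]: "\<alpha> \<in> borel_measurable borel" "\<beta> \<in> borel_measurable borel" "\<gamma> \<in> borel_measurable borel"
    using assms by auto
  show "(\<lambda>(t, x, v). \<alpha> t * \<beta> x * \<gamma> v) \<in> borel_measurable lborel" by measurable
  have "(\<integral>\<^sup>+(t, x, v). ennreal \<bar>\<alpha> t\<bar> * ennreal \<bar>\<beta> x\<bar> * ennreal \<bar>\<gamma> v\<bar> \<partial>lborel)
    = (\<integral>\<^sup>+t. ennreal \<bar>\<alpha> t\<bar> \<partial>lborel) * (\<integral>\<^sup>+t. ennreal \<bar>\<beta> t\<bar> \<partial>lborel) * (\<integral>\<^sup>+t. ennreal \<bar>\<gamma> t\<bar> \<partial>lborel)"
    by (rule nn_integral_tensor3) auto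
  also have "\<dots> < \<infinity>"
    using assms by (auto simp: integrable_iff_bounded ennreal_mult_less_top)
  also have "(\<integral>\<^sup>+(t, x, v). ennreal \<bar>\<alpha> t\<bar> * ennreal \<bar>\<beta> x\<bar> * ennreal \<bar>\<gamma> v\<bar> \<partial>lborel) = (\<integral>\<^sup>+p. ennreal (norm (case p of (t, x, v) \<Rightarrow> \<alpha> t * \<beta> x * \<gamma> v)) \<partial>lborel)"
    by (intro nn_integral_cong) (auto simp: abs_mult ennreal_mult)
  finally show "(\<integral>\<^sup>+p. ennreal (norm (case p of (t, x, v) \<Rightarrow> \<alpha> t * \<beta> x * \<gamma> v)) \<partial>lborel) < \<infinity>" .
qed

lemma integrable_weighted_tensor3:
  fixes \<alpha> \<beta> \<gamma> :: "real \<Rightarrow> real"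
  assumes "integrable lborel \<alpha>" "integrable lborel \<beta>" "integrable lborel \<gamma>"
    and "w \<in> borel_measurable borel" and w: "\<And>p. \<bar>w p\<bar> \<le> K"
  shows "integrable lborel (\<lambda>(t, x, v). w (t, x, v) * (\<alpha> t * \<beta> x * \<gamma> v))"
proof (rule integrable_abs_le[OF integrable_tensor3[OF assms(1-3)], of _ K])
  have [measurable]: "\<alpha> \<in> borel_measurable borel" "\<beta> \<in> borel_measurable borel" "\<gamma> \<in> borel_measurable borel" "w \<in> borel_measurable borel"
    using assms by auto
  show "(\<lambda>(t, x, v). w (t, x, v) * (\<alpha> t * \<beta> x * \<gamma> v)) \<in> borel_measurable lborel" by measurable
qed (auto simp: abs_mult intro!: mult_right_mono w split: prod.split)

text \<open>Two integrable densities coupled by a bounded kernel are the only form in which doubled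
  integrals occur. The measures stay general because one of the two points may be integrated against
  \<open>m\<close>.\<close>

lemma Fubini_kernel:
  fixes P :: "'a \<Rightarrow> real" and Q :: "'b \<Rightarrow> real" and k :: "'a \<Rightarrow> 'b \<Rightarrow> real"
  assumes "sigma_finite_measure M" "sigma_finite_measure N"
    and P: "integrable M P" and Q: "integrable N Q" and k: "case_prod k \<in> borel_measurable (M \<Otimes>\<^sub>M N)"
    and K: "\<And>x y. \<bar>k x y\<bar> \<le> K"
  shows "(\<integral>x. P x * (\<integral>y. Q y * k x y \<partial>N) \<partial>M) = (\<integral>y. Q y * (\<integral>x. P x * k x y \<partial>M) \<partial>N)"
    and "integrable M (\<lambda>x. P x * (\<integral>y. Q y * k x y \<partial>N))"
proof -
  interpret pair_sigma_finite M N using assms(1,2) by (simp add: pair_sigma_finite_def)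
  have [measurable]: "P \<in> borel_measurable M" "Q \<in> borel_measurable N" using P Q by auto
  have KP: "\<bar>P x * Q y * k x y\<bar> \<le> \<bar>P x\<bar> * \<bar>Q y\<bar> * K" for x y
    using K[of x y] by (auto simp: abs_mult intro!: mult_left_mono)
  have "integrable (M \<Otimes>\<^sub>M N) (\<lambda>(x, y). P x * Q y * k x y)"
  proof (rule integrableI_bounded)
    note k[measurable]
    show "(\<lambda>(x, y). P x * Q y * k x y) \<in> borel_measurable (M \<Otimes>\<^sub>M N)" by measurable
    have "(\<integral>\<^sup>+p. ennreal (norm (case p of (x, y) \<Rightarrow> P x * Q y * k x y)) \<partial>(M \<Otimes>\<^sub>M N))
      \<le> (\<integral>\<^sup>+p. ennreal \<bar>P (fst p)\<bar> * (ennreal \<bar>Q (snd p)\<bar> * ennreal \<bar>K\<bar>) \<partial>(M \<Otimes>\<^sub>M N))"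
    proof (intro nn_integral_mono, clarsimp simp flip: ennreal_mult intro!: ennreal_leI)
      fix x y show "\<bar>P x * Q y * k x y\<bar> \<le> \<bar>P x\<bar> * (\<bar>Q y\<bar> * \<bar>K\<bar>)"
        using KP[of x y] K[of x y] by (simp add: mult.assoc)
    qed
    also have "\<dots> = (\<integral>\<^sup>+x. ennreal \<bar>P x\<bar> \<partial>M) * ((\<integral>\<^sup>+y. ennreal \<bar>Q y\<bar> \<partial>N) * ennreal \<bar>K\<bar>)"
      by (subst M2.nn_integral_fst[symmetric]) (auto simp: nn_integral_cmult nn_integral_multc)
    also have "\<dots> < \<infinity>"
      using P Q by (auto simp: integrable_iff_bounded ennreal_mult_less_top)
    finally show "(\<integral>\<^sup>+p. ennreal (norm (case p of (x, y) \<Rightarrow> P x * Q y * k x y)) \<partial>(M \<Otimes>\<^sub>M N)) < \<infinity>" .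
  qed
  note I = this
  have "(\<integral>x. P x * (\<integral>y. Q y * k x y \<partial>N) \<partial>M) = (\<integral>x. (\<integral>y. P x * Q y * k x y \<partial>N) \<partial>M)"
    by (simp add: mult.assoc)
  also have "\<dots> = (\<integral>y. (\<integral>x. P x * Q y * k x y \<partial>M) \<partial>N)"
    by (rule Fubini_integral[OF I, symmetric])
  also have "\<dots> = (\<integral>y. Q y * (\<integral>x. P x * k x y \<partial>M) \<partial>N)"
  proof -
    have "(\<lambda>x. P x * Q y * k x y) = (\<lambda>x. Q y * (P x * k x y))" for y by (auto simp: ac_simps)
    then show ?thesis by (simp only: integral_mult_right_zero)
  qed
  finally show "(\<integral>x. P x * (\<integral>y. Q y * k x y \<partial>N) \<partial>M) = (\<integral>y. Q y * (\<integral>x. P x * k x y \<partial>M) \<partial>N)" .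
  show "integrable M (\<lambda>x. P x * (\<integral>y. Q y * k x y \<partial>N))"
    using integrable_fst[OF I] by (simp add: mult.assoc)
qed

section \<open>The equation on positive velocities\<close>

text \<open>
  The equation restricted to \<open>v > 0\<close>, where \<open>f\<close> is the indicator of \<open>0 < v < U\<close>. The part \<open>v < 0\<close> of
  the kinetic equation has the same form after the reflection \<open>v \<mapsto> -v\<close>; the sign \<open>sg\<close> of the
  velocity accounts for the two fluxes.
\<close>

locale half_problem =
  fixes T l sg M0 :: real and U S :: "real \<times> real \<Rightarrow> real" and m :: "(real \<times> real \<times> real) measure"
  assumes T_pos: "0 < T" and l_ge_1: "1 \<le> l" and sg: "sg = 1 \<or> sg = -1"
    and U_measurable [measurable]: "U \<in> borel_measurable borel"
    and S_integrable: "integrable lborel S"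
    and sets_m [measurable_cong]: "sets m = sets borel"
    and M0_nonneg: "0 \<le> M0"
    and marginal: "g \<in> borel_measurable borel \<Longrightarrow> (\<integral>\<^sup>+(t, x, v). g v \<partial>m) \<le> ennreal M0 * (\<integral>\<^sup>+v. g v \<partial>lborel)"
    and weak: "\<lbrakk>bump_on ta tb A; 0 < ta; tb < T; bump_on xa xb B; smooth E; bump_on va vb Z; 0 < va\<rbrakk> \<Longrightarrow>
      (LINT (t, x, v)|lborel. (if 0 < v \<and> v < U (t, x) then 1 else 0) *
          ((deriv A t * E (v - c * t) - c * A t * deriv E (v - c * t)) * B x * Z v
            + sg * (l + 1) * \<bar>v\<bar> powr l * A t * deriv B x * E (v - c * t) * Z v))
      = (LINT (t, x, v)|m. A t * B x * (deriv E (v - c * t) * Z v + E (v - c * t) * deriv Z v))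
        - (LINT (t, x)|lborel. S (t, x) * A t * B x * E (U (t, x) - c * t) * Z (U (t, x)))"
begin

definition flux :: "real \<Rightarrow> real" where "flux v = sg * (l + 1) * \<bar>v\<bar> powr l"

definition hf :: "real \<times> real \<times> real \<Rightarrow> real" where
  "hf = (\<lambda>(t, x, v). if 0 < v \<and> v < U (t, x) then 1 else 0)"

lemma flux_measurable [measurable]: "flux \<in> borel_measurable borel"
  unfolding flux_def[abs_def] by measurable

lemma S_measurable [measurable]: "S \<in> borel_measurable borel"
  using S_integrable by auto

lemma hf_measurable [measurable]: "hf \<in> borel_measurable borel"
  unfolding hf_def by measurable

lemma hf_range: "0 \<le> hf p" "hf p \<le> 1"
  by (auto simp: hf_def split: prod.splits)

lemma hf_abs: "\<bar>hf p\<bar> \<le> 1" using hf_range[of p] by simp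

text \<open>Plain tensor test functions. The extra factor \<open>E (v - c * t)\<close> in
  \<open>weak\<close> is there for the moving threshold in the upper bounds.\<close>

lemma weak3:
  assumes "bump_on ta tb A" "0 < ta" "tb < T" "bump_on xa xb B" "bump_on va vb C" "0 < va"
  shows "(LINT (t, x, v)|lborel. hf (t, x, v) * (deriv A t * B x * C v + flux v * A t * deriv B x * C v))
      = (LINT (t, x, v)|m. A t * B x * deriv C v) - (LINT (t, x)|lborel. S (t, x) * A t * B x * C (U (t, x)))"
  using weak[OF assms(1,2,3,4) smooth_const[of 1] assms(5,6), of 0] by (simp add: flux_def hf_def mult.assoc)

text \<open>Needed for Fubini with \<open>m\<close>. The slabs |v| \<le> n are unbounded in t and x,
  but the marginal bound gives them measure at most 2 n \<open>M0\<close>.\<close>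

lemma sigma_finite_m: "sigma_finite_measure m"
proof -
  define V where "V n = {p::real \<times> real \<times> real. snd (snd p) \<in> {- real n..real n}}" for n :: nat
  have [measurable]: "V n \<in> sets borel" for n unfolding V_def by measurable
  have "emeasure m (V n) \<noteq> \<infinity>" for n
  proof -
    have "emeasure m (V n) = (\<integral>\<^sup>+p. indicator (V n) p \<partial>m)" by (simp add: sets_m)
    also have "\<dots> = (\<integral>\<^sup>+(t, x, v). indicator {- real n..real n} v \<partial>m)"
      by (intro nn_integral_cong) (auto simp: V_def indicator_def)
    also have "\<dots> \<le> ennreal M0 * (\<integral>\<^sup>+v. indicator {- real n..real n} v \<partial>lborel)"
      by (rule marginal) auto
    also have "\<dots> < \<infinity>" by (simp add: ennreal_mult_less_top)
    finally show ?thesis by simp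
  qed
  moreover have "(\<Union>n. V n) = UNIV"
  proof -
    have "\<exists>n. v \<in> {- real n..real n}" for v :: real
      using real_arch_simple[of "\<bar>v\<bar>"] by (metis abs_le_iff atLeastAtMost_iff minus_le_iff)
    then show ?thesis by (auto simp: V_def)
  qed
  ultimately show ?thesis
    by (intro sigma_finite_measure.intro exI[of _ "range V"])
       (auto simp: sets_m sets_eq_imp_space_eq[OF sets_m])
qed

text \<open>Discrete integration by parts in x: translation invariance moves the increment from the
  rough function f to the test function.\<close>

lemma integral_shift:
  fixes g :: "real \<times> real \<times> real \<Rightarrow> real"
  assumes g: "integrable lborel g"
  shows "(\<integral>p. (hf p - hf (p + (0, h, 0))) * g p \<partial>lborel) = (\<integral>p. hf p * (g p - g (p - (0, h, 0))) \<partial>lborel)"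
proof -
  have [measurable]: "g \<in> borel_measurable borel" using g by auto
  have g': "integrable lborel (\<lambda>p. g (p - (0, h, 0)))"
  proof -
    have "integrable (distr lborel borel ((+) (0, - h, 0))) g" using g by (simp add: lborel_distr_plus)
    then have "integrable lborel (\<lambda>p. g ((0, - h, 0) + p))" by (subst (asm) integrable_distr_eq) auto
    moreover have "(0, - h, 0) + p = p - (0, h, 0)" for p :: "real \<times> real \<times> real" by (cases p) simp
    ultimately show ?thesis by simp
  qed
  have m: "integrable lborel (\<lambda>p. k p * G p)" if "integrable lborel G" "k \<in> borel_measurable borel" "\<And>p. \<bar>k p\<bar> \<le> 1"
    for k G :: "real \<times> real \<times> real \<Rightarrow> real"
    using that by (intro integrable_abs_le[OF that(1), of _ 1]) (auto simp: abs_mult intro!: mult_left_le_one_le)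
  have "(\<integral>p. (hf p - hf (p + (0, h, 0))) * g p \<partial>lborel) = (\<integral>p. hf p * g p \<partial>lborel) - (\<integral>p. hf (p + (0, h, 0)) * g p \<partial>lborel)"
    by (simp add: left_diff_distrib) (intro Bochner_Integration.integral_diff m g; auto simp: hf_abs)
  also have "(\<integral>p. hf (p + (0, h, 0)) * g p \<partial>lborel) = (\<integral>p. hf (p + (0, h, 0)) * g (p + (0, h, 0) - (0, h, 0)) \<partial>lborel)"
    by simp
  also have "\<dots> = (\<integral>p. hf p * g (p - (0, h, 0)) \<partial>lborel)"
    by (rule integral_translate[of "\<lambda>p. hf p * g (p - (0, h, 0))"]) measurable
  also have "(\<integral>p. hf p * g p \<partial>lborel) - (\<integral>p. hf p * g (p - (0, h, 0)) \<partial>lborel) = (\<integral>p. hf p * (g p - g (p - (0, h, 0))) \<partial>lborel)"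
    by (simp add: right_diff_distrib) (intro Bochner_Integration.integral_diff[symmetric] m g g'; auto simp: hf_abs)
  finally show ?thesis .
qed

lemma bump_on_shift: "bump_on a b g \<Longrightarrow> bump_on (a + h) (b + h) (\<lambda>x. g (x - h))"
  using smooth_affine_real[of g 1 "-h"] by (auto simp: bump_on_def)

lemma bump_on_diff: "bump_on a b f \<Longrightarrow> bump_on a' b' g \<Longrightarrow> bump_on (min a a') (max b b') (\<lambda>x. f x - g x)"
  unfolding bump_on_def by (simp add: smooth_diff min_le_iff_disj le_max_iff_disj)

lemma deriv_shift: assumes "bump_on a b g" shows "deriv (\<lambda>x. g (x - h)) x = deriv g (x - h)"
  by (rule DERIV_imp_deriv) (rule DERIV_cong[OF DERIV_chain2[OF bump_on_DERIV[OF assms]]], auto intro!: derivative_eq_intros)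

lemma flux_bound:
  assumes "0 < va" "va \<le> v" "v \<le> vb"
  shows "\<bar>flux v\<bar> \<le> (l + 1) * vb powr l"
  using assms l_ge_1 sg by (auto simp: flux_def abs_mult intro!: mult_left_mono powr_mono2)

lemma integrable_flux_bump:
  assumes C: "bump_on va vb C" and va: "0 < va"
  shows "integrable lborel (\<lambda>v. flux v * C v)"
proof (rule integrable_abs_le[OF bump_on_integrable[OF C], of _ "(l + 1) * vb powr l"])
  have [measurable]: "C \<in> borel_measurable borel" using C by measurable
  show "(\<lambda>v. flux v * C v) \<in> borel_measurable lborel" by measurable
  show "\<bar>flux v * C v\<bar> \<le> (l + 1) * vb powr l * \<bar>C v\<bar>" for v
    using flux_bound[OF va, of v vb] bump_onD(2)[OF C, of v] by (cases "v \<in> {va..vb}") (auto simp: abs_mult intro!: mult_right_mono)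
qed

text \<open>The flux does not depend on x, so the increment of f solves the same equation. On the
  right the shift is left on the test function, since neither \<open>m\<close> nor the source is to
  be differenced.\<close>

lemma weak_shifted:
  assumes A: "bump_on ta tb A" "0 < ta" "tb < T" and B: "bump_on xa xb B" and C: "bump_on va vb C" "0 < va"
  shows "(LINT (t, x, v)|lborel. (hf (t, x, v) - hf (t, x + h, v)) * (deriv A t * B x * C v + A t * deriv B x * (flux v * C v)))
      = (LINT (t, x, v)|m. A t * (B x - B (x - h)) * deriv C v)
        - (LINT (t, x)|lborel. S (t, x) * A t * (B x - B (x - h)) * C (U (t, x)))"
proof -
  define g where "g = (\<lambda>(t, x, v). deriv A t * B x * C v + A t * deriv B x * (flux v * C v))"
  have "integrable lborel (\<lambda>p. (case p of (t, x, v) \<Rightarrow> deriv A t * B x * C v) + (case p of (t, x, v) \<Rightarrow> A t * deriv B x * (flux v * C v)))"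
    by (intro Bochner_Integration.integrable_add integrable_tensor3 bump_on_integrable[OF bump_on_deriv[OF A(1)]]
        bump_on_integrable[OF B] bump_on_integrable[OF C(1)] bump_on_integrable[OF A(1)] bump_on_integrable[OF bump_on_deriv[OF B]]
        integrable_flux_bump[OF C])
  then have g: "integrable lborel g"
    by (rule back_subst[of "integrable lborel"]) (auto simp: g_def)
  have "(LINT (t, x, v)|lborel. (hf (t, x, v) - hf (t, x + h, v)) * (deriv A t * B x * C v + A t * deriv B x * (flux v * C v)))
     = (\<integral>p. (hf p - hf (p + (0, h, 0))) * g p \<partial>lborel)"
    by (intro Bochner_Integration.integral_cong) (auto simp: g_def)
  also have "\<dots> = (\<integral>p. hf p * (g p - g (p - (0, h, 0))) \<partial>lborel)"
    by (rule integral_shift[OF g])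
  also have "\<dots> = (LINT (t, x, v)|lborel. hf (t, x, v) * (deriv A t * (B x - B (x - h)) * C v + flux v * A t * deriv (\<lambda>x. B x - B (x - h)) x * C v))"
  proof -
    have dd: "deriv (\<lambda>x. B x - B (x - h)) x = deriv B x - deriv B (x - h)" for x
      using DERIV_diff[OF bump_on_DERIV[OF B, of x] bump_on_DERIV[OF bump_on_shift[OF B, of h], of x]] deriv_shift[OF B]
      by (simp add: DERIV_imp_deriv)
    have "g (t, x, v) - g ((t, x, v) - (0, h, 0)) = deriv A t * (B x - B (x - h)) * C v + flux v * A t * deriv (\<lambda>x. B x - B (x - h)) x * C v" for t x v
      unfolding dd by (simp add: g_def algebra_simps)
    then show ?thesis
      by (intro Bochner_Integration.integral_cong refl) (simp only: split_paired_all split_conv)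
  qed
  also have "\<dots> = (LINT (t, x, v)|m. A t * (B x - B (x - h)) * deriv C v)
        - (LINT (t, x)|lborel. S (t, x) * A t * (B x - B (x - h)) * C (U (t, x)))"
    by (rule weak3[OF A bump_on_diff[OF B bump_on_shift[OF B]] C])
  finally show ?thesis .
qed

end

section \<open>Doubling of variables\<close>

text \<open>\<open>bt\<close>, \<open>qx\<close> and \<open>ps\<close> cut off in time, space and
  velocity. The scale \<open>e\<close> of the mollifiers in t and x will tend to 0, whereas the
  scale \<open>e2\<close> of the smoothed sign in v stays fixed. \<open>V\<close> bounds the total
  variation of \<open>step_at e (y - x) * qx y\<close>: the step itself contributes 1, and the
  cut-off half of its own variation, because |\<open>step_at\<close>| \<le> 1/2.\<close>

locale doubling = half_problem +
  fixes bt qx ps :: "real \<Rightarrow> real" and ta tb xa xb va vb h V e e2 :: real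
  assumes bt: "bump_on ta tb bt" and ta: "0 < ta" and tb: "tb < T"
    and qx: "bump_on xa xb qx" and ps: "bump_on va vb ps" and va: "0 < va"
    and bt_range: "\<And>t. 0 \<le> bt t" "\<And>t. bt t \<le> 1"
    and qx_range: "\<And>t. 0 \<le> qx t" "\<And>t. qx t \<le> 1"
    and ps_range: "\<And>t. 0 \<le> ps t" "\<And>t. ps t \<le> 1"
    and h: "0 \<le> h" and e: "0 < e" and e2: "0 < e2"
    and V: "(\<integral>\<^sup>+x. ennreal (\<bar>deriv qx x\<bar> / 2) \<partial>lborel) \<le> ennreal (V - 1)" "1 \<le> V"
begin

lemma cutoffs_measurable [measurable]:
  "bt \<in> borel_measurable borel" "qx \<in> borel_measurable borel" "ps \<in> borel_measurable borel"
  "deriv bt \<in> borel_measurable borel" "deriv qx \<in> borel_measurable borel" "deriv ps \<in> borel_measurable borel"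
  using bt qx ps bump_on_deriv[OF bt] bump_on_deriv[OF qx] bump_on_deriv[OF ps] by measurable

definition prof :: "(real \<Rightarrow> real) \<Rightarrow> (real \<Rightarrow> real) \<Rightarrow> (real \<Rightarrow> real) \<Rightarrow> real \<times> real \<times> real \<Rightarrow> real" where
  "prof \<alpha> \<beta> \<gamma> = (\<lambda>(t, x, v). (hf (t, x, v) - hf (t, x + h, v)) * (\<alpha> t * \<beta> x * \<gamma> v))"

lemma dF_abs: "\<bar>hf p - hf p'\<bar> \<le> 1"
  using hf_range[of p] hf_range[of p'] by linarith

lemma prof_integrable:
  assumes "integrable lborel \<alpha>" "integrable lborel \<beta>" "integrable lborel \<gamma>"
  shows "integrable lborel (prof \<alpha> \<beta> \<gamma>)"
proof (rule integrable_abs_le[OF integrable_tensor3[OF assms], of _ 1])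
  have [measurable]: "\<alpha> \<in> borel_measurable borel" "\<beta> \<in> borel_measurable borel" "\<gamma> \<in> borel_measurable borel"
    using assms by auto
  show "prof \<alpha> \<beta> \<gamma> \<in> borel_measurable lborel" unfolding prof_def by measurable
  show "\<bar>prof \<alpha> \<beta> \<gamma> p\<bar> \<le> 1 * \<bar>case p of (t, x, v) \<Rightarrow> \<alpha> t * \<beta> x * \<gamma> v\<bar>" for p
  proof (cases p)
    case (fields t x v)
    show ?thesis unfolding fields prof_def
      using mult_right_mono[OF dF_abs[of "(t, x, v)" "(t, x + h, v)"], of "\<bar>\<alpha> t * \<beta> x * \<gamma> v\<bar>"] by (simp add: abs_mult)
  qed
qed

lemma prof_nn_le:
  assumes [measurable]: "\<alpha> \<in> borel_measurable borel" "\<beta> \<in> borel_measurable borel" "\<gamma> \<in> borel_measurable borel"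
    and "(\<integral>\<^sup>+t. ennreal \<bar>\<alpha> t\<bar> \<partial>lborel) \<le> ennreal a" "(\<integral>\<^sup>+t. ennreal \<bar>\<beta> t\<bar> \<partial>lborel) \<le> ennreal b" "(\<integral>\<^sup>+t. ennreal \<bar>\<gamma> t\<bar> \<partial>lborel) \<le> ennreal c"
    and "0 \<le> a" "0 \<le> b" "0 \<le> c"
  shows "(\<integral>\<^sup>+p. ennreal \<bar>prof \<alpha> \<beta> \<gamma> p\<bar> \<partial>lborel) \<le> ennreal (a * b * c)"
proof -
  have "(\<integral>\<^sup>+p. ennreal \<bar>prof \<alpha> \<beta> \<gamma> p\<bar> \<partial>lborel) \<le> (\<integral>\<^sup>+(t, x, v). ennreal \<bar>\<alpha> t\<bar> * ennreal \<bar>\<beta> x\<bar> * ennreal \<bar>\<gamma> v\<bar> \<partial>lborel)"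
  proof (intro nn_integral_mono)
    fix p :: "real \<times> real \<times> real"
    show "ennreal \<bar>prof \<alpha> \<beta> \<gamma> p\<bar> \<le> (case p of (t, x, v) \<Rightarrow> ennreal \<bar>\<alpha> t\<bar> * ennreal \<bar>\<beta> x\<bar> * ennreal \<bar>\<gamma> v\<bar>)"
    proof (cases p)
      case (fields t x v)
      show ?thesis unfolding fields prof_def
        using mult_right_mono[OF dF_abs[of "(t, x, v)" "(t, x + h, v)"], of "\<bar>\<alpha> t * \<beta> x * \<gamma> v\<bar>"]
        by (simp add: abs_mult flip: ennreal_mult)
    qed
  qed
  also have "\<dots> = (\<integral>\<^sup>+t. ennreal \<bar>\<alpha> t\<bar> \<partial>lborel) * (\<integral>\<^sup>+t. ennreal \<bar>\<beta> t\<bar> \<partial>lborel) * (\<integral>\<^sup>+t. ennreal \<bar>\<gamma> t\<bar> \<partial>lborel)"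
    by (rule nn_integral_tensor3) auto
  also have "\<dots> \<le> ennreal a * ennreal b * ennreal c" by (intro mult_mono assms) auto
  also have "\<dots> = ennreal (a * b * c)" using assms by (simp add: ennreal_mult)
  finally show ?thesis .
qed

definition PP where "PP = prof bt qx ps"

lemma PP_integrable: "integrable lborel PP"
  unfolding PP_def by (intro prof_integrable bump_on_integrable[OF bt] bump_on_integrable[OF qx] bump_on_integrable[OF ps])

lemma PP_measurable [measurable]: "PP \<in> borel_measurable borel"
  using PP_integrable by auto

text \<open>The increment of \<open>f\<close> in \<open>x\<close> is moved to the step function, whose total variation is bounded.\<close>

lemma gain_h:
  assumes [measurable]: "\<alpha> \<in> borel_measurable borel" "\<gamma> \<in> borel_measurable borel"
    and A: "(\<integral>\<^sup>+s. ennreal \<bar>\<alpha> s * bt s\<bar> \<partial>lborel) \<le> ennreal a" "0 \<le> a"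
    and G: "(\<integral>\<^sup>+w. ennreal \<bar>\<gamma> w * ps w\<bar> \<partial>lborel) \<le> ennreal c" "0 \<le> c"
  shows "\<bar>\<integral>p'. PP p' * (case p' of (s, y, w) \<Rightarrow> \<alpha> s * step_at e (y - x) * \<gamma> w) \<partial>lborel\<bar> \<le> V * h * a * c"
proof -
  \<comment> \<open>Step and cut-off form one profile in y, whose total variation is at most
    \<open>V\<close> uniformly in x and \<open>e\<close>.\<close>
  define X where "X y = step_at e (y - x) * qx y" for y
  have X_bump: "bump_on xa xb X"
    unfolding X_def[abs_def] using bump_on_mult[OF qx] smooth_affine_real[OF smooth_step_at, of e 1 "-x"] by auto
  have X_deriv: "(X has_real_derivative moll e (y - x) * qx y + step_at e (y - x) * deriv qx y) (at y)" for y
    unfolding X_def[abs_def]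
    by (rule DERIV_cong[OF DERIV_mult[OF DERIV_chain2[OF step_at_deriv] bump_on_DERIV[OF qx]]])
       (use e in \<open>auto intro!: derivative_eq_intros\<close>)
  have [measurable]: "X \<in> borel_measurable borel" using X_bump by measurable
  have TV: "(\<integral>\<^sup>+y. ennreal \<bar>X y - X (y - h)\<bar> \<partial>lborel) \<le> ennreal (V * h)"
  proof -
    have "(\<integral>\<^sup>+y. ennreal \<bar>moll e (y - x) * qx y + step_at e (y - x) * deriv qx y\<bar> \<partial>lborel)
      \<le> (\<integral>\<^sup>+y. ennreal (moll e (y + - x)) + ennreal (\<bar>deriv qx y\<bar> / 2) \<partial>lborel)"
    proof (intro nn_integral_mono)
      fix y
      have "\<bar>moll e (y - x) * qx y + step_at e (y - x) * deriv qx y\<bar> \<le> \<bar>moll e (y - x)\<bar> * \<bar>qx y\<bar> + \<bar>step_at e (y - x)\<bar> * \<bar>deriv qx y\<bar>"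
        using abs_triangle_ineq[of "moll e (y - x) * qx y" "step_at e (y - x) * deriv qx y"] by (simp add: abs_mult)
      also have "\<dots> \<le> moll e (y - x) * 1 + (1/2) * \<bar>deriv qx y\<bar>"
        using moll_nonneg[OF e] qx_range step_at_abs[of e "y - x"] by (intro add_mono mult_mono) auto
      finally show "ennreal \<bar>moll e (y - x) * qx y + step_at e (y - x) * deriv qx y\<bar> \<le> ennreal (moll e (y + - x)) + ennreal (\<bar>deriv qx y\<bar> / 2)"
        using moll_nonneg[OF e] by (simp flip: ennreal_plus add: ennreal_leI)
    qed
    also have "\<dots> = 1 + (\<integral>\<^sup>+y. ennreal (\<bar>deriv qx y\<bar> / 2) \<partial>lborel)"
      using nn_integral_translate[of "\<lambda>y. ennreal (moll e y)" "- x"] nn_integral_moll[OF e]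
      by (subst nn_integral_add) auto
    also have "\<dots> \<le> 1 + ennreal (V - 1)"
      by (intro add_left_mono V)
    also have "\<dots> = ennreal V"
      using V(2) by (simp flip: ennreal_1 ennreal_plus)
    finally have V': "(\<integral>\<^sup>+y. ennreal \<bar>moll e (y - x) * qx y + step_at e (y - x) * deriv qx y\<bar> \<partial>lborel) \<le> ennreal V" .
    have "(\<integral>\<^sup>+y. ennreal \<bar>X y - X (y - h)\<bar> \<partial>lborel) \<le> ennreal h * (\<integral>\<^sup>+y. ennreal \<bar>moll e (y - x) * qx y + step_at e (y - x) * deriv qx y\<bar> \<partial>lborel)"
      by (rule total_variation_shift[OF X_deriv _ h]) measurable
    also have "\<dots> \<le> ennreal h * ennreal V" by (intro mult_left_mono V') auto
    also have "\<dots> = ennreal (V * h)" using h V(2) by (simp flip: ennreal_mult add: mult.commute)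
    finally show ?thesis .
  qed
  have fin: "integrable lborel (\<lambda>s. \<alpha> s * bt s)" "integrable lborel (\<lambda>w. \<gamma> w * ps w)"
    using A G by (auto intro!: integrable_nnI)
  define g where "g = (\<lambda>(s, y, w). (\<alpha> s * bt s) * X y * (\<gamma> w * ps w))"
  have g: "integrable lborel g"
    unfolding g_def by (intro integrable_tensor3 fin bump_on_integrable[OF X_bump])
  have "(\<integral>p'. PP p' * (case p' of (s, y, w) \<Rightarrow> \<alpha> s * step_at e (y - x) * \<gamma> w) \<partial>lborel) = (\<integral>p. (hf p - hf (p + (0, h, 0))) * g p \<partial>lborel)"
    by (intro Bochner_Integration.integral_cong) (auto simp: PP_def prof_def g_def X_def ac_simps)
  \<comment> \<open>Once the shift sits on \<open>g\<close>, f is estimated by nothing better than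
    1.\<close>
  also have "\<dots> = (\<integral>p. hf p * (g p - g (p - (0, h, 0))) \<partial>lborel)" by (rule integral_shift[OF g])
  also have "\<bar>\<dots>\<bar> \<le> V * h * a * c"
  proof (rule abs_integral_leI)
    have "(\<integral>\<^sup>+p. ennreal \<bar>hf p * (g p - g (p - (0, h, 0)))\<bar> \<partial>lborel)
      \<le> (\<integral>\<^sup>+(s, y, w). ennreal \<bar>\<alpha> s * bt s\<bar> * ennreal \<bar>X y - X (y - h)\<bar> * ennreal \<bar>\<gamma> w * ps w\<bar> \<partial>lborel)"
    proof (intro nn_integral_mono, clarify)
      fix s y w
      have "g (s, y, w) - g ((s, y, w) - (0, h, 0)) = (\<alpha> s * bt s) * (X y - X (y - h)) * (\<gamma> w * ps w)"
        by (simp add: g_def algebra_simps)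
      then have "\<bar>hf (s, y, w) * (g (s, y, w) - g ((s, y, w) - (0, h, 0)))\<bar> = \<bar>hf (s, y, w)\<bar> * (\<bar>\<alpha> s * bt s\<bar> * \<bar>X y - X (y - h)\<bar> * \<bar>\<gamma> w * ps w\<bar>)"
        by (simp add: abs_mult)
      also have "\<dots> \<le> \<bar>\<alpha> s * bt s\<bar> * \<bar>X y - X (y - h)\<bar> * \<bar>\<gamma> w * ps w\<bar>"
        using hf_abs[of "(s, y, w)"] by (intro mult_left_le_one_le) auto
      finally show "ennreal \<bar>hf (s, y, w) * (g (s, y, w) - g ((s, y, w) - (0, h, 0)))\<bar>
        \<le> ennreal \<bar>\<alpha> s * bt s\<bar> * ennreal \<bar>X y - X (y - h)\<bar> * ennreal \<bar>\<gamma> w * ps w\<bar>"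
        by (simp flip: ennreal_mult add: ennreal_leI)
    qed
    also have "\<dots> = (\<integral>\<^sup>+s. ennreal \<bar>\<alpha> s * bt s\<bar> \<partial>lborel) * (\<integral>\<^sup>+y. ennreal \<bar>X y - X (y - h)\<bar> \<partial>lborel) * (\<integral>\<^sup>+w. ennreal \<bar>\<gamma> w * ps w\<bar> \<partial>lborel)"
      by (rule nn_integral_tensor3) auto
    also have "\<dots> \<le> ennreal a * ennreal (V * h) * ennreal c"
      by (intro mult_mono A G TV) auto
    also have "\<dots> = ennreal (V * h * a * c)"
      using A(2) G(2) h V(2) by (simp flip: ennreal_mult add: ac_simps)
    finally show "(\<integral>\<^sup>+p. ennreal \<bar>hf p * (g p - g (p - (0, h, 0)))\<bar> \<partial>lborel) \<le> ennreal (V * h * a * c)" .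
    show "0 \<le> V * h * a * c" using A(2) G(2) h V(2) by simp
  qed
  finally show ?thesis .
qed

text \<open>
  Kernels obtained from the test function \<open>\<rho>(t - s) G(y - x) G(v - w)\<close> at \<open>(t, x, v)\<close>, doubled with \<open>(s, y, w)\<close>.
  The kernel \<open>k1\<close> is antisymmetric, so its term vanishes; \<open>k3\<close> produces the interaction functional as \<open>e\<close> tends to \<open>0\<close>.
\<close>

definition k1 :: "real \<times> real \<times> real \<Rightarrow> real \<times> real \<times> real \<Rightarrow> real" where
  "k1 = (\<lambda>(s, y, w) (t, x, v). moll' e (t - s) * step_at e (y - x) * step_at e2 (v - w))"
definition k2 :: "real \<times> real \<times> real \<Rightarrow> real \<times> real \<times> real \<Rightarrow> real" where
  "k2 = (\<lambda>(s, y, w) (t, x, v). moll e (t - s) * step_at e (y - x) * step_at e2 (v - w))"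
definition k3 :: "real \<times> real \<times> real \<Rightarrow> real \<times> real \<times> real \<Rightarrow> real" where
  "k3 = (\<lambda>(s, y, w) (t, x, v). moll e (t - s) * moll e (y - x) * step_at e2 (v - w))"
text \<open>The difference in the middle is the cut-off step at x and at x - h, as left on the test
  function by \<open>weak_shifted\<close>; the last factor is the v-derivative of
  \<open>step_at e2 (v - w) * ps v\<close>. In \<open>ks\<close> that derivative is absent and v is
  replaced by the value of \<open>U\<close>.\<close>

definition km :: "real \<times> real \<times> real \<Rightarrow> real \<times> real \<times> real \<Rightarrow> real" where
  "km = (\<lambda>(s, y, w) (t, x, v). moll e (t - s) * bt t * (step_at e (y - x) * qx x - step_at e (y - (x - h)) * qx (x - h))
      * (moll e2 (v - w) * ps v + step_at e2 (v - w) * deriv ps v))"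
definition ks :: "real \<times> real \<times> real \<Rightarrow> real \<times> real \<Rightarrow> real" where
  "ks = (\<lambda>(s, y, w) (t, x). moll e (t - s) * bt t * (step_at e (y - x) * qx x - step_at e (y - (x - h)) * qx (x - h))
      * (step_at e2 (U (t, x) - w) * ps (U (t, x))))"

lemma kernels_measurable:
  "case_prod k1 \<in> borel_measurable (lborel \<Otimes>\<^sub>M lborel)"
  "case_prod k2 \<in> borel_measurable (lborel \<Otimes>\<^sub>M lborel)"
  "case_prod k3 \<in> borel_measurable (lborel \<Otimes>\<^sub>M lborel)"
  "case_prod km \<in> borel_measurable (lborel \<Otimes>\<^sub>M m)"
  "case_prod ks \<in> borel_measurable (lborel \<Otimes>\<^sub>M lborel)"
  unfolding k1_def k2_def k3_def km_def ks_def by (simp_all only: split_beta' split_beta measurable_lborel2) measurable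

lemma kernels_bounded:
  obtains K where "\<And>p p'. \<bar>k1 p p'\<bar> \<le> K" "\<And>p p'. \<bar>k2 p p'\<bar> \<le> K" "\<And>p p'. \<bar>k3 p p'\<bar> \<le> K"
    "\<And>p p'. \<bar>km p p'\<bar> \<le> K" "\<And>p p'. \<bar>ks p p'\<bar> \<le> K"
proof -
  obtain K1 where K1: "0 \<le> K1" "\<And>x. \<bar>moll e x\<bar> \<le> K1" using moll_bound[OF e] by metis
  obtain K2 where K2: "0 \<le> K2" "\<And>x. \<bar>moll' e x\<bar> \<le> K2" using moll'_bound[OF e] by metis
  obtain K3 where K3: "0 \<le> K3" "\<And>x. \<bar>moll e2 x\<bar> \<le> K3" using moll_bound[OF e2] by metis
  obtain K4 where K4: "0 \<le> K4" "\<And>x. \<bar>deriv ps x\<bar> \<le> K4" using bump_on_bounded[OF bump_on_deriv[OF ps]] by metis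
  have r: "\<bar>bt x\<bar> \<le> 1" "\<bar>qx x\<bar> \<le> 1" "\<bar>ps x\<bar> \<le> 1" for x using bt_range qx_range ps_range by auto
  have d: "\<bar>step_at e y1 * qx y2 - step_at e y3 * qx y4\<bar> \<le> 1" for y1 y2 y3 y4
  proof -
    have "\<bar>step_at e y1 * qx y2 - step_at e y3 * qx y4\<bar> \<le> \<bar>step_at e y1\<bar> * \<bar>qx y2\<bar> + \<bar>step_at e y3\<bar> * \<bar>qx y4\<bar>"
      using abs_triangle_ineq4[of "step_at e y1 * qx y2" "step_at e y3 * qx y4"] by (simp add: abs_mult)
    also have "\<dots> \<le> (1/2) * 1 + (1/2) * 1" by (intro add_mono mult_mono step_at_abs r) auto
    finally show ?thesis by simp
  qed
  have d': "\<bar>moll e2 y * ps v + step_at e2 y * deriv ps v\<bar> \<le> K3 * 1 + (1/2) * K4" for y v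
  proof -
    have "\<bar>moll e2 y * ps v + step_at e2 y * deriv ps v\<bar> \<le> \<bar>moll e2 y\<bar> * \<bar>ps v\<bar> + \<bar>step_at e2 y\<bar> * \<bar>deriv ps v\<bar>"
      using abs_triangle_ineq[of "moll e2 y * ps v" "step_at e2 y * deriv ps v"] by (simp add: abs_mult)
    also have "\<dots> \<le> K3 * 1 + (1/2) * K4" by (intro add_mono mult_mono step_at_abs r K3 K4) auto
    finally show ?thesis .
  qed
  define K where "K = Max {K2 * (1/2) * (1/2), K1 * (1/2) * (1/2), K1 * K1 * (1/2), K1 * 1 * 1 * (K3 * 1 + (1/2) * K4), K1 * 1 * 1 * ((1/2) * 1)}"
  show ?thesis
  proof (rule that[of K])
    fix p p' :: "real \<times> real \<times> real"
    obtain s y w t x v where [simp]: "p = (s, y, w)" "p' = (t, x, v)" by (cases p, cases p')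
    have "\<bar>k1 p p'\<bar> \<le> K2 * (1/2) * (1/2)"
      unfolding k1_def using K2 by (simp only: abs_mult split_conv \<open>p = _\<close> \<open>p' = _\<close>) (intro mult_mono step_at_abs; simp)
    then show "\<bar>k1 p p'\<bar> \<le> K" by (simp add: K_def)
    have "\<bar>k2 p p'\<bar> \<le> K1 * (1/2) * (1/2)"
      unfolding k2_def using K1 by (simp only: abs_mult split_conv \<open>p = _\<close> \<open>p' = _\<close>) (intro mult_mono step_at_abs; simp)
    then show "\<bar>k2 p p'\<bar> \<le> K" by (simp add: K_def)
    have "\<bar>k3 p p'\<bar> \<le> K1 * K1 * (1/2)"
      unfolding k3_def using K1 by (simp only: abs_mult split_conv \<open>p = _\<close> \<open>p' = _\<close>) (intro mult_mono step_at_abs; simp)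
    then show "\<bar>k3 p p'\<bar> \<le> K" by (simp add: K_def)
    have "\<bar>km p p'\<bar> \<le> K1 * 1 * 1 * (K3 * 1 + (1/2) * K4)"
      unfolding km_def using K1 K3(1) K4(1) by (simp only: abs_mult split_conv \<open>p = _\<close> \<open>p' = _\<close>) (intro mult_mono d d' r; simp)
    then show "\<bar>km p p'\<bar> \<le> K" by (simp add: K_def)
  next
    fix p :: "real \<times> real \<times> real" and p' :: "real \<times> real"
    obtain s y w t x where [simp]: "p = (s, y, w)" "p' = (t, x)" by (cases p, cases p')
    have "\<bar>ks p p'\<bar> \<le> K1 * 1 * 1 * ((1/2) * 1)"
      unfolding ks_def using K1 by (simp only: abs_mult split_conv \<open>p = _\<close> \<open>p' = _\<close>) (intro mult_mono d r step_at_abs; simp)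
    then show "\<bar>ks p p'\<bar> \<le> K" by (simp add: K_def)
  qed
qed

end

lemma nn_multc_le:
  fixes f :: "'a \<Rightarrow> real"
  assumes "f \<in> borel_measurable M" "\<And>x. 0 \<le> f x" "(\<integral>\<^sup>+x. ennreal (f x) \<partial>M) \<le> ennreal c" "0 \<le> c" "0 \<le> k"
  shows "(\<integral>\<^sup>+x. ennreal (f x * k) \<partial>M) \<le> ennreal (c * k)"
proof -
  have "(\<integral>\<^sup>+x. ennreal (f x * k) \<partial>M) = (\<integral>\<^sup>+x. ennreal (f x) \<partial>M) * ennreal k"
    using assms by (subst nn_integral_multc[symmetric]) (auto simp: ennreal_mult)
  also have "\<dots> \<le> ennreal c * ennreal k" by (intro mult_right_mono assms) simp
  finally show ?thesis using assms by (simp add: ennreal_mult)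
qed

section \<open>The doubled identity and the bound on its right-hand side\<close>

context doubling
begin

definition dbl :: "'b measure \<Rightarrow> ('b \<Rightarrow> real) \<Rightarrow> (real \<times> real \<times> real \<Rightarrow> 'b \<Rightarrow> real) \<Rightarrow> real" where
  "dbl M Q k = (\<integral>p'. PP p' * (\<integral>p. Q p * k p' p \<partial>M) \<partial>lborel)"

lemma ps_integrable: "integrable lborel ps" by (rule bump_on_integrable[OF ps])

lemma profs_integrable:
  "integrable lborel (prof (deriv bt) qx ps)"
  "integrable lborel (prof bt qx (\<lambda>v. flux v * ps v))"
  "integrable lborel (prof bt (deriv qx) (\<lambda>v. flux v * ps v))"
  by (intro prof_integrable bump_on_integrable[OF bt] bump_on_integrable[OF qx] ps_integrable
      bump_on_integrable[OF bump_on_deriv[OF bt]] bump_on_integrable[OF bump_on_deriv[OF qx]] integrable_flux_bump[OF ps va])+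

lemma integrable_slice:
  fixes Q :: "real \<times> real \<times> real \<Rightarrow> real"
  assumes "integrable lborel Q" "case_prod k \<in> borel_measurable (lborel \<Otimes>\<^sub>M lborel)" "\<And>p p'. \<bar>k p p'\<bar> \<le> K"
  shows "integrable lborel (\<lambda>p. Q p * k p' p)"
proof (rule integrable_abs_le[OF assms(1), of _ K])
  have [measurable]: "k p' \<in> borel_measurable lborel"
    using measurable_Pair2[OF assms(2), of p'] by simp
  have [measurable]: "Q \<in> borel_measurable lborel" using assms(1) by auto
  show "(\<lambda>p. Q p * k p' p) \<in> borel_measurable lborel" by measurable
  show "\<bar>Q p * k p' p\<bar> \<le> K * \<bar>Q p\<bar>" for p
    using mult_left_mono[OF assms(3)[of p' p], of "\<bar>Q p\<bar>"] by (simp add: abs_mult mult.commute)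
qed

text \<open>The shifted equation, with the point \<open>p'\<close> as a parameter of the test
  function. A derivative in t or x that falls on the kernel gives \<open>k1\<close> or
  \<open>k3\<close>, one that falls on a cut-off gives \<open>k2\<close>; the minus sign of
  \<open>k3\<close> comes from differentiating a function of y - x in x.\<close>

lemma slice_identity:
  "(\<integral>p. PP p * k1 p' p \<partial>lborel) + (\<integral>p. prof (deriv bt) qx ps p * k2 p' p \<partial>lborel)
    - (\<integral>p. prof bt qx (\<lambda>v. flux v * ps v) p * k3 p' p \<partial>lborel)
    + (\<integral>p. prof bt (deriv qx) (\<lambda>v. flux v * ps v) p * k2 p' p \<partial>lborel)
   = (\<integral>p. (case p of (t, x, v) \<Rightarrow> indicator {va..vb} v) * km p' p \<partial>m) - (\<integral>p. S p * ks p' p \<partial>lborel)"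
proof -
  obtain s y w where p': "p' = (s, y, w)" by (cases p')
  define A where "A t = moll e (t - s) * bt t" for t
  define B where "B x = step_at e (y - x) * qx x" for x
  define C where "C v = step_at e2 (v - w) * ps v" for v
  have A: "bump_on ta tb A" unfolding A_def[abs_def]
    using bump_on_mult[OF bt] smooth_affine_real[OF smooth_moll, of e 1 "-s"] by auto
  have B: "bump_on xa xb B" unfolding B_def[abs_def]
    using bump_on_mult[OF qx] smooth_affine_real[OF smooth_step_at, of e "-1" y] by auto
  have C: "bump_on va vb C" unfolding C_def[abs_def]
    using bump_on_mult[OF ps] smooth_affine_real[OF smooth_step_at, of e2 "1" "-w"] by auto
  have dA: "deriv A t = moll' e (t - s) * bt t + moll e (t - s) * deriv bt t" for t
    unfolding A_def[abs_def]
    by (rule DERIV_imp_deriv, rule DERIV_cong[OF DERIV_mult[OF DERIV_chain2[OF moll_deriv] bump_on_DERIV[OF bt]]])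
       (use e in \<open>auto intro!: derivative_eq_intros\<close>)
  have dB: "deriv B x = - (moll e (y - x) * qx x) + step_at e (y - x) * deriv qx x" for x
    unfolding B_def[abs_def]
    by (rule DERIV_imp_deriv, rule DERIV_cong[OF DERIV_mult[OF DERIV_chain2[OF step_at_deriv] bump_on_DERIV[OF qx]]])
       (use e in \<open>auto intro!: derivative_eq_intros\<close>)
  have dC: "deriv C v = moll e2 (v - w) * ps v + step_at e2 (v - w) * deriv ps v" for v
    unfolding C_def[abs_def]
    by (rule DERIV_imp_deriv, rule DERIV_cong[OF DERIV_mult[OF DERIV_chain2[OF step_at_deriv] bump_on_DERIV[OF ps]]])
       (use e2 in \<open>auto intro!: derivative_eq_intros\<close>)
  obtain K where K: "\<And>p p'. \<bar>k1 p p'\<bar> \<le> K" "\<And>p p'. \<bar>k2 p p'\<bar> \<le> K" "\<And>p p'. \<bar>k3 p p'\<bar> \<le> K"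
    using kernels_bounded by metis
  note km = kernels_measurable
  have i1: "integrable lborel (\<lambda>p. PP p * k1 p' p)" by (rule integrable_slice[OF PP_integrable km(1) K(1)])
  have i2: "integrable lborel (\<lambda>p. prof (deriv bt) qx ps p * k2 p' p)" by (rule integrable_slice[OF profs_integrable(1) km(2) K(2)])
  have i3: "integrable lborel (\<lambda>p. prof bt qx (\<lambda>v. flux v * ps v) p * k3 p' p)" by (rule integrable_slice[OF profs_integrable(2) km(3) K(3)])
  have i4: "integrable lborel (\<lambda>p. prof bt (deriv qx) (\<lambda>v. flux v * ps v) p * k2 p' p)" by (rule integrable_slice[OF profs_integrable(3) km(2) K(2)])
  have "(\<integral>p. PP p * k1 p' p \<partial>lborel) + (\<integral>p. prof (deriv bt) qx ps p * k2 p' p \<partial>lborel)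
    - (\<integral>p. prof bt qx (\<lambda>v. flux v * ps v) p * k3 p' p \<partial>lborel)
    + (\<integral>p. prof bt (deriv qx) (\<lambda>v. flux v * ps v) p * k2 p' p \<partial>lborel)
    = (\<integral>p. PP p * k1 p' p + prof (deriv bt) qx ps p * k2 p' p - prof bt qx (\<lambda>v. flux v * ps v) p * k3 p' p
        + prof bt (deriv qx) (\<lambda>v. flux v * ps v) p * k2 p' p \<partial>lborel)"
    using i1 i2 i3 i4 by simp
  also have "\<dots> = (LINT (t, x, v)|lborel. (hf (t, x, v) - hf (t, x + h, v)) * (deriv A t * B x * C v + A t * deriv B x * (flux v * C v)))"
  proof (intro Bochner_Integration.integral_cong refl, clarify)
    fix t x v
    show "PP (t, x, v) * k1 p' (t, x, v) + prof (deriv bt) qx ps (t, x, v) * k2 p' (t, x, v) - prof bt qx (\<lambda>v. flux v * ps v) (t, x, v) * k3 p' (t, x, v)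
        + prof bt (deriv qx) (\<lambda>v. flux v * ps v) (t, x, v) * k2 p' (t, x, v)
       = (hf (t, x, v) - hf (t, x + h, v)) * (deriv A t * B x * C v + A t * deriv B x * (flux v * C v))"
      unfolding dA dB A_def B_def C_def PP_def prof_def k1_def k2_def k3_def p' split_conv
      by (simp only: ring_distribs minus_mult_left[symmetric] minus_mult_right[symmetric] mult_minus_left) (simp add: ac_simps)
  qed
  also have "\<dots> = (LINT (t, x, v)|m. A t * (B x - B (x - h)) * deriv C v)
        - (LINT (t, x)|lborel. S (t, x) * A t * (B x - B (x - h)) * C (U (t, x)))"
    by (rule weak_shifted[OF A ta tb B C va])
  \<comment> \<open>The indicator changes nothing, since \<open>C\<close> is supported in [va, vb];
    it provides the \<open>m\<close>-integrable density that \<open>Fubini_kernel\<close> asks for,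
    as \<open>m\<close> itself may be infinite.\<close>
  also have "(LINT (t, x, v)|m. A t * (B x - B (x - h)) * deriv C v) = (\<integral>p. (case p of (t, x, v) \<Rightarrow> indicator {va..vb} v) * km p' p \<partial>m)"
  proof (intro Bochner_Integration.integral_cong refl, clarify)
    fix t x v
    have "deriv C v = indicator {va..vb} v * deriv C v"
      using bump_onD(2)[OF bump_on_deriv[OF C], of v] by (auto simp: indicator_def)
    then have "A t * (B x - B (x - h)) * deriv C v = indicator {va..vb} v * (A t * (B x - B (x - h)) * deriv C v)"
      by (metis mult.left_commute)
    then show "A t * (B x - B (x - h)) * deriv C v = indicator {va..vb} v * km p' (t, x, v)"
      by (simp add: dC km_def p' A_def B_def)
  qed
  also have "(LINT (t, x)|lborel. S (t, x) * A t * (B x - B (x - h)) * C (U (t, x))) = (\<integral>p. S p * ks p' p \<partial>lborel)"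
    by (intro Bochner_Integration.integral_cong refl) (auto simp: ks_def p' A_def B_def C_def)
  finally show ?thesis .
qed

lemma indicator_integrable: "integrable m (\<lambda>(t, x, v). indicator {va..vb} v :: real)"
proof (rule integrableI_bounded)
  have "(\<integral>\<^sup>+p. ennreal (norm ((case p of (t, x, v) \<Rightarrow> indicator {va..vb} v) :: real)) \<partial>m) = (\<integral>\<^sup>+(t, x, v). indicator {va..vb} v \<partial>m)"
    by (intro nn_integral_cong) (auto simp: indicator_def)
  also have "\<dots> \<le> ennreal M0 * (\<integral>\<^sup>+v. indicator {va..vb} v \<partial>lborel)"
    by (rule marginal) auto
  also have "\<dots> < \<infinity>" using emeasure_bounded_finite[of "{va..vb}"] by (simp add: ennreal_mult_less_top)
  finally show "(\<integral>\<^sup>+p. ennreal (norm ((case p of (t, x, v) \<Rightarrow> indicator {va..vb} v) :: real)) \<partial>m) < \<infinity>" .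
qed measurable

lemma dbl_identity:
  "dbl lborel PP k1 + dbl lborel (prof (deriv bt) qx ps) k2 - dbl lborel (prof bt qx (\<lambda>v. flux v * ps v)) k3
    + dbl lborel (prof bt (deriv qx) (\<lambda>v. flux v * ps v)) k2
   = dbl m (\<lambda>(t, x, v). indicator {va..vb} v) km - dbl lborel S ks"
proof -
  obtain K where K: "\<And>p p'. \<bar>k1 p p'\<bar> \<le> K" "\<And>p p'. \<bar>k2 p p'\<bar> \<le> K" "\<And>p p'. \<bar>k3 p p'\<bar> \<le> K"
    "\<And>p p'. \<bar>km p p'\<bar> \<le> K" "\<And>p p'. \<bar>ks p p'\<bar> \<le> K"
    using kernels_bounded by metis
  note F = Fubini_kernel(2)[OF sigma_finite_lborel]
  note i = F[OF sigma_finite_lborel PP_integrable PP_integrable kernels_measurable(1) K(1)]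
    F[OF sigma_finite_lborel PP_integrable profs_integrable(1) kernels_measurable(2) K(2)]
    F[OF sigma_finite_lborel PP_integrable profs_integrable(2) kernels_measurable(3) K(3)]
    F[OF sigma_finite_lborel PP_integrable profs_integrable(3) kernels_measurable(2) K(2)]
    F[OF sigma_finite_m PP_integrable indicator_integrable kernels_measurable(4) K(4)]
    F[OF sigma_finite_lborel PP_integrable S_integrable kernels_measurable(5) K(5)]
  have "dbl lborel PP k1 + dbl lborel (prof (deriv bt) qx ps) k2 - dbl lborel (prof bt qx (\<lambda>v. flux v * ps v)) k3
    + dbl lborel (prof bt (deriv qx) (\<lambda>v. flux v * ps v)) k2
    = (\<integral>p'. PP p' * (\<integral>p. PP p * k1 p' p \<partial>lborel) + PP p' * (\<integral>p. prof (deriv bt) qx ps p * k2 p' p \<partial>lborel)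
        - PP p' * (\<integral>p. prof bt qx (\<lambda>v. flux v * ps v) p * k3 p' p \<partial>lborel)
        + PP p' * (\<integral>p. prof bt (deriv qx) (\<lambda>v. flux v * ps v) p * k2 p' p \<partial>lborel) \<partial>lborel)"
    unfolding dbl_def using i by simp
  also have "\<dots> = (\<integral>p'. PP p' * (\<integral>p. (case p of (t, x, v) \<Rightarrow> indicator {va..vb} v) * km p' p \<partial>m) - PP p' * (\<integral>p. S p * ks p' p \<partial>lborel) \<partial>lborel)"
    by (simp only: distrib_left[symmetric] right_diff_distrib[symmetric] slice_identity)
  also have "\<dots> = dbl m (\<lambda>(t, x, v). indicator {va..vb} v) km - dbl lborel S ks"
    unfolding dbl_def using i by simp
  finally show ?thesis .
qed

text \<open>Exchanging the integrals puts the first point inside, where \<open>gain_h\<close>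
  supplies the factor h for every fixed second point; what remains is a weighted mass of
  \<open>Q\<close>.\<close>

lemma dbl_bound:
  assumes M: "sigma_finite_measure M" and Q: "integrable M Q" and k: "case_prod k \<in> borel_measurable (lborel \<Otimes>\<^sub>M M)"
    and K: "\<And>p p'. \<bar>k p' p\<bar> \<le> K"
    and R: "\<And>p. p \<in> space M \<Longrightarrow> \<bar>\<integral>p'. PP p' * k p' p \<partial>lborel\<bar> \<le> R p"
    and c: "(\<integral>\<^sup>+p. ennreal (\<bar>Q p\<bar> * R p) \<partial>M) \<le> ennreal c" "0 \<le> c"
  shows "\<bar>dbl M Q k\<bar> \<le> c"
proof -
  have "dbl M Q k = (\<integral>p. Q p * (\<integral>p'. PP p' * k p' p \<partial>lborel) \<partial>M)"
    unfolding dbl_def by (rule Fubini_kernel(1)[OF sigma_finite_lborel M PP_integrable Q k K])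
  also have "\<bar>\<dots>\<bar> \<le> c"
  proof (rule abs_integral_leI[OF order_trans[OF _ c(1)] c(2)], intro nn_integral_mono ennreal_leI)
    fix p assume "p \<in> space M"
    then show "\<bar>Q p * (\<integral>p'. PP p' * k p' p \<partial>lborel)\<bar> \<le> \<bar>Q p\<bar> * R p"
      using R by (auto simp: abs_mult intro!: mult_left_mono)
  qed
  finally show ?thesis .
qed

lemma dbl_k1: "dbl lborel PP k1 = 0"
proof -
  obtain K where K: "\<And>p p'. \<bar>k1 p p'\<bar> \<le> K" using kernels_bounded by metis
  have anti: "k1 p' p = - k1 p p'" for p p'
  proof -
    obtain s y w t x v where [simp]: "p = (s, y, w)" "p' = (t, x, v)" by (cases p, cases p')
    have 1: "moll' e (s - t) = - moll' e (t - s)" using moll'_odd[of e "t - s"] e by simp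
    have 2: "step_at e (x - y) = - step_at e (y - x)" using step_at_odd[of e "y - x"] by simp
    have 3: "step_at e2 (w - v) = - step_at e2 (v - w)" using step_at_odd[of e2 "v - w"] by simp
    show ?thesis by (simp add: k1_def 1 2 3)
  qed
  have "dbl lborel PP k1 = (\<integral>p. PP p * (\<integral>p'. PP p' * k1 p' p \<partial>lborel) \<partial>lborel)"
    unfolding dbl_def by (rule Fubini_kernel(1)[OF sigma_finite_lborel sigma_finite_lborel PP_integrable PP_integrable kernels_measurable(1) K])
  also have "\<dots> = - dbl lborel PP k1"
    unfolding dbl_def by (subst anti) simp
  finally show ?thesis by simp
qed

lemma nn_moll_bt: "(\<integral>\<^sup>+s. ennreal \<bar>moll e (t - s) * bt s\<bar> \<partial>lborel) \<le> ennreal 1"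
proof -
  have "(\<integral>\<^sup>+s. ennreal \<bar>moll e (t - s) * bt s\<bar> \<partial>lborel) \<le> (\<integral>\<^sup>+s. ennreal (moll e (t - s)) \<partial>lborel)"
    using moll_nonneg[OF e] bt_range by (intro nn_integral_mono ennreal_leI) (auto simp: abs_mult intro: mult_right_le_one_le)
  also have "\<dots> = ennreal 1" using nn_integral_moll_diff[OF e] by simp
  finally show ?thesis .
qed

lemma gain_k2:
  assumes I: "(\<integral>\<^sup>+v. ennreal (ps v) \<partial>lborel) \<le> ennreal I" "0 \<le> I"
  shows "\<bar>\<integral>p'. PP p' * k2 p' p \<partial>lborel\<bar> \<le> V * h * (I / 2)"
proof -
  obtain t x v where p: "p = (t, x, v)" by (cases p)
  have "\<bar>\<integral>p'. PP p' * (case p' of (s, y, w) \<Rightarrow> moll e (t - s) * step_at e (y - x) * step_at e2 (v - w)) \<partial>lborel\<bar> \<le> V * h * 1 * (I / 2)"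
  proof (rule gain_h[where \<alpha> = "\<lambda>s. moll e (t - s)" and \<gamma> = "\<lambda>w. step_at e2 (v - w)", OF _ _ nn_moll_bt])
    have "\<bar>step_at e2 (v - w) * ps w\<bar> \<le> ps w * (1/2)" for w
      using mult_right_mono[OF step_at_abs[of e2 "v - w"] ps_range(1)[of w]] ps_range(1)[of w] by (simp add: abs_mult)
    then have "(\<integral>\<^sup>+w. ennreal \<bar>step_at e2 (v - w) * ps w\<bar> \<partial>lborel) \<le> (\<integral>\<^sup>+w. ennreal (ps w * (1/2)) \<partial>lborel)"
      by (intro nn_integral_mono ennreal_leI)
    also have "\<dots> \<le> ennreal (I * (1/2))" by (rule nn_multc_le) (use I ps_range in auto)
    also have "I * (1/2) = I / 2" by simp
    finally show "(\<integral>\<^sup>+w. ennreal \<bar>step_at e2 (v - w) * ps w\<bar> \<partial>lborel) \<le> ennreal (I / 2)" .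
  qed (use I in auto)
  then show ?thesis by (simp add: k2_def p split_beta')
qed

text \<open>The cancellation between the steps at x and at x - h is not exploited: each of them is
  estimated by \<open>gain_h\<close>, hence the 2. A single factor h is all that the argument
  requires.\<close>

lemma gain_diff:
  assumes [measurable]: "\<gamma> \<in> borel_measurable borel" and K: "\<And>w. \<bar>\<gamma> w\<bar> \<le> K"
    and c: "(\<integral>\<^sup>+w. ennreal \<bar>\<gamma> w * ps w\<bar> \<partial>lborel) \<le> ennreal c" "0 \<le> c"
  shows "\<bar>\<integral>p'. PP p' * (case p' of (s, y, w) \<Rightarrow> moll e (t - s) * bt t *
      (step_at e (y - x) * qx x - step_at e (y - (x - h)) * qx (x - h)) * \<gamma> w) \<partial>lborel\<bar> \<le> 2 * V * h * c"
proof -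
  define J where "J x = (\<integral>p'. PP p' * (case p' of (s, y, w) \<Rightarrow> moll e (t - s) * step_at e (y - x) * \<gamma> w) \<partial>lborel)" for x
  have J: "\<bar>J x\<bar> \<le> V * h * c" for x
    unfolding J_def using gain_h[where \<alpha> = "\<lambda>s. moll e (t - s)" and \<gamma> = \<gamma> and x = x, OF _ _ nn_moll_bt _ c] by simp
  obtain K1 where K1: "0 \<le> K1" "\<And>x. \<bar>moll e x\<bar> \<le> K1" using moll_bound[OF e] by metis
  have int: "integrable lborel (\<lambda>p'. PP p' * (case p' of (s, y, w) \<Rightarrow> moll e (t - s) * step_at e (y - x) * \<gamma> w))" for x
  proof (rule integrable_abs_le[OF PP_integrable, of _ "K1 * (1/2) * K"])
    fix p' :: "real \<times> real \<times> real"
    obtain s y w where p': "p' = (s, y, w)" by (cases p')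
    have "\<bar>moll e (t - s) * step_at e (y - x) * \<gamma> w\<bar> \<le> K1 * (1/2) * K"
      unfolding abs_mult using K1 by (intro mult_mono step_at_abs K) auto
    then show "\<bar>PP p' * (case p' of (s, y, w) \<Rightarrow> moll e (t - s) * step_at e (y - x) * \<gamma> w)\<bar> \<le> K1 * (1/2) * K * \<bar>PP p'\<bar>"
      using mult_right_mono[of "\<bar>moll e (t - s) * step_at e (y - x) * \<gamma> w\<bar>" "K1 * (1/2) * K" "\<bar>PP p'\<bar>"]
      unfolding p' split_conv abs_mult[of "PP (s, y, w)"] by (simp only: mult.commute abs_ge_zero)
  qed measurable
  have "(\<integral>p'. PP p' * (case p' of (s, y, w) \<Rightarrow> moll e (t - s) * bt t *
      (step_at e (y - x) * qx x - step_at e (y - (x - h)) * qx (x - h)) * \<gamma> w) \<partial>lborel)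
    = (\<integral>p'. (bt t * qx x) * (PP p' * (case p' of (s, y, w) \<Rightarrow> moll e (t - s) * step_at e (y - x) * \<gamma> w))
       - (bt t * qx (x - h)) * (PP p' * (case p' of (s, y, w) \<Rightarrow> moll e (t - s) * step_at e (y - (x - h)) * \<gamma> w)) \<partial>lborel)"
    by (intro Bochner_Integration.integral_cong refl) (auto simp: algebra_simps)
  also have "\<dots> = (bt t * qx x) * J x - (bt t * qx (x - h)) * J (x - h)"
    unfolding J_def by (subst Bochner_Integration.integral_diff) (auto intro!: int)
  also have "\<bar>\<dots>\<bar> \<le> \<bar>(bt t * qx x) * J x\<bar> + \<bar>(bt t * qx (x - h)) * J (x - h)\<bar>"
    by (rule abs_triangle_ineq4)
  also have "\<dots> \<le> V * h * c + V * h * c"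
  proof (intro add_mono)
    have *: "\<bar>(bt t * qx x') * J x'\<bar> \<le> V * h * c" for x'
    proof -
      have "\<bar>bt t * qx x'\<bar> \<le> 1" using bt_range qx_range by (auto simp: abs_mult intro!: mult_le_one)
      then have "\<bar>bt t * qx x'\<bar> * \<bar>J x'\<bar> \<le> 1 * (V * h * c)" using J[of x'] by (intro mult_mono) auto
      then show ?thesis by (simp add: abs_mult)
    qed
    show "\<bar>(bt t * qx x) * J x\<bar> \<le> V * h * c" "\<bar>(bt t * qx (x - h)) * J (x - h)\<bar> \<le> V * h * c" by (rule *)+
  qed
  also have "V * h * c + V * h * c = 2 * V * h * c" by simp
  finally show ?thesis .
qed

text \<open>All terms of \<open>dbl_identity\<close> other than the one with \<open>k3\<close>
  receive \<open>V * h\<close> from the increment at the first point, and a velocity integral of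
  size \<open>I\<close> besides. The bound must contain neither \<open>e\<close> nor
  \<open>e2\<close>; the delicate term is the one with \<open>m\<close>, where a derivative in v
  falls on the smoothed sign.\<close>

lemma interaction_bound:
  assumes I: "(\<integral>\<^sup>+v. ennreal (ps v) \<partial>lborel) \<le> ennreal I" "0 \<le> I"
    and J: "(\<integral>\<^sup>+v. ennreal \<bar>deriv ps v\<bar> \<partial>lborel) \<le> ennreal J" "0 \<le> J"
    and Cb: "(\<integral>\<^sup>+t. ennreal \<bar>bt t\<bar> \<partial>lborel) \<le> ennreal Cb" "(\<integral>\<^sup>+t. ennreal \<bar>deriv bt t\<bar> \<partial>lborel) \<le> ennreal Cb" "0 \<le> Cb"
    and Cq: "(\<integral>\<^sup>+t. ennreal \<bar>qx t\<bar> \<partial>lborel) \<le> ennreal Cq" "(\<integral>\<^sup>+t. ennreal \<bar>deriv qx t\<bar> \<partial>lborel) \<le> ennreal Cq" "0 \<le> Cq"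
    and NS: "(\<integral>\<^sup>+p. ennreal \<bar>S p\<bar> \<partial>lborel) \<le> ennreal NS" "0 \<le> NS"
    and a0: "\<And>v. va \<le> v \<Longrightarrow> v \<le> vb \<Longrightarrow> \<bar>flux v\<bar> \<le> a0" "0 \<le> a0"
  shows "\<bar>dbl lborel (prof bt qx (\<lambda>v. flux v * ps v)) k3\<bar>
     \<le> h * V * I * (Cb * Cq * I * (1 + a0) / 2 + M0 * (2 + J) + NS)"
proof -
  obtain K where K: "\<And>p p'. \<bar>k2 p p'\<bar> \<le> K" "\<And>p p'. \<bar>km p p'\<bar> \<le> K" "\<And>p p'. \<bar>ks p p'\<bar> \<le> K"
    using kernels_bounded by metis
  have V0: "0 \<le> V" using V(2) by simp
  have aI: "(\<integral>\<^sup>+v. ennreal \<bar>ps v\<bar> \<partial>lborel) \<le> ennreal I" using I ps_range by simp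
  have "\<bar>dbl lborel (prof (deriv bt) qx ps) k2\<bar> \<le> (Cb * Cq * I) * (V * h * (I / 2))"
  proof (rule dbl_bound[OF sigma_finite_lborel profs_integrable(1) kernels_measurable(2) K(1) gain_k2[OF I]])
    show "(\<integral>\<^sup>+p. ennreal (\<bar>prof (deriv bt) qx ps p\<bar> * (V * h * (I / 2))) \<partial>lborel) \<le> ennreal (Cb * Cq * I * (V * h * (I / 2)))"
      by (rule nn_multc_le[OF _ _ prof_nn_le[OF _ _ _ Cb(2) Cq(1) aI]]) (use V0 h I Cb Cq profs_integrable(1) in auto)
  qed (use V0 h I Cb Cq in auto)
  moreover have "\<bar>dbl lborel (prof bt (deriv qx) (\<lambda>v. flux v * ps v)) k2\<bar> \<le> (Cb * Cq * (a0 * I)) * (V * h * (I / 2))"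
  proof (rule dbl_bound[OF sigma_finite_lborel profs_integrable(3) kernels_measurable(2) K(1) gain_k2[OF I]])
    have "(\<integral>\<^sup>+v. ennreal \<bar>flux v * ps v\<bar> \<partial>lborel) \<le> (\<integral>\<^sup>+v. ennreal a0 * ennreal (ps v) \<partial>lborel)"
    proof (intro nn_integral_mono)
      fix v
      have "\<bar>flux v * ps v\<bar> \<le> a0 * ps v"
        using a0(1)[of v] bump_onD(2)[OF ps, of v] ps_range[of v] by (cases "v \<in> {va..vb}") (auto simp: abs_mult intro!: mult_right_mono)
      then show "ennreal \<bar>flux v * ps v\<bar> \<le> ennreal a0 * ennreal (ps v)"
        using a0(2) ps_range by (simp flip: ennreal_mult add: ennreal_leI)
    qed
    also have "\<dots> \<le> ennreal a0 * ennreal I" by (subst nn_integral_cmult) (auto intro!: mult_left_mono I)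
    also have "\<dots> = ennreal (a0 * I)" using a0(2) I by (simp flip: ennreal_mult)
    finally have fI: "(\<integral>\<^sup>+v. ennreal \<bar>flux v * ps v\<bar> \<partial>lborel) \<le> ennreal (a0 * I)" .
    show "(\<integral>\<^sup>+p. ennreal (\<bar>prof bt (deriv qx) (\<lambda>v. flux v * ps v) p\<bar> * (V * h * (I / 2))) \<partial>lborel) \<le> ennreal (Cb * Cq * (a0 * I) * (V * h * (I / 2)))"
      by (rule nn_multc_le[OF _ _ prof_nn_le[OF _ _ _ Cb(1) Cq(2) fI]]) (use V0 h I Cb Cq a0(2) profs_integrable(3) in auto)
  qed (use V0 h I Cb Cq a0(2) in auto)
  moreover have "\<bar>dbl m (\<lambda>(t, x, v). indicator {va..vb} v) km\<bar> \<le> 2 * V * h * M0 * (I + J * (I / 2))"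
  proof -
    \<comment> \<open>Integrating in w first uses only the unit mass of \<open>moll e2\<close>, so
      the singular part of the kernel costs \<open>ps v\<close>; the part with
      |\<open>step_at\<close>| \<le> 1/2 costs half of |ps'| times the integral of
      \<open>ps\<close>. Integrated over v, both are again O(\<open>I\<close>).\<close>
    define R where "R v = ps v + \<bar>deriv ps v\<bar> * (I / 2)" for v
    have R0: "0 \<le> R v" for v using ps_range I by (simp add: R_def)
    have [measurable]: "R \<in> borel_measurable borel" unfolding R_def[abs_def] by measurable
    show ?thesis
    proof (rule dbl_bound[OF sigma_finite_m indicator_integrable kernels_measurable(4) K(2), where R = "\<lambda>(t, x, v). 2 * V * h * R v"])
      fix p :: "real \<times> real \<times> real"
      obtain t x v where p: "p = (t, x, v)" by (cases p)
      obtain K3 where K3: "0 \<le> K3" "\<And>x. \<bar>moll e2 x\<bar> \<le> K3" using moll_bound[OF e2] by metis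
      define \<gamma> where "\<gamma> w = moll e2 (v - w) * ps v + step_at e2 (v - w) * deriv ps v" for w
      have ab: "\<bar>\<gamma> w\<bar> \<le> \<bar>moll e2 (v - w)\<bar> * ps v + (1/2) * \<bar>deriv ps v\<bar>" for w
      proof -
        have "\<bar>\<gamma> w\<bar> \<le> \<bar>moll e2 (v - w)\<bar> * ps v + \<bar>step_at e2 (v - w)\<bar> * \<bar>deriv ps v\<bar>"
          using abs_triangle_ineq[of "moll e2 (v - w) * ps v" "step_at e2 (v - w) * deriv ps v"] ps_range[of v] by (simp add: abs_mult \<gamma>_def)
        also have "\<dots> \<le> \<bar>moll e2 (v - w)\<bar> * ps v + (1/2) * \<bar>deriv ps v\<bar>"
          by (intro add_left_mono mult_right_mono step_at_abs) auto
        finally show ?thesis .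
      qed
      have "\<bar>\<integral>p'. PP p' * (case p' of (s, y, w) \<Rightarrow> moll e (t - s) * bt t *
          (step_at e (y - x) * qx x - step_at e (y - (x - h)) * qx (x - h)) * \<gamma> w) \<partial>lborel\<bar> \<le> 2 * V * h * R v"
      proof (rule gain_diff)
        show "\<gamma> \<in> borel_measurable borel" unfolding \<gamma>_def[abs_def] by measurable
        show "\<bar>\<gamma> w\<bar> \<le> K3 * 1 + (1/2) * \<bar>deriv ps v\<bar>" for w
          using K3 ps_range by (intro order_trans[OF ab] add_mono mult_mono) auto
        have "(\<integral>\<^sup>+w. ennreal \<bar>\<gamma> w * ps w\<bar> \<partial>lborel) \<le> (\<integral>\<^sup>+w. ennreal (moll e2 (v - w)) * ennreal (ps v) + ennreal ((1/2) * \<bar>deriv ps v\<bar>) * ennreal (ps w) \<partial>lborel)"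
        proof (intro nn_integral_mono)
          fix w
          have "\<bar>\<gamma> w * ps w\<bar> \<le> (\<bar>moll e2 (v - w)\<bar> * ps v + (1/2) * \<bar>deriv ps v\<bar>) * ps w"
            using ab[of w] ps_range[of w] by (auto simp: abs_mult intro!: mult_right_mono)
          also have "\<dots> \<le> moll e2 (v - w) * ps v * 1 + (1/2) * \<bar>deriv ps v\<bar> * ps w"
            using moll_nonneg[OF e2, of "v - w"] ps_range[of w] ps_range[of v]
            by (simp add: distrib_right mult_right_le_one_le)
          finally show "ennreal \<bar>\<gamma> w * ps w\<bar> \<le> ennreal (moll e2 (v - w)) * ennreal (ps v) + ennreal ((1/2) * \<bar>deriv ps v\<bar>) * ennreal (ps w)"
            using moll_nonneg[OF e2] ps_range by (simp flip: ennreal_mult ennreal_plus add: ennreal_leI)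
        qed
        also have "\<dots> = ennreal (ps v) + ennreal ((1/2) * \<bar>deriv ps v\<bar>) * (\<integral>\<^sup>+w. ennreal (ps w) \<partial>lborel)"
          by (subst nn_integral_add) (auto simp: nn_integral_multc nn_integral_cmult nn_integral_moll_diff[OF e2] simp del: ennreal_half)
        also have "\<dots> \<le> ennreal (ps v) + ennreal ((1/2) * \<bar>deriv ps v\<bar>) * ennreal I"
          by (intro add_left_mono mult_left_mono I) auto
        also have "\<dots> = ennreal (R v)"
          using ps_range[of v] I by (simp add: R_def ac_simps flip: ennreal_mult ennreal_plus)
        finally show "(\<integral>\<^sup>+w. ennreal \<bar>\<gamma> w * ps w\<bar> \<partial>lborel) \<le> ennreal (R v)" .
      qed (rule R0)
      then show "\<bar>\<integral>p'. PP p' * km p' p \<partial>lborel\<bar> \<le> (case p of (t, x, v) \<Rightarrow> 2 * V * h * R v)"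
        by (simp add: p km_def \<gamma>_def split_beta')
    next
      have "(\<integral>\<^sup>+p. ennreal (\<bar>case p of (t, x, v) \<Rightarrow> indicator {va..vb} v\<bar> * (case p of (t, x, v) \<Rightarrow> 2 * V * h * R v)) \<partial>m)
        \<le> (\<integral>\<^sup>+(t, x, v). ennreal (2 * V * h) * ennreal (R v) \<partial>m)"
        using R0 V0 h by (intro nn_integral_mono) (auto simp: indicator_def ennreal_mult[symmetric])
      also have "\<dots> \<le> ennreal M0 * (\<integral>\<^sup>+v. ennreal (2 * V * h) * ennreal (R v) \<partial>lborel)"
        by (rule marginal) measurable
      also have "(\<integral>\<^sup>+v. ennreal (2 * V * h) * ennreal (R v) \<partial>lborel) = ennreal (2 * V * h) * (\<integral>\<^sup>+v. ennreal (R v) \<partial>lborel)"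
        by (rule nn_integral_cmult) measurable
      also have "(\<integral>\<^sup>+v. ennreal (R v) \<partial>lborel) = (\<integral>\<^sup>+v. ennreal (ps v) + ennreal \<bar>deriv ps v\<bar> * ennreal (I / 2) \<partial>lborel)"
        unfolding R_def using ps_range I by (intro nn_integral_cong) (simp flip: ennreal_mult ennreal_plus)
      also have "\<dots> = (\<integral>\<^sup>+v. ennreal (ps v) \<partial>lborel) + (\<integral>\<^sup>+v. ennreal \<bar>deriv ps v\<bar> \<partial>lborel) * ennreal (I / 2)"
        by (subst nn_integral_add) (auto simp: nn_integral_multc)
      also have "ennreal M0 * (ennreal (2 * V * h) * \<dots>) \<le> ennreal M0 * (ennreal (2 * V * h) * (ennreal I + ennreal J * ennreal (I / 2)))"
        by (intro mult_left_mono add_mono mult_right_mono I J) auto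
      also have "\<dots> = ennreal (2 * V * h * M0 * (I + J * (I / 2)))"
        using V0 h I J M0_nonneg by (simp flip: ennreal_mult ennreal_plus add: ac_simps)
      finally show "(\<integral>\<^sup>+p. ennreal (\<bar>case p of (t, x, v) \<Rightarrow> indicator {va..vb} v\<bar> * (case p of (t, x, v) \<Rightarrow> 2 * V * h * R v)) \<partial>m)
         \<le> ennreal (2 * V * h * M0 * (I + J * (I / 2)))" .
    qed (use V0 h I J M0_nonneg in auto)
  qed
  moreover have "\<bar>dbl lborel S ks\<bar> \<le> NS * (2 * V * h * (I / 2))"
  proof (rule dbl_bound[OF sigma_finite_lborel S_integrable kernels_measurable(5) K(3)])
    fix p :: "real \<times> real"
    obtain t x where p: "p = (t, x)" by (cases p)
    define \<gamma> where "\<gamma> w = step_at e2 (U (t, x) - w) * ps (U (t, x))" for w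
    have ab: "\<bar>\<gamma> w\<bar> \<le> 1/2" for w
    proof -
      have "\<bar>\<gamma> w\<bar> \<le> (1/2) * 1" unfolding \<gamma>_def abs_mult using ps_range by (intro mult_mono step_at_abs) auto
      then show ?thesis by simp
    qed
    have "\<bar>\<integral>p'. PP p' * (case p' of (s, y, w) \<Rightarrow> moll e (t - s) * bt t *
          (step_at e (y - x) * qx x - step_at e (y - (x - h)) * qx (x - h)) * \<gamma> w) \<partial>lborel\<bar> \<le> 2 * V * h * (I / 2)"
    proof (rule gain_diff[OF _ ab])
      show "\<gamma> \<in> borel_measurable borel" unfolding \<gamma>_def[abs_def] by measurable
      have "\<bar>\<gamma> w * ps w\<bar> \<le> ps w * (1/2)" for w
        using mult_right_mono[OF ab[of w] ps_range(1)[of w]] ps_range(1)[of w] by (simp add: abs_mult)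
      then have "(\<integral>\<^sup>+w. ennreal \<bar>\<gamma> w * ps w\<bar> \<partial>lborel) \<le> (\<integral>\<^sup>+w. ennreal (ps w * (1/2)) \<partial>lborel)"
        by (intro nn_integral_mono ennreal_leI)
      also have "\<dots> \<le> ennreal (I * (1/2))" by (rule nn_multc_le) (use I ps_range in auto)
      also have "I * (1/2) = I / 2" by simp
      finally show "(\<integral>\<^sup>+w. ennreal \<bar>\<gamma> w * ps w\<bar> \<partial>lborel) \<le> ennreal (I / 2)" .
    qed (use I in auto)
    then show "\<bar>\<integral>p'. PP p' * ks p' p \<partial>lborel\<bar> \<le> 2 * V * h * (I / 2)"
      by (simp add: p ks_def \<gamma>_def split_beta')
  next
    show "(\<integral>\<^sup>+p. ennreal (\<bar>S p\<bar> * (2 * V * h * (I / 2))) \<partial>lborel) \<le> ennreal (NS * (2 * V * h * (I / 2)))"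
      by (rule nn_multc_le) (use V0 h I NS in auto)
  qed (use V0 h I NS in auto)
  ultimately have "\<bar>dbl lborel (prof bt qx (\<lambda>v. flux v * ps v)) k3\<bar>
    \<le> (Cb * Cq * I) * (V * h * (I / 2)) + (Cb * Cq * (a0 * I)) * (V * h * (I / 2)) + 2 * V * h * M0 * (I + J * (I / 2)) + NS * (2 * V * h * (I / 2))"
    using dbl_identity dbl_k1 by linarith
  also have "\<dots> = h * V * I * (Cb * Cq * I * (1 + a0) / 2 + M0 * (2 + J) + NS)"
    by (simp add: field_simps)
  finally show ?thesis .
qed

end

section \<open>The limit of vanishing mollification\<close>

lemma integral_lborel_prod:
  fixes F :: "'a::euclidean_space \<times> 'b::euclidean_space \<Rightarrow> real"
  assumes "integrable lborel F"
  shows "(\<integral>p. F p \<partial>lborel) = (\<integral>x. \<integral>y. F (x, y) \<partial>lborel \<partial>lborel)"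
  using lborel_pair.integral_fst'[of F] assms by (simp add: lborel_prod)

lemma integral_tensor3:
  fixes \<alpha> \<beta> \<gamma> :: "real \<Rightarrow> real"
  assumes "integrable lborel \<alpha>" "integrable lborel \<beta>" "integrable lborel \<gamma>"
  shows "(\<integral>(t, x, v). \<alpha> t * \<beta> x * \<gamma> v \<partial>lborel) = (\<integral>t. \<alpha> t \<partial>lborel) * (\<integral>x. \<beta> x \<partial>lborel) * (\<integral>v. \<gamma> v \<partial>lborel)"
proof -
  have bc: "integrable lborel (\<lambda>(x, v). \<beta> x * \<gamma> v)"
  proof (rule integrableI_bounded)
    have [measurable]: "\<beta> \<in> borel_measurable borel" "\<gamma> \<in> borel_measurable borel" using assms by auto
    show "(\<lambda>(x, v). \<beta> x * \<gamma> v) \<in> borel_measurable lborel" by measurable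
    have "(\<integral>\<^sup>+p. ennreal (norm (case p of (x, v) \<Rightarrow> \<beta> x * \<gamma> v)) \<partial>lborel) = (\<integral>\<^sup>+(x, v). ennreal \<bar>\<beta> x\<bar> * ennreal \<bar>\<gamma> v\<bar> \<partial>lborel)"
      by (intro nn_integral_cong) (auto simp: abs_mult ennreal_mult)
    also have "\<dots> = (\<integral>\<^sup>+x. ennreal \<bar>\<beta> x\<bar> \<partial>lborel) * (\<integral>\<^sup>+v. ennreal \<bar>\<gamma> v\<bar> \<partial>lborel)"
      by (rule nn_integral_tensor2) auto
    also have "\<dots> < \<infinity>" using assms by (auto simp: integrable_iff_bounded ennreal_mult_less_top)
    finally show "(\<integral>\<^sup>+p. ennreal (norm (case p of (x, v) \<Rightarrow> \<beta> x * \<gamma> v)) \<partial>lborel) < \<infinity>" .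
  qed
  have "(\<integral>(t, x, v). \<alpha> t * \<beta> x * \<gamma> v \<partial>lborel) = (\<integral>t. \<integral>(x, v). \<alpha> t * \<beta> x * \<gamma> v \<partial>lborel \<partial>lborel)"
    using integral_lborel_prod[OF integrable_tensor3[OF assms]] by simp
  also have "\<dots> = (\<integral>t. \<alpha> t * (\<integral>(x, v). \<beta> x * \<gamma> v \<partial>lborel) \<partial>lborel)"
  proof (intro Bochner_Integration.integral_cong refl)
    fix t
    have "(\<lambda>(x, v). \<alpha> t * \<beta> x * \<gamma> v) = (\<lambda>p. \<alpha> t * (case p of (x, v) \<Rightarrow> \<beta> x * \<gamma> v))" by (auto simp: fun_eq_iff)
    then show "(\<integral>(x, v). \<alpha> t * \<beta> x * \<gamma> v \<partial>lborel) = \<alpha> t * (\<integral>(x, v). \<beta> x * \<gamma> v \<partial>lborel)" by simp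
  qed
  also have "\<dots> = (\<integral>t. \<alpha> t \<partial>lborel) * (\<integral>(x, v). \<beta> x * \<gamma> v \<partial>lborel)" by simp
  also have "(\<integral>(x, v). \<beta> x * \<gamma> v \<partial>lborel) = (\<integral>x. \<beta> x \<partial>lborel) * (\<integral>v. \<gamma> v \<partial>lborel)"
    using integral_lborel_prod[OF bc] by simp
  finally show ?thesis by (simp add: mult.assoc)
qed

lemma moll_integrable: "0 < e \<Longrightarrow> integrable lborel (moll e)"
  by (rule integrable_nnI[of _ _ 1]) (use nn_integral_moll moll_nonneg in auto)

lemma integral_moll: "0 < e \<Longrightarrow> (\<integral>x. moll e x \<partial>lborel) = 1"
  using nn_integral_eq_integral[OF moll_integrable, of e] moll_nonneg nn_integral_moll[of e]
  by (simp add: integral_nonneg_AE)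

lemma nn_integral_swap4:
  fixes G :: "'a::euclidean_space \<Rightarrow> 'b::euclidean_space \<Rightarrow> 'c::euclidean_space \<Rightarrow> 'd::euclidean_space \<Rightarrow> ennreal"
  assumes G: "(\<lambda>(t, x, \<tau>, \<xi>). G t x \<tau> \<xi>) \<in> borel_measurable borel"
  shows "(\<integral>\<^sup>+t. \<integral>\<^sup>+x. \<integral>\<^sup>+\<tau>. \<integral>\<^sup>+\<xi>. G t x \<tau> \<xi> \<partial>lborel \<partial>lborel \<partial>lborel \<partial>lborel)
    = (\<integral>\<^sup>+\<tau>. \<integral>\<^sup>+\<xi>. \<integral>\<^sup>+t. \<integral>\<^sup>+x. G t x \<tau> \<xi> \<partial>lborel \<partial>lborel \<partial>lborel \<partial>lborel)"
proof -
  have [measurable]: "(\<lambda>p. G (a p) (b p) (c p) (d p)) \<in> borel_measurable M"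
    if "a \<in> borel_measurable M" "b \<in> borel_measurable M" "c \<in> borel_measurable M" "d \<in> borel_measurable M"
    for a b c d and M :: "'z measure"
    using measurable_compose[OF borel_measurable_Pair[OF that(1) borel_measurable_Pair[OF that(2) borel_measurable_Pair[OF that(3,4)]]] G]
    by (simp only: split_conv)
  have "(\<integral>\<^sup>+t. \<integral>\<^sup>+x. \<integral>\<^sup>+\<tau>. \<integral>\<^sup>+\<xi>. G t x \<tau> \<xi> \<partial>lborel \<partial>lborel \<partial>lborel \<partial>lborel)
    = (\<integral>\<^sup>+t. \<integral>\<^sup>+\<tau>. \<integral>\<^sup>+x. \<integral>\<^sup>+\<xi>. G t x \<tau> \<xi> \<partial>lborel \<partial>lborel \<partial>lborel \<partial>lborel)"
    by (rule nn_integral_cong, rule nn_integral_lborel_swap) measurable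
  also have "\<dots> = (\<integral>\<^sup>+\<tau>. \<integral>\<^sup>+t. \<integral>\<^sup>+x. \<integral>\<^sup>+\<xi>. G t x \<tau> \<xi> \<partial>lborel \<partial>lborel \<partial>lborel \<partial>lborel)"
    by (rule nn_integral_lborel_swap) measurable
  also have "\<dots> = (\<integral>\<^sup>+\<tau>. \<integral>\<^sup>+t. \<integral>\<^sup>+\<xi>. \<integral>\<^sup>+x. G t x \<tau> \<xi> \<partial>lborel \<partial>lborel \<partial>lborel \<partial>lborel)"
    by (rule nn_integral_cong, rule nn_integral_cong, rule nn_integral_lborel_swap) measurable
  also have "\<dots> = (\<integral>\<^sup>+\<tau>. \<integral>\<^sup>+\<xi>. \<integral>\<^sup>+t. \<integral>\<^sup>+x. G t x \<tau> \<xi> \<partial>lborel \<partial>lborel \<partial>lborel \<partial>lborel)"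
    by (rule nn_integral_cong, rule nn_integral_lborel_swap) measurable
  finally show ?thesis .
qed

text \<open>The mollifiers concentrate on s = t, y = x. With s = t + \<tau> and y = x + \<xi> as new
  variables, the error is at most the L1 modulus of continuity of P in (t, x), times the bound on
  \<theta> and the length of the velocity interval, because |P| \<le> 1.\<close>

lemma diagonal_limit:
  fixes P :: "real \<times> real \<times> real \<Rightarrow> real" and \<theta> :: "real \<Rightarrow> real \<Rightarrow> real"
  assumes P: "integrable lborel P" and P1: "\<And>p. \<bar>P p\<bar> \<le> 1" and supp: "\<And>t x v. v \<notin> {va..vb} \<Longrightarrow> P (t, x, v) = 0"
    and th[measurable]: "case_prod \<theta> \<in> borel_measurable borel" and Th: "\<And>v w. \<bar>\<theta> v w\<bar> \<le> \<Theta>" and \<eta>: "0 < \<eta>"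
  shows "\<exists>e0>0. \<forall>e. 0 < e \<and> e < e0 \<longrightarrow>
    \<bar>(\<integral>(t, x, v). P (t, x, v) * (\<integral>(s, y, w). P (s, y, w) * (moll e (t - s) * moll e (y - x) * \<theta> v w) \<partial>lborel) \<partial>lborel)
      - (\<integral>(t, x, v). P (t, x, v) * (\<integral>w. P (t, x, w) * \<theta> v w \<partial>lborel) \<partial>lborel)\<bar> \<le> \<eta>"
proof -
  have [measurable]: "P \<in> borel_measurable borel" using P by auto
  have th2[measurable]: "(\<lambda>x. \<theta> (f x) (g x)) \<in> borel_measurable M" if "f \<in> borel_measurable M" "g \<in> borel_measurable M" for f g and M :: "'z measure"
    using measurable_compose[OF borel_measurable_Pair[OF that] th] by (simp only: split_conv)
  have Th0: "0 \<le> \<Theta>" using Th[of 0 0] by simp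
  define L where "L = \<bar>vb - va\<bar> + 1"
  have L: "L > 0" by (simp add: L_def)
  \<comment> \<open>\<open>L\<close> pays for the free integration in v and \<Theta> for the kernel;
    the added 1 avoids division by 0.\<close>
  define \<eta>' where "\<eta>' = \<eta> / (L * (\<Theta> + 1))"
  have \<eta>': "\<eta>' > 0" using \<eta> L Th0 by (simp add: \<eta>'_def)
  obtain d where d: "d > 0" "\<And>z. norm z < d \<Longrightarrow> (\<integral>\<^sup>+p. ennreal \<bar>P (p + z) - P p\<bar> \<partial>lborel) \<le> ennreal \<eta>'"
    using L1_translation[OF P, rule_format, OF \<eta>'] by blast
  have ind: "emeasure lborel {va..vb} \<le> ennreal L" by (cases "va \<le> vb") (auto simp: L_def intro!: ennreal_leI)
  show ?thesis
  proof (intro exI[of _ "d/2"] conjI allI impI; (elim conjE)?)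
    show "0 < d / 2" using d by simp
    fix e :: real assume e: "0 < e" "e < d / 2"
    let ?d = "\<lambda>\<tau> \<xi> t x w. ennreal \<bar>P (t + \<tau>, x + \<xi>, w) - P (t, x, w)\<bar>"
    let ?W = "\<lambda>t x. (\<integral>\<^sup>+(\<tau>, \<xi>, w). ennreal (moll e \<tau>) * ennreal (moll e \<xi>) * (ennreal \<Theta> * ?d \<tau> \<xi> t x w) \<partial>lborel)"
    \<comment> \<open>The shift has two components of size at most \<open>e\<close>, hence norm at
      most 2e; this is why \<open>e\<close> stays below d/2.\<close>
    have smalldist: "(\<integral>\<^sup>+(t, x, w). ?d \<tau> \<xi> t x w \<partial>lborel) \<le> ennreal \<eta>'" if "\<bar>\<tau>\<bar> \<le> e" "\<bar>\<xi>\<bar> \<le> e" for \<tau> \<xi>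
    proof -
      have "norm (\<tau>, \<xi>, 0::real) \<le> norm \<tau> + norm (\<xi>, 0::real)" by (rule norm_Pair_le)
      also have "\<dots> \<le> norm \<tau> + (norm \<xi> + norm (0::real))" by (intro add_left_mono norm_Pair_le)
      also have "\<dots> < d" using that e by simp
      finally have "(\<integral>\<^sup>+p. ennreal \<bar>P (p + (\<tau>, \<xi>, 0)) - P p\<bar> \<partial>lborel) \<le> ennreal \<eta>'" by (rule d(2))
      also have "(\<integral>\<^sup>+p. ennreal \<bar>P (p + (\<tau>, \<xi>, 0)) - P p\<bar> \<partial>lborel) = (\<integral>\<^sup>+(t, x, w). ?d \<tau> \<xi> t x w \<partial>lborel)"
        by (intro nn_integral_cong) auto
      finally show ?thesis .
    qed
    define k where "k v = (\<lambda>(\<tau>, \<xi>, w). moll e \<tau> * moll e \<xi> * \<theta> v w)" for v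
    obtain K1 where K1: "0 \<le> K1" "\<And>x. \<bar>moll e x\<bar> \<le> K1" using moll_bound[OF e(1)] by metis
    define KK where "KK = K1 * K1 * \<Theta>"
    have kb: "\<bar>k v q\<bar> \<le> KK" for v q
      unfolding k_def KK_def using K1 Th0 by (cases q) (simp only: split_conv abs_mult, intro mult_mono Th, auto)
    have inner1: "(\<integral>(s, y, w). P (s, y, w) * (moll e (t - s) * moll e (y - x) * \<theta> v w) \<partial>lborel)
        = (\<integral>(\<tau>, \<xi>, w). P (t + \<tau>, x + \<xi>, w) * k v (\<tau>, \<xi>, w) \<partial>lborel)" for t x v
    proof -
      have "(\<integral>p. (case p of (s, y, w) \<Rightarrow> P (s, y, w) * (moll e (t - s) * moll e (y - x) * \<theta> v w)) \<partial>lborel)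
        = (\<integral>p. (case p + (t, x, 0) of (s, y, w) \<Rightarrow> P (s, y, w) * (moll e (t - s) * moll e (y - x) * \<theta> v w)) \<partial>lborel)"
        by (rule integral_translate[symmetric]) measurable
      also have "\<dots> = (\<integral>(\<tau>, \<xi>, w). P (t + \<tau>, x + \<xi>, w) * k v (\<tau>, \<xi>, w) \<partial>lborel)"
        by (intro Bochner_Integration.integral_cong) (auto simp: k_def add.commute moll_even)
      finally show ?thesis .
    qed
    have Pw: "integrable lborel (\<lambda>w. P (t, x, w) * \<theta> v w)" for t x v
    proof (rule integrableI_bounded_set[where A = "{va..vb}" and B = "\<Theta>"])
      have "\<bar>P (t, x, w) * \<theta> v w\<bar> \<le> 1 * \<Theta>" for w unfolding abs_mult by (intro mult_mono P1 Th) auto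
      then show "AE w in lborel. w \<in> {va..vb} \<longrightarrow> norm (P (t, x, w) * \<theta> v w) \<le> \<Theta>" by simp
      show "emeasure lborel {va..vb} < \<infinity>" by (intro emeasure_bounded_finite) auto
    qed (use supp in auto)
    have tens: "(\<lambda>(\<tau>, \<xi>, w). P (t, x, w) * k v (\<tau>, \<xi>, w)) = (\<lambda>(\<tau>, \<xi>, w). moll e \<tau> * moll e \<xi> * (P (t, x, w) * \<theta> v w))" for t x v
      by (auto simp: fun_eq_iff k_def)
    have i2: "integrable lborel (\<lambda>(\<tau>, \<xi>, w). P (t, x, w) * k v (\<tau>, \<xi>, w))" for t x v
      unfolding tens by (intro integrable_tensor3 moll_integrable e Pw)
    \<comment> \<open>The diagonal integral is spread out over \<tau> and \<xi> with unit mass, so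
      that both inner integrals have the same kernel and can be subtracted under the integral
      sign.\<close>
    have inner2: "(\<integral>w. P (t, x, w) * \<theta> v w \<partial>lborel) = (\<integral>(\<tau>, \<xi>, w). P (t, x, w) * k v (\<tau>, \<xi>, w) \<partial>lborel)" for t x v
      unfolding tens using integral_tensor3[OF moll_integrable[OF e(1)] moll_integrable[OF e(1)] Pw] by (simp add: integral_moll[OF e(1)])
    \<comment> \<open>The parameter \<open>a\<close> treats the shifted integral, a = 1, and the
      unshifted one, a = 0, together.\<close>
    have nnb: "(\<integral>\<^sup>+p. ennreal \<bar>case p of (\<tau>, \<xi>, w) \<Rightarrow> P (t + a * \<tau>, x + a * \<xi>, w) * k v (\<tau>, \<xi>, w)\<bar> \<partial>lborel) \<le> ennreal (\<Theta> * L)" for a t x v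
    proof -
      have "(\<integral>\<^sup>+p. ennreal \<bar>case p of (\<tau>, \<xi>, w) \<Rightarrow> P (t + a * \<tau>, x + a * \<xi>, w) * k v (\<tau>, \<xi>, w)\<bar> \<partial>lborel)
        \<le> (\<integral>\<^sup>+(\<tau>, \<xi>, w). ennreal (moll e \<tau>) * ennreal (moll e \<xi>) * (ennreal \<Theta> * indicator {va..vb} w) \<partial>lborel)"
      proof (intro nn_integral_mono, clarify)
        fix \<tau> \<xi> w
        have "\<bar>P (t + a * \<tau>, x + a * \<xi>, w) * k v (\<tau>, \<xi>, w)\<bar> \<le> moll e \<tau> * moll e \<xi> * (\<Theta> * indicator {va..vb} w)"
        proof (cases "w \<in> {va..vb}")
          case True
          have "\<bar>P (t + a * \<tau>, x + a * \<xi>, w) * k v (\<tau>, \<xi>, w)\<bar> \<le> 1 * (moll e \<tau> * moll e \<xi> * \<Theta>)"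
            unfolding k_def split_conv abs_mult using moll_nonneg[OF e(1)] by (intro mult_mono P1 Th) auto
          then show ?thesis using True by simp
        next
          case False
          then show ?thesis using supp[OF False] by simp
        qed
        then show "ennreal \<bar>P (t + a * \<tau>, x + a * \<xi>, w) * k v (\<tau>, \<xi>, w)\<bar> \<le> ennreal (moll e \<tau>) * ennreal (moll e \<xi>) * (ennreal \<Theta> * indicator {va..vb} w)"
          using moll_nonneg[OF e(1)] Th0 by (cases "w \<in> {va..vb}") (simp_all flip: ennreal_mult add: ennreal_leI)
      qed
      also have "\<dots> = ennreal \<Theta> * emeasure lborel {va..vb}"
        by (subst nn_integral_tensor3) (auto simp: nn_integral_moll[OF e(1)] nn_integral_cmult)
      also have "\<dots> \<le> ennreal \<Theta> * ennreal L" by (intro mult_left_mono ind) auto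
      also have "\<dots> = ennreal (\<Theta> * L)" using Th0 L by (simp add: ennreal_mult)
      finally show ?thesis .
    qed
    have bnd: "\<bar>\<integral>(\<tau>, \<xi>, w). P (t + a * \<tau>, x + a * \<xi>, w) * k v (\<tau>, \<xi>, w) \<partial>lborel\<bar> \<le> \<Theta> * L" for a t x v
      by (rule abs_integral_leI[OF nnb]) (use Th0 L in auto)
    have i1: "integrable lborel (\<lambda>(\<tau>, \<xi>, w). P (t + \<tau>, x + \<xi>, w) * k v (\<tau>, \<xi>, w))" for t x v
      by (rule integrable_nnI[of _ _ "\<Theta> * L"], (simp only: k_def, measurable)[1]) (use nnb[of _ 1] in simp)
    define R where "R = (\<lambda>(t, x, v). (\<integral>(\<tau>, \<xi>, w). P (t + \<tau>, x + \<xi>, w) * k v (\<tau>, \<xi>, w) \<partial>lborel) - (\<integral>(\<tau>, \<xi>, w). P (t, x, w) * k v (\<tau>, \<xi>, w) \<partial>lborel))"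
    have Rle: "ennreal \<bar>R (t, x, v)\<bar> \<le> ?W t x" for t x v
    proof -
      have eq: "R (t, x, v) = (\<integral>q. (case q of (\<tau>, \<xi>, w) \<Rightarrow> P (t + \<tau>, x + \<xi>, w) * k v (\<tau>, \<xi>, w)) - (case q of (\<tau>, \<xi>, w) \<Rightarrow> P (t, x, w) * k v (\<tau>, \<xi>, w)) \<partial>lborel)"
        unfolding R_def split_conv by (rule Bochner_Integration.integral_diff[OF i1 i2, symmetric])
      have "ennreal \<bar>R (t, x, v)\<bar> \<le> (\<integral>\<^sup>+q. ennreal (norm ((case q of (\<tau>, \<xi>, w) \<Rightarrow> P (t + \<tau>, x + \<xi>, w) * k v (\<tau>, \<xi>, w)) - (case q of (\<tau>, \<xi>, w) \<Rightarrow> P (t, x, w) * k v (\<tau>, \<xi>, w)))) \<partial>lborel)"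
        unfolding eq real_norm_def[symmetric] by (rule integral_norm_bound_ennreal[OF Bochner_Integration.integrable_diff[OF i1 i2]])
      also have "\<dots> \<le> ?W t x"
      proof (intro nn_integral_mono, clarify)
        fix \<tau> \<xi> w
        have "P (t + \<tau>, x + \<xi>, w) * k v (\<tau>, \<xi>, w) - P (t, x, w) * k v (\<tau>, \<xi>, w) = moll e \<tau> * moll e \<xi> * (\<theta> v w * (P (t + \<tau>, x + \<xi>, w) - P (t, x, w)))"
          by (simp add: k_def algebra_simps)
        then have "\<bar>P (t + \<tau>, x + \<xi>, w) * k v (\<tau>, \<xi>, w) - P (t, x, w) * k v (\<tau>, \<xi>, w)\<bar> = moll e \<tau> * moll e \<xi> * (\<bar>\<theta> v w\<bar> * \<bar>P (t + \<tau>, x + \<xi>, w) - P (t, x, w)\<bar>)"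
          using moll_nonneg[OF e(1)] by (simp add: abs_mult)
        also have "\<dots> \<le> moll e \<tau> * moll e \<xi> * (\<Theta> * \<bar>P (t + \<tau>, x + \<xi>, w) - P (t, x, w)\<bar>)"
          using moll_nonneg[OF e(1)] by (intro mult_left_mono mult_right_mono Th) auto
        finally show "ennreal (norm (P (t + \<tau>, x + \<xi>, w) * k v (\<tau>, \<xi>, w) - P (t, x, w) * k v (\<tau>, \<xi>, w)))
          \<le> ennreal (moll e \<tau>) * ennreal (moll e \<xi>) * (ennreal \<Theta> * ?d \<tau> \<xi> t x w)"
          using moll_nonneg[OF e(1)] Th0 by (simp flip: ennreal_mult add: ennreal_leI)
      qed
      finally show ?thesis .
    qed
    have meas_j1: "(\<lambda>(t, x, v). \<integral>(\<tau>, \<xi>, w). P (t + \<tau>, x + \<xi>, w) * k v (\<tau>, \<xi>, w) \<partial>lborel) \<in> borel_measurable borel"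
      unfolding k_def by measurable
    have meas_j2: "(\<lambda>(t, x, v). \<integral>(\<tau>, \<xi>, w). P (t, x, w) * k v (\<tau>, \<xi>, w) \<partial>lborel) \<in> borel_measurable borel"
      unfolding k_def by measurable
    have o1: "integrable lborel (\<lambda>p. P p * (case p of (t, x, v) \<Rightarrow> \<integral>(\<tau>, \<xi>, w). P (t + \<tau>, x + \<xi>, w) * k v (\<tau>, \<xi>, w) \<partial>lborel))"
    proof (rule integrable_abs_le[OF P, of _ "\<Theta> * L"])
      show "\<bar>P p * (case p of (t, x, v) \<Rightarrow> \<integral>(\<tau>, \<xi>, w). P (t + \<tau>, x + \<xi>, w) * k v (\<tau>, \<xi>, w) \<partial>lborel)\<bar> \<le> \<Theta> * L * \<bar>P p\<bar>" for p
        using mult_left_mono[OF bnd[of "fst p" 1 "fst (snd p)" "snd (snd p)"], of "\<bar>P p\<bar>"] by (cases p) (auto simp: abs_mult mult.commute)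
    qed (use meas_j1 in measurable)
    have o2: "integrable lborel (\<lambda>p. P p * (case p of (t, x, v) \<Rightarrow> \<integral>(\<tau>, \<xi>, w). P (t, x, w) * k v (\<tau>, \<xi>, w) \<partial>lborel))"
    proof (rule integrable_abs_le[OF P, of _ "\<Theta> * L"])
      show "\<bar>P p * (case p of (t, x, v) \<Rightarrow> \<integral>(\<tau>, \<xi>, w). P (t, x, w) * k v (\<tau>, \<xi>, w) \<partial>lborel)\<bar> \<le> \<Theta> * L * \<bar>P p\<bar>" for p
        using mult_left_mono[OF bnd[of "fst p" 0 "fst (snd p)" "snd (snd p)"], of "\<bar>P p\<bar>"] by (cases p) (auto simp: abs_mult mult.commute)
    qed (use meas_j2 in measurable)
    have EQ: "(\<integral>(t, x, v). P (t, x, v) * (\<integral>(s, y, w). P (s, y, w) * (moll e (t - s) * moll e (y - x) * \<theta> v w) \<partial>lborel) \<partial>lborel)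
      - (\<integral>(t, x, v). P (t, x, v) * (\<integral>w. P (t, x, w) * \<theta> v w \<partial>lborel) \<partial>lborel)
      = (\<integral>p. P p * (case p of (t, x, v) \<Rightarrow> \<integral>(\<tau>, \<xi>, w). P (t + \<tau>, x + \<xi>, w) * k v (\<tau>, \<xi>, w) \<partial>lborel)
          - P p * (case p of (t, x, v) \<Rightarrow> \<integral>(\<tau>, \<xi>, w). P (t, x, w) * k v (\<tau>, \<xi>, w) \<partial>lborel) \<partial>lborel)"
      unfolding inner1 inner2 Bochner_Integration.integral_diff[OF o1 o2]
      by (intro arg_cong2[of _ _ _ _ "(-)"] Bochner_Integration.integral_cong refl) auto
    have EQ2: "\<dots> = (\<integral>p. P p * R p \<partial>lborel)"
      by (intro Bochner_Integration.integral_cong refl) (auto simp: R_def right_diff_distrib)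
    define G where "G t x \<tau> \<xi> = (\<integral>\<^sup>+w. ennreal (moll e \<tau>) * ennreal (moll e \<xi>) * (ennreal \<Theta> * ?d \<tau> \<xi> t x w) \<partial>lborel)" for t x \<tau> \<xi>
    have G_meas [measurable]: "(\<lambda>p. G (a p) (b p) (c p) (d p)) \<in> borel_measurable M"
      if [measurable]: "a \<in> borel_measurable M" "b \<in> borel_measurable M" "c \<in> borel_measurable M" "d \<in> borel_measurable M"
      for a b c d and M :: "'z measure"
      unfolding G_def by measurable
    have inG: "?W t x
      = (\<integral>\<^sup>+\<tau>. \<integral>\<^sup>+\<xi>. G t x \<tau> \<xi> \<partial>lborel \<partial>lborel)" for t x
    proof -
      have m: "(\<lambda>(\<tau>, \<xi>, w). ennreal (moll e \<tau>) * ennreal (moll e \<xi>) * (ennreal \<Theta> * ?d \<tau> \<xi> t x w)) \<in> borel_measurable borel"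
        by measurable
      show ?thesis unfolding G_def nn_integral_lborel3[OF m] by simp
    qed
    have mG: "(\<lambda>(t, x, v). indicator {va..vb} v * (\<integral>\<^sup>+\<tau>. \<integral>\<^sup>+\<xi>. G t x \<tau> \<xi> \<partial>lborel \<partial>lborel)) \<in> borel_measurable borel"
      by measurable
    have "\<bar>\<integral>p. P p * R p \<partial>lborel\<bar> \<le> L * (\<Theta> * \<eta>')"
    proof (rule abs_integral_leI)
      have "(\<integral>\<^sup>+p. ennreal \<bar>P p * R p\<bar> \<partial>lborel) \<le> (\<integral>\<^sup>+(t, x, v). indicator {va..vb} v *
          ?W t x \<partial>lborel)"
      proof (intro nn_integral_mono, clarify)
        fix t x v
        have "ennreal \<bar>P (t, x, v) * R (t, x, v)\<bar> = ennreal \<bar>P (t, x, v)\<bar> * ennreal \<bar>R (t, x, v)\<bar>"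
          by (simp add: abs_mult ennreal_mult)
        also have "\<dots> \<le> indicator {va..vb} v * ?W t x"
          using supp[of v t x] P1[of "(t, x, v)"] by (intro mult_mono Rle) (auto simp: indicator_def)
        finally show "ennreal \<bar>P (t, x, v) * R (t, x, v)\<bar> \<le> indicator {va..vb} v * ?W t x" .
      qed
      also have "\<dots> = (\<integral>\<^sup>+t. \<integral>\<^sup>+x. \<integral>\<^sup>+v. indicator {va..vb} v * (\<integral>\<^sup>+\<tau>. \<integral>\<^sup>+\<xi>. G t x \<tau> \<xi> \<partial>lborel \<partial>lborel) \<partial>lborel \<partial>lborel \<partial>lborel)"
        unfolding inG nn_integral_lborel3[OF mG] by (simp only: split_conv)
      also have "\<dots> = emeasure lborel {va..vb} * (\<integral>\<^sup>+t. \<integral>\<^sup>+x. \<integral>\<^sup>+\<tau>. \<integral>\<^sup>+\<xi>. G t x \<tau> \<xi> \<partial>lborel \<partial>lborel \<partial>lborel \<partial>lborel)"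
        by (simp add: nn_integral_multc nn_integral_cmult)
      also have "(\<integral>\<^sup>+t. \<integral>\<^sup>+x. \<integral>\<^sup>+\<tau>. \<integral>\<^sup>+\<xi>. G t x \<tau> \<xi> \<partial>lborel \<partial>lborel \<partial>lborel \<partial>lborel)
        = (\<integral>\<^sup>+\<tau>. \<integral>\<^sup>+\<xi>. \<integral>\<^sup>+t. \<integral>\<^sup>+x. G t x \<tau> \<xi> \<partial>lborel \<partial>lborel \<partial>lborel \<partial>lborel)"
        by (rule nn_integral_swap4) (unfold G_def, measurable)
      also have "\<dots> = (\<integral>\<^sup>+\<tau>. \<integral>\<^sup>+\<xi>. ennreal (moll e \<tau>) * ennreal (moll e \<xi>) * (ennreal \<Theta> * (\<integral>\<^sup>+(t, x, w). ?d \<tau> \<xi> t x w \<partial>lborel)) \<partial>lborel \<partial>lborel)"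
      proof (intro nn_integral_cong)
        fix \<tau> \<xi>
        have "(\<integral>\<^sup>+t. \<integral>\<^sup>+x. G t x \<tau> \<xi> \<partial>lborel \<partial>lborel) = ennreal (moll e \<tau>) * ennreal (moll e \<xi>) * (ennreal \<Theta> * (\<integral>\<^sup>+t. \<integral>\<^sup>+x. \<integral>\<^sup>+w. ?d \<tau> \<xi> t x w \<partial>lborel \<partial>lborel \<partial>lborel))"
          unfolding G_def by (simp add: nn_integral_cmult)
        moreover have m: "(\<lambda>(t, x, w). ?d \<tau> \<xi> t x w) \<in> borel_measurable borel"
          by measurable
        ultimately show "(\<integral>\<^sup>+t. \<integral>\<^sup>+x. G t x \<tau> \<xi> \<partial>lborel \<partial>lborel) = ennreal (moll e \<tau>) * ennreal (moll e \<xi>) * (ennreal \<Theta> * (\<integral>\<^sup>+(t, x, w). ?d \<tau> \<xi> t x w \<partial>lborel))"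
          unfolding nn_integral_lborel3[OF m] by (simp only: split_conv)
      qed
      also have "\<dots> \<le> (\<integral>\<^sup>+\<tau>. \<integral>\<^sup>+\<xi>. ennreal (moll e \<tau>) * ennreal (moll e \<xi>) * (ennreal \<Theta> * ennreal \<eta>') \<partial>lborel \<partial>lborel)"
      proof (intro nn_integral_mono)
        fix \<tau> \<xi>
        show "ennreal (moll e \<tau>) * ennreal (moll e \<xi>) * (ennreal \<Theta> * (\<integral>\<^sup>+(t, x, w). ?d \<tau> \<xi> t x w \<partial>lborel))
          \<le> ennreal (moll e \<tau>) * ennreal (moll e \<xi>) * (ennreal \<Theta> * ennreal \<eta>')"
        proof (cases "\<bar>\<tau>\<bar> \<le> e \<and> \<bar>\<xi>\<bar> \<le> e")
          case True
          then show ?thesis by (intro mult_left_mono smalldist) auto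
        next
          case False
          then have "moll e \<tau> = 0 \<or> moll e \<xi> = 0" using moll_outside[OF e(1), of \<tau>] moll_outside[OF e(1), of \<xi>] by (auto simp: not_le)
          then show ?thesis by auto
        qed
      qed
      also have "\<dots> = ennreal \<Theta> * ennreal \<eta>'"
        by (simp add: nn_integral_cmult nn_integral_multc nn_integral_moll[OF e(1)])
      also have "emeasure lborel {va..vb} * (ennreal \<Theta> * ennreal \<eta>') \<le> ennreal L * (ennreal \<Theta> * ennreal \<eta>')"
        by (intro mult_right_mono ind) auto
      also have "\<dots> = ennreal (L * (\<Theta> * \<eta>'))" using L Th0 \<eta>' by (simp add: ennreal_mult)
      finally show "(\<integral>\<^sup>+p. ennreal \<bar>P p * R p\<bar> \<partial>lborel) \<le> ennreal (L * (\<Theta> * \<eta>'))"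
        by (simp add: mult_left_mono)
    qed (use L Th0 \<eta>' in auto)
    also have "\<dots> \<le> \<eta>"
    proof -
      have "L * (\<Theta> * \<eta>') \<le> L * ((\<Theta> + 1) * \<eta>')" using L Th0 \<eta>' by (intro mult_left_mono mult_right_mono) auto
      also have "\<dots> = \<eta>" using L Th0 by (simp add: \<eta>'_def)
      finally show ?thesis .
    qed
    finally have "\<bar>\<integral>p. P p * R p \<partial>lborel\<bar> \<le> \<eta>" .
    then show "\<bar>(\<integral>(t, x, v). P (t, x, v) * (\<integral>(s, y, w). P (s, y, w) * (moll e (t - s) * moll e (y - x) * \<theta> v w) \<partial>lborel) \<partial>lborel)
      - (\<integral>(t, x, v). P (t, x, v) * (\<integral>w. P (t, x, w) * \<theta> v w \<partial>lborel) \<partial>lborel)\<bar> \<le> \<eta>"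
      unfolding EQ EQ2 .
  qed
qed

text \<open>Write \<open>w powr l = w powr (l - 1) * w\<close> and replace w by v in the first
  factor. On a band v \<ge> d this bounds the flux difference below by a multiple of d^(l-1) (v -
  w).\<close>

lemma powr_diff_lower:
  fixes v w l :: real
  assumes "1 \<le> l" "0 < w" "w \<le> v"
  shows "v powr (l - 1) * (v - w) \<le> v powr l - w powr l"
proof -
  have split: "x powr l = x powr (l - 1) * x" if "0 < x" for x :: real
    using that powr_mult_base[of x "l - 1"] by (simp add: mult.commute)
  have "w powr l = w powr (l - 1) * w" using assms by (intro split) simp
  also have "\<dots> \<le> v powr (l - 1) * w" using assms by (intro mult_right_mono powr_mono2) auto
  finally have 1: "w powr l \<le> v powr (l - 1) * w" .
  have "v powr l = v powr (l - 1) * v" using assms by (intro split) simp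
  with 1 show ?thesis by (simp add: right_diff_distrib)
qed

section \<open>Symmetrisation of the interaction functional, its sign and a lower bound\<close>

context doubling
begin

text \<open>The symmetrised form of \<open>flux v * step_at e2 (v - w)\<close>. The indicators
  restrict it to where \<open>PP\<close> can be nonzero, which makes it bounded although the flux is
  not.\<close>

definition th :: "real \<Rightarrow> real \<Rightarrow> real" where
  "th v w = indicator {va..vb} v * indicator {va..vb} w * ((flux v - flux w) / 2 * step_at e2 (v - w))"

lemma PP_flux: "prof bt qx (\<lambda>v. flux v * ps v) (t, x, v) = PP (t, x, v) * flux v"
  by (simp add: prof_def PP_def)

lemma PP_supp: "v \<notin> {va..vb} \<Longrightarrow> PP (t, x, v) = 0"
  using bump_onD(2)[OF ps, of v] by (simp add: PP_def prof_def)

text \<open>The integral is averaged with its copy in which the two points are exchanged: the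
  mollifiers in t and x are even and the step in v is odd, so \<open>flux v\<close> turns into half
  of \<open>flux v - flux w\<close>.\<close>

lemma dbl_symmetrized:
  "dbl lborel (prof bt qx (\<lambda>v. flux v * ps v)) k3
    = (\<integral>(t, x, v). PP (t, x, v) * (\<integral>(s, y, w). PP (s, y, w) * (moll e (t - s) * moll e (y - x) * th v w) \<partial>lborel) \<partial>lborel)"
proof -
let ?M = "\<lambda>t x v. (\<integral>(s, y, w). PP (s, y, w) * (moll e (t - s) * moll e (y - x) * th v w) \<partial>lborel)"
  define Q where "Q = prof bt qx (\<lambda>v. flux v * ps v)"
  have Qint: "integrable lborel Q" unfolding Q_def by (rule profs_integrable)
  obtain K where K: "\<And>p p'. \<bar>k3 p p'\<bar> \<le> K" using kernels_bounded by metis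
  have k3': "case_prod (\<lambda>p p'. k3 p' p) \<in> borel_measurable (lborel \<Otimes>\<^sub>M lborel)"
    unfolding k3_def by (simp_all only: split_beta' split_beta measurable_lborel2) measurable
  note F1 = Fubini_kernel[OF sigma_finite_lborel sigma_finite_lborel PP_integrable Qint kernels_measurable(3) K]
  note F2 = Fubini_kernel[OF sigma_finite_lborel sigma_finite_lborel Qint PP_integrable k3' K]
  define \<Phi>1 where "\<Phi>1 p = (\<integral>p'. PP p' * k3 p' p \<partial>lborel)" for p
  define \<Phi>2 where "\<Phi>2 p = (\<integral>p'. Q p' * k3 p p' \<partial>lborel)" for p
  have X: "dbl lborel Q k3 = (\<integral>p. Q p * \<Phi>1 p \<partial>lborel)" "dbl lborel Q k3 = (\<integral>p. PP p * \<Phi>2 p \<partial>lborel)"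
    unfolding dbl_def \<Phi>1_def \<Phi>2_def using F1(1) by simp_all
  have i: "integrable lborel (\<lambda>p. Q p * \<Phi>1 p)" "integrable lborel (\<lambda>p. PP p * \<Phi>2 p)"
    unfolding \<Phi>1_def \<Phi>2_def using F1(2) F2(2) by simp_all
  have "2 * dbl lborel Q k3 = (\<integral>p. Q p * \<Phi>1 p + PP p * \<Phi>2 p \<partial>lborel)"
    using X i by simp
  also have "\<dots> = (\<integral>p. 2 * (case p of (t, x, v) \<Rightarrow> PP (t, x, v) * ?M t x v) \<partial>lborel)"
  proof (intro Bochner_Integration.integral_cong refl, clarify)
    fix t x v
    show "Q (t, x, v) * \<Phi>1 (t, x, v) + PP (t, x, v) * \<Phi>2 (t, x, v)
       = 2 * (PP (t, x, v) * ?M t x v)"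
    proof (cases "v \<in> {va..vb}")
      case False
      then show ?thesis by (simp add: Q_def PP_flux PP_supp)
    next
      case True
      have j1: "integrable lborel (\<lambda>p'. PP p' * k3 p' (t, x, v))"
        by (rule integrable_slice[OF PP_integrable k3' K])
      have j2: "integrable lborel (\<lambda>p'. Q p' * k3 (t, x, v) p')"
        by (rule integrable_slice[OF Qint kernels_measurable(3) K])
      have "flux v * \<Phi>1 (t, x, v) + \<Phi>2 (t, x, v) = (\<integral>p'. flux v * (PP p' * k3 p' (t, x, v)) + Q p' * k3 (t, x, v) p' \<partial>lborel)"
        unfolding \<Phi>1_def \<Phi>2_def using j1 j2 by simp
      also have "\<dots> = (\<integral>p'. 2 * (case p' of (s, y, w) \<Rightarrow> PP (s, y, w) * (moll e (t - s) * moll e (y - x) * th v w)) \<partial>lborel)"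
      proof (intro Bochner_Integration.integral_cong refl, clarify)
        fix s y w
        have 1: "moll e (s - t) = moll e (t - s)" using moll_even[of e "t - s"] by simp
        have 2: "moll e (x - y) = moll e (y - x)" using moll_even[of e "y - x"] by simp
        have 3: "step_at e2 (w - v) = - step_at e2 (v - w)" using step_at_odd[of e2 "v - w"] by simp
        show "flux v * (PP (s, y, w) * k3 (s, y, w) (t, x, v)) + Q (s, y, w) * k3 (t, x, v) (s, y, w)
          = 2 * (PP (s, y, w) * (moll e (t - s) * moll e (y - x) * th v w))"
        proof (cases "w \<in> {va..vb}")
          case False
          then show ?thesis by (simp add: Q_def PP_flux PP_supp)
        next
          case w: True
          show ?thesis using True w
            unfolding Q_def PP_flux k3_def split_conv 1 2 3 th_def by (simp add: algebra_simps)
        qed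
      qed
      finally have "flux v * \<Phi>1 (t, x, v) + \<Phi>2 (t, x, v) = 2 * ?M t x v"
        by simp
      then show ?thesis
        by (simp add: Q_def PP_flux distrib_left[symmetric] mult.assoc)
    qed
  qed
  also have "\<dots> = 2 * (\<integral>(t, x, v). PP (t, x, v) * ?M t x v \<partial>lborel)"
    by simp
  finally show ?thesis by (simp add: Q_def)
qed

lemma PP_le_1: "\<bar>PP p\<bar> \<le> 1"
proof -
  obtain t x v where p: "p = (t, x, v)" by (cases p)
  have "\<bar>PP p\<bar> \<le> 1 * (1 * 1 * 1)"
    unfolding p PP_def prof_def split_conv abs_mult using bt_range qx_range ps_range by (intro mult_mono dF_abs) auto
  then show ?thesis by simp
qed

lemma th_measurable: "case_prod th \<in> borel_measurable borel"
  unfolding th_def by measurable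

lemma th_bound: "\<bar>th v w\<bar> \<le> (l + 1) * vb powr l"
proof (cases "v \<in> {va..vb} \<and> w \<in> {va..vb}")
  case True
  have "\<bar>(flux v - flux w) / 2 * step_at e2 (v - w)\<bar> \<le> ((l + 1) * vb powr l) * 1"
    unfolding abs_mult using flux_bound[OF va, of v vb] flux_bound[OF va, of w vb] True step_at_abs[of e2 "v - w"]
    by (intro mult_mono) auto
  with True show ?thesis by (simp add: th_def)
next
  case False
  then show ?thesis using l_ge_1 by (auto simp: th_def)
qed

text \<open>On positive velocities \<open>sg * flux\<close> is increasing, so its difference has the
  sign of v - w, and so has the step.\<close>

lemma th_nonneg: "0 \<le> sg * th v w"
proof (cases "v \<in> {va..vb} \<and> w \<in> {va..vb}")
  case True
  have s: "sg * flux v = (l + 1) * v powr l" if "v \<in> {va..vb}" for v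
    using that va sg by (auto simp: flux_def)
  have "0 \<le> (sg * flux v - sg * flux w) * step_at e2 (v - w)"
  proof (cases "w \<le> v")
    case le: True
    have "0 \<le> step_at e2 (v - w)" using step_at_mono[OF e2, of 0 "v - w"] le by (simp add: step_at_0)
    moreover have "w powr l \<le> v powr l" using le True va l_ge_1 by (intro powr_mono2) auto
    then have "sg * flux w \<le> sg * flux v" using True l_ge_1 by (simp add: s)
    ultimately show ?thesis by (intro mult_nonneg_nonneg) auto
  next
    case le: False
    have "step_at e2 (v - w) \<le> 0" using step_at_mono[OF e2, of "v - w" 0] le by (simp add: step_at_0)
    moreover have "v powr l \<le> w powr l" using le True va l_ge_1 by (intro powr_mono2) auto
    then have "sg * flux v \<le> sg * flux w" using True l_ge_1 by (simp add: s)
    ultimately show ?thesis by (intro mult_nonpos_nonpos) auto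
  qed
  then show ?thesis using True by (simp add: th_def algebra_simps)
next
  case False
  then show ?thesis by (auto simp: th_def)
qed

text \<open>For fixed (t, x), the increment of the indicator of 0 < v < U is plus or minus the
  indicator of one interval, with a sign that depends on which of the two values of \<open>U\<close>
  is larger but not on v.\<close>

lemma PP_same_sign: "0 \<le> PP (t, x, v) * PP (t, x, w)"
proof -
  have F: "0 \<le> (hf (t, x, v) - hf (t, x + h, v)) * (hf (t, x, w) - hf (t, x + h, w))"
    by (auto simp: hf_def)
  have "PP (t, x, v) * PP (t, x, w) = ((hf (t, x, v) - hf (t, x + h, v)) * (hf (t, x, w) - hf (t, x + h, w))) * ((bt t * qx x) * (bt t * qx x) * (ps v * ps w))"
    by (simp add: PP_def prof_def algebra_simps)
  also have "0 \<le> \<dots>" by (intro mult_nonneg_nonneg F) (use bt_range qx_range ps_range in auto)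
  finally show ?thesis .
qed

text \<open>Since the integrand has a sign, a bound on the integral is a bound on the integral of
  the absolute value; only in this form may the domain be restricted to a smaller set for a lower
  bound.\<close>

lemma nn_from_real:
  assumes B: "\<bar>\<integral>(t, x, v). PP (t, x, v) * (\<integral>w. PP (t, x, w) * th v w \<partial>lborel) \<partial>lborel\<bar> \<le> B"
  shows "(\<integral>\<^sup>+t. \<integral>\<^sup>+x. \<integral>\<^sup>+v. \<integral>\<^sup>+w. ennreal (PP (t, x, v) * PP (t, x, w) * (sg * th v w)) \<partial>lborel \<partial>lborel \<partial>lborel \<partial>lborel) \<le> ennreal B"
proof -
  note th_measurable[measurable]
  have th2[measurable]: "(\<lambda>x. th (f x) (g x)) \<in> borel_measurable M" if "f \<in> borel_measurable M" "g \<in> borel_measurable M" for f g and M :: "'z measure"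
    using measurable_compose[OF borel_measurable_Pair[OF that] th_measurable] by (simp only: split_conv)
  define J where "J = (\<lambda>(t, x, v). PP (t, x, v) * (\<integral>w. PP (t, x, w) * th v w \<partial>lborel))"
  have inner: "integrable lborel (\<lambda>w. PP (t, x, w) * th v w)" for t x v
  proof (rule integrableI_bounded_set[where A = "{va..vb}" and B = "(l + 1) * vb powr l"])
    have "\<bar>PP (t, x, w) * th v w\<bar> \<le> 1 * ((l + 1) * vb powr l)" for w unfolding abs_mult by (intro mult_mono PP_le_1 th_bound) auto
    then show "AE w in lborel. w \<in> {va..vb} \<longrightarrow> norm (PP (t, x, w) * th v w) \<le> (l + 1) * vb powr l" by simp
    show "emeasure lborel {va..vb} < \<infinity>" by (intro emeasure_bounded_finite) auto
  qed (use PP_supp in auto)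
  have Jb: "\<bar>\<integral>w. PP (t, x, w) * th v w \<partial>lborel\<bar> \<le> ((l + 1) * vb powr l) * \<bar>vb - va\<bar>" for t x v
  proof (rule abs_integral_leI)
    have "(\<integral>\<^sup>+w. ennreal \<bar>PP (t, x, w) * th v w\<bar> \<partial>lborel) \<le> (\<integral>\<^sup>+w. ennreal ((l + 1) * vb powr l) * indicator {va..vb} w \<partial>lborel)"
    proof (intro nn_integral_mono)
      fix w
      have "\<bar>PP (t, x, w) * th v w\<bar> \<le> 1 * ((l + 1) * vb powr l)" unfolding abs_mult by (intro mult_mono PP_le_1 th_bound) auto
      then show "ennreal \<bar>PP (t, x, w) * th v w\<bar> \<le> ennreal ((l + 1) * vb powr l) * indicator {va..vb} w"
        using PP_supp[of w t x] by (cases "w \<in> {va..vb}") (auto intro!: ennreal_leI)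
    qed
    also have "\<dots> \<le> ennreal ((l + 1) * vb powr l) * ennreal \<bar>vb - va\<bar>"
      by (subst nn_integral_cmult_indicator) (auto intro!: mult_left_mono simp: emeasure_lborel_Icc_eq ennreal_leI)
    also have "\<dots> = ennreal (((l + 1) * vb powr l) * \<bar>vb - va\<bar>)" using l_ge_1 by (simp add: ennreal_mult)
    finally show "(\<integral>\<^sup>+w. ennreal \<bar>PP (t, x, w) * th v w\<bar> \<partial>lborel) \<le> ennreal (((l + 1) * vb powr l) * \<bar>vb - va\<bar>)" .
  qed (use l_ge_1 in auto)
  have [measurable]: "J \<in> borel_measurable borel" unfolding J_def by measurable
  have Jint: "integrable lborel J"
  proof (rule integrable_abs_le[OF PP_integrable, of _ "((l + 1) * vb powr l) * \<bar>vb - va\<bar>"])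
    show "\<bar>J p\<bar> \<le> ((l + 1) * vb powr l) * \<bar>vb - va\<bar> * \<bar>PP p\<bar>" for p
      using mult_left_mono[OF Jb[of "fst p" "fst (snd p)" "snd (snd p)"], of "\<bar>PP p\<bar>"] by (cases p) (auto simp: J_def abs_mult mult.commute)
  qed measurable
  have eqw: "(\<integral>\<^sup>+w. ennreal (PP (t, x, v) * PP (t, x, w) * (sg * th v w)) \<partial>lborel) = ennreal (sg * J (t, x, v))" for t x v
  proof -
    have "(\<integral>\<^sup>+w. ennreal (PP (t, x, v) * PP (t, x, w) * (sg * th v w)) \<partial>lborel) = (\<integral>\<^sup>+w. ennreal ((sg * PP (t, x, v)) * (PP (t, x, w) * th v w)) \<partial>lborel)"
      by (simp add: ac_simps)
    also have "\<dots> = ennreal (\<integral>w. (sg * PP (t, x, v)) * (PP (t, x, w) * th v w) \<partial>lborel)"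
    proof (rule nn_integral_eq_integral)
      show "integrable lborel (\<lambda>w. (sg * PP (t, x, v)) * (PP (t, x, w) * th v w))" using inner by simp
      have "0 \<le> (PP (t, x, v) * PP (t, x, w)) * (sg * th v w)" for w
        by (intro mult_nonneg_nonneg PP_same_sign th_nonneg)
      then show "AE w in lborel. 0 \<le> (sg * PP (t, x, v)) * (PP (t, x, w) * th v w)" by (simp add: ac_simps)
    qed
    also have "\<dots> = ennreal (sg * J (t, x, v))" by (simp add: J_def mult.assoc)
    finally show ?thesis .
  qed
  have J0: "0 \<le> sg * J p" for p
  proof -
    obtain t x v where p: "p = (t, x, v)" by (cases p)
    have "sg * J p = (\<integral>w. (PP (t, x, v) * PP (t, x, w)) * (sg * th v w) \<partial>lborel)"
    proof -
      have "sg * J p = (\<integral>w. (sg * PP (t, x, v)) * (PP (t, x, w) * th v w) \<partial>lborel)" by (simp add: J_def p mult.assoc)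
      also have "\<dots> = (\<integral>w. (PP (t, x, v) * PP (t, x, w)) * (sg * th v w) \<partial>lborel)" by (intro Bochner_Integration.integral_cong) auto
      finally show ?thesis .
    qed
    also have "0 \<le> \<dots>" by (intro integral_nonneg_AE AE_I2 mult_nonneg_nonneg PP_same_sign th_nonneg)
    finally show ?thesis .
  qed
  have "(\<integral>\<^sup>+t. \<integral>\<^sup>+x. \<integral>\<^sup>+v. \<integral>\<^sup>+w. ennreal (PP (t, x, v) * PP (t, x, w) * (sg * th v w)) \<partial>lborel \<partial>lborel \<partial>lborel \<partial>lborel)
    = (\<integral>\<^sup>+t. \<integral>\<^sup>+x. \<integral>\<^sup>+v. ennreal (sg * J (t, x, v)) \<partial>lborel \<partial>lborel \<partial>lborel)"
    by (simp only: eqw)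
  also have "\<dots> = (\<integral>\<^sup>+p. ennreal (sg * J p) \<partial>lborel)"
    by (rule nn_integral_lborel3[symmetric]) measurable
  also have "\<dots> = ennreal (\<integral>p. sg * J p \<partial>lborel)"
    by (rule nn_integral_eq_integral) (use Jint J0 in auto)
  also have "(\<integral>p. sg * J p \<partial>lborel) = sg * (\<integral>(t, x, v). PP (t, x, v) * (\<integral>w. PP (t, x, w) * th v w \<partial>lborel) \<partial>lborel)"
    by (simp add: J_def)
  also have "ennreal \<dots> \<le> ennreal B"
    using B sg by (intro ennreal_leI) auto
  finally show ?thesis .
qed

end

definition clamp2 :: "real \<Rightarrow> real \<Rightarrow> real" where "clamp2 d u = max d (min u (2 * d))"

lemma clamp2_measurable [measurable]: "clamp2 d \<in> borel_measurable borel"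
  unfolding clamp2_def[abs_def] by measurable

context doubling
begin

text \<open>Between the two clamped values, at distance D, the increment of f is constant and equal
  to 1 or -1. Take v in the upper third and w in the lower third: then v - w \<ge> D/3 \<ge>
  \<open>e2\<close>, so the step equals 1/2, and the flux difference is at least (l+1) d^(l-1) D/3.
  The factor 1/4 from \<open>th\<close> and two intervals of length D/3 give 1/108.\<close>

lemma lower_pointwise:
  assumes d: "0 < d" and dab: "va \<le> d" "2 * d \<le> vb" and ps1: "\<And>v. d \<le> v \<Longrightarrow> v \<le> 2 * d \<Longrightarrow> ps v = 1"
    and tx: "bt t = 1" "qx x = 1" and big: "3 * e2 \<le> \<bar>clamp2 d (U (t, x + h)) - clamp2 d (U (t, x))\<bar>"
  shows "ennreal ((l + 1) * d powr (l - 1) / 108 * \<bar>clamp2 d (U (t, x + h)) - clamp2 d (U (t, x))\<bar> ^ 3)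
     \<le> (\<integral>\<^sup>+v. \<integral>\<^sup>+w. ennreal (PP (t, x, v) * PP (t, x, w) * (sg * th v w)) \<partial>lborel \<partial>lborel)"
proof -
  define c1 where "c1 = clamp2 d (U (t, x))"
  define c2 where "c2 = clamp2 d (U (t, x + h))"
  define lo where "lo = min c1 c2"
  define hi where "hi = max c1 c2"
  define D where "D = hi - lo"
  have D: "D = \<bar>c2 - c1\<bar>" by (auto simp: D_def hi_def lo_def)
  have D3: "3 * e2 \<le> D" using big by (simp add: D c1_def c2_def)
  have D0: "0 < D" using D3 e2 by simp
  have range: "d \<le> lo" "hi \<le> 2 * d" using d by (auto simp: lo_def hi_def c1_def c2_def clamp2_def)
  define K where "K = (l + 1) * d powr (l - 1) * (D / 3) / 4"
  have K0: "0 \<le> K" using l_ge_1 D0 by (simp add: K_def)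
  have F: "PP (t, x, v) * PP (t, x, w) = 1" if v: "v \<in> {lo<..<hi}" and w: "w \<in> {lo<..<hi}" for v w
  proof -
    have pv: "ps v = 1" "ps w = 1" using v w range by (auto intro!: ps1)
    \<comment> \<open>A point strictly between the clamped values lies between the unclamped ones as
      well, so clamping does no harm.\<close>
    have *: "hf (t, x, v) - hf (t, x + h, v) = (if c1 < c2 then -1 else 1)" if "v \<in> {lo<..<hi}" for v
      using that d unfolding hf_def lo_def hi_def c1_def c2_def clamp2_def
      by (auto simp: max_def min_def split: if_splits)
    show ?thesis using *[OF v] *[OF w] by (simp add: PP_def prof_def tx pv)
  qed
  have pt: "ennreal K * indicator {hi - D/3<..<hi} v * indicator {lo<..<lo + D/3} w \<le> ennreal (PP (t, x, v) * PP (t, x, w) * (sg * th v w))" for v w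
  proof (cases "v \<in> {hi - D/3<..<hi} \<and> w \<in> {lo<..<lo + D/3}")
    case True
    have vw: "v \<in> {lo<..<hi}" "w \<in> {lo<..<hi}" "D / 3 \<le> v - w" using True D0 by (auto simp: D_def field_simps)
    have in_ab: "v \<in> {va..vb}" "w \<in> {va..vb}" using vw range dab by auto
    have s: "sg * flux v = (l + 1) * v powr l" if "v \<in> {va..vb}" for v
      using that va sg by (auto simp: flux_def)
    have st: "step_at e2 (v - w) = 1/2" using vw(3) D3 e2 by (intro step_at_right) auto
    have "sg * th v w = (sg * flux v - sg * flux w) / 4"
      using in_ab unfolding th_def st by (simp add: right_diff_distrib)
    also have "\<dots> = (l + 1) * (v powr l - w powr l) / 4" by (simp only: s[OF in_ab(1)] s[OF in_ab(2)] right_diff_distrib)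
    finally have eq: "sg * th v w = (l + 1) * (v powr l - w powr l) / 4" .
    have "d powr (l - 1) * (D / 3) \<le> v powr (l - 1) * (v - w)"
      using vw range d D0 l_ge_1 by (intro mult_mono powr_mono2) auto
    also have "\<dots> \<le> v powr l - w powr l" using vw range d D0 l_ge_1 in_ab va by (intro powr_diff_lower) auto
    finally have "(l + 1) * (d powr (l - 1) * (D / 3)) \<le> (l + 1) * (v powr l - w powr l)"
      using l_ge_1 by (intro mult_left_mono) auto
    moreover have "K = (l + 1) * (d powr (l - 1) * (D / 3)) / 4" by (simp add: K_def)
    ultimately have "K \<le> sg * th v w" unfolding eq by linarith
    then show ?thesis using True F[OF vw(1,2)] by (auto intro!: ennreal_leI)
  qed auto
  have "(l + 1) * d powr (l - 1) / 108 * D ^ 3 = K * (D / 3) * (D / 3)"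
    by (simp add: K_def power3_eq_cube)
  then have "ennreal ((l + 1) * d powr (l - 1) / 108 * D ^ 3) = ennreal (K * (D / 3) * (D / 3))"
    by (simp only:)
  also have "\<dots> = ennreal K * ennreal (D / 3) * ennreal (D / 3)"
  proof -
    have d3: "0 \<le> D / 3" using D0 by simp
    show ?thesis by (simp only: ennreal_mult[OF mult_nonneg_nonneg[OF K0 d3] d3] ennreal_mult[OF K0 d3])
  qed
  also have "\<dots> = (\<integral>\<^sup>+v. \<integral>\<^sup>+w. ennreal K * indicator {hi - D/3<..<hi} v * indicator {lo<..<lo + D/3} w \<partial>lborel \<partial>lborel)"
    using D0 by (simp add: nn_integral_cmult_indicator nn_integral_multc nn_integral_cmult)
  also have "\<dots> \<le> (\<integral>\<^sup>+v. \<integral>\<^sup>+w. ennreal (PP (t, x, v) * PP (t, x, w) * (sg * th v w)) \<partial>lborel \<partial>lborel)"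
    by (intro nn_integral_mono pt)
  finally show ?thesis by (simp add: D c1_def c2_def)
qed

end

section \<open>Regularity in space\<close>

text \<open>Centring the steps at a - c and b + c puts both transitions outside [a, b], with support
  in [a - 2c, b + 2c].\<close>

definition plateau :: "real \<Rightarrow> real \<Rightarrow> real \<Rightarrow> real \<Rightarrow> real" where
  "plateau a b c x = (1/2 + step_at c (x - (a - c))) * (1/2 - step_at c (x - (b + c)))"

lemma plateau_eq_1: "0 < c \<Longrightarrow> a \<le> x \<Longrightarrow> x \<le> b \<Longrightarrow> plateau a b c x = 1"
  by (simp add: plateau_def step_at_right step_at_left)

lemma plateau_range: "0 \<le> plateau a b c x" "plateau a b c x \<le> 1"
proof -
  have *: "\<bar>step_at c y\<bar> \<le> 1/2" for y by (rule step_at_abs)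
  have 1: "0 \<le> 1/2 + step_at c (x - (a - c))" "1/2 + step_at c (x - (a - c)) \<le> 1"
    using *[of "x - (a - c)"] by linarith+
  have 2: "0 \<le> 1/2 - step_at c (x - (b + c))" "1/2 - step_at c (x - (b + c)) \<le> 1"
    using *[of "x - (b + c)"] by linarith+
  show "0 \<le> plateau a b c x" unfolding plateau_def by (intro mult_nonneg_nonneg 1 2)
  show "plateau a b c x \<le> 1" unfolding plateau_def using mult_mono[OF 1(2) 2(2)] 1 2 by simp
qed

lemma plateau_bump: assumes "0 < c" shows "bump_on (a - 2 * c) (b + 2 * c) (plateau a b c)"
proof -
  have "smooth (plateau a b c)" unfolding plateau_def[abs_def]
    by (intro smooth_mult smooth_add smooth_diff smooth_const)
      (use smooth_affine_real[OF smooth_step_at, of c 1 "- (a - c)"] smooth_affine_real[OF smooth_step_at, of c 1 "- (b + c)"] in \<open>auto simp: algebra_simps\<close>)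
  moreover have "plateau a b c x = 0" if "x \<notin> {a - 2 * c..b + 2 * c}" for x
    using that assms step_at_left[of c "x - (a - c)"] step_at_right[of c "x - (b + c)"] by (auto simp: plateau_def)
  ultimately show ?thesis by (auto simp: bump_on_def)
qed

lemma nn_plateau: assumes "0 < c" "a \<le> b" shows "(\<integral>\<^sup>+x. ennreal (plateau a b c x) \<partial>lborel) \<le> ennreal (b - a + 4 * c)"
proof -
  have "(\<integral>\<^sup>+x. ennreal (plateau a b c x) \<partial>lborel) \<le> (\<integral>\<^sup>+x. indicator {a - 2 * c..b + 2 * c} x \<partial>lborel)"
    using plateau_range[of a b c] bump_onD(2)[OF plateau_bump[OF assms(1), of a b]]
    by (intro nn_integral_mono) (auto simp: indicator_def)
  also have "\<dots> = ennreal (b - a + 4 * c)" using assms by simp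
  finally show ?thesis .
qed

text \<open>The bound does not depend on \<open>c\<close>. This scale invariance keeps the term with
  \<open>m\<close> under control when the velocity cut-off is as narrow as d.\<close>

lemma nn_plateau_deriv: assumes "0 < c" shows "(\<integral>\<^sup>+x. ennreal \<bar>deriv (plateau a b c) x\<bar> \<partial>lborel) \<le> ennreal 2"
proof -
  have d: "deriv (plateau a b c) x = moll c (x - (a - c)) * (1/2 - step_at c (x - (b + c))) - (1/2 + step_at c (x - (a - c))) * moll c (x - (b + c))" for x
    unfolding plateau_def[abs_def]
    by (rule DERIV_imp_deriv, rule DERIV_cong[OF DERIV_mult[OF DERIV_add[OF DERIV_const DERIV_chain2[OF step_at_deriv]] DERIV_diff[OF DERIV_const DERIV_chain2[OF step_at_deriv]]]])
       (use assms in \<open>auto intro!: derivative_eq_intros\<close>)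
  have "(\<integral>\<^sup>+x. ennreal \<bar>deriv (plateau a b c) x\<bar> \<partial>lborel) \<le> (\<integral>\<^sup>+x. ennreal (moll c (x - (a - c))) + ennreal (moll c (x - (b + c))) \<partial>lborel)"
  proof (intro nn_integral_mono)
    fix x
    have *: "\<bar>step_at c y\<bar> \<le> 1/2" for y by (rule step_at_abs)
    have 1: "\<bar>1/2 + step_at c (x - (a - c))\<bar> \<le> 1" "\<bar>1/2 - step_at c (x - (b + c))\<bar> \<le> 1"
      using *[of "x - (a - c)"] *[of "x - (b + c)"] by linarith+
    have "\<bar>deriv (plateau a b c) x\<bar> \<le> \<bar>moll c (x - (a - c)) * (1/2 - step_at c (x - (b + c)))\<bar> + \<bar>(1/2 + step_at c (x - (a - c))) * moll c (x - (b + c))\<bar>"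
      unfolding d by (rule abs_triangle_ineq4)
    also have "\<dots> \<le> moll c (x - (a - c)) * 1 + 1 * moll c (x - (b + c))"
      unfolding abs_mult using moll_nonneg[OF assms] 1 by (intro add_mono mult_mono) auto
    finally show "ennreal \<bar>deriv (plateau a b c) x\<bar> \<le> ennreal (moll c (x - (a - c))) + ennreal (moll c (x - (b + c)))"
      using moll_nonneg[OF assms] by (simp flip: ennreal_plus add: ennreal_leI)
  qed
  also have "\<dots> = 1 + 1"
  proof -
    have "(\<integral>\<^sup>+x. ennreal (moll c (x - z)) \<partial>lborel) = 1" for z
      using nn_integral_translate[of "\<lambda>x. ennreal (moll c x)" "- z"] nn_integral_moll[OF assms] by simp
    then show ?thesis by (subst nn_integral_add) auto
  qed
  also have "\<dots> = ennreal 2" by simp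
  finally show ?thesis .
qed

context half_problem
begin

text \<open>The cubic lower bound against the interaction bound C h d, on one band. Increments below
  \<open>lam\<close> are counted trivially; on the rest Chebyshev's inequality trades the cube for
  \<open>lam\<^sup>2\<close>. Dividing C h d by d^(l-1) leaves the power 2 - l of d.\<close>

lemma box_dyadic:
  assumes t: "0 < t0" "t0 \<le> t1" "t1 < T" and X: "0 \<le> X" and R: "0 < R"
  shows "\<exists>C\<ge>0. \<forall>d h lam. 0 < d \<and> d \<le> R \<and> 0 \<le> h \<and> 0 < lam \<longrightarrow>
    (\<integral>\<^sup>+t. \<integral>\<^sup>+x. indicator {t0..t1} t * indicator {-X..X} x * ennreal \<bar>clamp2 d (U (t, x + h)) - clamp2 d (U (t, x))\<bar> \<partial>lborel \<partial>lborel)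
      \<le> ennreal (lam * ((t1 - t0) * (2 * X)) + C * h * d powr (2 - l) / lam\<^sup>2)"
proof -
  \<comment> \<open>The time cut-off reaches 2c beyond [t0, t1]; a third of the distance to the ends
    keeps it inside (0, T).\<close>
  define c where "c = min t0 (T - t1) / 3"
  have c: "0 < c" using t by (simp add: c_def)
  have ct: "0 < t0 - 2 * c" "t1 + 2 * c < T" using t by (auto simp: c_def min_def field_simps)
  define bt where "bt = plateau t0 t1 c"
  define qx where "qx = plateau (-X) X 1"
  define Cb where "Cb = max (t1 - t0 + 4 * c) 2"
  define Cq where "Cq = max (X + X + 4) 2"
  obtain NS where NS: "(\<integral>\<^sup>+p. ennreal \<bar>S p\<bar> \<partial>lborel) \<le> ennreal NS" "0 \<le> NS"
  proof (rule that[of "\<integral>p. \<bar>S p\<bar> \<partial>lborel"])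
    show "(\<integral>\<^sup>+p. ennreal \<bar>S p\<bar> \<partial>lborel) \<le> ennreal (\<integral>p. \<bar>S p\<bar> \<partial>lborel)"
      using S_integrable by (subst nn_integral_eq_integral) auto
  qed simp
  \<comment> \<open>The bracket of \<open>interaction_bound\<close> with d replaced by its maximum
    \<open>R\<close>: there I = 2d, J = 2, and the velocities reach 5d/2. The leading 2 * 2 consists
    of V = 2 and the 2 of I, whose factor d is kept apart in \<open>B\<close>.\<close>
  define C1 where "C1 = 2 * 2 * (Cb * Cq * (2 * R) * (1 + (l + 1) * (5 / 2 * R) powr l) / 2 + M0 * (2 + 2) + NS)"
  have CC: "0 \<le> Cb" "0 \<le> Cq" by (auto simp: Cb_def Cq_def)
  have C1: "0 \<le> C1" using CC R l_ge_1 M0_nonneg NS by (simp add: C1_def)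
  show ?thesis
  proof (intro exI[of _ "108 / (l + 1) * C1"] conjI allI impI; (elim conjE)?)
    show "0 \<le> 108 / (l + 1) * C1" using C1 l_ge_1 by simp
    fix d h lam :: real
    assume d: "0 < d" "d \<le> R" and h: "0 \<le> h" and lam: "0 < lam"
    \<comment> \<open>Margins of d/4 keep the support in [d/2, 5d/2], away from 0 and of length
      comparable to d.\<close>
    define ps where "ps = plateau d (2 * d) (d / 4)"
    define va where "va = d - 2 * (d / 4)"
    define vb where "vb = 2 * d + 2 * (d / 4)"
    \<comment> \<open>Now \<open>3 * e2 = lam\<close>, so \<open>lower_pointwise\<close> applies
      wherever the increment exceeds \<open>lam\<close>; a limit in \<open>e2\<close> is never
      taken.\<close>
    define e2 where "e2 = lam / 3"
    have e2: "0 < e2" using lam by (simp add: e2_def)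
    have va: "0 < va" "va \<le> d" "2 * d \<le> vb" using d by (auto simp: va_def vb_def)
    have D: "doubling T l sg M0 U S m bt qx ps (t0 - 2 * c) (t1 + 2 * c) (- X - 2 * 1) (X + 2 * 1) va vb h 2 e e2" if "0 < e" for e
    proof (unfold_locales)
      show "bump_on (t0 - 2 * c) (t1 + 2 * c) bt" unfolding bt_def by (rule plateau_bump[OF c])
      show "bump_on (- X - 2 * 1) (X + 2 * 1) qx" unfolding qx_def by (rule plateau_bump) simp
      show "bump_on va vb ps" unfolding ps_def va_def vb_def by (rule plateau_bump) (use d in simp)
      show "(\<integral>\<^sup>+x. ennreal (\<bar>deriv qx x\<bar> / 2) \<partial>lborel) \<le> ennreal (2 - 1)"
      proof -
        have "(\<integral>\<^sup>+x. ennreal (\<bar>deriv qx x\<bar> * (1/2)) \<partial>lborel) \<le> ennreal (2 * (1/2))"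
          unfolding qx_def by (rule nn_multc_le[OF _ _ nn_plateau_deriv])
            (use bump_on_measurable[OF bump_on_deriv[OF plateau_bump[of 1 "-X" X]]] in auto)
        then show ?thesis by simp
      qed
    qed (use ct va h that e2 plateau_range in \<open>auto simp: bt_def qx_def ps_def\<close>)
    define B where "B = C1 * h * d"
    have psI: "(\<integral>\<^sup>+v. ennreal (ps v) \<partial>lborel) \<le> ennreal (2 * d)"
      using nn_plateau[of "d/4" d "2 * d"] d by (simp add: ps_def)
    have dbl: "\<bar>doubling.dbl U bt qx ps h lborel (doubling.prof U h bt qx (\<lambda>v. flux v * ps v)) (doubling.k3 e e2)\<bar> \<le> B" if e: "0 < e" for e
    proof -
      interpret D: doubling T l sg M0 U S m bt qx ps "t0 - 2 * c" "t1 + 2 * c" "- X - 2 * 1" "X + 2 * 1" va vb h 2 e e2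
        by (rule D[OF e])
      have a0: "\<bar>flux v\<bar> \<le> (l + 1) * (5 / 2 * R) powr l" if "va \<le> v" "v \<le> vb" for v
      proof -
        have "\<bar>flux v\<bar> \<le> (l + 1) * vb powr l" by (rule flux_bound[OF va(1) that])
        also have "\<dots> \<le> (l + 1) * (5 / 2 * R) powr l"
          using l_ge_1 d by (intro mult_left_mono powr_mono2) (auto simp: vb_def)
        finally show ?thesis .
      qed
      have "\<bar>D.dbl lborel (D.prof bt qx (\<lambda>v. flux v * ps v)) D.k3\<bar>
         \<le> h * 2 * (2 * d) * (Cb * Cq * (2 * d) * (1 + (l + 1) * (5 / 2 * R) powr l) / 2 + M0 * (2 + 2) + NS)"
      proof (rule D.interaction_bound[OF psI _ _ _ _ _ _ _ _ _ NS a0])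
        show "(\<integral>\<^sup>+v. ennreal \<bar>deriv ps v\<bar> \<partial>lborel) \<le> ennreal 2" unfolding ps_def by (rule nn_plateau_deriv) (use d in simp)
        have "(\<integral>\<^sup>+t. ennreal \<bar>bt t\<bar> \<partial>lborel) \<le> ennreal (t1 - t0 + 4 * c)"
          using nn_plateau[OF c t(2)] plateau_range by (simp add: bt_def)
        then show "(\<integral>\<^sup>+t. ennreal \<bar>bt t\<bar> \<partial>lborel) \<le> ennreal Cb"
          by (rule order_trans) (simp add: Cb_def ennreal_leI)
        have "(\<integral>\<^sup>+t. ennreal \<bar>qx t\<bar> \<partial>lborel) \<le> ennreal (X - (- X) + 4 * 1)"
          using nn_plateau[of 1 "-X" X] plateau_range X by (simp add: qx_def)
        then show "(\<integral>\<^sup>+t. ennreal \<bar>qx t\<bar> \<partial>lborel) \<le> ennreal Cq"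
          by (rule order_trans) (simp add: Cq_def ennreal_leI)
        show "(\<integral>\<^sup>+t. ennreal \<bar>deriv bt t\<bar> \<partial>lborel) \<le> ennreal Cb"
          by (rule order_trans[OF nn_plateau_deriv[OF c, of t0 t1, folded bt_def]]) (simp add: Cb_def ennreal_leI)
        show "(\<integral>\<^sup>+t. ennreal \<bar>deriv qx t\<bar> \<partial>lborel) \<le> ennreal Cq"
          by (rule order_trans[OF nn_plateau_deriv[of 1 "-X" X, folded qx_def]]) (simp_all add: Cq_def ennreal_leI)
      qed (use d CC l_ge_1 in auto)
      also have "\<dots> = h * d * (2 * 2 * (Cb * Cq * (2 * d) * (1 + (l + 1) * (5 / 2 * R) powr l) / 2 + M0 * (2 + 2) + NS))"
        by simp
      also have "\<dots> \<le> h * d * C1"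
        unfolding C1_def using d CC l_ge_1 h by (intro mult_left_mono add_right_mono divide_right_mono mult_right_mono) auto
      finally show ?thesis by (simp add: B_def ac_simps)
    qed
    interpret D: doubling T l sg M0 U S m bt qx ps "t0 - 2 * c" "t1 + 2 * c" "- X - 2 * 1" "X + 2 * 1" va vb h 2 1 e2
      by (rule D) simp
    have B0: "0 \<le> B" using C1 h d by (simp add: B_def)
    \<comment> \<open>\<open>B\<close> is independent of \<open>e\<close>, so the bound passes to
      the limit of vanishing mollification with an arbitrarily small error.\<close>
    have diag: "\<bar>\<integral>(t, x, v). D.PP (t, x, v) * (\<integral>w. D.PP (t, x, w) * D.th v w \<partial>lborel) \<partial>lborel\<bar> \<le> B"
    proof (rule field_le_epsilon)
      fix \<eta> :: real assume "0 < \<eta>"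
      from diagonal_limit[OF D.PP_integrable D.PP_le_1 D.PP_supp D.th_measurable D.th_bound this]
      obtain e0 where e0: "0 < e0" "\<And>e. 0 < e \<Longrightarrow> e < e0 \<Longrightarrow>
        \<bar>(\<integral>(t, x, v). D.PP (t, x, v) * (\<integral>(s, y, w). D.PP (s, y, w) * (moll e (t - s) * moll e (y - x) * D.th v w) \<partial>lborel) \<partial>lborel)
          - (\<integral>(t, x, v). D.PP (t, x, v) * (\<integral>w. D.PP (t, x, w) * D.th v w \<partial>lborel) \<partial>lborel)\<bar> \<le> \<eta>"
        by blast
      have e: "0 < e0 / 2" "e0 / 2 < e0" using e0 by auto
      show "\<bar>\<integral>(t, x, v). D.PP (t, x, v) * (\<integral>w. D.PP (t, x, w) * D.th v w \<partial>lborel) \<partial>lborel\<bar> \<le> B + \<eta>"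
        using e0(2)[OF e] dbl[OF e(1)] unfolding doubling.dbl_symmetrized[OF D[OF e(1)]] by linarith
    qed
    define k where "k = (l + 1) * d powr (l - 1) / 108"
    have k: "0 < k" using l_ge_1 d by (simp add: k_def)
    define Dd where "Dd t x = \<bar>clamp2 d (U (t, x + h)) - clamp2 d (U (t, x))\<bar>" for t x
    have Dm[measurable]: "(\<lambda>p. Dd (fst p) (snd p)) \<in> borel_measurable borel" unfolding Dd_def by measurable
    define G where "G t x = (\<integral>\<^sup>+v. \<integral>\<^sup>+w. ennreal (D.PP (t, x, v) * D.PP (t, x, w) * (sg * D.th v w)) \<partial>lborel \<partial>lborel)" for t x
    have G: "(\<integral>\<^sup>+t. \<integral>\<^sup>+x. G t x \<partial>lborel \<partial>lborel) \<le> ennreal B"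
      unfolding G_def by (rule D.nn_from_real[OF diag])
    \<comment> \<open>Either the increment is at most \<open>lam\<close>, or it is at most its cube
      over \<open>lam\<^sup>2\<close>, and the cube is dominated by \<open>G\<close> up to the
      factor \<open>k\<close>.\<close>
    have pt: "indicator {t0..t1} t * indicator {-X..X} x * ennreal (Dd t x)
       \<le> ennreal lam * (indicator {t0..t1} t * indicator {-X..X} x) + ennreal (1 / (k * lam\<^sup>2)) * G t x" for t x
    proof (cases "t \<in> {t0..t1} \<and> x \<in> {-X..X}")
      case False
      then have z: "indicator {t0..t1} t * indicator {-X..X} x = (0::ennreal)" by auto
      show ?thesis by (simp only: z mult_zero_left zero_le)
    next
      case True
      show ?thesis
      proof (cases "Dd t x \<le> lam")
        case le: True
        then have "ennreal (Dd t x) \<le> ennreal lam" by (rule ennreal_leI)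
        then show ?thesis using True by (simp add: add_increasing2)
      next
        case False
        have "ennreal (k * Dd t x ^ 3) \<le> G t x"
          unfolding G_def k_def Dd_def
        proof (rule D.lower_pointwise[OF d(1) va(2,3)])
          show "ps v = 1" if "d \<le> v" "v \<le> 2 * d" for v unfolding ps_def using that d by (intro plateau_eq_1) auto
          show "bt t = 1" unfolding bt_def using True c by (intro plateau_eq_1) auto
          show "qx x = 1" unfolding qx_def using True by (intro plateau_eq_1) auto
          show "3 * e2 \<le> \<bar>clamp2 d (U (t, x + h)) - clamp2 d (U (t, x))\<bar>" using False by (simp add: e2_def Dd_def)
        qed
        then have "ennreal (1 / (k * lam\<^sup>2)) * ennreal (k * Dd t x ^ 3) \<le> ennreal (1 / (k * lam\<^sup>2)) * G t x"
          by (rule mult_left_mono) simp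
        moreover have "Dd t x \<le> (1 / (k * lam\<^sup>2)) * (k * Dd t x ^ 3)"
        proof -
          have "lam\<^sup>2 \<le> (Dd t x)\<^sup>2" using False lam by (intro power_mono) auto
          then have "Dd t x * lam\<^sup>2 \<le> Dd t x * (Dd t x)\<^sup>2" using False lam by (intro mult_left_mono) auto
          then show ?thesis using k lam by (simp add: field_simps power3_eq_cube power2_eq_square)
        qed
        then have "ennreal (Dd t x) \<le> ennreal (1 / (k * lam\<^sup>2)) * ennreal (k * Dd t x ^ 3)"
          using k by (subst ennreal_mult'[symmetric]) (auto simp: Dd_def intro!: ennreal_leI)
        ultimately have "ennreal (Dd t x) \<le> ennreal (1 / (k * lam\<^sup>2)) * G t x" by (rule order_trans[rotated])
        then show ?thesis using True by (simp add: add_increasing)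
      qed
    qed
    have PPm: "D.PP \<in> borel_measurable borel" by (rule D.PP_measurable)
    note PPm[measurable]
    have th2[measurable]: "(\<lambda>x. D.th (f x) (g x)) \<in> borel_measurable M" if "f \<in> borel_measurable M" "g \<in> borel_measurable M" for f g and M :: "'z measure"
      using measurable_compose[OF borel_measurable_Pair[OF that] D.th_measurable] by (simp only: split_conv)
    have Gm[measurable]: "(\<lambda>p. G (f p) (g p)) \<in> borel_measurable M" if [measurable]: "f \<in> borel_measurable M" "g \<in> borel_measurable M" for f g and M :: "'z measure"
      unfolding G_def by measurable
    have "(\<integral>\<^sup>+t. \<integral>\<^sup>+x. indicator {t0..t1} t * indicator {-X..X} x * ennreal (Dd t x) \<partial>lborel \<partial>lborel)
      \<le> (\<integral>\<^sup>+t. \<integral>\<^sup>+x. ennreal lam * (indicator {t0..t1} t * indicator {-X..X} x) + ennreal (1 / (k * lam\<^sup>2)) * G t x \<partial>lborel \<partial>lborel)"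
      by (intro nn_integral_mono pt)
    also have "\<dots> = ennreal lam * (emeasure lborel {t0..t1} * emeasure lborel {-X..X}) + ennreal (1 / (k * lam\<^sup>2)) * (\<integral>\<^sup>+t. \<integral>\<^sup>+x. G t x \<partial>lborel \<partial>lborel)"
      by (simp add: nn_integral_add nn_integral_cmult nn_integral_multc)
    also have "\<dots> \<le> ennreal lam * (ennreal (t1 - t0) * ennreal (2 * X)) + ennreal (1 / (k * lam\<^sup>2)) * ennreal B"
      using t X by (intro add_mono mult_left_mono G) auto
    also have "\<dots> = ennreal (lam * ((t1 - t0) * (2 * X)) + 1 / (k * lam\<^sup>2) * B)"
      using t X lam k B0 by (simp flip: ennreal_mult ennreal_plus)
    also have "1 / (k * lam\<^sup>2) * B = 108 / (l + 1) * C1 * h * d powr (2 - l) / lam\<^sup>2"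
    proof -
      have "d powr (2 - l) * d powr (l - 1) = d" using d by (simp flip: powr_add)
      then have "1 / d powr (l - 1) * d = d powr (2 - l)" using d by (simp add: field_simps)
      moreover have "1 / (k * lam\<^sup>2) * B = 108 / (l + 1) * C1 * h * (1 / d powr (l - 1) * d) / lam\<^sup>2"
        by (simp add: k_def B_def)
      ultimately show ?thesis by simp
    qed
    finally show "(\<integral>\<^sup>+t. \<integral>\<^sup>+x. indicator {t0..t1} t * indicator {-X..X} x * ennreal \<bar>clamp2 d (U (t, x + h)) - clamp2 d (U (t, x))\<bar> \<partial>lborel \<partial>lborel)
      \<le> ennreal (lam * ((t1 - t0) * (2 * X)) + 108 / (l + 1) * C1 * h * d powr (2 - l) / lam\<^sup>2)"
      by (simp add: Dd_def)
  qed
qed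

end

section \<open>Summation over dyadic layers\<close>

definition trunc :: "real \<Rightarrow> real \<Rightarrow> real" where "trunc R u = min (max u 0) R"

lemma trunc_measurable [measurable]: "trunc R \<in> borel_measurable borel"
  unfolding trunc_def[abs_def] by measurable

text \<open>Halving the level of a truncation splits off exactly one layer of the kind treated in
  \<open>box_dyadic\<close>.\<close>

lemma trunc_double: "0 < d \<Longrightarrow> trunc (2 * d) u = trunc d u + (clamp2 d u - d)"
  by (auto simp: trunc_def clamp2_def min_def max_def)

lemma trunc_diff_le: "0 \<le> R \<Longrightarrow> \<bar>trunc R u - trunc R w\<bar> \<le> R"
  by (auto simp: trunc_def min_def max_def)

text \<open>The number of dyadic layers is a logarithm, and ln y \<le> y^\<kappa> / \<kappa>; so
  summing them costs an arbitrarily small power only.\<close>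

lemma of_nat_le_powr:
  fixes y \<kappa> :: real
  assumes "0 < \<kappa>" "2 ^ J \<le> y"
  shows "real J \<le> y powr \<kappa> / (\<kappa> * ln 2)"
proof -
  have y: "0 < y" using assms(2) by (rule less_le_trans[rotated]) simp
  have "real J * ln 2 = ln (2 ^ J)" by (simp add: ln_realpow)
  also have "\<dots> \<le> ln y" using assms(2) y by (subst ln_le_cancel_iff) auto
  finally have "\<kappa> * (real J * ln 2) \<le> \<kappa> * ln y" using assms(1) by (intro mult_left_mono) auto
  also have "\<dots> \<le> exp (\<kappa> * ln y)" using exp_ge_add_one_self[of "\<kappa> * ln y"] by linarith
  also have "\<dots> = y powr \<kappa>" using y by (simp add: powr_def)
  finally show ?thesis using assms(1) by (simp add: field_simps)
qed

text \<open>A local Nikolskii condition: L1 increments in x of order |h|^s, on boxes away from the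
  initial and final times. Only the base point is confined to the box; its translate may leave
  it.\<close>

definition xreg :: "real \<Rightarrow> real \<Rightarrow> (real \<times> real \<Rightarrow> real) \<Rightarrow> bool" where
  "xreg T s g \<longleftrightarrow> (\<forall>t0 t1 X. 0 < t0 \<and> t0 \<le> t1 \<and> t1 < T \<and> 0 \<le> X \<longrightarrow>
     (\<exists>C\<ge>0. \<forall>h. \<bar>h\<bar> \<le> 1 \<longrightarrow>
       (\<integral>\<^sup>+t. \<integral>\<^sup>+x. indicator {t0..t1} t * indicator {-X..X} x * ennreal \<bar>g (t, x + h) - g (t, x)\<bar> \<partial>lborel \<partial>lborel)
         \<le> ennreal (C * \<bar>h\<bar> powr s)))"

lemma xregD:
  assumes "xreg T s g" "0 < t0" "t0 \<le> t1" "t1 < T" "0 \<le> X"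
  obtains C where "0 \<le> C" "\<And>h. \<bar>h\<bar> \<le> 1 \<Longrightarrow>
    (\<integral>\<^sup>+t. \<integral>\<^sup>+x. indicator {t0..t1} t * indicator {-X..X} x * ennreal \<bar>g (t, x + h) - g (t, x)\<bar> \<partial>lborel \<partial>lborel)
      \<le> ennreal (C * \<bar>h\<bar> powr s)"
  using assms unfolding xreg_def by blast

text \<open>A negative shift is a positive one seen from the other end point. The window then moves
  by at most 1, which the larger box with \<open>X + 1\<close> absorbs.\<close>

lemma xregI_pos:
  assumes [measurable]: "g \<in> borel_measurable borel"
    and *: "\<And>t0 t1 X. 0 < t0 \<Longrightarrow> t0 \<le> t1 \<Longrightarrow> t1 < T \<Longrightarrow> 0 \<le> X \<Longrightarrow>
     \<exists>C\<ge>0. \<forall>h. 0 < h \<and> h \<le> 1 \<longrightarrow>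
       (\<integral>\<^sup>+t. \<integral>\<^sup>+x. indicator {t0..t1} t * indicator {-X..X} x * ennreal \<bar>g (t, x + h) - g (t, x)\<bar> \<partial>lborel \<partial>lborel)
         \<le> ennreal (C * h powr s)"
  shows "xreg T s g"
  unfolding xreg_def
proof (intro allI impI; elim conjE)
  fix t0 t1 X :: real assume t: "0 < t0" "t0 \<le> t1" "t1 < T" "0 \<le> X"
  let ?N = "\<lambda>h. (\<integral>\<^sup>+t. \<integral>\<^sup>+x. indicator {t0..t1} t * indicator {-X..X} x * ennreal \<bar>g (t, x + h) - g (t, x)\<bar> \<partial>lborel \<partial>lborel)"
  have "0 \<le> X + 1" using t by simp
  from *[OF t(1-3) this] obtain C where C: "0 \<le> C" "\<And>h. 0 < h \<Longrightarrow> h \<le> 1 \<Longrightarrow>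
       (\<integral>\<^sup>+t. \<integral>\<^sup>+x. indicator {t0..t1} t * indicator {-(X+1)..X+1} x * ennreal \<bar>g (t, x + h) - g (t, x)\<bar> \<partial>lborel \<partial>lborel)
         \<le> ennreal (C * h powr s)" by blast
  show "\<exists>C\<ge>0. \<forall>h. \<bar>h\<bar> \<le> 1 \<longrightarrow>
       ?N h
         \<le> ennreal (C * \<bar>h\<bar> powr s)"
  proof (intro exI[of _ C] conjI allI impI C)
    fix h :: real assume h: "\<bar>h\<bar> \<le> 1"
    consider "h = 0" | "h > 0" | "h < 0" by linarith
    then show "?N h
         \<le> ennreal (C * \<bar>h\<bar> powr s)"
    proof cases
      case 1 then show ?thesis by simp
    next
      case 2
      have "?N h
        \<le> (\<integral>\<^sup>+t. \<integral>\<^sup>+x. indicator {t0..t1} t * indicator {-(X+1)..X+1} x * ennreal \<bar>g (t, x + h) - g (t, x)\<bar> \<partial>lborel \<partial>lborel)"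
        by (intro nn_integral_mono mult_right_mono mult_left_mono) (auto simp: indicator_def)
      also have "\<dots> \<le> ennreal (C * \<bar>h\<bar> powr s)" using C(2)[of h] 2 h by simp
      finally show ?thesis .
    next
      case 3
      have "?N h
        = (\<integral>\<^sup>+t. \<integral>\<^sup>+x. indicator {t0..t1} t * indicator {-X..X} (x + - h) * ennreal \<bar>g (t, x + - h + h) - g (t, x + - h)\<bar> \<partial>lborel \<partial>lborel)"
        by (rule nn_integral_cong, rule nn_integral_translate[symmetric]) measurable
      also have "\<dots> \<le> (\<integral>\<^sup>+t. \<integral>\<^sup>+x. indicator {t0..t1} t * indicator {-(X+1)..X+1} x * ennreal \<bar>g (t, x + - h) - g (t, x)\<bar> \<partial>lborel \<partial>lborel)"
        using 3 h by (intro nn_integral_mono mult_mono) (auto simp: indicator_def abs_minus_commute)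
      also have "\<dots> \<le> ennreal (C * \<bar>h\<bar> powr s)" using C(2)[of "-h"] 3 h by simp
      finally show ?thesis .
    qed
  qed
qed

lemma xreg_lipschitz:
  assumes [measurable]: "g1 \<in> borel_measurable borel" "g2 \<in> borel_measurable borel"
    and "xreg T s g1" "xreg T s g2" "0 \<le> L"
    and lip: "\<And>z z'. \<bar>g z - g z'\<bar> \<le> L * (\<bar>g1 z - g1 z'\<bar> + \<bar>g2 z - g2 z'\<bar>)"
  shows "xreg T s g"
  unfolding xreg_def
proof (intro allI impI; elim conjE)
  fix t0 t1 X :: real assume t: "0 < t0" "t0 \<le> t1" "t1 < T" "0 \<le> X"
  define I :: "real \<Rightarrow> real \<Rightarrow> ennreal" where "I t x = indicator {t0..t1} t * indicator {-X..X} x" for t x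
  have I[measurable]: "(\<lambda>p. I (a p) (b p)) \<in> borel_measurable M" if [measurable]: "a \<in> borel_measurable M" "b \<in> borel_measurable M" for a b and M :: "'z measure"
    unfolding I_def by measurable
  obtain C1 where C1: "0 \<le> C1" "\<And>h. \<bar>h\<bar> \<le> 1 \<Longrightarrow> (\<integral>\<^sup>+t. \<integral>\<^sup>+x. I t x * ennreal \<bar>g1 (t, x + h) - g1 (t, x)\<bar> \<partial>lborel \<partial>lborel) \<le> ennreal (C1 * \<bar>h\<bar> powr s)"
    using assms(3) t unfolding xreg_def I_def by blast
  obtain C2 where C2: "0 \<le> C2" "\<And>h. \<bar>h\<bar> \<le> 1 \<Longrightarrow> (\<integral>\<^sup>+t. \<integral>\<^sup>+x. I t x * ennreal \<bar>g2 (t, x + h) - g2 (t, x)\<bar> \<partial>lborel \<partial>lborel) \<le> ennreal (C2 * \<bar>h\<bar> powr s)"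
    using assms(4) t unfolding xreg_def I_def by blast
  show "\<exists>C\<ge>0. \<forall>h. \<bar>h\<bar> \<le> 1 \<longrightarrow>
       (\<integral>\<^sup>+t. \<integral>\<^sup>+x. indicator {t0..t1} t * indicator {-X..X} x * ennreal \<bar>g (t, x + h) - g (t, x)\<bar> \<partial>lborel \<partial>lborel)
         \<le> ennreal (C * \<bar>h\<bar> powr s)"
    unfolding I_def[symmetric]
  proof (intro exI[of _ "L * (C1 + C2)"] conjI allI impI)
    show "0 \<le> L * (C1 + C2)" using C1 C2 assms by simp
    fix h :: real assume h: "\<bar>h\<bar> \<le> 1"
    have "(\<integral>\<^sup>+t. \<integral>\<^sup>+x. I t x * ennreal \<bar>g (t, x + h) - g (t, x)\<bar> \<partial>lborel \<partial>lborel)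
      \<le> (\<integral>\<^sup>+t. \<integral>\<^sup>+x. ennreal L * (I t x * ennreal \<bar>g1 (t, x + h) - g1 (t, x)\<bar> + I t x * ennreal \<bar>g2 (t, x + h) - g2 (t, x)\<bar>) \<partial>lborel \<partial>lborel)"
    proof (intro nn_integral_mono)
      fix t x
      have "ennreal \<bar>g (t, x + h) - g (t, x)\<bar> \<le> ennreal L * (ennreal \<bar>g1 (t, x + h) - g1 (t, x)\<bar> + ennreal \<bar>g2 (t, x + h) - g2 (t, x)\<bar>)"
        using lip[of "(t, x + h)" "(t, x)"] assms(5) by (simp flip: ennreal_mult ennreal_plus add: ennreal_leI)
      then have "I t x * ennreal \<bar>g (t, x + h) - g (t, x)\<bar> \<le> I t x * (ennreal L * (ennreal \<bar>g1 (t, x + h) - g1 (t, x)\<bar> + ennreal \<bar>g2 (t, x + h) - g2 (t, x)\<bar>))"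
        by (intro mult_left_mono) auto
      then show "I t x * ennreal \<bar>g (t, x + h) - g (t, x)\<bar> \<le> ennreal L * (I t x * ennreal \<bar>g1 (t, x + h) - g1 (t, x)\<bar> + I t x * ennreal \<bar>g2 (t, x + h) - g2 (t, x)\<bar>)"
        by (simp add: distrib_left mult.left_commute)
    qed
    also have "\<dots> = ennreal L * ((\<integral>\<^sup>+t. \<integral>\<^sup>+x. I t x * ennreal \<bar>g1 (t, x + h) - g1 (t, x)\<bar> \<partial>lborel \<partial>lborel) + (\<integral>\<^sup>+t. \<integral>\<^sup>+x. I t x * ennreal \<bar>g2 (t, x + h) - g2 (t, x)\<bar> \<partial>lborel \<partial>lborel))"
      by (simp add: nn_integral_cmult nn_integral_add)
    also have "\<dots> \<le> ennreal L * (ennreal (C1 * \<bar>h\<bar> powr s) + ennreal (C2 * \<bar>h\<bar> powr s))"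
      by (intro mult_left_mono add_mono C1 C2 h) auto
    also have "\<dots> = ennreal (L * (C1 + C2) * \<bar>h\<bar> powr s)"
      using C1 C2 assms(5) by (simp flip: ennreal_mult ennreal_plus add: algebra_simps)
    finally show "(\<integral>\<^sup>+t. \<integral>\<^sup>+x. I t x * ennreal \<bar>g (t, x + h) - g (t, x)\<bar> \<partial>lborel \<partial>lborel) \<le> ennreal (L * (C1 + C2) * \<bar>h\<bar> powr s)" .
  qed
qed

context half_problem
begin

text \<open>Layers are peeled off from level \<open>R\<close> down to level \<open>lam\<close>. Each
  costs O(\<open>lam\<close>), and the truncation that remains is itself O(\<open>lam\<close>), so
  the only loss is the number of layers.\<close>

lemma xreg_trunc:
  assumes s: "s < min (1/3) (1 / (l + 1))" and R: "0 < R"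
  shows "xreg T s (\<lambda>z. trunc R (U z))"
proof (rule xregI_pos)
  fix t0 t1 X :: real assume t: "0 < t0" "t0 \<le> t1" "t1 < T" "0 \<le> X"
  define I :: "real \<Rightarrow> real \<Rightarrow> ennreal" where "I t x = indicator {t0..t1} t * indicator {-X..X} x" for t x
  have I[measurable]: "(\<lambda>p. I (a p) (b p)) \<in> borel_measurable M" if [measurable]: "a \<in> borel_measurable M" "b \<in> borel_measurable M" for a b and M :: "'z measure"
    unfolding I_def by measurable
  define A0 where "A0 = (t1 - t0) * (2 * X)"
  have A0: "0 \<le> A0" using t by (simp add: A0_def)
  obtain C where C: "0 \<le> C" "\<And>d h lam. 0 < d \<Longrightarrow> d \<le> R \<Longrightarrow> 0 \<le> h \<Longrightarrow> 0 < lam \<Longrightarrow>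
    (\<integral>\<^sup>+t. \<integral>\<^sup>+x. I t x * ennreal \<bar>clamp2 d (U (t, x + h)) - clamp2 d (U (t, x))\<bar> \<partial>lborel \<partial>lborel)
      \<le> ennreal (lam * A0 + C * h * d powr (2 - l) / lam\<^sup>2)"
    using box_dyadic[OF t R] unfolding I_def A0_def by blast
  define p where "p = max 3 (l + 1)"
  have p: "3 \<le> p" "l + 1 \<le> p" by (auto simp: p_def)
  have "1 / p = min (1/3) (1 / (l + 1))" using l_ge_1 by (auto simp: p_def max_def min_def field_simps)
  then have sp: "s < 1 / p" using s by simp
  define K where "K = A0 + C * (1 + R powr (2 - l))"
  have K: "0 \<le> K" using A0 C(1) by (simp add: K_def)
  \<comment> \<open>The loss for the number of layers: \<open>J\<close> is
    O(\<open>lam powr - \<kappa>\<close>), and \<open>lam powr (1 - \<kappa>)\<close> is exactly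
    \<open>h powr s\<close>.\<close>
  define \<kappa> where "\<kappa> = p * (1 / p - s)"
  have \<kappa>: "0 < \<kappa>" using sp p by (simp add: \<kappa>_def)
  define Cf where "Cf = K * (R powr \<kappa> / (\<kappa> * ln 2)) + 2 * A0"
  show "\<exists>C\<ge>0. \<forall>h. 0 < h \<and> h \<le> 1 \<longrightarrow>
       (\<integral>\<^sup>+t. \<integral>\<^sup>+x. indicator {t0..t1} t * indicator {-X..X} x * ennreal \<bar>trunc R (U (t, x + h)) - trunc R (U (t, x))\<bar> \<partial>lborel \<partial>lborel)
         \<le> ennreal (C * h powr s)"
    unfolding I_def[symmetric]
  proof (intro exI[of _ Cf] conjI allI impI; (elim conjE)?)
    show "0 \<le> Cf" using K \<kappa> A0 by (simp add: Cf_def)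
    fix h :: real assume h: "0 < h" "h \<le> 1"
    let ?N = "\<lambda>d. (\<integral>\<^sup>+t. \<integral>\<^sup>+x. I t x * ennreal \<bar>trunc d (U (t, x + h)) - trunc d (U (t, x))\<bar> \<partial>lborel \<partial>lborel)"
    define lam where "lam = h powr (1 / p)"
    have lam: "0 < lam" using h by (simp add: lam_def)
    have level: "(\<integral>\<^sup>+t. \<integral>\<^sup>+x. I t x * ennreal \<bar>clamp2 d (U (t, x + h)) - clamp2 d (U (t, x))\<bar> \<partial>lborel \<partial>lborel) \<le> ennreal (K * lam)"
      if d: "lam \<le> d" "d \<le> R" for d
    proof -
      have d0: "0 < d" using d lam by simp
      \<comment> \<open>One constant for both regimes: if l \<le> 2, the power of d is at most
        \<open>R powr (2 - l)\<close> and the rest equals \<open>lam\<close>; otherwise the power is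
        largest at d = \<open>lam\<close>, where the whole expression equals
        \<open>lam\<close>.\<close>
      have "h * d powr (2 - l) / lam\<^sup>2 \<le> (1 + R powr (2 - l)) * lam"
      proof (cases "l \<le> 2")
        case True
        then have p3: "p = 3" by (simp add: p_def)
        have "lam ^ 3 = h" using h by (simp add: lam_def p3 powr_powr flip: powr_realpow)
        then have "h / lam\<^sup>2 = lam" using lam by (simp add: field_simps power3_eq_cube power2_eq_square)
        moreover have "d powr (2 - l) \<le> R powr (2 - l)" using True d0 d by (intro powr_mono2) auto
        ultimately have "h / lam\<^sup>2 * d powr (2 - l) \<le> lam * (1 + R powr (2 - l))"
          using lam by (intro mult_mono) auto
        then show ?thesis by (simp add: mult.commute)
      next
        case False
        then have pl: "p = l + 1" by (simp add: p_def)
        have "d powr (2 - l) \<le> lam powr (2 - l)" using False d lam by (intro powr_mono2') auto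
        then have "h * d powr (2 - l) / lam\<^sup>2 \<le> h * lam powr (2 - l) / lam\<^sup>2"
          using h by (intro divide_right_mono mult_left_mono) auto
        also have "\<dots> = lam"
        proof -
          have "h = lam powr (l + 1)" using h l_ge_1 by (simp add: lam_def pl powr_powr)
          moreover have "lam\<^sup>2 = lam powr 2" using lam by simp
          ultimately have "h * lam powr (2 - l) / lam\<^sup>2 = lam powr (l + 1) * lam powr (2 - l) / lam powr 2" by simp
          also have "\<dots> = lam powr (l + 1 + (2 - l) - 2)" by (simp only: powr_add powr_diff)
          also have "\<dots> = lam" using lam by simp
          finally show ?thesis .
        qed
        also have "\<dots> \<le> (1 + R powr (2 - l)) * lam" using lam by (simp add: distrib_right)
        finally show ?thesis .
      qed
      then have "C * (h * d powr (2 - l) / lam\<^sup>2) \<le> C * ((1 + R powr (2 - l)) * lam)" using C(1) by (rule mult_left_mono)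
      then have "lam * A0 + C * h * d powr (2 - l) / lam\<^sup>2 \<le> K * lam" by (simp add: K_def algebra_simps)
      then show ?thesis
        using C(2)[OF d0 d(2) less_imp_le[OF h(1)] lam] by (meson ennreal_leI order_trans)
    qed
    have ex: "\<exists>n. R / 2 ^ Suc n < lam"
    proof -
      obtain n where "R / lam < 2 ^ n" using real_arch_pow[of 2 "R / lam"] by auto
      then have "R < lam * 2 ^ n" using lam by (simp add: field_simps)
      also have "\<dots> \<le> lam * 2 ^ Suc n" using lam by simp
      finally show ?thesis by (intro exI[of _ n]) (simp add: field_simps)
    qed
    \<comment> \<open>With this choice every layer that is peeled off has level at least
      \<open>lam\<close>, while the remaining truncation level \<open>R / 2 ^ J\<close> is below
      \<open>2 * lam\<close>.\<close>
    define J where "J = (LEAST n. R / 2 ^ Suc n < lam)"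
    have J: "R / 2 ^ Suc J < lam" unfolding J_def by (rule LeastI_ex[OF ex])
    have Jl: "lam \<le> R / 2 ^ Suc j" if "j < J" for j
      using not_less_Least[of j "\<lambda>n. R / 2 ^ Suc n < lam"] that by (simp add: J_def)
    have sum: "?N R
       \<le> ennreal (real n * (K * lam)) + (\<integral>\<^sup>+t. \<integral>\<^sup>+x. I t x * ennreal \<bar>trunc (R / 2 ^ n) (U (t, x + h)) - trunc (R / 2 ^ n) (U (t, x))\<bar> \<partial>lborel \<partial>lborel)"
      if "n \<le> J" for n
      using that
    proof (induction n)
      case 0
      then show ?case by simp
    next
      case (Suc n)
      define d where "d = R / 2 ^ Suc n"
      have "d \<le> R / 1" unfolding d_def using R by (intro divide_left_mono one_le_power) auto
      then have d: "0 < d" "R / 2 ^ n = 2 * d" "lam \<le> d" "d \<le> R"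
        using R Jl[of n] Suc.prems by (auto simp: d_def)
      have "(\<integral>\<^sup>+t. \<integral>\<^sup>+x. I t x * ennreal \<bar>trunc (2 * d) (U (t, x + h)) - trunc (2 * d) (U (t, x))\<bar> \<partial>lborel \<partial>lborel)
        \<le> (\<integral>\<^sup>+t. \<integral>\<^sup>+x. I t x * ennreal \<bar>clamp2 d (U (t, x + h)) - clamp2 d (U (t, x))\<bar> + I t x * ennreal \<bar>trunc d (U (t, x + h)) - trunc d (U (t, x))\<bar> \<partial>lborel \<partial>lborel)"
        unfolding distrib_left[symmetric]
        by (intro nn_integral_mono mult_left_mono) (auto simp: trunc_double[OF d(1)] simp flip: ennreal_plus intro!: ennreal_leI)
      also have "\<dots> = (\<integral>\<^sup>+t. \<integral>\<^sup>+x. I t x * ennreal \<bar>clamp2 d (U (t, x + h)) - clamp2 d (U (t, x))\<bar> \<partial>lborel \<partial>lborel) + ?N d"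
        by (simp add: nn_integral_add)
      also have "\<dots> \<le> ennreal (K * lam) + ?N d"
        by (intro add_right_mono level d)
      finally have "?N R
        \<le> ennreal (real n * (K * lam)) + (ennreal (K * lam) + ?N d)"
        using Suc.IH Suc.prems unfolding d(2) by (meson Suc_leD add_left_mono order_trans)
      also have "\<dots> = ennreal (real (Suc n) * (K * lam)) + ?N d"
        unfolding add.assoc[symmetric] using K lam by (simp flip: ennreal_plus add: algebra_simps)
      finally show ?case by (simp only: d_def)
    qed
    have "(\<integral>\<^sup>+t. \<integral>\<^sup>+x. I t x * ennreal \<bar>trunc (R / 2 ^ J) (U (t, x + h)) - trunc (R / 2 ^ J) (U (t, x))\<bar> \<partial>lborel \<partial>lborel)
      \<le> (\<integral>\<^sup>+t. \<integral>\<^sup>+x. I t x * ennreal (2 * lam) \<partial>lborel \<partial>lborel)"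
    proof (intro nn_integral_mono mult_left_mono ennreal_leI)
      fix t x
      have "\<bar>trunc (R / 2 ^ J) (U (t, x + h)) - trunc (R / 2 ^ J) (U (t, x))\<bar> \<le> R / 2 ^ J" using R by (intro trunc_diff_le) simp
      also have "\<dots> \<le> 2 * lam" using J by (simp add: field_simps)
      finally show "\<bar>trunc (R / 2 ^ J) (U (t, x + h)) - trunc (R / 2 ^ J) (U (t, x))\<bar> \<le> 2 * lam" .
    qed simp
    also have "\<dots> = ennreal (t1 - t0) * ennreal (2 * X) * ennreal (2 * lam)"
      unfolding I_def using t by (simp add: nn_integral_multc nn_integral_cmult)
    also have "\<dots> = ennreal (2 * A0 * lam)"
      using t lam by (simp add: A0_def ac_simps flip: ennreal_mult)
    finally have "?N R
       \<le> ennreal (real J * (K * lam)) + ennreal (2 * A0 * lam)"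
      using sum[of J] by (meson add_left_mono order_refl order_trans)
    also have "\<dots> = ennreal (K * (real J * lam) + 2 * A0 * lam)"
      using K lam A0 by (simp flip: ennreal_plus add: ac_simps)
    also have "\<dots> \<le> ennreal (Cf * h powr s)"
    proof (rule ennreal_leI)
      have lam_s: "lam \<le> h powr s" using h sp by (auto simp: lam_def intro!: powr_mono')
      have Jlam: "real J * lam \<le> R powr \<kappa> / (\<kappa> * ln 2) * h powr s"
      proof (cases J)
        case 0
        then show ?thesis using \<kappa> by simp
      next
        case (Suc j)
        then have "lam \<le> R / 2 ^ J" using Jl[of j] by simp
        then have "2 ^ J \<le> R / lam" using lam by (simp add: field_simps)
        from of_nat_le_powr[OF \<kappa> this] have "real J \<le> (R / lam) powr \<kappa> / (\<kappa> * ln 2)" .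
        then have "real J * lam \<le> (R / lam) powr \<kappa> / (\<kappa> * ln 2) * lam" using lam by (intro mult_right_mono) auto
        also have "\<dots> = R powr \<kappa> / (\<kappa> * ln 2) * (lam / lam powr \<kappa>)" using R lam by (simp add: powr_divide)
        also have "lam / lam powr \<kappa> = h powr s"
        proof -
          have "lam / lam powr \<kappa> = lam powr 1 / lam powr \<kappa>" using lam by simp
          also have "\<dots> = lam powr (1 - \<kappa>)" by (simp only: powr_diff)
          also have "\<dots> = h powr (1 / p * (1 - \<kappa>))" by (simp add: lam_def powr_powr)
          also have "1 / p * (1 - \<kappa>) = s" using p by (simp add: \<kappa>_def field_simps)
          finally show ?thesis .
        qed
        finally show ?thesis .
      qed
      have "K * (real J * lam) + 2 * A0 * lam \<le> K * (R powr \<kappa> / (\<kappa> * ln 2) * h powr s) + 2 * A0 * h powr s"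
        using K A0 Jlam lam_s by (intro add_mono mult_left_mono) auto
      also have "\<dots> = Cf * h powr s" by (simp add: Cf_def algebra_simps)
      finally show "K * (real J * lam) + 2 * A0 * lam \<le> Cf * h powr s" .
    qed
    finally show "?N R \<le> ennreal (Cf * h powr s)" .
  qed
qed measurable

end

section \<open>Regularity in time\<close>

text \<open>In contrast to \<open>xreg\<close> the shift is limited by an \<eta> that depends on the
  box, since t + \<tau> must stay inside (0, T). Negative shifts are reduced to positive ones in
  \<open>sobolev_from_shifts\<close>.\<close>

definition treg :: "real \<Rightarrow> real \<Rightarrow> (real \<times> real \<Rightarrow> real) \<Rightarrow> bool" where
  "treg T s g \<longleftrightarrow> (\<forall>t0 t1 X. 0 < t0 \<and> t0 \<le> t1 \<and> t1 < T \<and> 0 \<le> X \<longrightarrow>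
     (\<exists>C\<ge>0. \<exists>\<eta>>0. \<forall>\<tau>. 0 \<le> \<tau> \<and> \<tau> \<le> \<eta> \<longrightarrow>
       (\<integral>\<^sup>+t. \<integral>\<^sup>+x. indicator {t0..t1} t * indicator {-X..X} x * ennreal \<bar>g (t + \<tau>, x) - g (t, x)\<bar> \<partial>lborel \<partial>lborel)
         \<le> ennreal (C * \<tau> powr s)))"

definition mollify :: "real \<Rightarrow> real \<Rightarrow> (real \<times> real \<Rightarrow> real) \<Rightarrow> real \<times> real \<Rightarrow> real" where
  "mollify e r g = (\<lambda>(t, x). \<integral>(\<sigma>, y). g (\<sigma>, y) * (moll e (\<sigma> - t) * moll r (y - x)) \<partial>lborel)"

lemma moll2_nn: "0 < e \<Longrightarrow> 0 < r \<Longrightarrow> (\<integral>\<^sup>+(\<sigma>, y). ennreal (moll e (\<sigma> - t) * moll r (y - x)) \<partial>lborel) = 1"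
proof -
  assume e: "0 < e" and r: "0 < r"
  have tr: "(\<integral>\<^sup>+y. ennreal (moll c (y - z)) \<partial>lborel) = 1" if "0 < c" for c z
    using nn_integral_translate[of "\<lambda>x. ennreal (moll c x)" "- z"] nn_integral_moll[OF that] by simp
  have "(\<integral>\<^sup>+(\<sigma>, y). ennreal (moll e (\<sigma> - t) * moll r (y - x)) \<partial>lborel) = (\<integral>\<^sup>+(\<sigma>, y). ennreal (moll e (\<sigma> - t)) * ennreal (moll r (y - x)) \<partial>lborel)"
    using moll_nonneg[OF e] moll_nonneg[OF r] by (intro nn_integral_cong) (auto simp: ennreal_mult)
  also have "\<dots> = 1" by (subst nn_integral_tensor2) (auto simp: tr e r)
  finally show ?thesis .
qed

lemma moll2_integrable: "0 < e \<Longrightarrow> 0 < r \<Longrightarrow> integrable lborel (\<lambda>(\<sigma>, y). moll e (\<sigma> - t) * moll r (y - x))"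
proof (rule integrable_nnI[of _ _ 1])
  assume e: "0 < e" and r: "0 < r"
  have "(\<integral>\<^sup>+p. ennreal \<bar>case p of (\<sigma>, y) \<Rightarrow> moll e (\<sigma> - t) * moll r (y - x)\<bar> \<partial>lborel) = (\<integral>\<^sup>+(\<sigma>, y). ennreal (moll e (\<sigma> - t) * moll r (y - x)) \<partial>lborel)"
    using moll_nonneg[OF e] moll_nonneg[OF r] by (intro nn_integral_cong) (auto simp: abs_mult)
  then show "(\<integral>\<^sup>+p. ennreal \<bar>case p of (\<sigma>, y) \<Rightarrow> moll e (\<sigma> - t) * moll r (y - x)\<bar> \<partial>lborel) \<le> ennreal 1"
    using moll2_nn[OF e r] by simp
qed measurable

lemma integral_moll2: "0 < e \<Longrightarrow> 0 < r \<Longrightarrow> (\<integral>(\<sigma>, y). moll e (\<sigma> - t) * moll r (y - x) \<partial>lborel) = 1"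
proof -
  assume e: "0 < e" and r: "0 < r"
  have "ennreal (\<integral>(\<sigma>, y). moll e (\<sigma> - t) * moll r (y - x) \<partial>lborel) = (\<integral>\<^sup>+(\<sigma>, y). ennreal (moll e (\<sigma> - t) * moll r (y - x)) \<partial>lborel)"
    using nn_integral_eq_integral[OF moll2_integrable[OF e r, of t x]] moll_nonneg[OF e] moll_nonneg[OF r]
    by (auto simp: split_beta')
  then have "ennreal (\<integral>(\<sigma>, y). moll e (\<sigma> - t) * moll r (y - x) \<partial>lborel) = 1" by (simp only: moll2_nn[OF e r])
  then show ?thesis by (metis ennreal_eq_1)
qed

lemma mollify_diff_le:
  fixes g :: "real \<times> real \<Rightarrow> real"
  assumes [measurable]: "g \<in> borel_measurable borel" and G0: "\<And>z. \<bar>g z\<bar> \<le> G0" and e: "0 < e" "0 < r"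
  shows "ennreal \<bar>mollify e r g (t, x) - g (t, x)\<bar>
     \<le> (\<integral>\<^sup>+\<theta>. \<integral>\<^sup>+\<xi>. ennreal (moll e \<theta>) * ennreal (moll r \<xi>) * ennreal \<bar>g (t + \<theta>, x + \<xi>) - g (t, x)\<bar> \<partial>lborel \<partial>lborel)"
proof -
  have i1: "integrable lborel (\<lambda>(\<sigma>, y). g (\<sigma>, y) * (moll e (\<sigma> - t) * moll r (y - x)))"
    by (rule integrable_abs_le[OF moll2_integrable[OF e, of t x], of _ G0], measurable)
       (auto simp: abs_mult intro!: mult_right_mono G0)
  have i2: "integrable lborel (\<lambda>(\<sigma>, y). g (t, x) * (moll e (\<sigma> - t) * moll r (y - x)))"
    by (rule integrable_abs_le[OF moll2_integrable[OF e, of t x], of _ G0], measurable)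
       (auto simp: abs_mult intro!: mult_right_mono G0)
  have gx: "g (t, x) = (\<integral>(\<sigma>, y). g (t, x) * (moll e (\<sigma> - t) * moll r (y - x)) \<partial>lborel)"
  proof -
    have "(\<lambda>(\<sigma>, y). g (t, x) * (moll e (\<sigma> - t) * moll r (y - x))) = (\<lambda>p. g (t, x) * (case p of (\<sigma>, y) \<Rightarrow> moll e (\<sigma> - t) * moll r (y - x)))"
      by (auto simp: fun_eq_iff)
    then show ?thesis using integral_moll2[OF e, of t x] by simp
  qed
  have eq: "mollify e r g (t, x) - g (t, x) = (\<integral>p. (case p of (\<sigma>, y) \<Rightarrow> g (\<sigma>, y) * (moll e (\<sigma> - t) * moll r (y - x))) - (case p of (\<sigma>, y) \<Rightarrow> g (t, x) * (moll e (\<sigma> - t) * moll r (y - x))) \<partial>lborel)"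
    unfolding mollify_def split_conv by (subst gx) (rule Bochner_Integration.integral_diff[OF i1 i2, symmetric])
  have "ennreal \<bar>mollify e r g (t, x) - g (t, x)\<bar> \<le> (\<integral>\<^sup>+p. ennreal (norm ((case p of (\<sigma>, y) \<Rightarrow> g (\<sigma>, y) * (moll e (\<sigma> - t) * moll r (y - x))) - (case p of (\<sigma>, y) \<Rightarrow> g (t, x) * (moll e (\<sigma> - t) * moll r (y - x))))) \<partial>lborel)"
    unfolding eq real_norm_def[symmetric] by (rule integral_norm_bound_ennreal[OF Bochner_Integration.integrable_diff[OF i1 i2]])
  also have "\<dots> = (\<integral>\<^sup>+(\<sigma>, y). ennreal (moll e (\<sigma> - t)) * ennreal (moll r (y - x)) * ennreal \<bar>g (\<sigma>, y) - g (t, x)\<bar> \<partial>lborel)"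
  proof (intro nn_integral_cong, clarify)
    fix \<sigma> y
    have "g (\<sigma>, y) * (moll e (\<sigma> - t) * moll r (y - x)) - g (t, x) * (moll e (\<sigma> - t) * moll r (y - x)) = moll e (\<sigma> - t) * moll r (y - x) * (g (\<sigma>, y) - g (t, x))"
      by (simp add: algebra_simps)
    then show "ennreal (norm (g (\<sigma>, y) * (moll e (\<sigma> - t) * moll r (y - x)) - g (t, x) * (moll e (\<sigma> - t) * moll r (y - x)))) = ennreal (moll e (\<sigma> - t)) * ennreal (moll r (y - x)) * ennreal \<bar>g (\<sigma>, y) - g (t, x)\<bar>"
      using moll_nonneg[OF e(1)] moll_nonneg[OF e(2)] by (simp add: abs_mult ennreal_mult)
  qed
  also have "\<dots> = (\<integral>\<^sup>+p. (case p + (t, x) of (\<sigma>, y) \<Rightarrow> ennreal (moll e (\<sigma> - t)) * ennreal (moll r (y - x)) * ennreal \<bar>g (\<sigma>, y) - g (t, x)\<bar>) \<partial>lborel)"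
    by (rule nn_integral_translate[symmetric]) measurable
  also have "\<dots> = (\<integral>\<^sup>+(\<theta>, \<xi>). ennreal (moll e \<theta>) * ennreal (moll r \<xi>) * ennreal \<bar>g (t + \<theta>, x + \<xi>) - g (t, x)\<bar> \<partial>lborel)"
    by (intro nn_integral_cong) (auto simp: add.commute)
  also have "\<dots> = (\<integral>\<^sup>+\<theta>. \<integral>\<^sup>+\<xi>. ennreal (moll e \<theta>) * ennreal (moll r \<xi>) * ennreal \<bar>g (t + \<theta>, x + \<xi>) - g (t, x)\<bar> \<partial>lborel \<partial>lborel)"
    by (rule nn_integral_lborel_split2) measurable
  finally show ?thesis .
qed

text \<open>The weights have mass one and vanish for longer shifts, so a bound that is uniform over
  the short shifts survives averaging with the same constant.\<close>

lemma moll_avg_bound: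
  fixes F :: "real \<Rightarrow> real \<Rightarrow> real \<Rightarrow> real \<Rightarrow> ennreal"
  assumes F: "(\<lambda>(t, x, \<theta>, \<xi>). F t x \<theta> \<xi>) \<in> borel_measurable borel" and e: "0 < e" "0 < r"
    and bnd: "\<And>\<theta> \<xi>. \<bar>\<theta>\<bar> \<le> e \<Longrightarrow> \<bar>\<xi>\<bar> \<le> r \<Longrightarrow> (\<integral>\<^sup>+t. \<integral>\<^sup>+x. F t x \<theta> \<xi> \<partial>lborel \<partial>lborel) \<le> K"
  shows "(\<integral>\<^sup>+t. \<integral>\<^sup>+x. \<integral>\<^sup>+\<theta>. \<integral>\<^sup>+\<xi>. ennreal (moll e \<theta>) * ennreal (moll r \<xi>) * F t x \<theta> \<xi> \<partial>lborel \<partial>lborel \<partial>lborel \<partial>lborel) \<le> K"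
proof -
  have F2[measurable]: "(\<lambda>p. F (a p) (b p) (c p) (d p)) \<in> borel_measurable M"
    if "a \<in> borel_measurable M" "b \<in> borel_measurable M" "c \<in> borel_measurable M" "d \<in> borel_measurable M"
    for a b c d and M :: "'z measure"
    using measurable_compose[OF borel_measurable_Pair[OF that(1) borel_measurable_Pair[OF that(2) borel_measurable_Pair[OF that(3,4)]]] F]
    by (simp only: split_conv)
  have "(\<integral>\<^sup>+t. \<integral>\<^sup>+x. \<integral>\<^sup>+\<theta>. \<integral>\<^sup>+\<xi>. ennreal (moll e \<theta>) * ennreal (moll r \<xi>) * F t x \<theta> \<xi> \<partial>lborel \<partial>lborel \<partial>lborel \<partial>lborel)
    = (\<integral>\<^sup>+\<theta>. \<integral>\<^sup>+\<xi>. \<integral>\<^sup>+t. \<integral>\<^sup>+x. ennreal (moll e \<theta>) * ennreal (moll r \<xi>) * F t x \<theta> \<xi> \<partial>lborel \<partial>lborel \<partial>lborel \<partial>lborel)"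
    by (rule nn_integral_swap4) measurable
  also have "\<dots> = (\<integral>\<^sup>+\<theta>. \<integral>\<^sup>+\<xi>. ennreal (moll e \<theta>) * ennreal (moll r \<xi>) * (\<integral>\<^sup>+t. \<integral>\<^sup>+x. F t x \<theta> \<xi> \<partial>lborel \<partial>lborel) \<partial>lborel \<partial>lborel)"
    by (simp add: nn_integral_cmult)
  also have "\<dots> \<le> (\<integral>\<^sup>+\<theta>. \<integral>\<^sup>+\<xi>. ennreal (moll e \<theta>) * ennreal (moll r \<xi>) * K \<partial>lborel \<partial>lborel)"
  proof (intro nn_integral_mono)
    fix \<theta> \<xi>
    show "ennreal (moll e \<theta>) * ennreal (moll r \<xi>) * (\<integral>\<^sup>+t. \<integral>\<^sup>+x. F t x \<theta> \<xi> \<partial>lborel \<partial>lborel) \<le> ennreal (moll e \<theta>) * ennreal (moll r \<xi>) * K"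
    proof (cases "\<bar>\<theta>\<bar> \<le> e \<and> \<bar>\<xi>\<bar> \<le> r")
      case True
      then show ?thesis by (intro mult_left_mono bnd) auto
    next
      case False
      then have "moll e \<theta> = 0 \<or> moll r \<xi> = 0"
        using moll_outside[OF e(1), of \<theta>] moll_outside[OF e(2), of \<xi>] by (auto simp: not_le)
      then show ?thesis by auto
    qed
  qed
  also have "\<dots> = K"
    by (simp add: nn_integral_cmult nn_integral_multc nn_integral_moll[OF e(1)] nn_integral_moll[OF e(2)])
  finally show ?thesis .
qed

text \<open>The error of mollifying in x inherits the rate r^s from \<open>xreg\<close>. In t only
  continuity of translations in L1 is at hand, which has no rate; hence the arbitrary \<kappa>, and
  a time scale \<open>e\<close> chosen after it.\<close>

lemma box_mollify_error:
  fixes g :: "real \<times> real \<Rightarrow> real"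
  assumes g[measurable]: "g \<in> borel_measurable borel" and G0: "\<And>z. \<bar>g z\<bar> \<le> G0" and reg: "xreg T s g" and s: "0 < s"
    and t: "0 < t0" "t0 \<le> t1" "t1 < T" "0 \<le> X"
  shows "\<exists>C\<ge>0. \<forall>\<kappa> r. 0 < \<kappa> \<and> 0 < r \<and> r \<le> 1 \<longrightarrow> (\<exists>e0>0. \<forall>e. 0 < e \<and> e < e0 \<longrightarrow>
    (\<integral>\<^sup>+t. \<integral>\<^sup>+x. indicator {t0..t1} t * indicator {-X..X} x * ennreal \<bar>mollify e r g (t, x) - g (t, x)\<bar> \<partial>lborel \<partial>lborel)
      \<le> ennreal (C * r powr s + \<kappa>))"
proof -
  define I :: "real \<Rightarrow> real \<Rightarrow> ennreal" where "I t x = indicator {t0..t1} t * indicator {-X..X} x" for t x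
  have I[measurable]: "(\<lambda>p. I (a p) (b p)) \<in> borel_measurable M" if [measurable]: "a \<in> borel_measurable M" "b \<in> borel_measurable M" for a b and M :: "'z measure"
    unfolding I_def by measurable
  define c where "c = min t0 (T - t1) / 2"
  have c: "0 < c" "0 < t0 - c" "t1 + c < T" using t by (auto simp: c_def min_def field_simps)
  have tc: "t0 - c \<le> t1 + c" using t c by simp
  obtain C where C: "0 \<le> C" "\<And>h. \<bar>h\<bar> \<le> 1 \<Longrightarrow>
    (\<integral>\<^sup>+t. \<integral>\<^sup>+x. indicator {t0 - c..t1 + c} t * indicator {-X..X} x * ennreal \<bar>g (t, x + h) - g (t, x)\<bar> \<partial>lborel \<partial>lborel)
      \<le> ennreal (C * \<bar>h\<bar> powr s)"
    using reg c(2) tc c(3) t(4) unfolding xreg_def by blast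
  \<comment> \<open>Cutting off to a box makes \<open>g\<close> integrable, as
    \<open>L1_translation\<close> requires; the box is longer by \<open>c\<close> in time so that
    the cut is not felt at t + \<theta>.\<close>
  define gb where "gb = (\<lambda>(t, x). indicator {t0 - c..t1 + c} t * indicator {-X..X} x * g (t, x))"
  have gb: "integrable lborel gb"
  proof (rule integrableI_bounded_set[where A = "{t0 - c..t1 + c} \<times> {-X..X}" and B = G0])
    show "gb \<in> borel_measurable lborel" unfolding gb_def by measurable
    have "closed ({t0 - c..t1 + c} \<times> {-X..X})" by (intro closed_Times) auto
    then show "{t0 - c..t1 + c} \<times> {-X..X} \<in> sets lborel" by (simp add: borel_closed)
    show "emeasure lborel ({t0 - c..t1 + c} \<times> {-X..X}) < \<infinity>" by (intro emeasure_bounded_finite bounded_Times) auto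
    show "AE x in lborel. x \<in> {t0 - c..t1 + c} \<times> {- X..X} \<longrightarrow> norm (gb x) \<le> G0" using G0 by (auto simp: gb_def)
  qed (auto simp: gb_def indicator_def intro!: AE_I2)
  show ?thesis
    unfolding I_def[symmetric]
  proof (rule exI[of _ C], intro conjI allI impI C(1); (elim conjE)?)
    fix \<kappa> r :: real assume \<kappa>: "0 < \<kappa>" and r: "0 < r" "r \<le> 1"
    obtain d where d: "0 < d" "\<And>z. norm z < d \<Longrightarrow> (\<integral>\<^sup>+p. ennreal \<bar>gb (p + z) - gb p\<bar> \<partial>lborel) \<le> ennreal \<kappa>"
      using L1_translation[OF gb, rule_format, OF \<kappa>] by blast
    show "\<exists>e0>0. \<forall>e. 0 < e \<and> e < e0 \<longrightarrow> (\<integral>\<^sup>+t. \<integral>\<^sup>+x. I t x * ennreal \<bar>mollify e r g (t, x) - g (t, x)\<bar> \<partial>lborel \<partial>lborel)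
      \<le> ennreal (C * r powr s + \<kappa>)"
    proof (rule exI[of _ "min d c"], intro conjI allI impI; (elim conjE)?)
      show "0 < min d c" using d c by simp
      fix e assume e: "0 < e" "e < min d c"
      have bnd: "(\<integral>\<^sup>+t. \<integral>\<^sup>+x. I t x * ennreal \<bar>g (t + \<theta>, x + \<xi>) - g (t, x)\<bar> \<partial>lborel \<partial>lborel) \<le> ennreal (C * r powr s + \<kappa>)" if th: "\<bar>\<theta>\<bar> \<le> e" "\<bar>\<xi>\<bar> \<le> r" for \<theta> \<xi>
      proof -
        define I' :: "real \<Rightarrow> real \<Rightarrow> ennreal" where "I' t x = indicator {t0 - c..t1 + c} t * indicator {-X..X} x" for t x
        have I'[measurable]: "(\<lambda>p. I' (a p) (b p)) \<in> borel_measurable M" if [measurable]: "a \<in> borel_measurable M" "b \<in> borel_measurable M" for a b and M :: "'z measure"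
          unfolding I'_def by measurable
        \<comment> \<open>The increment is split at (t + \<theta>, x): after a translation in time
          the spatial part is the one bounded by \<open>xreg\<close>, and the temporal part is a
          shift of \<open>gb\<close>.\<close>
        have "(\<integral>\<^sup>+t. \<integral>\<^sup>+x. I t x * ennreal \<bar>g (t + \<theta>, x + \<xi>) - g (t, x)\<bar> \<partial>lborel \<partial>lborel)
          \<le> (\<integral>\<^sup>+t. \<integral>\<^sup>+x. I' (t + \<theta>) x * ennreal \<bar>g (t + \<theta>, x + \<xi>) - g (t + \<theta>, x)\<bar> + ennreal \<bar>gb ((t, x) + (\<theta>, 0)) - gb (t, x)\<bar> \<partial>lborel \<partial>lborel)"
        proof (intro nn_integral_mono)
          fix t x
          show "I t x * ennreal \<bar>g (t + \<theta>, x + \<xi>) - g (t, x)\<bar> \<le> I' (t + \<theta>) x * ennreal \<bar>g (t + \<theta>, x + \<xi>) - g (t + \<theta>, x)\<bar> + ennreal \<bar>gb ((t, x) + (\<theta>, 0)) - gb (t, x)\<bar>"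
          proof (cases "t \<in> {t0..t1} \<and> x \<in> {-X..X}")
            case True
            have i: "t \<in> {t0 - c..t1 + c}" "t + \<theta> \<in> {t0 - c..t1 + c}" using True th e by auto
            have "\<bar>g (t + \<theta>, x + \<xi>) - g (t, x)\<bar> \<le> \<bar>g (t + \<theta>, x + \<xi>) - g (t + \<theta>, x)\<bar> + \<bar>g (t + \<theta>, x) - g (t, x)\<bar>" by simp
            then show ?thesis using True i by (simp add: I_def I'_def gb_def flip: ennreal_plus add: ennreal_leI)
          next
            case False
            then have z: "I t x = 0" by (auto simp: I_def)
            show ?thesis by (simp only: z mult_zero_left zero_le)
          qed
        qed
        also have "\<dots> = (\<integral>\<^sup>+t. \<integral>\<^sup>+x. I' (t + \<theta>) x * ennreal \<bar>g (t + \<theta>, x + \<xi>) - g (t + \<theta>, x)\<bar> \<partial>lborel \<partial>lborel) + (\<integral>\<^sup>+t. \<integral>\<^sup>+x. ennreal \<bar>gb ((t, x) + (\<theta>, 0)) - gb (t, x)\<bar> \<partial>lborel \<partial>lborel)"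
        proof -
          have [measurable]: "gb \<in> borel_measurable borel" using gb by auto
          show ?thesis by (simp add: nn_integral_add)
        qed
        also have "\<dots> \<le> ennreal (C * r powr s) + ennreal \<kappa>"
        proof (intro add_mono)
          have [measurable]: "gb \<in> borel_measurable borel" using gb by auto
          have "(\<integral>\<^sup>+t. \<integral>\<^sup>+x. I' (t + \<theta>) x * ennreal \<bar>g (t + \<theta>, x + \<xi>) - g (t + \<theta>, x)\<bar> \<partial>lborel \<partial>lborel) = (\<integral>\<^sup>+t. \<integral>\<^sup>+x. I' t x * ennreal \<bar>g (t, x + \<xi>) - g (t, x)\<bar> \<partial>lborel \<partial>lborel)"
            by (rule nn_integral_translate[of "\<lambda>t. \<integral>\<^sup>+x. I' t x * ennreal \<bar>g (t, x + \<xi>) - g (t, x)\<bar> \<partial>lborel"]) measurable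
          also have "\<dots> \<le> ennreal (C * \<bar>\<xi>\<bar> powr s)" unfolding I'_def using C(2)[of \<xi>] th r by simp
          also have "\<dots> \<le> ennreal (C * r powr s)"
            using th C(1) s by (intro ennreal_leI mult_left_mono powr_mono2) auto
          finally show "(\<integral>\<^sup>+t. \<integral>\<^sup>+x. I' (t + \<theta>) x * ennreal \<bar>g (t + \<theta>, x + \<xi>) - g (t + \<theta>, x)\<bar> \<partial>lborel \<partial>lborel) \<le> ennreal (C * r powr s)" .
          have m: "(\<lambda>p. ennreal \<bar>gb (p + (\<theta>, 0)) - gb p\<bar>) \<in> borel_measurable borel" by measurable
          have "norm (\<theta>, 0::real) < d" using th e by (simp add: norm_Pair)
          from d(2)[OF this] show "(\<integral>\<^sup>+t. \<integral>\<^sup>+x. ennreal \<bar>gb ((t, x) + (\<theta>, 0)) - gb (t, x)\<bar> \<partial>lborel \<partial>lborel) \<le> ennreal \<kappa>"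
            unfolding nn_integral_lborel_prod[OF m] .
        qed
        also have "\<dots> = ennreal (C * r powr s + \<kappa>)" using C(1) \<kappa> by (simp flip: ennreal_plus)
        finally show ?thesis .
      qed
      have "(\<integral>\<^sup>+t. \<integral>\<^sup>+x. I t x * ennreal \<bar>mollify e r g (t, x) - g (t, x)\<bar> \<partial>lborel \<partial>lborel)
        \<le> (\<integral>\<^sup>+t. \<integral>\<^sup>+x. I t x * (\<integral>\<^sup>+\<theta>. \<integral>\<^sup>+\<xi>. ennreal (moll e \<theta>) * ennreal (moll r \<xi>) * ennreal \<bar>g (t + \<theta>, x + \<xi>) - g (t, x)\<bar> \<partial>lborel \<partial>lborel) \<partial>lborel \<partial>lborel)"
        by (intro nn_integral_mono mult_left_mono mollify_diff_le[OF g G0 e(1) r(1)]) auto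
      also have "\<dots> = (\<integral>\<^sup>+t. \<integral>\<^sup>+x. \<integral>\<^sup>+\<theta>. \<integral>\<^sup>+\<xi>. ennreal (moll e \<theta>) * ennreal (moll r \<xi>) * (I t x * ennreal \<bar>g (t + \<theta>, x + \<xi>) - g (t, x)\<bar>) \<partial>lborel \<partial>lborel \<partial>lborel \<partial>lborel)"
        by (simp add: nn_integral_cmult[symmetric] ac_simps)
      also have "\<dots> \<le> ennreal (C * r powr s + \<kappa>)"
        by (rule moll_avg_bound[OF _ e(1) r(1) bnd]) measurable
      finally show "(\<integral>\<^sup>+t. \<integral>\<^sup>+x. I t x * ennreal \<bar>mollify e r g (t, x) - g (t, x)\<bar> \<partial>lborel \<partial>lborel) \<le> ennreal (C * r powr s + \<kappa>)" .
    qed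
  qed
qed

section \<open>Time strips, and time regularity from the averaged equation\<close>

lemma moll'_scaled_bound:
  obtains K where "0 \<le> K" "\<And>r x. 0 < r \<Longrightarrow> \<bar>moll' r x\<bar> \<le> K / r\<^sup>2"
proof -
  obtain K where K: "0 \<le> K" "\<And>x. \<bar>moll' 1 x\<bar> \<le> K" using moll'_bound[of 1] by auto
  have "\<bar>moll' r x\<bar> \<le> K / r\<^sup>2" if "0 < r" for r x
  proof -
    have "moll' r x = moll' 1 (x / r) / r\<^sup>2" by (simp add: moll'_def power2_eq_square)
    then show ?thesis using K(2)[of "x / r"] that by (simp add: divide_right_mono)
  qed
  with K(1) that show ?thesis by blast
qed

text \<open>The kernel is odd. Its vanishing mean allows subtracting the value of the flux at the
  centre, so that only increments of the flux remain.\<close>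

lemma integral_moll': assumes "0 < r" shows "(\<integral>x. moll' r x \<partial>lborel) = 0"
proof -
  have "(\<integral>x. moll' r x \<partial>lborel) = (\<integral>x. moll' r (0 + (-1) * x) \<partial>lborel)"
    using lborel_integral_real_affine[of "-1" "moll' r" 0] by simp
  also have "\<dots> = - (\<integral>x. moll' r x \<partial>lborel)" using moll'_odd[of r] assms by simp
  finally show ?thesis by simp
qed

text \<open>A smoothed indicator of [t, t + \<tau>] as a function of \<sigma>. Its derivative is a
  difference of two mollifiers, so testing with it produces the increment over \<tau> of the
  mollified function.\<close>

definition strip :: "real \<Rightarrow> real \<Rightarrow> real \<Rightarrow> real \<Rightarrow> real" where
  "strip e t \<tau> \<sigma> = step_at e (\<sigma> - t) - step_at e (\<sigma> - t - \<tau>)"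

lemma strip_measurable [measurable]: "(\<lambda>p. strip e (a p) \<tau> (b p)) \<in> borel_measurable M"
  if [measurable]: "a \<in> borel_measurable M" "b \<in> borel_measurable M"
  unfolding strip_def by measurable

lemma strip_bump: assumes "0 < e" "0 \<le> \<tau>" shows "bump_on (t - e) (t + \<tau> + e) (strip e t \<tau>)"
proof -
  have "smooth (strip e t \<tau>)" unfolding strip_def[abs_def]
    by (intro smooth_diff)
      (use smooth_affine_real[OF smooth_step_at, of e 1 "- t"] smooth_affine_real[OF smooth_step_at, of e 1 "- t - \<tau>"] in \<open>auto simp: algebra_simps\<close>)
  moreover have "strip e t \<tau> x = 0" if "x \<notin> {t - e..t + \<tau> + e}" for x
  proof (cases "x < t - e")
    case True
    then show ?thesis
      using assms step_at_left[of e "x - t"] step_at_left[of e "x - t - \<tau>"] by (auto simp: strip_def)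
  next
    case False
    then have "x > t + \<tau> + e" using that by auto
    then show ?thesis
      using assms step_at_right[of e "x - t"] step_at_right[of e "x - t - \<tau>"] by (auto simp: strip_def)
  qed
  ultimately show ?thesis by (auto simp: bump_on_def)
qed

lemma strip_nonneg: "0 < e \<Longrightarrow> 0 \<le> \<tau> \<Longrightarrow> 0 \<le> strip e t \<tau> \<sigma>"
  using step_at_mono[of e "\<sigma> - t - \<tau>" "\<sigma> - t"] by (simp add: strip_def)

lemma strip_deriv: "0 < e \<Longrightarrow> deriv (strip e t \<tau>) \<sigma> = moll e (\<sigma> - t) - moll e (\<sigma> - (t + \<tau>))"
  unfolding strip_def[abs_def]
  by (rule DERIV_imp_deriv, rule DERIV_cong[OF DERIV_diff[OF DERIV_chain2[OF step_at_deriv] DERIV_chain2[OF step_at_deriv]]])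
     (auto intro!: derivative_eq_intros simp: algebra_simps)

lemma strip_nn: assumes e: "0 < e" "0 \<le> \<tau>" shows "(\<integral>\<^sup>+t. ennreal (strip e t \<tau> \<sigma>) \<partial>lborel) \<le> ennreal \<tau>"
proof -
  have "(\<integral>\<^sup>+t. ennreal (strip e t \<tau> \<sigma>) \<partial>lborel) = (\<integral>\<^sup>+t. ennreal (strip e (\<sigma> - t) \<tau> \<sigma>) \<partial>lborel)"
    by (rule nn_integral_reflect[symmetric]) measurable
  also have "\<dots> = (\<integral>\<^sup>+t. ennreal \<bar>step_at e t - step_at e (t - \<tau>)\<bar> \<partial>lborel)"
    using step_at_mono[OF e(1)] e(2) by (intro nn_integral_cong) (auto simp: strip_def)
  also have "\<dots> \<le> ennreal \<tau> * (\<integral>\<^sup>+t. ennreal \<bar>moll e t\<bar> \<partial>lborel)"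
    by (rule total_variation_shift[OF step_at_deriv]) (use e in auto)
  also have "\<dots> = ennreal \<tau>" using moll_nonneg[OF e(1)] nn_integral_moll[OF e(1)] by simp
  finally show ?thesis .
qed

text \<open>By Tonelli, each point (\<sigma>, y) contributes the t-integral of the strip, at most
  \<tau>, times the unit mass of the mollifier in x. The measure may therefore be singular.\<close>

lemma strip_measure_bound:
  fixes \<nu> :: "(real \<times> real) measure"
  assumes \<nu>: "finite_measure \<nu>" and sets_\<nu>[measurable_cong]: "sets \<nu> = sets borel" and e: "0 < e" and tau: "0 < \<tau>"
  shows "(\<integral>\<^sup>+t. \<integral>\<^sup>+x. (\<integral>\<^sup>+(\<sigma>, y). ennreal (strip e t \<tau> \<sigma> * moll \<tau> (y - x)) \<partial>\<nu>) \<partial>lborel \<partial>lborel) \<le> ennreal (measure \<nu> UNIV * \<tau>)"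
proof -
  interpret \<nu>: finite_measure \<nu> by fact
  interpret P: pair_sigma_finite \<nu> "lborel :: (real \<times> real) measure" ..
  have tau': "0 \<le> \<tau>" using tau by simp
  define T2 where "T2 t x = (\<integral>\<^sup>+(\<sigma>, y). ennreal (strip e t \<tau> \<sigma> * moll \<tau> (y - x)) \<partial>\<nu>)" for t x
  have T2m[measurable]: "(\<lambda>p. T2 (a p) (b p)) \<in> borel_measurable M'" if [measurable]: "a \<in> borel_measurable M'" "b \<in> borel_measurable M'" for a b and M' :: "'z measure"
    unfolding T2_def by measurable
  have "(\<integral>\<^sup>+t. \<integral>\<^sup>+x. T2 t x \<partial>lborel \<partial>lborel) = (\<integral>\<^sup>+z. T2 (fst z) (snd z) \<partial>lborel)"
    using nn_integral_lborel_prod[of "\<lambda>z. T2 (fst z) (snd z)"] by simp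
  also have "\<dots> = (\<integral>\<^sup>+p. \<integral>\<^sup>+z. ennreal (strip e (fst z) \<tau> (fst p) * moll \<tau> (snd p - snd z)) \<partial>lborel \<partial>\<nu>)"
    unfolding T2_def split_beta' by (rule P.Fubini') measurable
  also have "\<dots> \<le> (\<integral>\<^sup>+p. ennreal \<tau> \<partial>\<nu>)"
  proof (intro nn_integral_mono)
    fix p :: "real \<times> real"
    have "(\<integral>\<^sup>+z. ennreal (strip e (fst z) \<tau> (fst p) * moll \<tau> (snd p - snd z)) \<partial>lborel) = (\<integral>\<^sup>+(t, x). ennreal (strip e t \<tau> (fst p)) * ennreal (moll \<tau> (snd p - x)) \<partial>lborel)"
      using strip_nonneg[OF e tau'] moll_nonneg[OF tau] by (intro nn_integral_cong) (auto simp: ennreal_mult)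
    also have "\<dots> = (\<integral>\<^sup>+t. ennreal (strip e t \<tau> (fst p)) \<partial>lborel) * (\<integral>\<^sup>+x. ennreal (moll \<tau> (snd p - x)) \<partial>lborel)"
      by (rule nn_integral_tensor2) measurable
    also have "\<dots> \<le> ennreal \<tau>" using strip_nn[OF e tau'] nn_integral_moll_diff[OF tau] by simp
    finally show "(\<integral>\<^sup>+z. ennreal (strip e (fst z) \<tau> (fst p) * moll \<tau> (snd p - snd z)) \<partial>lborel) \<le> ennreal \<tau>" .
  qed
  also have "\<dots> = ennreal (measure \<nu> UNIV * \<tau>)"
    using tau by (simp add: sets_eq_imp_space_eq[OF sets_\<nu>] \<nu>.emeasure_eq_measure mult.commute flip: ennreal_mult)
  finally show ?thesis unfolding T2_def .
qed

text \<open>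
  Time regularity from space regularity of \<open>g\<close> and of its flux \<open>Q\<close>: mollify in \<open>x\<close> at the scale
  \<open>r = \<tau>\<close> of the time shift, and in \<open>t\<close> at a negligible scale.
\<close>

lemma treg_from_equation:
  fixes g Q :: "real \<times> real \<Rightarrow> real" and \<nu>1 \<nu>2 :: "(real \<times> real) measure"
  assumes g[measurable]: "g \<in> borel_measurable borel" and Q[measurable]: "Q \<in> borel_measurable borel"
    and G0: "\<And>z. \<bar>g z\<bar> \<le> G0" and Q0: "\<And>z. \<bar>Q z\<bar> \<le> G0"
    and xg: "xreg T s g" and xQ: "xreg T s Q" and s: "0 < s" "s \<le> 1"
    and \<nu>: "finite_measure \<nu>1" "finite_measure \<nu>2"
    and sets_\<nu>[measurable_cong]: "sets \<nu>1 = sets borel" "sets \<nu>2 = sets borel"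
    and eq: "\<And>a b c d A B. bump_on a b A \<Longrightarrow> 0 < a \<Longrightarrow> b < T \<Longrightarrow> bump_on c d B \<Longrightarrow>
      ennreal \<bar>\<integral>(t, x). g (t, x) * (deriv A t * B x) + Q (t, x) * (A t * deriv B x) \<partial>lborel\<bar> \<le> (\<integral>\<^sup>+(t, x). ennreal (\<bar>A t\<bar> * \<bar>B x\<bar>) \<partial>\<nu>1) + (\<integral>\<^sup>+(t, x). ennreal (\<bar>A t\<bar> * \<bar>B x\<bar>) \<partial>\<nu>2)"
  shows "treg T s g"
  unfolding treg_def
proof (intro allI impI; elim conjE)
  fix t0 t1 X :: real assume t: "0 < t0" "t0 \<le> t1" "t1 < T" "0 \<le> X"
  interpret n1: finite_measure \<nu>1 by fact
  interpret n2: finite_measure \<nu>2 by fact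
  \<comment> \<open>Room for the strip, the time mollification and the shift at both ends of
    [t0, t1]; the bound by 1 ensures that \<tau> is at most \<open>\<tau> powr s\<close>.\<close>
  define c where "c = min (min t0 (T - t1)) 1 / 4"
  have c: "0 < c" "c < 1" "0 < t0 - 3 * c" "t1 + 3 * c < T" using t by (auto simp: c_def min_def field_simps)
  have tc: "t0 - 2 * c \<le> t1 + 2 * c" "0 < t0 - 2 * c" "t1 + 2 * c < T" using t c by auto
  define I :: "real \<Rightarrow> real \<Rightarrow> ennreal" where "I t x = indicator {t0..t1} t * indicator {-X..X} x" for t x
  have I[measurable]: "(\<lambda>p. I (a p) (b p)) \<in> borel_measurable M" if [measurable]: "a \<in> borel_measurable M" "b \<in> borel_measurable M" for a b and M :: "'z measure"
    unfolding I_def by measurable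
  define I2 :: "real \<Rightarrow> real \<Rightarrow> ennreal" where "I2 t x = indicator {t0 - 2 * c..t1 + 2 * c} t * indicator {-X..X} x" for t x
  have I2[measurable]: "(\<lambda>p. I2 (a p) (b p)) \<in> borel_measurable M" if [measurable]: "a \<in> borel_measurable M" "b \<in> borel_measurable M" for a b and M :: "'z measure"
    unfolding I2_def by measurable
  obtain C1 where C1: "0 \<le> C1" "\<And>\<kappa> r. 0 < \<kappa> \<Longrightarrow> 0 < r \<Longrightarrow> r \<le> 1 \<Longrightarrow> \<exists>e0>0. \<forall>e. 0 < e \<and> e < e0 \<longrightarrow>
    (\<integral>\<^sup>+t. \<integral>\<^sup>+x. I2 t x * ennreal \<bar>mollify e r g (t, x) - g (t, x)\<bar> \<partial>lborel \<partial>lborel) \<le> ennreal (C1 * r powr s + \<kappa>)"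
    using box_mollify_error[OF g G0 xg s(1) tc(2,1,3) t(4)] unfolding I2_def by blast
  obtain C2 where C2: "0 \<le> C2" "\<And>h. \<bar>h\<bar> \<le> 1 \<Longrightarrow>
    (\<integral>\<^sup>+t. \<integral>\<^sup>+x. I2 t x * ennreal \<bar>Q (t, x + h) - Q (t, x)\<bar> \<partial>lborel \<partial>lborel) \<le> ennreal (C2 * \<bar>h\<bar> powr s)"
    using xQ tc t(4) unfolding xreg_def I2_def by blast
  obtain K where K: "0 \<le> K" "\<And>r x. 0 < r \<Longrightarrow> \<bar>moll' r x\<bar> \<le> K / r\<^sup>2" using moll'_scaled_bound by blast
  define N where "N = measure \<nu>1 UNIV + measure \<nu>2 UNIV"
  have N: "0 \<le> N" by (simp add: N_def)
  \<comment> \<open>Two mollification errors, at t and at t + \<tau>, each with an extra 1 for the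
    mollification in time; the flux term, where the bound \<open>K / \<tau>\<^sup>2\<close> on the
    kernel, its support of length 2\<tau> and the strip of length \<tau> cancel; and the masses of
    the two measures.\<close>
  define CC where "CC = 2 * (C1 + 1) + 2 * K * C2 + N"
  show "\<exists>C\<ge>0. \<exists>\<eta>>0. \<forall>\<tau>. 0 \<le> \<tau> \<and> \<tau> \<le> \<eta> \<longrightarrow>
       (\<integral>\<^sup>+t. \<integral>\<^sup>+x. indicator {t0..t1} t * indicator {-X..X} x * ennreal \<bar>g (t + \<tau>, x) - g (t, x)\<bar> \<partial>lborel \<partial>lborel)
         \<le> ennreal (C * \<tau> powr s)"
    unfolding I_def[symmetric]
  proof (rule exI[of _ CC], rule conjI, goal_cases)
    case 1
    show "0 \<le> CC" using C1 C2 K N by (simp add: CC_def)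
  next
    case 2
    show ?case
  proof (rule exI[of _ c], intro conjI allI impI; (elim conjE)?)
    show "0 < c" by (rule c)
    fix \<tau> :: real assume tau: "0 \<le> \<tau>" "\<tau> \<le> c"
    show "(\<integral>\<^sup>+t. \<integral>\<^sup>+x. I t x * ennreal \<bar>g (t + \<tau>, x) - g (t, x)\<bar> \<partial>lborel \<partial>lborel) \<le> ennreal (CC * \<tau> powr s)"
    proof (cases "\<tau> = 0")
      case True
      then show ?thesis by simp
    next
      case False
      with tau have tau0: "0 < \<tau>" "\<tau> \<le> 1" using c by auto
      have tps: "0 < \<tau> powr s" using tau0 by simp
      \<comment> \<open>The time scale comes last, so small that its error, which has no rate of its
        own, is at most \<open>\<tau> powr s\<close>.\<close>
      obtain e0 where e0: "0 < e0" "\<And>e. 0 < e \<Longrightarrow> e < e0 \<Longrightarrow>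
        (\<integral>\<^sup>+t. \<integral>\<^sup>+x. I2 t x * ennreal \<bar>mollify e \<tau> g (t, x) - g (t, x)\<bar> \<partial>lborel \<partial>lborel) \<le> ennreal (C1 * \<tau> powr s + \<tau> powr s)"
        using C1(2)[OF tps tau0] by blast
      define e where "e = min e0 c / 2"
      have e: "0 < e" "e < e0" "e < c" using e0(1) c by (auto simp: e_def)
      let ?T1 = "\<lambda>t x. (\<integral>\<^sup>+\<sigma>. ennreal (strip e t \<tau> \<sigma>) * (\<integral>\<^sup>+\<xi>. ennreal \<bar>moll' \<tau> \<xi>\<bar> * ennreal \<bar>Q (\<sigma>, x + \<xi>) - Q (\<sigma>, x)\<bar> \<partial>lborel) \<partial>lborel)"
      let ?n = "\<lambda>\<nu> t x. (\<integral>\<^sup>+(\<sigma>, y). ennreal (strip e t \<tau> \<sigma> * moll \<tau> (y - x)) \<partial>\<nu>)"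
      let ?k = "\<lambda>\<xi>. ennreal (K / \<tau>\<^sup>2) * indicator {-\<tau>..\<tau>} \<xi>"
      let ?q = "\<lambda>\<sigma> x \<xi>. ennreal \<bar>Q (\<sigma>, x + \<xi>) - Q (\<sigma>, x)\<bar>"
      define M where "M = mollify e \<tau> g"
      have [measurable]: "M \<in> borel_measurable borel" unfolding M_def mollify_def by measurable
      have err: "(\<integral>\<^sup>+t. \<integral>\<^sup>+x. I2 t x * ennreal \<bar>M (t, x) - g (t, x)\<bar> \<partial>lborel \<partial>lborel) \<le> ennreal ((C1 + 1) * \<tau> powr s)"
        using e0(2)[OF e(1,2)] by (simp add: M_def distrib_right)
      have Mpt: "ennreal \<bar>M (t + \<tau>, x) - M (t, x)\<bar> \<le>
         ?T1 t x
         + (?n \<nu>1 t x + ?n \<nu>2 t x)" if "t \<in> {t0..t1}" for t x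
      proof -
        define A where "A = strip e t \<tau>"
        define B where "B y = moll \<tau> (y - x)" for y
        have A: "bump_on (t - e) (t + \<tau> + e) A" unfolding A_def by (rule strip_bump) (use e tau in auto)
        have B: "bump_on (x - \<tau>) (x + \<tau>) B" unfolding B_def[abs_def] bump_on_def
          using smooth_affine_real[OF smooth_moll, of \<tau> 1 "-x"] moll_outside[OF tau0(1)] by auto
        have dA: "deriv A \<sigma> = moll e (\<sigma> - t) - moll e (\<sigma> - (t + \<tau>))" for \<sigma> unfolding A_def by (rule strip_deriv[OF e(1)])
        have dB: "deriv B y = moll' \<tau> (y - x)" for y unfolding B_def[abs_def]
          by (rule DERIV_imp_deriv, rule DERIV_cong[OF DERIV_chain2[OF moll_deriv]]) (use tau0 in \<open>auto intro!: derivative_eq_intros\<close>)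
        have Am[measurable]: "A \<in> borel_measurable borel" unfolding A_def by measurable
        have dbint: "integrable lborel (\<lambda>y. moll' \<tau> (y - x))"
          using bump_on_integrable[OF bump_on_deriv[OF B]] by (simp add: dB[abs_def])
        have i1: "integrable lborel (\<lambda>(\<sigma>, y). g (\<sigma>, y) * (moll e (\<sigma> - t') * moll \<tau> (y - x)))" for t'
          by (rule integrable_abs_le[OF moll2_integrable[OF e(1) tau0(1), of t' x], of _ G0], measurable)
             (auto simp: abs_mult intro!: mult_right_mono G0)
        have i3: "integrable lborel (\<lambda>(\<sigma>, y). Q (\<sigma>, y) * (A \<sigma> * moll' \<tau> (y - x)))"
          by (rule integrable_abs_le[OF integrable_tensor2[OF bump_on_integrable[OF A] dbint], of _ G0], measurable)
             (auto simp: abs_mult intro!: mult_right_mono Q0)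
        have i4: "integrable lborel (\<lambda>(\<sigma>, y). Q (\<sigma>, x) * (A \<sigma> * moll' \<tau> (y - x)))"
          by (rule integrable_abs_le[OF integrable_tensor2[OF bump_on_integrable[OF A] dbint], of _ G0], measurable)
             (auto simp: abs_mult intro!: mult_right_mono Q0)
        have "(\<integral>(\<sigma>, y). g (\<sigma>, y) * (deriv A \<sigma> * B y) + Q (\<sigma>, y) * (A \<sigma> * deriv B y) \<partial>lborel)
          = (\<integral>p. ((case p of (\<sigma>, y) \<Rightarrow> g (\<sigma>, y) * (moll e (\<sigma> - t) * moll \<tau> (y - x))) - (case p of (\<sigma>, y) \<Rightarrow> g (\<sigma>, y) * (moll e (\<sigma> - (t + \<tau>)) * moll \<tau> (y - x))))
             + (case p of (\<sigma>, y) \<Rightarrow> Q (\<sigma>, y) * (A \<sigma> * moll' \<tau> (y - x))) \<partial>lborel)"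
          by (intro Bochner_Integration.integral_cong refl) (auto simp: dA dB B_def algebra_simps)
        also have "\<dots> = M (t, x) - M (t + \<tau>, x) + (\<integral>(\<sigma>, y). Q (\<sigma>, y) * (A \<sigma> * moll' \<tau> (y - x)) \<partial>lborel)"
          unfolding M_def mollify_def split_conv
          by (subst Bochner_Integration.integral_add, intro Bochner_Integration.integrable_diff i1, rule i3, subst Bochner_Integration.integral_diff, rule i1, rule i1) (rule refl)
        finally have E: "(\<integral>(\<sigma>, y). g (\<sigma>, y) * (deriv A \<sigma> * B y) + Q (\<sigma>, y) * (A \<sigma> * deriv B y) \<partial>lborel)
          = M (t, x) - M (t + \<tau>, x) + (\<integral>(\<sigma>, y). Q (\<sigma>, y) * (A \<sigma> * moll' \<tau> (y - x)) \<partial>lborel)" .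
        have zero: "(\<integral>(\<sigma>, y). Q (\<sigma>, x) * (A \<sigma> * moll' \<tau> (y - x)) \<partial>lborel) = 0"
        proof -
          have "(\<integral>(\<sigma>, y). Q (\<sigma>, x) * (A \<sigma> * moll' \<tau> (y - x)) \<partial>lborel) = (\<integral>\<sigma>. \<integral>y. Q (\<sigma>, x) * (A \<sigma> * moll' \<tau> (y - x)) \<partial>lborel \<partial>lborel)"
            using integral_lborel_prod[OF i4] by (simp only: split_conv)
          also have "\<dots> = (\<integral>\<sigma>. Q (\<sigma>, x) * (A \<sigma> * (\<integral>y. moll' \<tau> (y - x) \<partial>lborel)) \<partial>lborel)" by simp
          also have "(\<integral>y. moll' \<tau> (y - x) \<partial>lborel) = 0"
            using integral_translate[of "moll' \<tau>" "-x"] integral_moll'[OF tau0(1)] by simp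
          finally show ?thesis by simp
        qed
        have Qb: "ennreal \<bar>\<integral>(\<sigma>, y). Q (\<sigma>, y) * (A \<sigma> * moll' \<tau> (y - x)) \<partial>lborel\<bar>
          \<le> ?T1 t x"
        proof -
          have eqQ: "(\<integral>(\<sigma>, y). Q (\<sigma>, y) * (A \<sigma> * moll' \<tau> (y - x)) \<partial>lborel) = (\<integral>p. (case p of (\<sigma>, y) \<Rightarrow> Q (\<sigma>, y) * (A \<sigma> * moll' \<tau> (y - x))) - (case p of (\<sigma>, y) \<Rightarrow> Q (\<sigma>, x) * (A \<sigma> * moll' \<tau> (y - x))) \<partial>lborel)"
            unfolding Bochner_Integration.integral_diff[OF i3 i4] zero by simp
          have "ennreal \<bar>\<integral>(\<sigma>, y). Q (\<sigma>, y) * (A \<sigma> * moll' \<tau> (y - x)) \<partial>lborel\<bar> \<le> (\<integral>\<^sup>+p. ennreal (norm ((case p of (\<sigma>, y) \<Rightarrow> Q (\<sigma>, y) * (A \<sigma> * moll' \<tau> (y - x))) - (case p of (\<sigma>, y) \<Rightarrow> Q (\<sigma>, x) * (A \<sigma> * moll' \<tau> (y - x))))) \<partial>lborel)"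
            unfolding eqQ real_norm_def[symmetric] by (rule integral_norm_bound_ennreal[OF Bochner_Integration.integrable_diff[OF i3 i4]])
          also have "\<dots> = (\<integral>\<^sup>+(\<sigma>, y). ennreal (strip e t \<tau> \<sigma>) * (ennreal \<bar>moll' \<tau> (y - x)\<bar> * ennreal \<bar>Q (\<sigma>, y) - Q (\<sigma>, x)\<bar>) \<partial>lborel)"
          proof (intro nn_integral_cong, clarify)
            fix \<sigma> y
            have "Q (\<sigma>, y) * (A \<sigma> * moll' \<tau> (y - x)) - Q (\<sigma>, x) * (A \<sigma> * moll' \<tau> (y - x)) = A \<sigma> * (moll' \<tau> (y - x) * (Q (\<sigma>, y) - Q (\<sigma>, x)))"
              by (simp add: algebra_simps)
            then show "ennreal (norm (Q (\<sigma>, y) * (A \<sigma> * moll' \<tau> (y - x)) - Q (\<sigma>, x) * (A \<sigma> * moll' \<tau> (y - x)))) = ennreal (strip e t \<tau> \<sigma>) * (ennreal \<bar>moll' \<tau> (y - x)\<bar> * ennreal \<bar>Q (\<sigma>, y) - Q (\<sigma>, x)\<bar>)"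
              using strip_nonneg[OF e(1) tau(1), of t \<sigma>] by (simp add: abs_mult ennreal_mult A_def)
          qed
          also have "\<dots> = (\<integral>\<^sup>+\<sigma>. \<integral>\<^sup>+y. ennreal (strip e t \<tau> \<sigma>) * (ennreal \<bar>moll' \<tau> (y - x)\<bar> * ennreal \<bar>Q (\<sigma>, y) - Q (\<sigma>, x)\<bar>) \<partial>lborel \<partial>lborel)"
            by (rule nn_integral_lborel_split2) measurable
          also have "\<dots> = (\<integral>\<^sup>+\<sigma>. ennreal (strip e t \<tau> \<sigma>) * (\<integral>\<^sup>+y. ennreal \<bar>moll' \<tau> (y - x)\<bar> * ennreal \<bar>Q (\<sigma>, y) - Q (\<sigma>, x)\<bar> \<partial>lborel) \<partial>lborel)"
            by (simp add: nn_integral_cmult)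
          also have "\<dots> = ?T1 t x"
          proof -
            have "(\<integral>\<^sup>+y. ennreal \<bar>moll' \<tau> (y - x)\<bar> * ennreal \<bar>Q (\<sigma>, y) - Q (\<sigma>, x)\<bar> \<partial>lborel) = (\<integral>\<^sup>+\<xi>. ennreal \<bar>moll' \<tau> \<xi>\<bar> * ?q \<sigma> x \<xi> \<partial>lborel)" for \<sigma>
            proof -
            have "(\<integral>\<^sup>+y. ennreal \<bar>moll' \<tau> (y + x - x)\<bar> * ennreal \<bar>Q (\<sigma>, y + x) - Q (\<sigma>, x)\<bar> \<partial>lborel) = (\<integral>\<^sup>+y. ennreal \<bar>moll' \<tau> (y - x)\<bar> * ennreal \<bar>Q (\<sigma>, y) - Q (\<sigma>, x)\<bar> \<partial>lborel)"
              by (rule nn_integral_translate[of "\<lambda>y. ennreal \<bar>moll' \<tau> (y - x)\<bar> * ennreal \<bar>Q (\<sigma>, y) - Q (\<sigma>, x)\<bar>"]) measurable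
            then show ?thesis
              by (simp add: add.commute)
            qed
            then show ?thesis by (simp only:)
          qed
          finally show ?thesis .
        qed
        have "ennreal \<bar>\<integral>(\<sigma>, y). g (\<sigma>, y) * (deriv A \<sigma> * B y) + Q (\<sigma>, y) * (A \<sigma> * deriv B y) \<partial>lborel\<bar> \<le> (\<integral>\<^sup>+(\<sigma>, y). ennreal (\<bar>A \<sigma>\<bar> * \<bar>B y\<bar>) \<partial>\<nu>1) + (\<integral>\<^sup>+(\<sigma>, y). ennreal (\<bar>A \<sigma>\<bar> * \<bar>B y\<bar>) \<partial>\<nu>2)"
          by (rule eq[OF A _ _ B]) (use that e c tau in auto)
        also have "\<dots> = (?n \<nu>1 t x + ?n \<nu>2 t x)"
          using strip_nonneg[OF e(1) tau(1), of t] moll_nonneg[OF tau0(1)] by (intro arg_cong2[of _ _ _ _ "(+)"] nn_integral_cong) (auto simp: A_def B_def)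
        finally have N1: "ennreal \<bar>M (t, x) - M (t + \<tau>, x) + (\<integral>(\<sigma>, y). Q (\<sigma>, y) * (A \<sigma> * moll' \<tau> (y - x)) \<partial>lborel)\<bar> \<le> (?n \<nu>1 t x + ?n \<nu>2 t x)"
          unfolding E .
        have "ennreal \<bar>M (t + \<tau>, x) - M (t, x)\<bar> \<le> ennreal \<bar>\<integral>(\<sigma>, y). Q (\<sigma>, y) * (A \<sigma> * moll' \<tau> (y - x)) \<partial>lborel\<bar> + ennreal \<bar>M (t, x) - M (t + \<tau>, x) + (\<integral>(\<sigma>, y). Q (\<sigma>, y) * (A \<sigma> * moll' \<tau> (y - x)) \<partial>lborel)\<bar>"
          by (simp flip: ennreal_plus add: ennreal_leI)
        also have "\<dots> \<le> ?T1 t x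
           + (?n \<nu>1 t x + ?n \<nu>2 t x)"
          by (rule add_mono[OF Qb N1])
        finally show ?thesis .
      qed
      define T1 where "T1 t x = ?T1 t x" for t x
      define T2 where "T2 t x = (?n \<nu>1 t x + ?n \<nu>2 t x)" for t x
      have T1m[measurable]: "(\<lambda>p. T1 (a p) (b p)) \<in> borel_measurable M'" if [measurable]: "a \<in> borel_measurable M'" "b \<in> borel_measurable M'" for a b and M' :: "'z measure"
        unfolding T1_def by measurable
      have T2m[measurable]: "(\<lambda>p. T2 (a p) (b p)) \<in> borel_measurable M'" if [measurable]: "a \<in> borel_measurable M'" "b \<in> borel_measurable M'" for a b and M' :: "'z measure"
        unfolding T2_def by measurable
      have B1: "(\<integral>\<^sup>+t. \<integral>\<^sup>+x. I t x * T1 t x \<partial>lborel \<partial>lborel) \<le> ennreal (2 * K * C2 * \<tau> powr s)"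
      proof -
        have "(\<integral>\<^sup>+t. \<integral>\<^sup>+x. I t x * T1 t x \<partial>lborel \<partial>lborel)
          \<le> (\<integral>\<^sup>+t. \<integral>\<^sup>+x. \<integral>\<^sup>+\<sigma>. \<integral>\<^sup>+\<xi>. ?k \<xi> * (ennreal (strip e t \<tau> \<sigma>) * (I2 \<sigma> x * ?q \<sigma> x \<xi>)) \<partial>lborel \<partial>lborel \<partial>lborel \<partial>lborel)"
        proof (intro nn_integral_mono)
          fix t x
          have "I t x * T1 t x = (\<integral>\<^sup>+\<sigma>. \<integral>\<^sup>+\<xi>. I t x * (ennreal (strip e t \<tau> \<sigma>) * (ennreal \<bar>moll' \<tau> \<xi>\<bar> * ?q \<sigma> x \<xi>)) \<partial>lborel \<partial>lborel)"
            unfolding T1_def by (simp add: nn_integral_cmult)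
          also have "\<dots> \<le> (\<integral>\<^sup>+\<sigma>. \<integral>\<^sup>+\<xi>. ?k \<xi> * (ennreal (strip e t \<tau> \<sigma>) * (I2 \<sigma> x * ?q \<sigma> x \<xi>)) \<partial>lborel \<partial>lborel)"
          proof (intro nn_integral_mono)
            fix \<sigma> \<xi>
            have k: "ennreal \<bar>moll' \<tau> \<xi>\<bar> \<le> ?k \<xi>"
            proof (cases "\<bar>\<xi>\<bar> \<le> \<tau>")
              case True
              then have "\<xi> \<in> {-\<tau>..\<tau>}" by auto
              then show ?thesis using K(2)[OF tau0(1), of \<xi>] by (simp add: ennreal_leI)
            next
              case False
              then show ?thesis using moll'_outside[OF tau0(1), of \<xi>] by simp
            qed
            \<comment> \<open>Points \<sigma> of the strip are within e + \<tau> \<le> 2c of t or of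
              [t0, t1], so the regularity of \<open>Q\<close> is needed on the longer box
              only.\<close>
            have i: "I t x * ennreal (strip e t \<tau> \<sigma>) \<le> ennreal (strip e t \<tau> \<sigma>) * I2 \<sigma> x"
            proof (cases "t \<in> {t0..t1} \<and> \<sigma> \<in> {t - e..t + \<tau> + e}")
              case True
              then have "\<sigma> \<in> {t0 - 2 * c..t1 + 2 * c}" using e tau by auto
              then show ?thesis using True by (auto simp: I_def I2_def indicator_def)
            next
              case False
              then have "I t x = 0 \<or> strip e t \<tau> \<sigma> = 0" using bump_onD(2)[OF strip_bump[OF e(1) tau(1)], of \<sigma> t] by (auto simp: I_def)
              then show ?thesis by auto
            qed
            have "I t x * (ennreal (strip e t \<tau> \<sigma>) * (ennreal \<bar>moll' \<tau> \<xi>\<bar> * ?q \<sigma> x \<xi>))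
              = ennreal \<bar>moll' \<tau> \<xi>\<bar> * (I t x * ennreal (strip e t \<tau> \<sigma>)) * ?q \<sigma> x \<xi>" by (simp add: ac_simps)
            also have "\<dots> \<le> (?k \<xi>) * (ennreal (strip e t \<tau> \<sigma>) * I2 \<sigma> x) * ?q \<sigma> x \<xi>"
              by (intro mult_mono k i) auto
            finally show "I t x * (ennreal (strip e t \<tau> \<sigma>) * (ennreal \<bar>moll' \<tau> \<xi>\<bar> * ?q \<sigma> x \<xi>))
              \<le> ?k \<xi> * (ennreal (strip e t \<tau> \<sigma>) * (I2 \<sigma> x * ?q \<sigma> x \<xi>))"
              by (simp add: ac_simps)
          qed
          finally show "I t x * T1 t x \<le> (\<integral>\<^sup>+\<sigma>. \<integral>\<^sup>+\<xi>. ?k \<xi> * (ennreal (strip e t \<tau> \<sigma>) * (I2 \<sigma> x * ?q \<sigma> x \<xi>)) \<partial>lborel \<partial>lborel)" .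
        qed
        also have "\<dots> = (\<integral>\<^sup>+\<sigma>. \<integral>\<^sup>+\<xi>. \<integral>\<^sup>+t. \<integral>\<^sup>+x. ?k \<xi> * (ennreal (strip e t \<tau> \<sigma>) * (I2 \<sigma> x * ?q \<sigma> x \<xi>)) \<partial>lborel \<partial>lborel \<partial>lborel \<partial>lborel)"
          by (rule nn_integral_swap4) measurable
        also have "\<dots> = (\<integral>\<^sup>+\<sigma>. \<integral>\<^sup>+\<xi>. ?k \<xi> * ((\<integral>\<^sup>+t. ennreal (strip e t \<tau> \<sigma>) \<partial>lborel) * (\<integral>\<^sup>+x. I2 \<sigma> x * ?q \<sigma> x \<xi> \<partial>lborel)) \<partial>lborel \<partial>lborel)"
          by (simp add: nn_integral_cmult nn_integral_multc)
        also have "\<dots> \<le> (\<integral>\<^sup>+\<sigma>. \<integral>\<^sup>+\<xi>. ?k \<xi> * (ennreal \<tau> * (\<integral>\<^sup>+x. I2 \<sigma> x * ?q \<sigma> x \<xi> \<partial>lborel)) \<partial>lborel \<partial>lborel)"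
          by (intro nn_integral_mono mult_left_mono mult_right_mono strip_nn e tau) auto
        also have "\<dots> = (\<integral>\<^sup>+\<xi>. \<integral>\<^sup>+\<sigma>. ?k \<xi> * (ennreal \<tau> * (\<integral>\<^sup>+x. I2 \<sigma> x * ?q \<sigma> x \<xi> \<partial>lborel)) \<partial>lborel \<partial>lborel)"
          by (rule nn_integral_lborel_swap) measurable
        also have "\<dots> = (\<integral>\<^sup>+\<xi>. ?k \<xi> * (ennreal \<tau> * (\<integral>\<^sup>+\<sigma>. \<integral>\<^sup>+x. I2 \<sigma> x * ?q \<sigma> x \<xi> \<partial>lborel \<partial>lborel)) \<partial>lborel)"
          by (simp add: nn_integral_cmult)
        also have "\<dots> \<le> (\<integral>\<^sup>+\<xi>. ?k \<xi> * (ennreal \<tau> * ennreal (C2 * \<tau> powr s)) \<partial>lborel)"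
        proof (intro nn_integral_mono)
          fix \<xi>
          show "?k \<xi> * (ennreal \<tau> * (\<integral>\<^sup>+\<sigma>. \<integral>\<^sup>+x. I2 \<sigma> x * ?q \<sigma> x \<xi> \<partial>lborel \<partial>lborel))
            \<le> ?k \<xi> * (ennreal \<tau> * ennreal (C2 * \<tau> powr s))"
          proof (cases "\<bar>\<xi>\<bar> \<le> \<tau>")
            case True
            have "ennreal (C2 * \<bar>\<xi>\<bar> powr s) \<le> ennreal (C2 * \<tau> powr s)"
              using True C2(1) s by (intro ennreal_leI mult_left_mono powr_mono2) auto
            then show ?thesis using C2(2)[of \<xi>] True tau0 by (intro mult_left_mono) (auto intro: order_trans)
          next
            case False
            then show ?thesis by (auto simp: indicator_def)
          qed
        qed
        also have "\<dots> = ennreal (K / \<tau>\<^sup>2) * ennreal (2 * \<tau>) * (ennreal \<tau> * ennreal (C2 * \<tau> powr s))"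
          using tau0 by (simp add: nn_integral_multc nn_integral_cmult)
        also have "\<dots> = ennreal (2 * K * C2 * \<tau> powr s)"
          using K(1) C2(1) tau0 by (simp flip: ennreal_mult add: power2_eq_square)
        finally show ?thesis .
      qed
      have B2: "(\<integral>\<^sup>+t. \<integral>\<^sup>+x. I t x * T2 t x \<partial>lborel \<partial>lborel) \<le> ennreal (N * \<tau>)"
      proof -
        have "(\<integral>\<^sup>+t. \<integral>\<^sup>+x. I t x * T2 t x \<partial>lborel \<partial>lborel) \<le> (\<integral>\<^sup>+t. \<integral>\<^sup>+x. T2 t x \<partial>lborel \<partial>lborel)"
          by (intro nn_integral_mono) (auto simp: I_def indicator_def)
        also have "\<dots> = (\<integral>\<^sup>+t. \<integral>\<^sup>+x. ?n \<nu>1 t x \<partial>lborel \<partial>lborel) + (\<integral>\<^sup>+t. \<integral>\<^sup>+x. ?n \<nu>2 t x \<partial>lborel \<partial>lborel)"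
          unfolding T2_def by (simp add: nn_integral_add)
        also have "\<dots> \<le> ennreal (measure \<nu>1 UNIV * \<tau>) + ennreal (measure \<nu>2 UNIV * \<tau>)"
          by (intro add_mono strip_measure_bound \<nu> sets_\<nu> e tau0)
        also have "\<dots> = ennreal (N * \<tau>)" using tau by (simp add: N_def distrib_right flip: ennreal_plus)
        finally show ?thesis .
      qed
      \<comment> \<open>\<open>g\<close> is compared with its mollification \<open>M\<close> at both
        times, and the increment of \<open>M\<close> is controlled by the equation through
        \<open>Mpt\<close>.\<close>
      have "(\<integral>\<^sup>+t. \<integral>\<^sup>+x. I t x * ennreal \<bar>g (t + \<tau>, x) - g (t, x)\<bar> \<partial>lborel \<partial>lborel)
        \<le> (\<integral>\<^sup>+t. \<integral>\<^sup>+x. (I2 (t + \<tau>) x * ennreal \<bar>M (t + \<tau>, x) - g (t + \<tau>, x)\<bar> + I2 t x * ennreal \<bar>M (t, x) - g (t, x)\<bar>) + (I t x * T1 t x + I t x * T2 t x) \<partial>lborel \<partial>lborel)"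
      proof (intro nn_integral_mono)
        fix t x
        show "I t x * ennreal \<bar>g (t + \<tau>, x) - g (t, x)\<bar> \<le> (I2 (t + \<tau>) x * ennreal \<bar>M (t + \<tau>, x) - g (t + \<tau>, x)\<bar> + I2 t x * ennreal \<bar>M (t, x) - g (t, x)\<bar>) + (I t x * T1 t x + I t x * T2 t x)"
        proof (cases "t \<in> {t0..t1} \<and> x \<in> {-X..X}")
          case False
          then have z: "I t x = 0" by (auto simp: I_def)
          show ?thesis by (simp only: z mult_zero_left zero_le)
        next
          case True
          then have o: "I t x = 1" "I2 t x = 1" "I2 (t + \<tau>) x = 1" using tau c by (auto simp: I_def I2_def)
          have "ennreal \<bar>g (t + \<tau>, x) - g (t, x)\<bar> \<le> (ennreal \<bar>M (t + \<tau>, x) - g (t + \<tau>, x)\<bar> + ennreal \<bar>M (t, x) - g (t, x)\<bar>) + ennreal \<bar>M (t + \<tau>, x) - M (t, x)\<bar>"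
            by (simp flip: ennreal_plus add: ennreal_leI)
          also have "\<dots> \<le> (ennreal \<bar>M (t + \<tau>, x) - g (t + \<tau>, x)\<bar> + ennreal \<bar>M (t, x) - g (t, x)\<bar>) + (T1 t x + T2 t x)"
            using Mpt[of t x] True by (intro add_left_mono) (simp add: T1_def T2_def)
          finally show ?thesis by (simp add: o)
        qed
      qed
      also have "\<dots> = ((\<integral>\<^sup>+t. \<integral>\<^sup>+x. I2 (t + \<tau>) x * ennreal \<bar>M (t + \<tau>, x) - g (t + \<tau>, x)\<bar> \<partial>lborel \<partial>lborel) + (\<integral>\<^sup>+t. \<integral>\<^sup>+x. I2 t x * ennreal \<bar>M (t, x) - g (t, x)\<bar> \<partial>lborel \<partial>lborel))
        + ((\<integral>\<^sup>+t. \<integral>\<^sup>+x. I t x * T1 t x \<partial>lborel \<partial>lborel) + (\<integral>\<^sup>+t. \<integral>\<^sup>+x. I t x * T2 t x \<partial>lborel \<partial>lborel))"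
        by (simp add: nn_integral_add)
      also have "(\<integral>\<^sup>+t. \<integral>\<^sup>+x. I2 (t + \<tau>) x * ennreal \<bar>M (t + \<tau>, x) - g (t + \<tau>, x)\<bar> \<partial>lborel \<partial>lborel) = (\<integral>\<^sup>+t. \<integral>\<^sup>+x. I2 t x * ennreal \<bar>M (t, x) - g (t, x)\<bar> \<partial>lborel \<partial>lborel)"
        by (rule nn_integral_translate[of "\<lambda>t. \<integral>\<^sup>+x. I2 t x * ennreal \<bar>M (t, x) - g (t, x)\<bar> \<partial>lborel"]) measurable
      also have "((\<integral>\<^sup>+t. \<integral>\<^sup>+x. I2 t x * ennreal \<bar>M (t, x) - g (t, x)\<bar> \<partial>lborel \<partial>lborel) + (\<integral>\<^sup>+t. \<integral>\<^sup>+x. I2 t x * ennreal \<bar>M (t, x) - g (t, x)\<bar> \<partial>lborel \<partial>lborel))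
        + ((\<integral>\<^sup>+t. \<integral>\<^sup>+x. I t x * T1 t x \<partial>lborel \<partial>lborel) + (\<integral>\<^sup>+t. \<integral>\<^sup>+x. I t x * T2 t x \<partial>lborel \<partial>lborel))
        \<le> (ennreal ((C1 + 1) * \<tau> powr s) + ennreal ((C1 + 1) * \<tau> powr s)) + (ennreal (2 * K * C2 * \<tau> powr s) + ennreal (N * \<tau>))"
        by (intro add_mono err B1 B2)
      also have "\<dots> = ennreal ((C1 + 1) * \<tau> powr s + (C1 + 1) * \<tau> powr s + (2 * K * C2 * \<tau> powr s + N * \<tau>))"
        using C1(1) C2(1) K(1) N tau by (simp flip: ennreal_plus)
      also have "\<dots> \<le> ennreal (CC * \<tau> powr s)"
      proof (rule ennreal_leI)
        have "\<tau> powr 1 \<le> \<tau> powr s" using tau0 s by (intro powr_mono') auto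
        then have "N * \<tau> \<le> N * \<tau> powr s" using N tau0 by (intro mult_left_mono) auto
        then show "(C1 + 1) * \<tau> powr s + (C1 + 1) * \<tau> powr s + (2 * K * C2 * \<tau> powr s + N * \<tau>) \<le> CC * \<tau> powr s"
          by (simp add: CC_def algebra_simps)
      qed
      finally show ?thesis .
    qed
  qed
  qed
qed

section \<open>Fractional Sobolev regularity from shifts\<close>

lemma tregD:
  assumes "treg T s g" "0 < t0" "t0 \<le> t1" "t1 < T" "0 \<le> X"
  obtains C \<eta> where "0 \<le> C" "0 < \<eta>" "\<And>\<tau>. 0 \<le> \<tau> \<Longrightarrow> \<tau> \<le> \<eta> \<Longrightarrow>
    (\<integral>\<^sup>+t. \<integral>\<^sup>+x. indicator {t0..t1} t * indicator {-X..X} x * ennreal \<bar>g (t + \<tau>, x) - g (t, x)\<bar> \<partial>lborel \<partial>lborel)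
      \<le> ennreal (C * \<tau> powr s)"
  using assms(1)[unfolded treg_def, THEN spec, THEN spec, THEN spec, THEN mp,
      OF conjI[OF assms(2) conjI[OF assms(3) conjI[OF assms(4,5)]]]]
  by (elim exE conjE) (rule that, assumption+, simp)

lemma nn_integral_powr_finite:
  assumes c: "-1 < c"
  shows "(\<integral>\<^sup>+\<tau>. indicator {-1..1} \<tau> * ennreal (\<bar>\<tau>\<bar> powr c) \<partial>lborel) < \<infinity>"
proof -
  define F :: "real \<Rightarrow> ennreal" where "F \<tau> = ennreal (\<tau> powr c) * indicator {0..1} \<tau>" for \<tau>
  have [measurable]: "F \<in> borel_measurable borel" unfolding F_def[abs_def] by measurable
  have "((\<lambda>x. x powr c) has_integral (1 powr (c + 1) / (c + 1))) {0..1}"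
    using has_integral_powr_from_0[OF c, of 1] by simp
  then have "(\<integral>\<^sup>+\<tau>. F \<tau> \<partial>lborel) = ennreal (1 powr (c + 1) / (c + 1))"
    unfolding F_def by (intro nn_integral_has_integral_lebesgue') auto
  then have fin: "(\<integral>\<^sup>+\<tau>. F \<tau> \<partial>lborel) < \<infinity>" by simp
  have "(\<integral>\<^sup>+\<tau>. indicator {-1..1} \<tau> * ennreal (\<bar>\<tau>\<bar> powr c) \<partial>lborel) \<le> (\<integral>\<^sup>+\<tau>. F \<tau> + F (0 - \<tau>) \<partial>lborel)"
    by (intro nn_integral_mono) (auto simp: F_def indicator_def)
  also have "\<dots> = (\<integral>\<^sup>+\<tau>. F \<tau> \<partial>lborel) + (\<integral>\<^sup>+\<tau>. F \<tau> \<partial>lborel)"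
    using nn_integral_reflect[of F 0] by (subst nn_integral_add) simp_all
  also have "\<dots> < \<infinity>" using fin by simp
  finally show ?thesis .
qed

lemma compact_in_box:
  assumes "compact K" "K \<subseteq> {0<..<T} \<times> (UNIV :: real set)" "0 < (T::real)"
  obtains t0 t1 X where "0 < t0" "t0 \<le> t1" "t1 < T" "0 \<le> X" "K \<subseteq> {t0..t1} \<times> {-X..X}"
proof (cases "K = {}")
  case True
  then show ?thesis using that[of "T/2" "T/2" 0] assms(3) by auto
next
  case False
  have c: "compact (fst ` K)" "compact (snd ` K)"
    by (intro compact_continuous_image continuous_intros assms)+
  obtain t0 where t0: "t0 \<in> fst ` K" "\<And>t. t \<in> fst ` K \<Longrightarrow> t0 \<le> t" using compact_attains_inf[OF c(1)] False by auto
  obtain t1 where t1: "t1 \<in> fst ` K" "\<And>t. t \<in> fst ` K \<Longrightarrow> t \<le> t1" using compact_attains_sup[OF c(1)] False by auto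
  obtain X where X: "\<And>x. x \<in> snd ` K \<Longrightarrow> \<bar>x\<bar> \<le> X"
    using compact_imp_bounded[OF c(2)] by (auto simp: bounded_iff)
  show ?thesis
  proof (rule that[of t0 t1 "max X 0"])
    show "0 < t0" using t0(1) assms(2) by auto
    show "t1 < T" using t1(1) assms(2) by auto
    show "t0 \<le> t1" using t0(1) t1(2) by auto
    show "K \<subseteq> {t0..t1} \<times> {- max X 0..max X 0}"
    proof
      fix p assume p: "p \<in> K"
      then have "fst p \<in> fst ` K" "snd p \<in> snd ` K" by auto
      then show "p \<in> {t0..t1} \<times> {- max X 0..max X 0}"
        using t0(2)[of "fst p"] t1(2)[of "fst p"] X[of "snd p"] by (cases p) (auto simp: abs_le_iff)
    qed
  qed simp
qed

text \<open>With w = z + \<zeta> the Gagliardo seminorm becomes an integral over \<zeta> of L1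
  increments weighted by |\<zeta>|^(-2-s). For short shifts the increments are O(|\<zeta>|^s') with
  s' > s, which is integrable in the plane; for long shifts boundedness of \<open>g\<close> and of
  the box suffices.\<close>

lemma sobolev_from_shifts:
  fixes g :: "real \<times> real \<Rightarrow> real"
  assumes g[measurable]: "g \<in> borel_measurable borel" and G0: "\<And>z. \<bar>g z\<bar> \<le> G0"
    and xr: "xreg T s' g" and tr: "treg T s' g" and s: "0 \<le> s" "s < s'" "s' \<le> 1" and T: "0 < T"
  shows "sobolev_W1_loc s ({0<..<T} \<times> UNIV) g"
  unfolding sobolev_W1_loc_def
proof (intro allI impI; elim conjE)
  fix V :: "(real \<times> real) set" assume V: "open V" "compact (closure V)" "closure V \<subseteq> {0<..<T} \<times> UNIV"
  have [measurable]: "V \<in> sets borel" using V by simp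
  obtain t0 t1 X where t: "0 < t0" "t0 \<le> t1" "t1 < T" "0 \<le> X" and box: "closure V \<subseteq> {t0..t1} \<times> {-X..X}"
    using compact_in_box[OF V(2,3) T] by blast
  have Vbox: "t \<in> {t0..t1} \<and> x \<in> {-X..X}" if "(t, x) \<in> V" for t x
    using box closure_subset that by blast
  have G0': "0 \<le> G0" using G0[of "(0,0)"] by linarith
  have bV: "emeasure lborel V < \<infinity>"
    by (rule emeasure_bounded_finite[OF bounded_subset[OF compact_imp_bounded[OF V(2)] closure_subset]])
  have "integrable lborel (\<lambda>z. indicator V z *\<^sub>R g z)"
    by (rule integrableI_bounded_set[where A = V and B = G0]) (use bV G0 in \<open>auto simp: indicator_def\<close>)
  then have int: "g absolutely_integrable_on V"
    by (simp add: set_integrable_def integrable_completion)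
  have seminorm: "(\<lambda>(z, w). \<bar>g z - g w\<bar> / norm (z - w) powr (real DIM(real \<times> real) + s)) absolutely_integrable_on (V \<times> V)" if s0: "0 < s"
  proof -
    define J :: "real \<Rightarrow> real \<Rightarrow> ennreal" where "J t x = indicator {t0..t1} t * indicator {-X..X} x" for t x
    let ?J = "\<lambda>z \<zeta>. J (fst z) (snd z) * J (fst z + fst \<zeta>) (snd z + snd \<zeta>) * ennreal \<bar>g (fst z + fst \<zeta>, snd z + snd \<zeta>) - g z\<bar>"
    have J[measurable]: "(\<lambda>p. J (a p) (b p)) \<in> borel_measurable M" if [measurable]: "a \<in> borel_measurable M" "b \<in> borel_measurable M" for a b and M :: "'z measure"
      unfolding J_def by measurable
    define k where "k \<tau> \<xi> = ennreal (1 / norm (\<tau>, \<xi>) powr (2 + s))" for \<tau> \<xi> :: real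
    have k[measurable]: "(\<lambda>p. k (a p) (b p)) \<in> borel_measurable M" if [measurable]: "a \<in> borel_measurable M" "b \<in> borel_measurable M" for a b and M :: "'z measure"
      unfolding k_def by measurable
    define \<Phi> where "\<Phi> \<tau> \<xi> = (\<integral>\<^sup>+t. \<integral>\<^sup>+x. J t x * J (t + \<tau>) (x + \<xi>) * ennreal \<bar>g (t + \<tau>, x + \<xi>) - g (t, x)\<bar> \<partial>lborel \<partial>lborel)" for \<tau> \<xi>
    have \<Phi>m[measurable]: "(\<lambda>p. \<Phi> (a p) (b p)) \<in> borel_measurable M" if [measurable]: "a \<in> borel_measurable M" "b \<in> borel_measurable M" for a b and M :: "'z measure"
      unfolding \<Phi>_def by measurable
    obtain Cx where Cx: "0 \<le> Cx" "\<And>h. \<bar>h\<bar> \<le> 1 \<Longrightarrow> (\<integral>\<^sup>+t. \<integral>\<^sup>+x. J t x * ennreal \<bar>g (t, x + h) - g (t, x)\<bar> \<partial>lborel \<partial>lborel) \<le> ennreal (Cx * \<bar>h\<bar> powr s')"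
      by (rule xregD[OF xr t]) (use that in \<open>unfold J_def, blast\<close>)
    obtain Ct \<eta>0 where Ct: "0 \<le> Ct" "0 < \<eta>0" "\<And>\<tau>. 0 \<le> \<tau> \<Longrightarrow> \<tau> \<le> \<eta>0 \<Longrightarrow> (\<integral>\<^sup>+t. \<integral>\<^sup>+x. J t x * ennreal \<bar>g (t + \<tau>, x) - g (t, x)\<bar> \<partial>lborel \<partial>lborel) \<le> ennreal (Ct * \<tau> powr s')"
      by (rule tregD[OF tr t]) (use that in \<open>unfold J_def, blast\<close>)
    define \<eta> where "\<eta> = min \<eta>0 1"
    have \<eta>: "0 < \<eta>" "\<eta> \<le> 1" "\<eta> \<le> \<eta>0" using Ct by (auto simp: \<eta>_def)
    define Ar where "Ar = (t1 - t0) * (2 * X)"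
    \<comment> \<open>A longer shift cannot keep both points in the box.\<close>
    define L where "L = max (t1 - t0) (2 * X)"
    \<comment> \<open>The path goes in x at time t, then in t at the position x + \<xi>. A negative
      \<tau> is treated by exchanging the end points, which is possible because \<open>J\<close>
      confines both of them.\<close>
    have small: "\<Phi> \<tau> \<xi> \<le> ennreal (Cx * \<bar>\<xi>\<bar> powr s' + Ct * \<bar>\<tau>\<bar> powr s')" if "\<bar>\<tau>\<bar> \<le> \<eta>" "\<bar>\<xi>\<bar> \<le> \<eta>" for \<tau> \<xi>
    proof -
      define H where "H t y = J t y * J (t + \<tau>) y * ennreal \<bar>g (t + \<tau>, y) - g (t, y)\<bar>" for t y
      have Hm[measurable]: "(\<lambda>p. H (a p) (b p)) \<in> borel_measurable M" if [measurable]: "a \<in> borel_measurable M" "b \<in> borel_measurable M" for a b and M :: "'z measure"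
        unfolding H_def by measurable
      have "\<Phi> \<tau> \<xi> \<le> (\<integral>\<^sup>+t. \<integral>\<^sup>+x. J t x * ennreal \<bar>g (t, x + \<xi>) - g (t, x)\<bar> + H t (x + \<xi>) \<partial>lborel \<partial>lborel)"
        unfolding \<Phi>_def
      proof (intro nn_integral_mono)
        fix t x
        show "J t x * J (t + \<tau>) (x + \<xi>) * ennreal \<bar>g (t + \<tau>, x + \<xi>) - g (t, x)\<bar> \<le> J t x * ennreal \<bar>g (t, x + \<xi>) - g (t, x)\<bar> + H t (x + \<xi>)"
        proof (cases "t \<in> {t0..t1} \<and> x \<in> {-X..X} \<and> t + \<tau> \<in> {t0..t1} \<and> x + \<xi> \<in> {-X..X}")
          case True
          then have o: "J t x = 1" "J (t + \<tau>) (x + \<xi>) = 1" "J t (x + \<xi>) = 1" by (auto simp: J_def)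
          show ?thesis unfolding H_def o by (simp flip: ennreal_plus add: ennreal_leI)
        next
          case False
          then have z: "J t x * J (t + \<tau>) (x + \<xi>) = 0" by (auto simp: J_def indicator_def)
          show ?thesis by (simp only: z mult_zero_left zero_le)
        qed
      qed
      also have "\<dots> = (\<integral>\<^sup>+t. \<integral>\<^sup>+x. J t x * ennreal \<bar>g (t, x + \<xi>) - g (t, x)\<bar> \<partial>lborel \<partial>lborel) + (\<integral>\<^sup>+t. \<integral>\<^sup>+x. H t (x + \<xi>) \<partial>lborel \<partial>lborel)"
        by (simp add: nn_integral_add)
      also have "(\<integral>\<^sup>+t. \<integral>\<^sup>+x. H t (x + \<xi>) \<partial>lborel \<partial>lborel) = (\<integral>\<^sup>+t. \<integral>\<^sup>+x. H t x \<partial>lborel \<partial>lborel)"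
        by (rule nn_integral_cong, rule nn_integral_translate) measurable
      also have "\<dots> \<le> ennreal (Ct * \<bar>\<tau>\<bar> powr s')"
      proof (cases "0 \<le> \<tau>")
        case True
        have "(\<integral>\<^sup>+t. \<integral>\<^sup>+x. H t x \<partial>lborel \<partial>lborel) \<le> (\<integral>\<^sup>+t. \<integral>\<^sup>+x. J t x * ennreal \<bar>g (t + \<tau>, x) - g (t, x)\<bar> \<partial>lborel \<partial>lborel)"
          by (intro nn_integral_mono) (auto simp: H_def J_def indicator_def)
        also have "\<dots> \<le> ennreal (Ct * \<bar>\<tau>\<bar> powr s')" using Ct(3)[of \<tau>] True that \<eta> by simp
        finally show ?thesis .
      next
        case False
        have "(\<integral>\<^sup>+t. \<integral>\<^sup>+x. H t x \<partial>lborel \<partial>lborel) = (\<integral>\<^sup>+t. \<integral>\<^sup>+x. H (t + - \<tau>) x \<partial>lborel \<partial>lborel)"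
          by (rule nn_integral_translate[symmetric]) measurable
        also have "\<dots> \<le> (\<integral>\<^sup>+t. \<integral>\<^sup>+x. J t x * ennreal \<bar>g (t + - \<tau>, x) - g (t, x)\<bar> \<partial>lborel \<partial>lborel)"
          by (intro nn_integral_mono) (auto simp: H_def J_def indicator_def abs_minus_commute)
        also have "\<dots> \<le> ennreal (Ct * \<bar>\<tau>\<bar> powr s')" using Ct(3)[of "-\<tau>"] False that \<eta> by simp
        finally show ?thesis .
      qed
      also have "(\<integral>\<^sup>+t. \<integral>\<^sup>+x. J t x * ennreal \<bar>g (t, x + \<xi>) - g (t, x)\<bar> \<partial>lborel \<partial>lborel) \<le> ennreal (Cx * \<bar>\<xi>\<bar> powr s')"
        using Cx(2)[of \<xi>] that \<eta> by simp
      finally have "\<Phi> \<tau> \<xi> \<le> ennreal (Cx * \<bar>\<xi>\<bar> powr s') + ennreal (Ct * \<bar>\<tau>\<bar> powr s')"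
        by (simp add: add_right_mono add_left_mono)
      then show ?thesis using Cx(1) Ct(1) by (simp flip: ennreal_plus)
    qed
    have large: "\<Phi> \<tau> \<xi> \<le> ennreal (2 * G0 * Ar) * (indicator {-L..L} \<tau> * indicator {-L..L} \<xi>)" for \<tau> \<xi>
    proof (cases "\<tau> \<in> {-L..L} \<and> \<xi> \<in> {-L..L}")
      case True
      have "\<Phi> \<tau> \<xi> \<le> (\<integral>\<^sup>+t. \<integral>\<^sup>+x. J t x * ennreal (2 * G0) \<partial>lborel \<partial>lborel)"
        unfolding \<Phi>_def
      proof (intro nn_integral_mono)
        fix t x
        have "\<bar>g (t + \<tau>, x + \<xi>) - g (t, x)\<bar> \<le> 2 * G0" using G0[of "(t + \<tau>, x + \<xi>)"] G0[of "(t, x)"] by linarith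
        then have "J t x * J (t + \<tau>) (x + \<xi>) * ennreal \<bar>g (t + \<tau>, x + \<xi>) - g (t, x)\<bar> \<le> J t x * 1 * ennreal (2 * G0)"
          by (intro mult_mono ennreal_leI) (auto simp: J_def indicator_def)
        then show "J t x * J (t + \<tau>) (x + \<xi>) * ennreal \<bar>g (t + \<tau>, x + \<xi>) - g (t, x)\<bar> \<le> J t x * ennreal (2 * G0)" by simp
      qed
      also have "\<dots> = ennreal (t1 - t0) * ennreal (2 * X) * ennreal (2 * G0)"
        unfolding J_def using t by (simp add: nn_integral_multc nn_integral_cmult)
      also have "\<dots> = ennreal (2 * G0 * Ar)" using t G0' by (simp add: Ar_def ac_simps flip: ennreal_mult)
      finally show ?thesis using True by simp
    next
      case False
      have "J t x * J (t + \<tau>) (x + \<xi>) = 0" for t x using False by (auto simp: J_def indicator_def L_def)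
      then have "\<Phi> \<tau> \<xi> = 0" unfolding \<Phi>_def by (simp only: mult_zero_left nn_integral_const)
      then show ?thesis by simp
    qed
    \<comment> \<open>The weight n^(s'-s-2) is split into n^c n^c; as c < 0 and n dominates both
      components, it is at most |\<tau>|^c |\<xi>|^c. Each factor is integrable near 0, because s' >
      s means c > -1, so polar coordinates are avoided.\<close>
    define c where "c = (s' - s - 2) / 2"
    have c: "-1 < c" "c < 0" using s by (auto simp: c_def)
    define D1 where "D1 = ennreal (Cx + Ct)"
    define D2 where "D2 = ennreal (1 / \<eta> powr (2 + s)) * ennreal (2 * G0 * Ar)"
    define P :: "real \<Rightarrow> ennreal" where "P \<tau> = indicator {-1..1} \<tau> * ennreal (\<bar>\<tau>\<bar> powr c)" for \<tau>
    have [measurable]: "P \<in> borel_measurable borel" unfolding P_def[abs_def] by measurable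
    have kb: "k \<tau> \<xi> * \<Phi> \<tau> \<xi> \<le> D1 * (P \<tau> * P \<xi>) + D2 * (indicator {-L..L} \<tau> * indicator {-L..L} \<xi>)" if nz: "\<tau> \<noteq> 0" "\<xi> \<noteq> 0" for \<tau> \<xi>
    proof -
      define n where "n = norm (\<tau>, \<xi>)"
      have n: "\<bar>\<tau>\<bar> \<le> n" "\<bar>\<xi>\<bar> \<le> n" using norm_fst_le[of \<tau> \<xi>] norm_snd_le[of \<xi> \<tau>] by (auto simp: n_def)
      have n0: "0 < n" using n nz by linarith
      show ?thesis
      proof (cases "\<bar>\<tau>\<bar> \<le> \<eta> \<and> \<bar>\<xi>\<bar> \<le> \<eta>")
        case True
        have "1 / n powr (2 + s) * (Cx * \<bar>\<xi>\<bar> powr s' + Ct * \<bar>\<tau>\<bar> powr s') \<le> 1 / n powr (2 + s) * (Cx * n powr s' + Ct * n powr s')"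
          using n s Cx(1) Ct(1) by (intro mult_left_mono add_mono powr_mono2) auto
        also have "\<dots> = (Cx + Ct) * (n powr s' / n powr (2 + s))" by (simp add: field_simps)
        also have "n powr s' / n powr (2 + s) = n powr c * n powr c"
          by (simp add: c_def powr_diff[symmetric] diff_diff_eq add.commute flip: powr_add)
        also have "(Cx + Ct) * (n powr c * n powr c) \<le> (Cx + Ct) * (\<bar>\<tau>\<bar> powr c * \<bar>\<xi>\<bar> powr c)"
          using n nz c Cx(1) Ct(1) by (intro mult_left_mono mult_mono powr_mono2') auto
        finally have "ennreal (1 / n powr (2 + s) * (Cx * \<bar>\<xi>\<bar> powr s' + Ct * \<bar>\<tau>\<bar> powr s')) \<le> ennreal ((Cx + Ct) * (\<bar>\<tau>\<bar> powr c * \<bar>\<xi>\<bar> powr c))"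
          by (rule ennreal_leI)
        also have "\<dots> = D1 * (P \<tau> * P \<xi>)"
        proof -
          have "\<tau> \<in> {-1..1}" "\<xi> \<in> {-1..1}" using True \<eta> by auto
          then show ?thesis using Cx(1) Ct(1) by (simp add: D1_def P_def ennreal_mult)
        qed
        finally have 1: "ennreal (1 / n powr (2 + s) * (Cx * \<bar>\<xi>\<bar> powr s' + Ct * \<bar>\<tau>\<bar> powr s')) \<le> D1 * (P \<tau> * P \<xi>)" .
        have "k \<tau> \<xi> * \<Phi> \<tau> \<xi> \<le> k \<tau> \<xi> * ennreal (Cx * \<bar>\<xi>\<bar> powr s' + Ct * \<bar>\<tau>\<bar> powr s')"
          using True by (intro mult_left_mono small) auto
        also have "\<dots> = ennreal (1 / n powr (2 + s) * (Cx * \<bar>\<xi>\<bar> powr s' + Ct * \<bar>\<tau>\<bar> powr s'))"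
          unfolding k_def n_def by (rule ennreal_mult[symmetric]) (use Cx(1) Ct(1) in auto)
        also have "\<dots> \<le> D1 * (P \<tau> * P \<xi>)" by (rule 1)
        finally show ?thesis by (simp add: add_increasing2)
      next
        case False
        then have "\<eta> \<le> n" using n by linarith
        then have "\<eta> powr (2 + s) \<le> n powr (2 + s)" using \<eta> s by (intro powr_mono2) auto
        then have "1 / n powr (2 + s) \<le> 1 / \<eta> powr (2 + s)" using \<eta> n0 by (intro divide_left_mono mult_pos_pos) auto
        then have "k \<tau> \<xi> \<le> ennreal (1 / \<eta> powr (2 + s))" unfolding k_def n_def by (rule ennreal_leI)
        then have "k \<tau> \<xi> * \<Phi> \<tau> \<xi> \<le> ennreal (1 / \<eta> powr (2 + s)) * (ennreal (2 * G0 * Ar) * (indicator {-L..L} \<tau> * indicator {-L..L} \<xi>))"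
          by (intro mult_mono large) auto
        then show ?thesis by (simp add: D2_def mult.assoc add_increasing)
      qed
    qed
    define \<Psi> where "\<Psi> = (\<lambda>(z, w). \<bar>g z - g w\<bar> / norm (z - w) powr (real DIM(real \<times> real) + s))"
    have [measurable]: "\<Psi> \<in> borel_measurable borel" unfolding \<Psi>_def by measurable
    have VV[measurable]: "V \<times> V \<in> sets borel" using V(1) by (intro borel_open open_Times)
    have "integrable lborel (\<lambda>p. indicator (V \<times> V) p *\<^sub>R \<Psi> p)"
    proof (rule integrableI_bounded)
      show "(\<lambda>p. indicator (V \<times> V) p *\<^sub>R \<Psi> p) \<in> borel_measurable lborel" by measurable
      have dim: "real DIM(real \<times> real) = 2" by simp
      have m1: "(\<lambda>p. ennreal (norm (indicator (V \<times> V) p *\<^sub>R \<Psi> p))) \<in> borel_measurable borel" by measurable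
      have "(\<integral>\<^sup>+p. ennreal (norm (indicator (V \<times> V) p *\<^sub>R \<Psi> p)) \<partial>lborel) = (\<integral>\<^sup>+z. \<integral>\<^sup>+w. ennreal (norm (indicator (V \<times> V) (z, w) *\<^sub>R \<Psi> (z, w))) \<partial>lborel \<partial>lborel)"
        by (rule nn_integral_lborel_prod[OF m1])
      also have "\<dots> = (\<integral>\<^sup>+z. \<integral>\<^sup>+\<zeta>. ennreal (norm (indicator (V \<times> V) (z, \<zeta> + z) *\<^sub>R \<Psi> (z, \<zeta> + z))) \<partial>lborel \<partial>lborel)"
        by (rule nn_integral_cong, rule nn_integral_translate[symmetric]) measurable
      also have "\<dots> \<le> (\<integral>\<^sup>+z. \<integral>\<^sup>+\<zeta>. k (fst \<zeta>) (snd \<zeta>) * ?J z \<zeta> \<partial>lborel \<partial>lborel)"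
      proof (intro nn_integral_mono)
        fix z \<zeta> :: "real \<times> real"
        show "ennreal (norm (indicator (V \<times> V) (z, \<zeta> + z) *\<^sub>R \<Psi> (z, \<zeta> + z))) \<le> k (fst \<zeta>) (snd \<zeta>) * ?J z \<zeta>"
        proof (cases "z \<in> V \<and> \<zeta> + z \<in> V")
          case False
          then have z: "indicator (V \<times> V) (z, \<zeta> + z) *\<^sub>R \<Psi> (z, \<zeta> + z) = 0" by auto
          show ?thesis by (simp only: z norm_zero ennreal_0 zero_le)
        next
          case True
          obtain t x \<tau> \<xi> where zz: "z = (t, x)" "\<zeta> = (\<tau>, \<xi>)" by (cases z, cases \<zeta>)
          have J1: "J t x = 1" "J (t + \<tau>) (x + \<xi>) = 1"
            using True Vbox[of t x] Vbox[of "t + \<tau>" "x + \<xi>"] by (auto simp: zz J_def add.commute)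
          have "norm (z - (\<zeta> + z)) = norm \<zeta>" by (simp add: norm_minus_commute)
          then have "\<Psi> (z, \<zeta> + z) = 1 / norm (\<tau>, \<xi>) powr (2 + s) * \<bar>g (t + \<tau>, x + \<xi>) - g (t, x)\<bar>"
            unfolding \<Psi>_def split_conv dim by (simp add: zz abs_minus_commute add.commute)
          then have "ennreal (norm (indicator (V \<times> V) (z, \<zeta> + z) *\<^sub>R \<Psi> (z, \<zeta> + z))) = k \<tau> \<xi> * ennreal \<bar>g (t + \<tau>, x + \<xi>) - g (t, x)\<bar>"
            using True unfolding k_def by (simp add: abs_mult flip: ennreal_mult)
          then show ?thesis by (simp add: zz J1)
        qed
      qed
      also have "\<dots> = (\<integral>\<^sup>+t. \<integral>\<^sup>+x. \<integral>\<^sup>+\<tau>. \<integral>\<^sup>+\<xi>. k \<tau> \<xi> * (J t x * J (t + \<tau>) (x + \<xi>) * ennreal \<bar>g (t + \<tau>, x + \<xi>) - g (t, x)\<bar>) \<partial>lborel \<partial>lborel \<partial>lborel \<partial>lborel)"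
      proof -
        have i: "(\<integral>\<^sup>+\<zeta>. k (fst \<zeta>) (snd \<zeta>) * ?J z \<zeta> \<partial>lborel)
          = (\<integral>\<^sup>+\<tau>. \<integral>\<^sup>+\<xi>. k \<tau> \<xi> * (J (fst z) (snd z) * J (fst z + \<tau>) (snd z + \<xi>) * ennreal \<bar>g (fst z + \<tau>, snd z + \<xi>) - g z\<bar>) \<partial>lborel \<partial>lborel)" for z
        proof -
          have m: "(\<lambda>\<zeta>. k (fst \<zeta>) (snd \<zeta>) * ?J z \<zeta>) \<in> borel_measurable borel"
            by measurable
          show ?thesis unfolding nn_integral_lborel_prod[OF m] by (simp only: fst_conv snd_conv)
        qed
        have m2: "(\<lambda>z. \<integral>\<^sup>+\<tau>. \<integral>\<^sup>+\<xi>. k \<tau> \<xi> * (J (fst z) (snd z) * J (fst z + \<tau>) (snd z + \<xi>) * ennreal \<bar>g (fst z + \<tau>, snd z + \<xi>) - g z\<bar>) \<partial>lborel \<partial>lborel) \<in> borel_measurable borel" by measurable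
        show ?thesis unfolding i nn_integral_lborel_prod[OF m2] by (simp only: fst_conv snd_conv)
      qed
      also have "\<dots> = (\<integral>\<^sup>+\<tau>. \<integral>\<^sup>+\<xi>. \<integral>\<^sup>+t. \<integral>\<^sup>+x. k \<tau> \<xi> * (J t x * J (t + \<tau>) (x + \<xi>) * ennreal \<bar>g (t + \<tau>, x + \<xi>) - g (t, x)\<bar>) \<partial>lborel \<partial>lborel \<partial>lborel \<partial>lborel)"
        by (rule nn_integral_swap4) measurable
      also have "\<dots> = (\<integral>\<^sup>+\<tau>. \<integral>\<^sup>+\<xi>. k \<tau> \<xi> * \<Phi> \<tau> \<xi> \<partial>lborel \<partial>lborel)"
        unfolding \<Phi>_def by (simp add: nn_integral_cmult)
      also have "\<dots> \<le> (\<integral>\<^sup>+\<tau>. \<integral>\<^sup>+\<xi>. D1 * (P \<tau> * P \<xi>) + D2 * (indicator {-L..L} \<tau> * indicator {-L..L} \<xi>) \<partial>lborel \<partial>lborel)"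
      proof (rule nn_integral_mono_AE, use AE_lborel_singleton[of "0::real"] in eventually_elim)
        \<comment> \<open>On the axes \<open>0 powr c = 0\<close> would spoil the product bound;
          they are null sets.\<close>
        fix \<tau> :: real assume \<tau>: "\<tau> \<noteq> 0"
        show "(\<integral>\<^sup>+\<xi>. k \<tau> \<xi> * \<Phi> \<tau> \<xi> \<partial>lborel) \<le> (\<integral>\<^sup>+\<xi>. D1 * (P \<tau> * P \<xi>) + D2 * (indicator {-L..L} \<tau> * indicator {-L..L} \<xi>) \<partial>lborel)"
          by (rule nn_integral_mono_AE, use AE_lborel_singleton[of "0::real"] in eventually_elim) (rule kb[OF \<tau>])
      qed
      also have "\<dots> = D1 * ((\<integral>\<^sup>+\<tau>. P \<tau> \<partial>lborel) * (\<integral>\<^sup>+\<xi>. P \<xi> \<partial>lborel)) + D2 * (emeasure lborel {-L..L} * emeasure lborel {-L..L})"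
        by (simp add: nn_integral_add nn_integral_cmult nn_integral_multc)
      also have "\<dots> < \<infinity>"
        using nn_integral_powr_finite[OF c(1)] emeasure_bounded_finite[of "{-L..L}"]
        by (auto simp: D1_def D2_def P_def ennreal_mult_less_top)
      finally show "(\<integral>\<^sup>+p. ennreal (norm (indicator (V \<times> V) p *\<^sub>R \<Psi> p)) \<partial>lborel) < \<infinity>" .
    qed
    then show ?thesis unfolding \<Psi>_def[symmetric] by (simp add: set_integrable_def integrable_completion)
  qed
  show "sobolev_W1 s V g"
  proof (cases "s = 0")
    case False
    then show ?thesis using int seminorm s(1) unfolding sobolev_W1_def by linarith
  qed (use int in \<open>simp add: sobolev_W1_def\<close>)
qed

section \<open>Upper bounds for bounded data\<close>

text \<open>A smooth step that starts exactly at c and is complete at c + 1, so that the test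
  function vanishes below the threshold.\<close>

definition rise :: "real \<Rightarrow> real \<Rightarrow> real" where "rise c r = 1/2 + step_at (1/2) (r - c - 1/2)"
definition rise' :: "real \<Rightarrow> real \<Rightarrow> real" where "rise' c r = moll (1/2) (r - c - 1/2)"

lemma smooth_rise: "smooth (rise c)"
proof -
  have "smooth (\<lambda>x. step_at (1/2) (1 * x + (- c - 1/2)))" by (rule smooth_affine_real[OF smooth_step_at])
  then have "smooth (\<lambda>x. 1/2 + step_at (1/2) (x - c - 1/2))"
    by (intro smooth_add smooth_const) (simp add: algebra_simps)
  then show ?thesis by (simp add: rise_def[abs_def])
qed

lemma rise_DERIV: "(rise c has_real_derivative rise' c r) (at r)"
  unfolding rise_def[abs_def] rise'_def
  by (rule DERIV_cong[OF DERIV_add[OF DERIV_const DERIV_chain2[OF step_at_deriv]]]) (auto intro!: derivative_eq_intros)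

lemma rise_range: "0 \<le> rise c r" "rise c r \<le> 1"
  using step_at_abs[of "1/2" "r - c - 1/2"] unfolding rise_def by linarith+

lemma rise_0: "r \<le> c \<Longrightarrow> rise c r = 0" by (simp add: rise_def step_at_left)
lemma rise_1: "c + 1 \<le> r \<Longrightarrow> rise c r = 1" by (simp add: rise_def step_at_right)
lemma rise'_nonneg: "0 \<le> rise' c r" by (simp add: rise'_def moll_nonneg)
lemma rise'_outside: "r \<le> c \<or> c + 1 \<le> r \<Longrightarrow> rise' c r = 0" by (auto simp: rise'_def moll_outside)

lemma rise_measurable [measurable]: "rise c \<in> borel_measurable borel" by (rule smooth_measurable[OF smooth_rise])
lemma rise'_measurable [measurable]: "rise' c \<in> borel_measurable borel" unfolding rise'_def[abs_def] by measurable

context half_problem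
begin

lemma integrable_m:
  assumes g: "integrable lborel g"
  shows "integrable m (\<lambda>(t, x, v). g v :: real)"
proof (rule integrableI_bounded)
  have [measurable]: "g \<in> borel_measurable borel" using g by auto
  show "(\<lambda>(t, x, v). g v) \<in> borel_measurable m" by measurable
  have "(\<integral>\<^sup>+p. ennreal (norm ((case p of (t, x, v) \<Rightarrow> g v) :: real)) \<partial>m) = (\<integral>\<^sup>+(t, x, v). ennreal \<bar>g v\<bar> \<partial>m)"
    by (intro nn_integral_cong) auto
  also have "\<dots> \<le> ennreal M0 * (\<integral>\<^sup>+v. ennreal \<bar>g v\<bar> \<partial>lborel)" by (rule marginal) measurable
  also have "\<dots> < \<infinity>" using g by (auto simp: integrable_iff_bounded ennreal_mult_less_top)
  finally show "(\<integral>\<^sup>+p. ennreal (norm ((case p of (t, x, v) \<Rightarrow> g v) :: real)) \<partial>m) < \<infinity>" .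
qed

text \<open>\<open>ennreal\<close> sends negative reals to 0, so the right-hand side is the positive
  part of the excess: velocity integrals of f measure the overshoot of \<open>U\<close>.\<close>

lemma hf_nn_v: "(\<integral>\<^sup>+v. ennreal (hf (t, x, v)) * indicator {c<..} v \<partial>lborel) = ennreal (U (t, x) - max c 0)"
proof -
  have "(\<integral>\<^sup>+v. ennreal (hf (t, x, v)) * indicator {c<..} v \<partial>lborel) = (\<integral>\<^sup>+v. indicator {max c 0<..<U (t, x)} v \<partial>lborel)"
    by (intro nn_integral_cong) (auto simp: hf_def indicator_def)
  also have "\<dots> = ennreal (U (t, x) - max c 0)"
  proof -
    have "emeasure lborel {a<..<b} = ennreal (b - a)" for a b :: real
      by (cases "a \<le> b") (auto simp: ennreal_neg)
    then show ?thesis by (simp only: nn_integral_indicator sets_lborel borel_open open_greaterThanLessThan)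
  qed
  finally show ?thesis .
qed

text \<open>
  Testing with a smoothed indicator of \<open>v > C0 + C1 t\<close>: the measure \<open>m\<close> contributes with a sign, and the moving threshold
  absorbs the source. The cut-off at large \<open>v\<close> is harmless since the marginal of \<open>m\<close> decays.
\<close>

lemma upper_bound_step:
  assumes T\<theta>: "0 < \<theta>" "\<theta> < T / 2"
    and decay: "\<And>e. 0 < e \<Longrightarrow> \<exists>R. \<forall>g \<in> borel_measurable borel. (\<forall>v\<le>R. g v = 0) \<longrightarrow> (\<integral>\<^sup>+(t, x, v). g v \<partial>m) \<le> ennreal e * (\<integral>\<^sup>+v. g v \<partial>lborel)"
    and S_le: "AE z in lborel. S z \<le> C1" and C: "0 \<le> C1" "0 < C0"
    and U_int: "integrable lborel U"
    and init: "\<And>\<eta>. 0 < \<eta> \<Longrightarrow> \<exists>\<tau>>0. AE t in lborel. 0 < t \<and> t < \<tau> \<longrightarrow> (\<integral>\<^sup>+x. ennreal (U (t, x) - C0) \<partial>lborel) \<le> ennreal \<eta>"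
  shows "AE z in lborel. \<theta> < fst z \<and> fst z < T - \<theta> \<longrightarrow> U z \<le> C0 + C1 * T + 2"
proof -
  \<comment> \<open>The threshold ends at C0 + C1 T, the step needs one more unit to reach 1, and
    the last unit leaves an interval (M - 1, M) of velocities that are seen in full wherever
    \<open>U\<close> exceeds \<open>M\<close>.\<close>
  define M where "M = C0 + C1 * T + 2"
  \<comment> \<open>The mollifier at scale d around T/2 is then positive precisely on (\<theta>, T -
    \<theta>).\<close>
  define d where "d = T / 2 - \<theta>"
  have d: "0 < d" using T\<theta> by (simp add: d_def)
  obtain Km where Km: "0 \<le> Km" "\<And>x. \<bar>moll 1 x\<bar> \<le> Km" using moll_bound[of 1] by auto
  have mollk: "\<bar>moll k x\<bar> \<le> Km / k" if "0 < k" for k x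
  proof -
    have "moll k x = moll 1 (x / k) / k" by (simp add: moll_def)
    then show ?thesis using Km(2)[of "x / k"] that by (simp add: divide_right_mono)
  qed
  obtain NU where NU: "0 \<le> NU" "(\<integral>\<^sup>+z. ennreal (U z) \<partial>lborel) \<le> ennreal NU"
  proof (rule that[of "\<integral>z. \<bar>U z\<bar> \<partial>lborel"])
    have "(\<integral>\<^sup>+z. ennreal (U z) \<partial>lborel) \<le> (\<integral>\<^sup>+z. ennreal \<bar>U z\<bar> \<partial>lborel)" by (intro nn_integral_mono ennreal_leI) auto
    also have "\<dots> = ennreal (\<integral>z. \<bar>U z\<bar> \<partial>lborel)" using U_int by (intro nn_integral_eq_integral) auto
    finally show "(\<integral>\<^sup>+z. ennreal (U z) \<partial>lborel) \<le> ennreal (\<integral>z. \<bar>U z\<bar> \<partial>lborel)" .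
  qed simp
  have key: "(\<integral>\<^sup>+(t, x). ennreal (moll d (t - T / 2)) * indicator {-X..X} x * indicator {z. M < U z} (t, x) \<partial>lborel) \<le> ennreal \<eta>"
    if \<eta>: "0 < \<eta>" and X: "0 < X" for \<eta> X
  proof -
    have \<eta>4: "0 < \<eta> / 4" using \<eta> by simp
    obtain \<tau> where \<tau>: "0 < \<tau>" "AE t in lborel. 0 < t \<and> t < \<tau> \<longrightarrow> (\<integral>\<^sup>+x. ennreal (U (t, x) - C0) \<partial>lborel) \<le> ennreal (\<eta>/4)"
      using init[OF \<eta>4] by blast
    \<comment> \<open>The cut-off in time rises on [ep, 3 ep]: early enough for the initial
      estimate, which holds up to \<tau>, and finished before it starts to fall at \<theta>.\<close>
    define ep where "ep = min \<tau> \<theta> / 4"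
    have ep: "0 < ep" "3 * ep < \<tau>" "3 * ep < \<theta>" using \<tau> T\<theta> by (auto simp: ep_def min_def)
    \<comment> \<open>The variation of \<open>Z\<close> is at most 2, so the tail bound \<eta>/8
      leaves \<eta>/4.\<close>
    obtain R where R: "\<And>g. g \<in> borel_measurable borel \<Longrightarrow> (\<And>v. v \<le> R \<Longrightarrow> g v = 0) \<Longrightarrow> (\<integral>\<^sup>+(t, x, v). g v \<partial>m) \<le> ennreal (\<eta>/8) * (\<integral>\<^sup>+v. g v \<partial>lborel)"
      using decay[of "\<eta>/8"] \<eta> by auto
    define j where "j = max (max M R) C0"
    have j: "M \<le> j" "R \<le> j" "C0 \<le> j" by (auto simp: j_def)
    define aj where "aj = (l + 1) * (j + C0) powr l"
    have aj: "0 \<le> aj" using l_ge_1 by (simp add: aj_def)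
    \<comment> \<open>The cut-off in x has slope at most 2 Km / k, and the flux term is at most 2 Km
      aj NU / k; this k makes it at most \<eta>/4.\<close>
    define k where "k = max X (8 * Km * aj * NU / \<eta> + 1)"
    have k: "X \<le> k" "0 < k" "8 * Km * aj * NU / \<eta> \<le> k" using X by (auto simp: k_def)
    \<comment> \<open>The rise and the fall do not overlap, so the derivative is the mollifier of
      the rise minus that of the fall. The first is met by the initial data, the second carries the
      quantity to be estimated.\<close>
    define A where "A t = (1/2 + step_at ep (t - 2 * ep)) * (1/2 - step_at d (t - T / 2))" for t
    define A' where "A' t = moll ep (t - 2 * ep) - moll d (t - T / 2)" for t
    define B where "B = plateau (- k) k k"
    define Z where "Z = plateau C0 j (C0 / 4)"
    have A_bump: "bump_on ep (T - \<theta>) A"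
    proof -
      have s1: "smooth (\<lambda>t. step_at ep (1 * t + (- 2 * ep)))" "smooth (\<lambda>t. step_at d (1 * t + (- T / 2)))"
        by (rule smooth_affine_real[OF smooth_step_at])+
      have "smooth A" unfolding A_def[abs_def] by (intro smooth_mult smooth_add smooth_diff smooth_const) (use s1 in simp_all)
      moreover have "A t = 0" if "t \<notin> {ep..T - \<theta>}" for t
        using that ep d step_at_left[of ep "t - 2 * ep"] step_at_right[of d "t - T / 2"] by (auto simp: A_def d_def)
      ultimately show ?thesis by (auto simp: bump_on_def)
    qed
    have A_range: "0 \<le> A t" "A t \<le> 1" for t
    proof -
      have *: "\<bar>step_at c y\<bar> \<le> 1/2" for c y by (rule step_at_abs)
      have 1: "0 \<le> 1/2 + step_at ep (t - 2 * ep)" "1/2 + step_at ep (t - 2 * ep) \<le> 1" using *[of ep "t - 2 * ep"] by linarith+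
      have 2: "0 \<le> 1/2 - step_at d (t - T / 2)" "1/2 - step_at d (t - T / 2) \<le> 1" using *[of d "t - T / 2"] by linarith+
      show "0 \<le> A t" unfolding A_def by (intro mult_nonneg_nonneg 1 2)
      show "A t \<le> 1" unfolding A_def using mult_mono[OF 1(2) 2(2)] 1 2 by simp
    qed
    have dA: "deriv A t = A' t" for t
    proof -
      have "(A has_real_derivative moll ep (t - 2 * ep) * (1/2 - step_at d (t - T / 2)) - (1/2 + step_at ep (t - 2 * ep)) * moll d (t - T / 2)) (at t)"
        unfolding A_def[abs_def]
        by (rule DERIV_cong[OF DERIV_mult[OF DERIV_add[OF DERIV_const DERIV_chain2[OF step_at_deriv]] DERIV_diff[OF DERIV_const DERIV_chain2[OF step_at_deriv]]]])
           (use ep d in \<open>auto intro!: derivative_eq_intros\<close>)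
      moreover have "moll ep (t - 2 * ep) * (1/2 - step_at d (t - T / 2)) = moll ep (t - 2 * ep)"
      proof (cases "\<bar>t - 2 * ep\<bar> < ep")
        case True
        then have "t - T / 2 \<le> - d" using ep by (auto simp: d_def)
        then show ?thesis using step_at_left[OF d, of "t - T / 2"] by simp
      next
        case False
        then show ?thesis using moll_outside[OF ep(1), of "t - 2 * ep"] by simp
      qed
      moreover have "(1/2 + step_at ep (t - 2 * ep)) * moll d (t - T / 2) = moll d (t - T / 2)"
      proof (cases "\<bar>t - T / 2\<bar> < d")
        case True
        then have "ep \<le> t - 2 * ep" using ep by (auto simp: d_def)
        then show ?thesis using step_at_right[OF ep(1), of "t - 2 * ep"] by simp
      next
        case False
        then show ?thesis using moll_outside[OF d, of "t - T / 2"] by simp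
      qed
      ultimately show ?thesis by (simp add: A'_def DERIV_imp_deriv)
    qed
    have B_bump: "bump_on (- k - 2 * k) (k + 2 * k) B" unfolding B_def by (rule plateau_bump) (rule k)
    have B_range: "0 \<le> B x" "B x \<le> 1" for x unfolding B_def by (rule plateau_range)+
    have dB: "\<bar>deriv B x\<bar> \<le> 2 * Km / k" for x
    proof -
      have d: "deriv B x = moll k (x - (- k - k)) * (1/2 - step_at k (x - (k + k))) - (1/2 + step_at k (x - (- k - k))) * moll k (x - (k + k))"
        unfolding B_def plateau_def[abs_def]
        by (rule DERIV_imp_deriv, rule DERIV_cong[OF DERIV_mult[OF DERIV_add[OF DERIV_const DERIV_chain2[OF step_at_deriv]] DERIV_diff[OF DERIV_const DERIV_chain2[OF step_at_deriv]]]])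
           (use k in \<open>auto intro!: derivative_eq_intros\<close>)
      have *: "\<bar>step_at c y\<bar> \<le> 1/2" for c y by (rule step_at_abs)
      have 1: "\<bar>1/2 + step_at k (x - (- k - k))\<bar> \<le> 1" "\<bar>1/2 - step_at k (x - (k + k))\<bar> \<le> 1"
        using *[of k "x - (- k - k)"] *[of k "x - (k + k)"] by linarith+
      have "\<bar>deriv B x\<bar> \<le> \<bar>moll k (x - (- k - k)) * (1/2 - step_at k (x - (k + k)))\<bar> + \<bar>(1/2 + step_at k (x - (- k - k))) * moll k (x - (k + k))\<bar>"
        unfolding d by (rule abs_triangle_ineq4)
      also have "\<dots> \<le> Km / k * 1 + 1 * (Km / k)"
        unfolding abs_mult using mollk[OF k(2)] 1 Km(1) k(2) by (intro add_mono mult_mono) auto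
      finally show ?thesis by simp
    qed
    have Z_bump: "bump_on (C0 - 2 * (C0 / 4)) (j + 2 * (C0 / 4)) Z" unfolding Z_def by (rule plateau_bump) (use C in simp)
    have Z_range: "0 \<le> Z x" "Z x \<le> 1" for x unfolding Z_def by (rule plateau_range)+
    have Z1: "Z v = 1" if "C0 \<le> v" "v \<le> j" for v unfolding Z_def using that C by (intro plateau_eq_1) auto
    have meas[measurable]: "A \<in> borel_measurable borel" "B \<in> borel_measurable borel" "Z \<in> borel_measurable borel"
      "deriv B \<in> borel_measurable borel" "deriv Z \<in> borel_measurable borel" "A' \<in> borel_measurable borel"
      by (rule bump_on_measurable, rule A_bump B_bump Z_bump bump_on_deriv[OF B_bump] bump_on_deriv[OF Z_bump])+
        (unfold A'_def[abs_def], measurable)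
    define E where "E t v = rise C0 (v - C1 * t)" for t v
    define E' where "E' t v = rise' C0 (v - C1 * t)" for t v
    let ?V = "\<lambda>t x. (\<integral>\<^sup>+v. ennreal (hf (t, x, v) * (E' t v * Z v)) \<partial>lborel)"
    have E_range: "0 \<le> E t v" "E t v \<le> 1" for t v by (simp_all add: E_def rise_range)
    have E_meas[measurable]: "(\<lambda>p. E (a p) (b p)) \<in> borel_measurable N" "(\<lambda>p. E' (a p) (b p)) \<in> borel_measurable N"
      if [measurable]: "a \<in> borel_measurable N" "b \<in> borel_measurable N" for a b and N :: "'z measure"
      unfolding E_def E'_def by measurable
    obtain KE where KE0: "0 \<le> KE" "\<And>x. \<bar>moll (1/2) x\<bar> \<le> KE" using moll_bound[of "1/2"] by auto
    have KE: "0 \<le> KE" "\<And>t v. \<bar>E' t v\<bar> \<le> KE" using KE0 by (auto simp: E'_def rise'_def)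
    have hfle: "\<bar>hf p * y\<bar> \<le> \<bar>y\<bar>" for p y using mult_right_mono[OF hf_abs[of p], of "\<bar>y\<bar>"] by (simp add: abs_mult)
    have E_0: "E t v = 0" if "0 \<le> t" "v \<le> C0" for t v
    proof -
      have "0 \<le> C1 * t" using that C by simp
      then show ?thesis unfolding E_def using that by (intro rise_0) linarith
    qed
    \<comment> \<open>The parts of the left-hand side: \<open>F1\<close> from the rise of the time
      cut-off, \<open>F2\<close> from its fall, \<open>F3\<close> from the motion of the threshold,
      \<open>F4\<close> from the flux through the spatial cut-off.\<close>
    define F1 where "F1 = (\<lambda>(t, x, v). hf (t, x, v) * (moll ep (t - 2 * ep) * B x * (E t v * Z v)))"
    define F2 where "F2 = (\<lambda>(t, x, v). hf (t, x, v) * (moll d (t - T / 2) * B x * (E t v * Z v)))"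
    define F3 where "F3 = (\<lambda>(t, x, v). hf (t, x, v) * (A t * B x * (E' t v * Z v)))"
    define F4 where "F4 = (\<lambda>(t, x, v). hf (t, x, v) * (A t * deriv B x * (flux v * (E t v * Z v))))"
    have mi: "integrable lborel (\<lambda>t. moll c (t - z))" if "0 < c" for c z
      by (rule integrable_nnI[of _ _ 1]) (use that moll_nonneg[OF that] nn_integral_translate[of "\<lambda>t. ennreal (moll c t)" "- z"] nn_integral_moll[OF that] in auto)
    note bi = bump_on_integrable[OF A_bump] bump_on_integrable[OF B_bump] bump_on_integrable[OF Z_bump] bump_on_integrable[OF bump_on_deriv[OF B_bump]]
      integrable_flux_bump[OF Z_bump]
    have hfE: "\<bar>hf p * E (fst p) (snd (snd p))\<bar> \<le> 1" "\<bar>hf p * E' (fst p) (snd (snd p))\<bar> \<le> KE" for p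
      using order_trans[OF hfle KE(2)] order_trans[OF hfle, of "E (fst p) (snd (snd p))" 1 p] E_range by auto
    have hfE_m: "(\<lambda>p. hf p * E (fst p) (snd (snd p))) \<in> borel_measurable borel" "(\<lambda>p. hf p * E' (fst p) (snd (snd p))) \<in> borel_measurable borel"
      by measurable
    have i1: "integrable lborel F1"
      using integrable_weighted_tensor3[OF mi[OF ep(1), of "2 * ep"] bi(2,3) hfE_m(1) hfE(1)] unfolding F1_def by (simp add: ac_simps)
    have i2: "integrable lborel F2"
      using integrable_weighted_tensor3[OF mi[OF d, of "T / 2"] bi(2,3) hfE_m(1) hfE(1)] unfolding F2_def by (simp add: ac_simps)
    have i3: "integrable lborel F3"
      using integrable_weighted_tensor3[OF bi(1,2,3) hfE_m(2) hfE(2)] unfolding F3_def by (simp add: ac_simps)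
    have i4: "integrable lborel F4"
      using integrable_weighted_tensor3[OF bi(1,4) bi(5) hfE_m(1) hfE(1)] C unfolding F4_def by (simp add: ac_simps)
    define G5 where "G5 = (\<lambda>(t, x, v). A t * B x * (E' t v * Z v))"
    define G6 where "G6 = (\<lambda>(t, x, v). A t * B x * (E t v * deriv Z v))"
    have AB: "\<bar>A t * B x\<bar> \<le> 1" for t x using A_range[of t] B_range[of x] by (auto simp: abs_mult intro!: mult_le_one)
    have m5: "integrable m G5"
    proof (rule integrable_abs_le[OF integrable_m[OF bi(3)], of _ KE])
      show "G5 \<in> borel_measurable m" unfolding G5_def by measurable
      show "\<bar>G5 p\<bar> \<le> KE * \<bar>case p of (t, x, v) \<Rightarrow> Z v\<bar>" for p
      proof (cases p)
        case (fields t x v)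
        have "\<bar>G5 p\<bar> \<le> 1 * (KE * \<bar>Z v\<bar>)" unfolding G5_def fields split_conv abs_mult[of "A t * B x"] abs_mult[of "E' t v"]
          by (intro mult_mono AB KE) auto
        then show ?thesis by (simp add: fields)
      qed
    qed
    have m6: "integrable m G6"
    proof (rule integrable_abs_le[OF integrable_m[OF bump_on_integrable[OF bump_on_deriv[OF Z_bump]]], of _ 1])
      show "G6 \<in> borel_measurable m" unfolding G6_def by measurable
      show "\<bar>G6 p\<bar> \<le> 1 * \<bar>case p of (t, x, v) \<Rightarrow> deriv Z v\<bar>" for p
      proof (cases p)
        case (fields t x v)
        have "\<bar>G6 p\<bar> \<le> 1 * (1 * \<bar>deriv Z v\<bar>)" unfolding G6_def fields split_conv abs_mult[of "A t * B x"] abs_mult[of "E t v"]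
          using E_range by (intro mult_mono AB) auto
        then show ?thesis by (simp add: fields)
      qed
    qed
    define H7 where "H7 = (\<lambda>(t, x). S (t, x) * A t * B x * E t (U (t, x)) * Z (U (t, x)))"
    have identity: "(\<integral>p. F1 p \<partial>lborel) - (\<integral>p. F2 p \<partial>lborel) - C1 * (\<integral>p. F3 p \<partial>lborel) + (\<integral>p. F4 p \<partial>lborel)
      = (\<integral>p. G5 p \<partial>m) + (\<integral>p. G6 p \<partial>m) - (\<integral>z. H7 z \<partial>lborel)"
    proof -
      have dE: "deriv (rise C0) = rise' C0" using rise_DERIV by (intro ext DERIV_imp_deriv)
      have w: "(LINT (t, x, v)|lborel. (if 0 < v \<and> v < U (t, x) then 1 else 0) *
          ((deriv A t * rise C0 (v - C1 * t) - C1 * A t * deriv (rise C0) (v - C1 * t)) * B x * Z v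
            + sg * (l + 1) * \<bar>v\<bar> powr l * A t * deriv B x * rise C0 (v - C1 * t) * Z v))
      = (LINT (t, x, v)|m. A t * B x * (deriv (rise C0) (v - C1 * t) * Z v + rise C0 (v - C1 * t) * deriv Z v))
        - (LINT (t, x)|lborel. S (t, x) * A t * B x * rise C0 (U (t, x) - C1 * t) * Z (U (t, x)))"
        by (rule weak[OF A_bump ep(1) _ B_bump smooth_rise Z_bump]) (use T\<theta> C in auto)
      have "(\<integral>p. F1 p \<partial>lborel) - (\<integral>p. F2 p \<partial>lborel) - C1 * (\<integral>p. F3 p \<partial>lborel) + (\<integral>p. F4 p \<partial>lborel)
        = (\<integral>p. F1 p - F2 p - C1 * F3 p + F4 p \<partial>lborel)" using i1 i2 i3 i4 by simp
      also have "\<dots> = (LINT (t, x, v)|lborel. (if 0 < v \<and> v < U (t, x) then 1 else 0) *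
          ((deriv A t * rise C0 (v - C1 * t) - C1 * A t * deriv (rise C0) (v - C1 * t)) * B x * Z v
            + sg * (l + 1) * \<bar>v\<bar> powr l * A t * deriv B x * rise C0 (v - C1 * t) * Z v))"
        by (intro Bochner_Integration.integral_cong refl)
           (auto simp: F1_def F2_def F3_def F4_def hf_def flux_def dA A'_def dE E_def E'_def algebra_simps)
      also note w
      also have "(LINT (t, x, v)|m. A t * B x * (deriv (rise C0) (v - C1 * t) * Z v + rise C0 (v - C1 * t) * deriv Z v)) = (\<integral>p. G5 p + G6 p \<partial>m)"
        by (intro Bochner_Integration.integral_cong refl) (auto simp: G5_def G6_def E_def E'_def dE algebra_simps)
      also have "\<dots> = (\<integral>p. G5 p \<partial>m) + (\<integral>p. G6 p \<partial>m)" using m5 m6 by simp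
      finally show ?thesis by (simp add: H7_def E_def)
    qed
    have b1: "(\<integral>p. F1 p \<partial>lborel) \<le> \<eta> / 4"
    proof (rule integral_real_bounded)
      have "(\<integral>\<^sup>+p. ennreal (F1 p) \<partial>lborel) \<le> (\<integral>\<^sup>+(t, x, v). ennreal (moll ep (t - 2 * ep)) * (ennreal (hf (t, x, v)) * indicator {C0<..} v) \<partial>lborel)"
      proof (intro nn_integral_mono, clarify)
        fix t x v
        have m0: "0 \<le> moll ep (t - 2 * ep)" by (rule moll_nonneg[OF ep(1)])
        show "ennreal (F1 (t, x, v)) \<le> ennreal (moll ep (t - 2 * ep)) * (ennreal (hf (t, x, v)) * indicator {C0<..} v)"
        proof (cases "v \<le> C0 \<and> 0 < moll ep (t - 2 * ep)")
          case True
          have "0 \<le> t" using True moll_outside[OF ep(1), of "t - 2 * ep"] ep by (cases "ep \<le> \<bar>t - 2 * ep\<bar>") auto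
          then have "E t v = 0" using True by (intro E_0) auto
          then show ?thesis by (simp add: F1_def)
        next
          case False
          then consider "C0 < v" | "moll ep (t - 2 * ep) = 0" using m0 by linarith
          then show ?thesis
          proof cases
            case 1
            have "B x * (E t v * Z v) \<le> 1" using B_range E_range Z_range by (intro mult_le_one mult_nonneg_nonneg) auto
            then have "(moll ep (t - 2 * ep) * hf (t, x, v)) * (B x * (E t v * Z v)) \<le> (moll ep (t - 2 * ep) * hf (t, x, v)) * 1"
              using m0 hf_range by (intro mult_left_mono) auto
            then have "F1 (t, x, v) \<le> moll ep (t - 2 * ep) * hf (t, x, v)" by (simp add: F1_def ac_simps)
            then show ?thesis using 1 m0 hf_range by (simp flip: ennreal_mult add: ennreal_leI)
          next
            case 2 then show ?thesis by (simp add: F1_def)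
          qed
        qed
      qed
      also have "\<dots> = (\<integral>\<^sup>+t. \<integral>\<^sup>+x. \<integral>\<^sup>+v. ennreal (moll ep (t - 2 * ep)) * (ennreal (hf (t, x, v)) * indicator {C0<..} v) \<partial>lborel \<partial>lborel \<partial>lborel)"
        by (rule nn_integral_lborel_split3) measurable
      also have "\<dots> = (\<integral>\<^sup>+t. ennreal (moll ep (t - 2 * ep)) * (\<integral>\<^sup>+x. ennreal (U (t, x) - C0) \<partial>lborel) \<partial>lborel)"
        using C by (simp add: nn_integral_cmult hf_nn_v)
      also have "\<dots> \<le> (\<integral>\<^sup>+t. ennreal (moll ep (t - 2 * ep)) * ennreal (\<eta>/4) \<partial>lborel)"
      proof (rule nn_integral_mono_AE, use \<tau>(2) in eventually_elim)
        fix t assume *: "0 < t \<and> t < \<tau> \<longrightarrow> (\<integral>\<^sup>+x. ennreal (U (t, x) - C0) \<partial>lborel) \<le> ennreal (\<eta>/4)"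
        show "ennreal (moll ep (t - 2 * ep)) * (\<integral>\<^sup>+x. ennreal (U (t, x) - C0) \<partial>lborel) \<le> ennreal (moll ep (t - 2 * ep)) * ennreal (\<eta>/4)"
        proof (cases "\<bar>t - 2 * ep\<bar> < ep")
          case True
          then have "0 < t \<and> t < \<tau>" using ep by auto
          then show ?thesis using * by (intro mult_left_mono) auto
        next
          case False
          then show ?thesis using moll_outside[OF ep(1), of "t - 2 * ep"] by simp
        qed
      qed
      also have "\<dots> = ennreal (\<eta>/4)"
        using nn_integral_translate[of "\<lambda>t. ennreal (moll ep t)" "- 2 * ep"] nn_integral_moll[OF ep(1)] by (simp add: nn_integral_multc)
      finally show "(\<integral>\<^sup>+p. ennreal (F1 p) \<partial>lborel) \<le> ennreal (\<eta> / 4)" .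
    qed (use \<eta> in auto)
    have b4: "\<bar>\<integral>p. F4 p \<partial>lborel\<bar> \<le> \<eta> / 4"
    proof -
      have "\<bar>\<integral>p. F4 p \<partial>lborel\<bar> \<le> 2 * Km / k * aj * NU"
      proof (rule abs_integral_leI)
        have "(\<integral>\<^sup>+p. ennreal \<bar>F4 p\<bar> \<partial>lborel) \<le> (\<integral>\<^sup>+(t, x, v). ennreal (2 * Km / k * aj) * (ennreal (hf (t, x, v)) * indicator {0<..} v) \<partial>lborel)"
        proof (intro nn_integral_mono, clarify)
          fix t x v
          have fz: "\<bar>flux v * (E t v * Z v)\<bar> \<le> aj"
          proof (cases "v \<in> {C0 - 2 * (C0 / 4)..j + 2 * (C0 / 4)}")
            case True
            have "\<bar>flux v\<bar> \<le> (l + 1) * (j + 2 * (C0 / 4)) powr l" using flux_bound[of "C0 - 2 * (C0 / 4)" v "j + 2 * (C0 / 4)"] True C by auto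
            also have "\<dots> \<le> aj" unfolding aj_def using l_ge_1 C j by (intro mult_left_mono powr_mono2) auto
            finally have "\<bar>flux v\<bar> * \<bar>E t v * Z v\<bar> \<le> aj * 1" using E_range Z_range by (intro mult_mono) (auto simp: abs_mult intro!: mult_le_one)
            then show ?thesis by (simp add: abs_mult)
          next
            case False
            then show ?thesis using bump_onD(2)[OF Z_bump False] aj by simp
          qed
          have "\<bar>F4 (t, x, v)\<bar> = hf (t, x, v) * ((A t * \<bar>deriv B x\<bar>) * \<bar>flux v * (E t v * Z v)\<bar>)"
            using A_range hf_range by (simp add: F4_def abs_mult)
          also have "\<dots> \<le> hf (t, x, v) * ((1 * (2 * Km / k)) * aj)"
            using A_range hf_range dB fz aj Km(1) k(2) by (intro mult_left_mono mult_mono) auto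
          finally have "\<bar>F4 (t, x, v)\<bar> \<le> 2 * Km / k * aj * hf (t, x, v)" by (simp add: ac_simps)
          then show "ennreal \<bar>F4 (t, x, v)\<bar> \<le> ennreal (2 * Km / k * aj) * (ennreal (hf (t, x, v)) * indicator {0<..} v)"
            using aj Km(1) k(2) hf_range[of "(t, x, v)"] by (cases "0 < v") (auto simp: hf_def ennreal_mult'[symmetric] intro!: ennreal_leI)
        qed
        also have "\<dots> = (\<integral>\<^sup>+t. \<integral>\<^sup>+x. \<integral>\<^sup>+v. ennreal (2 * Km / k * aj) * (ennreal (hf (t, x, v)) * indicator {0<..} v) \<partial>lborel \<partial>lborel \<partial>lborel)"
          by (rule nn_integral_lborel_split3) measurable
        also have "\<dots> = ennreal (2 * Km / k * aj) * (\<integral>\<^sup>+t. \<integral>\<^sup>+x. ennreal (U (t, x)) \<partial>lborel \<partial>lborel)"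
          by (simp add: nn_integral_cmult hf_nn_v)
        also have "\<dots> = ennreal (2 * Km / k * aj) * (\<integral>\<^sup>+z. ennreal (U z) \<partial>lborel)"
          by (subst nn_integral_lborel_prod) auto
        also have "\<dots> \<le> ennreal (2 * Km / k * aj) * ennreal NU" by (intro mult_left_mono NU) auto
        also have "\<dots> = ennreal (2 * Km / k * aj * NU)" using aj Km(1) k(2) NU by (simp flip: ennreal_mult)
        finally show "(\<integral>\<^sup>+p. ennreal \<bar>F4 p\<bar> \<partial>lborel) \<le> ennreal (2 * Km / k * aj * NU)" .
      qed (use aj Km(1) k(2) NU in auto)
      also have "\<dots> \<le> \<eta> / 4" using k \<eta> by (simp add: field_simps)
      finally show ?thesis .
    qed
    \<comment> \<open>Here the sign of \<open>m\<close> enters: \<open>E\<close> increases with v,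
      so the v-derivative falling on it gives a nonnegative term.\<close>
    have b5: "0 \<le> (\<integral>p. G5 p \<partial>m)"
      using A_range B_range Z_range rise'_nonneg by (intro integral_nonneg_AE AE_I2) (auto simp: G5_def E'_def)
    have b6: "\<bar>\<integral>p. G6 p \<partial>m\<bar> \<le> \<eta> / 4"
    proof (rule abs_integral_leI)
      define g where "g v = ennreal \<bar>deriv Z v\<bar> * indicator {j<..} v" for v
      have [measurable]: "g \<in> borel_measurable borel" unfolding g_def by measurable
      have dZ0: "deriv Z v = 0" if "C0 < v" "v < j" for v
      proof -
        have "\<forall>\<^sub>F y in nhds v. y \<in> {C0<..<j}" using that by (intro eventually_nhds_in_open) auto
        then have "\<forall>\<^sub>F y in nhds v. 1 = Z y" by eventually_elim (use Z1 in auto)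
        then have "((\<lambda>_. 1) has_real_derivative deriv Z v) (at v)"
          using DERIV_cong_ev[OF refl _ refl, of "\<lambda>_. 1" Z v] bump_on_DERIV[OF Z_bump] by auto
        then show ?thesis using DERIV_unique[OF _ DERIV_const] by blast
      qed
      \<comment> \<open>At v = j, where \<open>Z\<close> stops being constant, the derivative
        vanishes because \<open>Z\<close> attains its maximum there.\<close>
      have dZj: "deriv Z j = 0"
      proof (rule DERIV_local_max[OF bump_on_DERIV[OF Z_bump], of 1])
        show "\<forall>y. \<bar>j - y\<bar> < 1 \<longrightarrow> Z y \<le> Z j" using Z1[of j] j Z_range by auto
      qed simp
      have "(\<integral>\<^sup>+p. ennreal \<bar>G6 p\<bar> \<partial>m) \<le> (\<integral>\<^sup>+(t, x, v). g v \<partial>m)"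
      proof (intro nn_integral_mono, clarify)
        fix t x v
        show "ennreal \<bar>G6 (t, x, v)\<bar> \<le> g v"
        proof (cases "A t = 0 \<or> v \<le> C0 \<or> v \<le> j")
          case True
          have "G6 (t, x, v) = 0"
          proof (cases "A t = 0")
            case False
            then have t: "0 \<le> t" using bump_onD(2)[OF A_bump, of t] ep by fastforce
            show ?thesis
            proof (cases "v \<le> C0")
              case True
              then have "E t v = 0" using t True by (intro E_0)
              then show ?thesis by (simp add: G6_def)
            next
              case vC: False
              then have "deriv Z v = 0" using True False dZ0[of v] dZj by (cases "v = j") auto
              then show ?thesis by (simp add: G6_def)
            qed
          qed (simp add: G6_def)
          then show ?thesis by simp
        next
          case False
          have "\<bar>G6 (t, x, v)\<bar> \<le> 1 * (1 * \<bar>deriv Z v\<bar>)" unfolding G6_def split_conv abs_mult[of "A t * B x"] abs_mult[of "E t v"]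
            using E_range by (intro mult_mono AB) auto
          then show ?thesis using False by (simp add: g_def ennreal_leI)
        qed
      qed
      also have "\<dots> \<le> ennreal (\<eta>/8) * (\<integral>\<^sup>+v. g v \<partial>lborel)" by (rule R) (use j in \<open>auto simp: g_def\<close>)
      also have "\<dots> \<le> ennreal (\<eta>/8) * (\<integral>\<^sup>+v. ennreal \<bar>deriv Z v\<bar> \<partial>lborel)"
        by (intro mult_left_mono nn_integral_mono) (auto simp: g_def indicator_def)
      also have "\<dots> \<le> ennreal (\<eta>/8) * ennreal 2"
        unfolding Z_def by (intro mult_left_mono nn_plateau_deriv) (use C in auto)
      also have "\<dots> = ennreal (\<eta>/8 * 2)" by (rule ennreal_mult[symmetric]) (use \<eta> in auto)
      also have "\<eta>/8 * 2 = \<eta> / 4" by simp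
      finally show "(\<integral>\<^sup>+p. ennreal \<bar>G6 p\<bar> \<partial>m) \<le> ennreal (\<eta> / 4)" .
    qed (use \<eta> in auto)
    \<comment> \<open>The motion of the threshold pays for the source: \<open>E t (U z)\<close> is
      the integral of \<open>E'\<close> over 0 < v < U, that is, the velocity integral in
      \<open>F3\<close>, because \<open>Z\<close> equals 1 wherever \<open>E'\<close> is
      nonzero.\<close>
    have b37: "(\<integral>z. H7 z \<partial>lborel) \<le> C1 * (\<integral>p. F3 p \<partial>lborel)"
    proof (rule integral_real_bounded)
      have F30: "0 \<le> F3 p" for p using A_range B_range Z_range rise'_nonneg hf_range by (auto simp: F3_def E'_def split: prod.splits)
      have vint: "ennreal (E t (U (t, x))) \<le> ?V t x" if t: "0 < t" "t < T" for t x
      proof (cases "U (t, x) \<le> 0")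
        case True
        have "U (t, x) - C1 * t \<le> C0" using True t C mult_nonneg_nonneg[of C1 t] by linarith
        then have "E t (U (t, x)) = 0" by (simp add: E_def rise_0)
        then show ?thesis by simp
      next
        case False
        have dv: "((\<lambda>v. E t v) has_real_derivative E' t v) (at v)" for v
          unfolding E_def E'_def by (rule DERIV_cong[OF DERIV_chain2[OF rise_DERIV]]) (auto intro!: derivative_eq_intros)
        have "(\<integral>\<^sup>+v. ennreal (E' t v) * indicator {0..U (t, x)} v \<partial>lborel) = ennreal (E t (U (t, x)) - E t 0)"
          by (rule nn_integral_FTC_Icc) (use False rise'_nonneg in \<open>auto simp: E'_def intro: has_field_derivative_at_within[OF dv, unfolded E'_def]\<close>)
        also have "E t 0 = 0" using t C by (intro E_0) auto
        finally have "ennreal (E t (U (t, x))) = (\<integral>\<^sup>+v. ennreal (E' t v) * indicator {0..U (t, x)} v \<partial>lborel)" by simp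
        also have "\<dots> \<le> ?V t x"
        proof (rule nn_integral_mono_AE, use AE_lborel_singleton[of 0] AE_lborel_singleton[of "U (t, x)"] in eventually_elim)
          fix v assume v: "v \<noteq> 0" "v \<noteq> U (t, x)"
          show "ennreal (E' t v) * indicator {0..U (t, x)} v \<le> ennreal (hf (t, x, v) * (E' t v * Z v))"
          proof (cases "v \<in> {0..U (t, x)} \<and> E' t v \<noteq> 0")
            case True
            then have h1: "hf (t, x, v) = 1" using v by (auto simp: hf_def)
            have "\<not> (v - C1 * t \<le> C0 \<or> C0 + 1 \<le> v - C1 * t)" using True rise'_outside[of "v - C1 * t" C0] by (auto simp: E'_def)
            then have "C0 < v - C1 * t" "v - C1 * t < C0 + 1" by auto
            moreover have "0 \<le> C1 * t" "C1 * t \<le> C1 * T" using t C by (auto intro!: mult_left_mono)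
            ultimately have "C0 \<le> v" "v \<le> j" using j unfolding M_def by linarith+
            then show ?thesis using True h1 Z1 by simp
          qed auto
        qed
        finally show ?thesis .
      qed
      have "(\<integral>\<^sup>+z. ennreal (H7 z) \<partial>lborel) \<le> (\<integral>\<^sup>+(t, x). ennreal (C1 * (A t * B x)) * ?V t x \<partial>lborel)"
      proof (rule nn_integral_mono_AE, use S_le in eventually_elim)
        fix z :: "real \<times> real" assume Sz: "S z \<le> C1"
        obtain t x where z: "z = (t, x)" by (cases z)
        show "ennreal (H7 z) \<le> (case z of (t, x) \<Rightarrow> ennreal (C1 * (A t * B x)) * ?V t x)"
        proof (cases "A t = 0")
          case True
          then show ?thesis by (simp add: H7_def z)
        next
          case False
          then have t: "0 < t" "t < T" using bump_onD(2)[OF A_bump, of t] ep T\<theta> by fastforce+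
          have "S z * Z (U z) \<le> C1"
          proof -
            have "S z * Z (U z) \<le> C1 * Z (U z)" using Sz Z_range by (intro mult_right_mono) auto
            also have "\<dots> \<le> C1 * 1" using C Z_range by (intro mult_left_mono) auto
            finally show ?thesis by simp
          qed
          then have "(A t * B x * E t (U z)) * (S z * Z (U z)) \<le> (A t * B x * E t (U z)) * C1"
            using A_range B_range E_range by (intro mult_left_mono mult_nonneg_nonneg) auto
          then have "H7 z \<le> C1 * (A t * B x) * E t (U z)" by (simp add: H7_def z ac_simps)
          then have "ennreal (H7 z) \<le> ennreal (C1 * (A t * B x)) * ennreal (E t (U z))"
            using C A_range B_range E_range by (subst ennreal_mult[symmetric]) (auto intro!: ennreal_leI)
          also have "\<dots> \<le> ennreal (C1 * (A t * B x)) * ?V t x"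
            using vint[OF t, of x] by (intro mult_left_mono) (auto simp: z)
          finally show ?thesis by (simp add: z)
        qed
      qed
      also have "\<dots> = (\<integral>\<^sup>+t. \<integral>\<^sup>+x. \<integral>\<^sup>+v. ennreal C1 * ennreal (F3 (t, x, v)) \<partial>lborel \<partial>lborel \<partial>lborel)"
      proof -
        have m: "(\<lambda>(t, x). ennreal (C1 * (A t * B x)) * ?V t x) \<in> borel_measurable borel" by measurable
        have "ennreal (C1 * (A t * B x)) * ?V t x = (\<integral>\<^sup>+v. ennreal C1 * ennreal (F3 (t, x, v)) \<partial>lborel)" for t x
        proof -
          have "ennreal (C1 * (A t * B x)) * ?V t x = (\<integral>\<^sup>+v. ennreal (C1 * (A t * B x)) * ennreal (hf (t, x, v) * (E' t v * Z v)) \<partial>lborel)"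
            by (rule nn_integral_cmult[symmetric]) measurable
          also have "\<dots> = (\<integral>\<^sup>+v. ennreal C1 * ennreal (F3 (t, x, v)) \<partial>lborel)"
          proof (intro nn_integral_cong)
            fix v
            have "0 \<le> hf (t, x, v) * (E' t v * Z v)" using hf_range Z_range rise'_nonneg by (simp add: E'_def)
            then have "ennreal (C1 * (A t * B x)) * ennreal (hf (t, x, v) * (E' t v * Z v)) = ennreal (C1 * F3 (t, x, v))"
              using C A_range B_range by (simp add: F3_def ac_simps flip: ennreal_mult)
            also have "\<dots> = ennreal C1 * ennreal (F3 (t, x, v))" using C F30 by (intro ennreal_mult) auto
            finally show "ennreal (C1 * (A t * B x)) * ennreal (hf (t, x, v) * (E' t v * Z v)) = ennreal C1 * ennreal (F3 (t, x, v))" .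
          qed
          finally show ?thesis .
        qed
        then show ?thesis unfolding nn_integral_lborel_prod[OF m] by (simp only: split_conv)
      qed
      also have "\<dots> = (\<integral>\<^sup>+p. ennreal C1 * ennreal (F3 p) \<partial>lborel)"
      proof -
        have [measurable]: "F3 \<in> borel_measurable borel" using i3 by auto
        show ?thesis by (rule nn_integral_lborel3[symmetric]) measurable
      qed
      also have "\<dots> = ennreal C1 * ennreal (\<integral>p. F3 p \<partial>lborel)"
      proof -
        have [measurable]: "F3 \<in> borel_measurable borel" using i3 by auto
        show ?thesis using i3 F30 by (subst nn_integral_cmult) (auto simp: nn_integral_eq_integral)
      qed
      also have "\<dots> = ennreal (C1 * (\<integral>p. F3 p \<partial>lborel))" using C F30 by (intro ennreal_mult[symmetric] integral_nonneg_AE) auto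
      finally show "(\<integral>\<^sup>+z. ennreal (H7 z) \<partial>lborel) \<le> ennreal (C1 * (\<integral>p. F3 p \<partial>lborel))" .
      show "0 \<le> C1 * (\<integral>p. F3 p \<partial>lborel)" using C F30 by (intro mult_nonneg_nonneg integral_nonneg_AE) auto
    qed
    have F2le: "(\<integral>p. F2 p \<partial>lborel) \<le> \<eta>"
      using identity b1 b4 b5 b6 b37 \<eta> by linarith
    have F20: "0 \<le> F2 p" for p using moll_nonneg[OF d] B_range Z_range E_range hf_range by (auto simp: F2_def split: prod.splits)
    have "(\<integral>\<^sup>+(t, x). ennreal (moll d (t - T / 2)) * indicator {-X..X} x * indicator {z. M < U z} (t, x) \<partial>lborel)
      = (\<integral>\<^sup>+t. \<integral>\<^sup>+x. ennreal (moll d (t - T / 2)) * indicator {-X..X} x * indicator {z. M < U z} (t, x) \<partial>lborel \<partial>lborel)"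
      by (rule nn_integral_lborel_split2) measurable
    also have "\<dots> \<le> (\<integral>\<^sup>+t. \<integral>\<^sup>+x. \<integral>\<^sup>+v. ennreal (F2 (t, x, v)) \<partial>lborel \<partial>lborel \<partial>lborel)"
    proof (intro nn_integral_mono)
      fix t x
      show "ennreal (moll d (t - T / 2)) * indicator {-X..X} x * indicator {z. M < U z} (t, x) \<le> (\<integral>\<^sup>+v. ennreal (F2 (t, x, v)) \<partial>lborel)"
      proof (cases "x \<in> {-X..X} \<and> M < U (t, x) \<and> \<bar>t - T / 2\<bar> < d")
        case False
        then have "ennreal (moll d (t - T / 2)) * indicator {-X..X} x * indicator {z. M < U z} (t, x) = 0"
          using moll_outside[OF d, of "t - T / 2"] by (auto simp: indicator_def)
        then show ?thesis by (simp only: zero_le)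
      next
        case True
        then have t: "0 < t" "t < T" using T\<theta> by (auto simp: d_def abs_less_iff)
        have CT: "0 \<le> C1 * t" "C1 * t \<le> C1 * T" "0 \<le> C1 * T" using t C by (auto intro!: mult_left_mono)
        have "ennreal (moll d (t - T / 2)) * indicator {-X..X} x * indicator {z. M < U z} (t, x) = (\<integral>\<^sup>+v. ennreal (moll d (t - T / 2)) * indicator {M - 1<..<M} v \<partial>lborel)"
          using True by (simp add: nn_integral_cmult_indicator)
        also have "\<dots> \<le> (\<integral>\<^sup>+v. ennreal (F2 (t, x, v)) \<partial>lborel)"
        proof (intro nn_integral_mono)
          fix v
          show "ennreal (moll d (t - T / 2)) * indicator {M - 1<..<M} v \<le> ennreal (F2 (t, x, v))"
          proof (cases "v \<in> {M - 1<..<M}")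
            case v: True
            have "0 < v" "C0 \<le> v" "C0 + 1 \<le> v - C1 * t" using v CT C unfolding M_def by auto
            moreover have "v < U (t, x)" "v \<le> j" using v True j by auto
            moreover have "B x = 1" unfolding B_def using True k by (intro plateau_eq_1) auto
            ultimately have "F2 (t, x, v) = moll d (t - T / 2)" by (simp add: F2_def hf_def E_def rise_1 Z1)
            then show ?thesis using v by simp
          qed simp
        qed
        finally show ?thesis .
      qed
    qed
    also have "\<dots> = (\<integral>\<^sup>+p. ennreal (F2 p) \<partial>lborel)"
    proof -
      have [measurable]: "F2 \<in> borel_measurable borel" using i2 by auto
      show ?thesis by (rule nn_integral_lborel3[symmetric]) measurable
    qed
    also have "\<dots> = ennreal (\<integral>p. F2 p \<partial>lborel)" using i2 F20 by (intro nn_integral_eq_integral) auto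
    also have "\<dots> \<le> ennreal \<eta>" by (rule ennreal_leI[OF F2le])
    finally show ?thesis .
  qed
  \<comment> \<open>As \<eta> is arbitrary the weighted integral vanishes; the weight is strictly
    positive for \<theta> < t < T - \<theta> and |x| \<le> X.\<close>
  have zero: "AE z in lborel. \<theta> < fst z \<and> fst z < T - \<theta> \<and> \<bar>snd z\<bar> \<le> X \<longrightarrow> U z \<le> M" if X: "0 < X" for X
  proof -
    define F where "F = (\<lambda>(t, x). ennreal (moll d (t - T / 2)) * indicator {-X..X} x * indicator {z. M < U z} (t, x))"
    have [measurable]: "F \<in> borel_measurable borel" unfolding F_def by measurable
    have "(\<integral>\<^sup>+z. F z \<partial>lborel) = 0"
    proof (rule ccontr)
      assume "(\<integral>\<^sup>+z. F z \<partial>lborel) \<noteq> 0"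
      then have pos: "0 < (\<integral>\<^sup>+z. F z \<partial>lborel)" by (simp add: zero_less_iff_neq_zero)
      have le: "(\<integral>\<^sup>+z. F z \<partial>lborel) \<le> ennreal \<eta>" if "0 < \<eta>" for \<eta> using key[OF that X] by (simp add: F_def)
      have "(\<integral>\<^sup>+z. F z \<partial>lborel) < \<infinity>" using le[of 1] by (simp add: order_le_less_trans)
      then obtain r where r: "(\<integral>\<^sup>+z. F z \<partial>lborel) = ennreal r" "0 \<le> r" by (metis ennreal_cases infinity_ennreal_def less_irrefl)
      then have "0 < r" using pos by simp
      then show False using le[of "r / 2"] r by (simp add: ennreal_le_iff)
    qed
    then have "AE z in lborel. F z = 0" by (subst (asm) nn_integral_0_iff_AE) auto
    then show ?thesis
    proof eventually_elim
      fix z :: "real \<times> real" assume F0: "F z = 0"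
      obtain t x where z: "z = (t, x)" by (cases z)
      show "\<theta> < fst z \<and> fst z < T - \<theta> \<and> \<bar>snd z\<bar> \<le> X \<longrightarrow> U z \<le> M"
      proof (intro impI, rule ccontr)
        assume a: "\<theta> < fst z \<and> fst z < T - \<theta> \<and> \<bar>snd z\<bar> \<le> X" "\<not> U z \<le> M"
        then have "\<bar>t - T / 2\<bar> < d" by (auto simp: z d_def abs_less_iff)
        then have "\<bar>(t - T / 2) / d\<bar> < 1" using d by (simp add: abs_divide)
        then have "0 < moll d (t - T / 2)" using d by (simp add: moll_def bmp_pos)
        moreover have "x \<in> {-X..X}" "M < U (t, x)" using a by (auto simp: z abs_le_iff)
        ultimately show False using F0 by (simp add: F_def z)
      qed
    qed
  qed
  have "AE z in lborel. \<forall>n::nat. \<theta> < fst z \<and> fst z < T - \<theta> \<and> \<bar>snd z\<bar> \<le> real (Suc n) \<longrightarrow> U z \<le> M"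
    unfolding AE_all_countable by (intro allI zero) simp
  then show ?thesis
  proof eventually_elim
    fix z :: "real \<times> real"
    assume *: "\<forall>n::nat. \<theta> < fst z \<and> fst z < T - \<theta> \<and> \<bar>snd z\<bar> \<le> real (Suc n) \<longrightarrow> U z \<le> M"
    obtain n where "\<bar>snd z\<bar> \<le> real n" using real_arch_simple by blast
    then have "\<bar>snd z\<bar> \<le> real (Suc n)" by simp
    then show "\<theta> < fst z \<and> fst z < T - \<theta> \<longrightarrow> U z \<le> C0 + C1 * T + 2" using * unfolding M_def by blast
  qed
qed

end

section \<open>Reduction of the entropy solution to Borel data\<close>

text \<open>Slices and compositions of Lebesgue measurable functions need not be measurable, so the
  data are replaced once and for all by Borel representatives that vanish off the domain.\<close>

lemma borel_version:
  fixes f :: "'a::euclidean_space \<Rightarrow> real"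
  assumes f: "f \<in> borel_measurable (lebesgue_on X)" and X [measurable]: "X \<in> sets borel"
  obtains g where "g \<in> borel_measurable borel" "\<And>z. z \<notin> X \<Longrightarrow> g z = 0" "AE z in lborel. z \<in> X \<longrightarrow> f z = g z"
proof -
  have "(\<lambda>x. if x \<in> X then f x else 0) \<in> borel_measurable lebesgue" by (rule borel_measurable_if_I[OF f]) (use X in simp)
  from completion_ex_borel_measurable_real[OF this] obtain h
    where [measurable]: "h \<in> borel_measurable borel" and h: "AE z in lborel. (if z \<in> X then f z else 0) = h z" by auto
  show ?thesis
  proof (rule that[of "\<lambda>z. if z \<in> X then h z else 0"])
    show "AE z in lborel. z \<in> X \<longrightarrow> f z = (if z \<in> X then h z else 0)" using h by eventually_elim auto
    show "(\<lambda>z. if z \<in> X then h z else 0) \<in> borel_measurable borel" by measurable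
  qed auto
qed

lemma AE_lebesgue_iff: "(AE z in lebesgue. P z) \<longleftrightarrow> (AE z in lborel. P z)" by (rule AE_completion_iff)

lemma lebesgue_integral_borel_version:
  fixes f g :: "'a::euclidean_space \<Rightarrow> real"
  assumes g [measurable]: "g \<in> borel_measurable borel" and ae: "AE z in lborel. f z = g z"
  shows "integral\<^sup>L lebesgue f = integral\<^sup>L lborel g"
proof -
  have g': "g \<in> borel_measurable lebesgue" by (rule measurable_completion) simp
  have ae': "AE z in lebesgue. g z = f z" using ae unfolding AE_lebesgue_iff by eventually_elim auto
  have "integral\<^sup>L lebesgue f = integral\<^sup>L lebesgue g"
    by (rule integral_cong_AE[OF borel_measurable_AE[OF g' ae'] g']) (use ae' in \<open>eventually_elim, simp\<close>)
  then show ?thesis using integral_completion[of g lborel] by simp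
qed

lemma integrable_borel_version:
  fixes f g :: "'a::euclidean_space \<Rightarrow> real"
  assumes g [measurable]: "g \<in> borel_measurable borel" and ae: "AE z in lborel. f z = g z"
  shows "integrable lebesgue f \<longleftrightarrow> integrable lborel g"
proof -
  have g': "g \<in> borel_measurable lebesgue" by (rule measurable_completion) simp
  have ae': "AE z in lebesgue. g z = f z" using ae unfolding AE_lebesgue_iff by eventually_elim auto
  have "integrable lebesgue f = integrable lebesgue g"
    by (rule integrable_cong_AE[OF borel_measurable_AE[OF g' ae'] g']) (use ae' in \<open>eventually_elim, simp\<close>)
  then show ?thesis using integrable_completion[of g lborel] by simp
qed

text \<open>The Borel representative agrees with the solution almost everywhere in (t, x), while the
  kinetic equation integrates over (t, x, v).\<close>

lemma AE_lborel_lift: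
  fixes P :: "real \<times> real \<Rightarrow> bool"
  assumes "AE z in lborel. P z"
  shows "AE p in (lborel :: (real \<times> real \<times> real) measure). P (fst p, fst (snd p))"
proof -
  obtain N where N: "{z. \<not> P z} \<subseteq> N" "emeasure lborel N = 0" "N \<in> sets borel"
    using AE_E[OF assms] by auto
  note [measurable] = N(3)
  have m: "(\<lambda>z. indicator N z :: ennreal) \<in> borel_measurable borel" by measurable
  have "AE t in lborel. (\<integral>\<^sup>+x. indicator N (t, x) \<partial>lborel) = (0::ennreal)"
  proof -
    have "(\<integral>\<^sup>+t. \<integral>\<^sup>+x. indicator N (t, x) \<partial>lborel \<partial>lborel) = (0::ennreal)"
      using N nn_integral_lborel_prod[OF m] nn_integral_indicator[of N lborel] by simp
    then show ?thesis by (subst (asm) nn_integral_0_iff_AE) measurable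
  qed
  then have "(\<integral>\<^sup>+t. \<integral>\<^sup>+x. \<integral>\<^sup>+v. indicator N (t, x) \<partial>(lborel :: real measure) \<partial>lborel \<partial>lborel) = (\<integral>\<^sup>+t. 0 \<partial>(lborel::real measure))"
    by (intro nn_integral_cong_AE) (auto elim!: eventually_mono simp: nn_integral_multc)
  moreover have m3: "(\<lambda>p. indicator N (fst p, fst (snd p)) :: ennreal) \<in> borel_measurable (borel :: (real \<times> real \<times> real) measure)" by measurable
  ultimately have "(\<integral>\<^sup>+p. indicator N (fst p, fst (snd p)) \<partial>(lborel :: (real \<times> real \<times> real) measure)) = (0::ennreal)"
    unfolding nn_integral_lborel3[OF m3] by simp
  then have "AE p in (lborel :: (real \<times> real \<times> real) measure). indicator N (fst p, fst (snd p)) = (0::ennreal)"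
    using m3 by (subst (asm) nn_integral_0_iff_AE) auto
  then show ?thesis by eventually_elim (use N in \<open>auto simp: indicator_def split: if_splits\<close>)
qed

text \<open>The inequality between set functions passes to integrals by comparing measures: the
  marginal restricted to \<open>V\<close> lies below \<open>e\<close> times Lebesgue measure.
  \<open>V = UNIV\<close> gives the global bound, the complement of a large interval the
  decay.\<close>

lemma marginal_nn_integral:
  fixes g :: "real \<Rightarrow> ennreal"
  assumes vm: "v_marginal_le m \<mu>" and sets_m [measurable_cong]: "sets m = sets borel"
    and V [measurable]: "V \<in> sets borel" and \<mu>: "AE v in lebesgue. v \<in> V \<longrightarrow> \<mu> v \<le> e"
    and g [measurable]: "g \<in> borel_measurable borel" and g0: "\<And>v. v \<notin> V \<Longrightarrow> g v = 0"
  shows "(\<integral>\<^sup>+(t, x, v). g v \<partial>m) \<le> ennreal e * (\<integral>\<^sup>+v. g v \<partial>lborel)"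
proof -
  define M1 where "M1 = distr m borel (\<lambda>(t::real, x::real, v::real). v)"
  have [measurable_cong]: "sets M1 = sets borel" by (simp add: M1_def)
  have gV: "g v * indicator V v = g v" "indicator V v * g v = g v" for v using g0[of v] by (auto simp: indicator_def)
  have "(\<integral>\<^sup>+(t, x, v). g v \<partial>m) = (\<integral>\<^sup>+v. g v \<partial>M1)"
    unfolding M1_def by (subst nn_integral_distr) (measurable, auto simp: case_prod_unfold)
  also have "\<dots> = (\<integral>\<^sup>+v. g v \<partial>density M1 (indicator V))"
    by (subst nn_integral_density) (auto simp: gV)
  also have "\<dots> \<le> (\<integral>\<^sup>+v. g v \<partial>scale_measure (ennreal e) lborel)"
  proof (rule nn_integral_mono_measure)
    show s: "sets (density M1 (indicator V)) = sets (scale_measure (ennreal e) lborel)" by (simp add: M1_def)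
    show "density M1 (indicator V) \<le> scale_measure (ennreal e) lborel"
    proof (subst le_measure[OF s], rule ballI)
      fix B assume "B \<in> sets (density M1 (indicator V))"
      then have B [measurable]: "B \<in> sets borel" by (simp add: M1_def)
      have "emeasure (density M1 (indicator V)) B = (\<integral>\<^sup>+v. indicator V v * indicator B v \<partial>M1)"
        by (subst emeasure_density) auto
      also have "\<dots> = emeasure M1 (V \<inter> B)"
        by (subst indicator_inter_arith[symmetric], subst nn_integral_indicator) auto
      also have "\<dots> \<le> (\<integral>\<^sup>+v\<in>V \<inter> B. ennreal (\<mu> v) \<partial>lebesgue)"
        using vm unfolding v_marginal_le_def M1_def by auto
      also have "\<dots> \<le> (\<integral>\<^sup>+v. ennreal e * indicator B v \<partial>lebesgue)"
        by (rule nn_integral_mono_AE) (use \<mu> in \<open>eventually_elim, auto simp: indicator_def intro!: ennreal_leI\<close>)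
      also have "\<dots> = ennreal e * emeasure lborel B" by (simp add: nn_integral_completion nn_integral_cmult)
      finally show "emeasure (density M1 (indicator V)) B \<le> emeasure (scale_measure (ennreal e) lborel) B" by simp
    qed
  qed
  also have "\<dots> = ennreal e * (\<integral>\<^sup>+v. g v \<partial>lborel)" by (rule nn_integral_scale_measure) simp
  finally show ?thesis .
qed

text \<open>Away from 0 the sign is locally constant and the power rule applies to
  \<open>sgn v * w\<close>; at 0 the difference quotient has size |h|^l and tends to 0.\<close>

lemma abs_powr_DERIV:
  fixes l :: real assumes l: "1 \<le> l"
  shows "((\<lambda>v. \<bar>v\<bar> powr (l + 1)) has_real_derivative (l + 1) * \<bar>v\<bar> powr l * sgn v) (at v)"
    and "((\<lambda>v. sgn v * \<bar>v\<bar> powr (l + 1)) has_real_derivative (l + 1) * \<bar>v\<bar> powr l) (at v)"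
proof -
  have lim: "((\<lambda>h::real. \<bar>h\<bar> powr l) \<longlongrightarrow> 0) (at 0)"
    using l by (auto intro!: tendsto_eq_intros)
  have e: "\<bar>h\<bar> powr (l + 1) / h = sgn h * \<bar>h\<bar> powr l" "sgn h * \<bar>h\<bar> powr (l + 1) / h = \<bar>h\<bar> powr l" for h :: real
    by (auto simp: powr_add sgn_real_def)
  have "((\<lambda>h::real. sgn h * \<bar>h\<bar> powr l) \<longlongrightarrow> 0) (at 0)"
    by (rule Lim_null_comparison[OF _ lim]) (auto simp: abs_mult sgn_real_def)
  then have z: "((\<lambda>v. \<bar>v\<bar> powr (l + 1)) has_real_derivative 0) (at 0)"
    "((\<lambda>v. sgn v * \<bar>v\<bar> powr (l + 1)) has_real_derivative 0) (at 0)"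
    using lim unfolding DERIV_def by (simp_all add: e)
  have ev: "\<forall>\<^sub>F w in nhds v. sgn w = sgn v" if "v \<noteq> 0"
  proof (cases "0 < v")
    case True
    have "\<forall>\<^sub>F w in nhds v. w \<in> {0<..}" using True by (intro eventually_nhds_in_open) auto
    then show ?thesis by eventually_elim (use True in auto)
  next
    case False
    have "\<forall>\<^sub>F w in nhds v. w \<in> {..<0}" using False that by (intro eventually_nhds_in_open) auto
    then show ?thesis by eventually_elim (use False that in auto)
  qed
  have nz: "((\<lambda>w. (sgn v * w) powr (l + 1)) has_real_derivative (l + 1) * \<bar>v\<bar> powr l * sgn v) (at v)" if "v \<noteq> 0"
    using that by (auto intro!: derivative_eq_intros simp: sgn_real_def)
  show "((\<lambda>v. \<bar>v\<bar> powr (l + 1)) has_real_derivative (l + 1) * \<bar>v\<bar> powr l * sgn v) (at v)"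
  proof (cases "v = 0")
    case False
    have "\<forall>\<^sub>F w in nhds v. \<bar>w\<bar> powr (l + 1) = (sgn v * w) powr (l + 1)"
      using ev[OF False] by eventually_elim (metis abs_sgn mult.commute)
    from DERIV_cong_ev[OF refl this refl] nz[OF False] show ?thesis by (rule iffD2)
  qed (use z l in auto)
  show "((\<lambda>v. sgn v * \<bar>v\<bar> powr (l + 1)) has_real_derivative (l + 1) * \<bar>v\<bar> powr l) (at v)"
  proof (cases "v = 0")
    case False
    have "\<forall>\<^sub>F w in nhds v. sgn w * \<bar>w\<bar> powr (l + 1) = sgn v * (sgn v * w) powr (l + 1)"
      using ev[OF False] by eventually_elim (metis abs_sgn mult.commute)
    from DERIV_cong_ev[OF refl this refl] have "?thesis \<longleftrightarrow> ((\<lambda>w. sgn v * (sgn v * w) powr (l + 1)) has_real_derivative (l + 1) * \<bar>v\<bar> powr l) (at v)" .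
    moreover have "((\<lambda>w. sgn v * (sgn v * w) powr (l + 1)) has_real_derivative (l + 1) * \<bar>v\<bar> powr l) (at v)"
      using DERIV_cmult[OF nz[OF False], of "sgn v"] False by (simp add: sgn_real_def split: if_splits)
    ultimately show ?thesis by (rule iffD2)
  qed (use z l in auto)
qed

section \<open>Kinetic solutions with Borel data, and their two half-problems\<close>

lemma distr_reflect3:
  assumes "\<tau> = 1 \<or> \<tau> = (-1::real)"
  shows "distr lborel borel (\<lambda>(t::real, x::real, v::real). (t, x, \<tau> * v)) = lborel"
proof (rule measure_eqI)
  fix B assume "B \<in> sets (distr lborel borel (\<lambda>(t::real, x::real, v::real). (t, x, \<tau> * v)))"
  then have [measurable]: "B \<in> sets borel" by simp
  have m: "(\<lambda>p. indicator B p :: ennreal) \<in> borel_measurable borel"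
    "(\<lambda>(t, x, v). indicator B (t, x, \<tau> * v) :: ennreal) \<in> borel_measurable borel" by measurable
  have *: "(\<integral>\<^sup>+v. indicator B (t, x, \<tau> * v) \<partial>lborel) = (\<integral>\<^sup>+v. indicator B (t, x, v) \<partial>lborel :: ennreal)" for t x
    using assms nn_integral_reflect[of "\<lambda>v. indicator B (t, x, v)" 0] by auto
  have "emeasure (distr lborel borel (\<lambda>(t, x, v). (t, x, \<tau> * v))) B = (\<integral>\<^sup>+p. indicator B p \<partial>distr lborel borel (\<lambda>(t, x, v). (t, x, \<tau> * v)))" by simp
  also have "\<dots> = (\<integral>\<^sup>+(t, x, v). indicator B (t, x, \<tau> * v) \<partial>lborel)"
    by (subst nn_integral_distr) (measurable, auto simp: case_prod_unfold)
  also have "\<dots> = (\<integral>\<^sup>+p. indicator B p \<partial>lborel)"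
    unfolding nn_integral_lborel3[OF m(1)] nn_integral_lborel3[OF m(2)] by (simp only: split_conv *)
  finally show "emeasure (distr lborel borel (\<lambda>(t, x, v). (t, x, \<tau> * v))) B = emeasure lborel B" by simp
qed simp

lemma smooth_test_function:
  assumes "smooth \<theta>" "compact K" "K \<subseteq> \<Omega>" "\<And>z. z \<notin> K \<Longrightarrow> \<theta> z = 0"
  shows "test_function \<Omega> \<theta>"
proof -
  have "closure {z. \<theta> z \<noteq> 0} \<subseteq> K"
    using assms(2,4) by (intro closure_minimal compact_imp_closed) auto
  then show ?thesis
    using assms compact_closure[of "{z. \<theta> z \<noteq> 0}"] bounded_subset[OF compact_imp_bounded[OF assms(2)], of "{z. \<theta> z \<noteq> 0}"]
    unfolding test_function_def smooth_def using closure_subset[of "{z. \<theta> z \<noteq> 0}"] by blast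
qed

text \<open>The entropy solution in Borel form, with all integrals over the whole space. It is
  obtained in \<open>entropy_solution_kinetic\<close>, where \<open>U\<close> and \<open>S\<close>
  are extended by 0 and \<open>m\<close> is carried over from the open strip.\<close>

locale kinetic_solution =
  fixes T l :: real and A :: "real \<Rightarrow> real" and U S :: "real \<times> real \<Rightarrow> real"
    and m :: "(real \<times> real \<times> real) measure" and \<mu> :: "real \<Rightarrow> real"
  assumes T_pos: "0 < T" and l_ge_1: "1 \<le> l"
    and A: "A = (\<lambda>v. \<bar>v\<bar> powr (l + 1)) \<or> A = (\<lambda>v. sgn v * \<bar>v\<bar> powr (l + 1))"
    and U_measurable [measurable]: "U \<in> borel_measurable borel"
    and U_integrable: "integrable lborel U"
    and S_integrable: "integrable lborel S"
    and sets_m [measurable_cong]: "sets m = sets borel"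
    and marginal: "v_marginal_le m \<mu>" and decay: "L0_infinity \<mu>"
    and equation: "test_function ({0<..<T} \<times> UNIV \<times> UNIV) \<theta> \<Longrightarrow>
      (LINT (t, x, v)|lborel. kin_chi v (U (t, x)) *
          (frechet_derivative \<theta> (at (t, x, v)) (1, 0, 0) + deriv A v * frechet_derivative \<theta> (at (t, x, v)) (0, 1, 0)))
      = (LINT p|m. frechet_derivative \<theta> (at p) (0, 0, 1)) - (LINT (t, x)|lborel. S (t, x) * \<theta> (t, x, U (t, x)))"
begin

lemma deriv_A: "deriv A = (\<lambda>v. (l + 1) * \<bar>v\<bar> powr l * sgn v) \<or> deriv A = (\<lambda>v. (l + 1) * \<bar>v\<bar> powr l)"
  using A abs_powr_DERIV[OF l_ge_1, THEN DERIV_imp_deriv] by auto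

lemma deriv_A_measurable [measurable]: "deriv A \<in> borel_measurable borel"
  using deriv_A by (elim disjE) simp_all

lemma deriv_A_bound: "\<bar>deriv A v\<bar> \<le> (l + 1) * \<bar>v\<bar> powr l"
  using deriv_A l_ge_1 by (auto simp: abs_mult sgn_real_def)

lemma S_measurable [measurable]: "S \<in> borel_measurable borel"
  using S_integrable by auto

text \<open>With \<tau> = -1 the cut-off \<open>Z\<close> selects negative velocities in reflected
  form. Compact support comes from f, g and \<open>Z\<close> alone, so \<open>E\<close> may be any
  smooth profile, even one that moves with t.\<close>

lemma tensor_equation:
  assumes f: "bump_on ta tb f" "0 < ta" "tb < T" and g: "bump_on xa xb g" and E: "smooth E" and Z: "bump_on va vb Z"
    and \<tau>: "\<tau> = 1 \<or> \<tau> = -1"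
  shows "(LINT (t, x, v)|lborel. kin_chi v (U (t, x)) *
          ((deriv f t * E (\<tau> * v - c * t) - c * f t * deriv E (\<tau> * v - c * t)) * g x * Z (\<tau> * v)
            + deriv A v * f t * deriv g x * E (\<tau> * v - c * t) * Z (\<tau> * v)))
      = (LINT (t, x, v)|m. \<tau> * (f t * g x * (deriv E (\<tau> * v - c * t) * Z (\<tau> * v) + E (\<tau> * v - c * t) * deriv Z (\<tau> * v))))
        - (LINT (t, x)|lborel. S (t, x) * f t * g x * E (\<tau> * U (t, x) - c * t) * Z (\<tau> * U (t, x)))"
proof -
  define \<theta> where "\<theta> = (\<lambda>p::real \<times> real \<times> real. f (fst p) * g (fst (snd p)) * (E (\<tau> * snd (snd p) - c * fst p) * Z (\<tau> * snd (snd p))))"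
  have "smooth \<theta>"
  proof -
    have bl: "bounded_linear (\<lambda>p::real \<times> real \<times> real. fst p)" "bounded_linear (\<lambda>p::real \<times> real \<times> real. fst (snd p))"
      "bounded_linear (\<lambda>p::real \<times> real \<times> real. \<tau> * snd (snd p) - c * fst p)" "bounded_linear (\<lambda>p::real \<times> real \<times> real. \<tau> * snd (snd p))"
      by (auto intro!: bounded_linear_intros)
    show ?thesis unfolding \<theta>_def
      using smooth_compose_affine[OF bl(1) bump_onD(1)[OF f(1)], of 0] smooth_compose_affine[OF bl(2) bump_onD(1)[OF g], of 0]
        smooth_compose_affine[OF bl(3) E, of 0] smooth_compose_affine[OF bl(4) bump_onD(1)[OF Z], of 0]
      by (intro smooth_mult) simp_all
  qed
  moreover have "compact ({ta..tb} \<times> {xa..xb} \<times> (*) \<tau> ` {va..vb})"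
    by (intro compact_Times compact_Icc compact_continuous_image continuous_intros)
  ultimately have tf: "test_function ({0<..<T} \<times> UNIV \<times> UNIV) \<theta>"
  proof (rule smooth_test_function)
    show "{ta..tb} \<times> {xa..xb} \<times> (*) \<tau> ` {va..vb} \<subseteq> {0<..<T} \<times> UNIV \<times> UNIV" using f by auto
    fix z assume "z \<notin> {ta..tb} \<times> {xa..xb} \<times> (*) \<tau> ` {va..vb}"
    then have "fst z \<notin> {ta..tb} \<or> fst (snd z) \<notin> {xa..xb} \<or> snd (snd z) \<notin> (*) \<tau> ` {va..vb}" by (cases z) auto
    moreover have "snd (snd z) = \<tau> * (\<tau> * snd (snd z))" using \<tau> by auto
    ultimately have "fst z \<notin> {ta..tb} \<or> fst (snd z) \<notin> {xa..xb} \<or> \<tau> * snd (snd z) \<notin> {va..vb}" by (metis imageI)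
    then show "\<theta> z = 0" using bump_onD(2)[OF f(1)] bump_onD(2)[OF g] bump_onD(2)[OF Z] by (auto simp: \<theta>_def)
  qed
  have D: "frechet_derivative \<theta> (at p) = (\<lambda>h.
      f (fst p) * g (fst (snd p)) * (E (\<tau> * snd (snd p) - c * fst p) * (\<tau> * snd (snd h) * deriv Z (\<tau> * snd (snd p)))
         + (\<tau> * snd (snd h) - c * fst h) * deriv E (\<tau> * snd (snd p) - c * fst p) * Z (\<tau> * snd (snd p)))
      + (f (fst p) * (fst (snd h) * deriv g (fst (snd p))) + fst h * deriv f (fst p) * g (fst (snd p)))
         * (E (\<tau> * snd (snd p) - c * fst p) * Z (\<tau> * snd (snd p))))" for p
    unfolding \<theta>_def
    by (intro frechet_derivative_at[symmetric] has_derivative_mult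
          DERIV_compose_FDERIV[OF bump_on_DERIV[OF f(1)]] DERIV_compose_FDERIV[OF bump_on_DERIV[OF g]]
          DERIV_compose_FDERIV[OF bump_on_DERIV[OF Z]] DERIV_compose_FDERIV[OF has_real_derivative_deriv_smooth[OF E]])
      (auto intro!: derivative_eq_intros)
  have eqs: "(\<lambda>(t, x, v). kin_chi v (U (t, x)) *
          (frechet_derivative \<theta> (at (t, x, v)) (1, 0, 0) + deriv A v * frechet_derivative \<theta> (at (t, x, v)) (0, 1, 0)))
      = (\<lambda>(t, x, v). kin_chi v (U (t, x)) *
          ((deriv f t * E (\<tau> * v - c * t) - c * f t * deriv E (\<tau> * v - c * t)) * g x * Z (\<tau> * v)
            + deriv A v * f t * deriv g x * E (\<tau> * v - c * t) * Z (\<tau> * v)))"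
    "(\<lambda>p. frechet_derivative \<theta> (at p) (0, 0, 1)) = (\<lambda>(t, x, v). \<tau> * (f t * g x * (deriv E (\<tau> * v - c * t) * Z (\<tau> * v) + E (\<tau> * v - c * t) * deriv Z (\<tau> * v))))"
    "(\<lambda>(t, x). S (t, x) * \<theta> (t, x, U (t, x))) = (\<lambda>(t, x). S (t, x) * f t * g x * E (\<tau> * U (t, x) - c * t) * Z (\<tau> * U (t, x)))"
    unfolding D by (simp_all add: fun_eq_iff \<theta>_def algebra_simps)
  show ?thesis using equation[OF tf] unfolding eqs .
qed

definition reflected :: "real \<Rightarrow> (real \<times> real \<times> real) measure" where
  "reflected \<tau> = distr m borel (\<lambda>(t, x, v). (t, x, \<tau> * v))"

lemma nn_integral_reflected:
  fixes g :: "real \<Rightarrow> ennreal"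
  assumes [measurable]: "g \<in> borel_measurable borel"
  shows "(\<integral>\<^sup>+(t, x, v). g v \<partial>reflected \<tau>) = (\<integral>\<^sup>+(t, x, v). g (\<tau> * v) \<partial>m)"
  unfolding reflected_def by (subst nn_integral_distr) (measurable, auto simp: case_prod_unfold)

lemma reflected_marginal:
  fixes g :: "real \<Rightarrow> ennreal"
  assumes V: "V \<in> sets borel" and \<mu>: "AE v in lebesgue. v \<in> V \<longrightarrow> \<mu> v \<le> e" and \<tau>: "\<tau> = 1 \<or> \<tau> = -1"
    and g [measurable]: "g \<in> borel_measurable borel" and g0: "\<And>v. v \<notin> V \<Longrightarrow> g (\<tau> * v) = 0"
  shows "(\<integral>\<^sup>+(t, x, v). g v \<partial>reflected \<tau>) \<le> ennreal e * (\<integral>\<^sup>+v. g v \<partial>lborel)"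
proof -
  have "(\<integral>\<^sup>+v. g (\<tau> * v) \<partial>lborel) = (\<integral>\<^sup>+v. g v \<partial>lborel)"
    using \<tau> nn_integral_reflect[of g 0] by auto
  moreover have "(\<lambda>v. g (\<tau> * v)) \<in> borel_measurable borel" by measurable
  ultimately show ?thesis
    using marginal_nn_integral[OF marginal sets_m V \<mu>, of "\<lambda>v. g (\<tau> * v)"] g0 by (simp add: nn_integral_reflected)
qed

definition M0 :: real where "M0 = max 0 (SOME C. AE v in lebesgue. \<bar>\<mu> v\<bar> \<le> C)"

lemma M0: "0 \<le> M0" "AE v in lebesgue. v \<in> UNIV \<longrightarrow> \<mu> v \<le> M0"
proof -
  have "\<exists>C. AE v in lebesgue. \<bar>\<mu> v\<bar> \<le> C"
    using decay unfolding L0_infinity_def ess_bounded_on_def lebesgue_on_UNIV_eq by blast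
  from someI_ex[OF this] show "AE v in lebesgue. v \<in> UNIV \<longrightarrow> \<mu> v \<le> M0"
    by eventually_elim (auto simp: M0_def)
qed (simp add: M0_def)

lemma reflected_decay:
  assumes \<tau>: "\<tau> = 1 \<or> \<tau> = -1" and e: "0 < e"
  shows "\<exists>R. \<forall>g \<in> borel_measurable borel. (\<forall>v\<le>R. g v = 0) \<longrightarrow> (\<integral>\<^sup>+(t, x, v). g v \<partial>reflected \<tau>) \<le> ennreal e * (\<integral>\<^sup>+v. g v \<partial>lborel)"
proof -
  obtain R where R: "AE v in lebesgue. \<bar>v\<bar> > R \<longrightarrow> \<bar>\<mu> v\<bar> < e"
    using decay e unfolding L0_infinity_def by blast
  show ?thesis
  proof (rule exI[of _ R], intro ballI impI)
    fix g :: "real \<Rightarrow> ennreal" assume g: "g \<in> borel_measurable borel" "\<forall>v\<le>R. g v = 0"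
    have "{v. R < \<bar>v\<bar>} \<in> sets borel" by measurable
    moreover have "AE v in lebesgue. v \<in> {v. R < \<bar>v\<bar>} \<longrightarrow> \<mu> v \<le> e" using R by eventually_elim auto
    ultimately show "(\<integral>\<^sup>+(t, x, v). g v \<partial>reflected \<tau>) \<le> ennreal e * (\<integral>\<^sup>+v. g v \<partial>lborel)"
      by (rule reflected_marginal) (use \<tau> g in auto)
  qed
qed

text \<open>Where \<tau> v > 0, the kinetic function is \<tau> times the indicator of 0 < \<tau> v <
  \<tau> U. Multiplying the equation by \<tau> removes that sign. The term with \<open>m\<close>
  carries another \<tau> from the chain rule in v, so the reflected measure enters with its original
  sign, whereas the source becomes \<tau> S.\<close>

lemma reflected_half_problem:
  assumes \<tau>: "\<tau> = 1 \<or> \<tau> = -1"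
  obtains sg where "half_problem T l sg M0 (\<lambda>z. \<tau> * U z) (\<lambda>z. \<tau> * S z) (reflected \<tau>)"
proof -
  have \<tau>\<tau>: "\<tau> * \<tau> = 1" "\<tau> * (\<tau> * x) = x" for x using \<tau> by auto
  \<comment> \<open>For the even flux function A the velocity a is odd and has the sign \<tau> on
    the half-line considered; for the odd one a is nonnegative on both half-lines.\<close>
  obtain sg where sg: "sg = 1 \<or> sg = -1" and flux: "\<And>v. 0 < \<tau> * v \<Longrightarrow> deriv A v = sg * (l + 1) * \<bar>\<tau> * v\<bar> powr l"
    using deriv_A
  proof
    assume "deriv A = (\<lambda>v. (l + 1) * \<bar>v\<bar> powr l * sgn v)"
    then show ?thesis using that[of \<tau>] \<tau> by (auto simp: abs_mult)
  next
    assume "deriv A = (\<lambda>v. (l + 1) * \<bar>v\<bar> powr l)"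
    then show ?thesis using that[of 1] \<tau> by (auto simp: abs_mult)
  qed
  show ?thesis
  proof (rule that, unfold_locales)
    show "0 < T" "1 \<le> l" "sg = 1 \<or> sg = -1" "0 \<le> M0" by (fact T_pos l_ge_1 sg M0(1))+
    show "(\<lambda>z. \<tau> * U z) \<in> borel_measurable borel" by measurable
    show "integrable lborel (\<lambda>z. \<tau> * S z)" using S_integrable by simp
    show "sets (reflected \<tau>) = sets borel" by (simp add: reflected_def)
    show "(\<integral>\<^sup>+(t, x, v). g v \<partial>reflected \<tau>) \<le> ennreal M0 * (\<integral>\<^sup>+v. g v \<partial>lborel)" if "g \<in> borel_measurable borel" for g
      by (rule reflected_marginal[OF _ M0(2) \<tau> that]) auto
    fix f g E Z :: "real \<Rightarrow> real" and c ta tb xa xb va vb :: real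
    assume f: "bump_on ta tb f" "0 < ta" "tb < T" and g: "bump_on xa xb g" and E: "smooth E" and Z: "bump_on va vb Z" "0 < va"
    have [measurable]: "f \<in> borel_measurable borel" "deriv f \<in> borel_measurable borel" "g \<in> borel_measurable borel" "deriv g \<in> borel_measurable borel"
      "E \<in> borel_measurable borel" "deriv E \<in> borel_measurable borel" "Z \<in> borel_measurable borel" "deriv Z \<in> borel_measurable borel"
      using bump_on_measurable bump_on_deriv f(1) g Z(1) smooth_measurable smooth_deriv E by blast+
    define F where "F = (\<lambda>(t, x, v). (if 0 < v \<and> v < \<tau> * U (t, x) then 1 else 0) *
          ((deriv f t * E (v - c * t) - c * f t * deriv E (v - c * t)) * g x * Z v
            + sg * (l + 1) * \<bar>v\<bar> powr l * f t * deriv g x * E (v - c * t) * Z v))"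
    define Y where "Y = (\<lambda>(t, x, v). f t * g x * (deriv E (v - c * t) * Z v + E (v - c * t) * deriv Z v))"
    have [measurable]: "F \<in> borel_measurable borel" "Y \<in> borel_measurable borel" unfolding F_def Y_def by measurable
    have 1: "(\<lambda>(t, x, v). kin_chi v (U (t, x)) *
          ((deriv f t * E (\<tau> * v - c * t) - c * f t * deriv E (\<tau> * v - c * t)) * g x * Z (\<tau> * v)
            + deriv A v * f t * deriv g x * E (\<tau> * v - c * t) * Z (\<tau> * v)))
        = (\<lambda>p. \<tau> * F ((\<lambda>(t, x, v). (t, x, \<tau> * v)) p))"
    proof (rule ext)
      fix p :: "real \<times> real \<times> real"
      obtain t x v where p: "p = (t, x, v)" by (cases p) auto
      have "kin_chi v (U (t, x)) *
          ((deriv f t * E (\<tau> * v - c * t) - c * f t * deriv E (\<tau> * v - c * t)) * g x * Z (\<tau> * v)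
            + deriv A v * f t * deriv g x * E (\<tau> * v - c * t) * Z (\<tau> * v))
          = \<tau> * F (t, x, \<tau> * v)"
      proof (cases "0 < \<tau> * v")
        case True
        have "kin_chi v (U (t, x)) = \<tau> * (if 0 < \<tau> * v \<and> \<tau> * v < \<tau> * U (t, x) then 1 else 0)"
          using \<tau> True by (auto simp: kin_chi_def indicator_def)
        then show ?thesis by (simp add: F_def flux[OF True])
      next
        case False
        then have "Z (\<tau> * v) = 0" using Z by (intro bump_onD(2)[OF Z(1)]) auto
        then show ?thesis by (simp add: F_def)
      qed
      then show "(\<lambda>(t, x, v). kin_chi v (U (t, x)) *
          ((deriv f t * E (\<tau> * v - c * t) - c * f t * deriv E (\<tau> * v - c * t)) * g x * Z (\<tau> * v)
            + deriv A v * f t * deriv g x * E (\<tau> * v - c * t) * Z (\<tau> * v))) p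
        = \<tau> * F ((\<lambda>(t, x, v). (t, x, \<tau> * v)) p)" by (simp add: p)
    qed
    have "(LINT p|lborel. F ((\<lambda>(t, x, v). (t, x, \<tau> * v)) p)) = (LINT p|distr lborel borel (\<lambda>(t, x, v). (t, x, \<tau> * v)). F p)"
      by (rule integral_distr[symmetric]) measurable
    then have 2: "(LINT p|lborel. \<tau> * F ((\<lambda>(t, x, v). (t, x, \<tau> * v)) p)) = \<tau> * (LINT p|lborel. F p)"
      unfolding distr_reflect3[OF \<tau>] by simp
    have 3: "(LINT (t, x, v)|m. \<tau> * (f t * g x * (deriv E (\<tau> * v - c * t) * Z (\<tau> * v) + E (\<tau> * v - c * t) * deriv Z (\<tau> * v)))) = \<tau> * (LINT p|reflected \<tau>. Y p)"
    proof -
      have "(LINT p|reflected \<tau>. Y p) = (LINT p|m. Y ((\<lambda>(t, x, v). (t, x, \<tau> * v)) p))"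
        unfolding reflected_def by (rule integral_distr) measurable
      then show ?thesis by (simp add: Y_def case_prod_unfold)
    qed
    have "\<tau> * (LINT p|lborel. F p) = \<tau> * (LINT p|reflected \<tau>. Y p)
      - (LINT (t, x)|lborel. S (t, x) * f t * g x * E (\<tau> * U (t, x) - c * t) * Z (\<tau> * U (t, x)))" (is "_ = _ - ?W")
      using tensor_equation[OF f g E Z(1) \<tau>, of c] unfolding 1 2 3 .
    then have "\<tau> * (\<tau> * (LINT p|lborel. F p)) = \<tau> * (\<tau> * (LINT p|reflected \<tau>. Y p)) - \<tau> * ?W"
      by (simp add: right_diff_distrib)
    moreover have "\<tau> * ?W = (LINT (t, x)|lborel. \<tau> * S (t, x) * f t * g x * E (\<tau> * U (t, x) - c * t) * Z (\<tau> * U (t, x)))"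
      by (subst integral_mult_right_zero[symmetric]) (simp add: case_prod_unfold mult.assoc)
    ultimately have "(LINT p|lborel. F p) = (LINT p|reflected \<tau>. Y p) - (LINT (t, x)|lborel. \<tau> * S (t, x) * f t * g x * E (\<tau> * U (t, x) - c * t) * Z (\<tau> * U (t, x)))"
      unfolding \<tau>\<tau> by simp
    then show "(LINT (t, x, v)|lborel. (if 0 < v \<and> v < \<tau> * U (t, x) then 1 else 0) *
          ((deriv f t * E (v - c * t) - c * f t * deriv E (v - c * t)) * g x * Z v
            + sg * (l + 1) * \<bar>v\<bar> powr l * f t * deriv g x * E (v - c * t) * Z v))
      = (LINT (t, x, v)|reflected \<tau>. f t * g x * (deriv E (v - c * t) * Z v + E (v - c * t) * deriv Z v))
        - (LINT (t, x)|lborel. \<tau> * S (t, x) * f t * g x * E (\<tau> * U (t, x) - c * t) * Z (\<tau> * U (t, x)))"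
      unfolding F_def Y_def .
  qed
qed

end

section \<open>Velocity averages\<close>

definition chi_avg :: "(real \<Rightarrow> real) \<Rightarrow> real \<Rightarrow> real" where
  "chi_avg \<psi> w = (LINT v|lborel. kin_chi v w * \<psi> v)"

lemma kin_chi_measurable [measurable (raw)]:
  assumes [measurable]: "f \<in> borel_measurable M" "g \<in> borel_measurable M"
  shows "(\<lambda>x. kin_chi (f x) (g x)) \<in> borel_measurable M"
proof -
  have "kin_chi v w = (if 0 < v \<and> v < w then 1 else 0) - (if w < v \<and> v < 0 then 1 else 0)" for v w
    by (auto simp: kin_chi_def)
  then show ?thesis by simp
qed

lemma kin_chi_abs: "\<bar>kin_chi v w\<bar> \<le> 1"
  by (auto simp: kin_chi_def indicator_def)

lemma kin_chi_0 [simp]: "kin_chi v 0 = 0"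
  by (simp add: kin_chi_def)

lemma chi_avg_measurable [measurable]:
  assumes [measurable]: "\<psi> \<in> borel_measurable borel"
  shows "chi_avg \<psi> \<in> borel_measurable borel"
  unfolding chi_avg_def[abs_def] by measurable

lemma integrable_bounded_support:
  fixes \<psi> :: "real \<Rightarrow> real"
  assumes [measurable]: "\<psi> \<in> borel_measurable borel" and "\<And>v. \<bar>\<psi> v\<bar> \<le> K" "\<And>v. R < \<bar>v\<bar> \<Longrightarrow> \<psi> v = 0"
  shows "integrable lborel \<psi>"
proof (rule integrableI_bounded_set[where A = "{-R..R}" and B = K])
  show "emeasure lborel {-R..R} < \<infinity>" by (intro emeasure_bounded_finite) auto
  have *: "\<psi> v = 0" if "v \<notin> {- R..R}" for v using that by (intro assms(3)) auto
  show "AE v in lborel. v \<notin> {- R..R} \<longrightarrow> \<psi> v = 0" using * by auto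
qed (use assms(2) in auto)

lemma integrable_chi:
  assumes [measurable]: "\<psi> \<in> borel_measurable borel" and "integrable lborel \<psi>"
  shows "integrable lborel (\<lambda>v. kin_chi v w * \<psi> v)"
  using kin_chi_abs[of _ w] by (intro integrable_abs_le[OF assms(2), of _ 1]) (auto simp: abs_mult intro: mult_left_le_one_le)

text \<open>Two kinetic functions differ only for v between a and b, and \<psi> sees only |v| \<le>
  R. The truncations of a, b and of -a, -b measure this set on the positive and on the negative
  half-line.\<close>

lemma chi_avg_lipschitz:
  assumes \<psi> [measurable]: "\<psi> \<in> borel_measurable borel" and K: "\<And>v. \<bar>\<psi> v\<bar> \<le> K" and R: "\<And>v. R < \<bar>v\<bar> \<Longrightarrow> \<psi> v = 0"
  shows "\<bar>chi_avg \<psi> a - chi_avg \<psi> b\<bar> \<le> K * (\<bar>trunc R a - trunc R b\<bar> + \<bar>trunc R (- a) - trunc R (- b)\<bar>)"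
proof -
  have K0: "0 \<le> K" using K[of 0] by linarith
  define I where "I a b = {min (trunc R a) (trunc R b)..max (trunc R a) (trunc R b)}" for a b
  let ?J = "\<lambda>v. indicator (I a b) v + indicator (I (- a) (- b)) (- v)"
  have I: "emeasure lborel (I a b) = ennreal \<bar>trunc R a - trunc R b\<bar>" for a b
    by (auto simp: I_def min_def max_def)
  have [measurable]: "I a b \<in> sets borel" for a b by (simp add: I_def)
  have pt: "\<bar>(kin_chi v a - kin_chi v b) * \<psi> v\<bar> \<le> K * (indicator (I a b) v + indicator (I (- a) (- b)) (- v))" for v
  proof (cases "R < \<bar>v\<bar>")
    case False
    have "\<bar>kin_chi v a - kin_chi v b\<bar> \<le> indicator (I a b) v + indicator (I (- a) (- b)) (- v)"
    proof (cases "0 \<le> v")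
      case True
      then have "kin_chi v w = (if 0 < v \<and> v < w then 1 else 0)" for w by (auto simp: kin_chi_def)
      then have "\<bar>kin_chi v a - kin_chi v b\<bar> \<le> indicator (I a b) v"
        using False True by (auto simp: indicator_def I_def trunc_def)
      then show ?thesis by (rule order_trans) simp
    next
      case neg: False
      then have "kin_chi v w = (if w < v then - 1 else 0)" for w by (auto simp: kin_chi_def)
      then have "\<bar>kin_chi v a - kin_chi v b\<bar> \<le> indicator (I (- a) (- b)) (- v)"
        using False neg by (auto simp: indicator_def I_def trunc_def)
      then show ?thesis by (rule order_trans) simp
    qed
    then have "\<bar>kin_chi v a - kin_chi v b\<bar> * \<bar>\<psi> v\<bar> \<le> (indicator (I a b) v + indicator (I (- a) (- b)) (- v)) * K"
      by (intro mult_mono K) auto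
    then show ?thesis by (simp add: abs_mult mult.commute)
  qed (use K0 R in auto)
  have "integrable lborel \<psi>" by (rule integrable_bounded_support[OF \<psi> K R])
  then have eq: "chi_avg \<psi> a - chi_avg \<psi> b = (LINT v|lborel. (kin_chi v a - kin_chi v b) * \<psi> v)"
    unfolding chi_avg_def left_diff_distrib by (intro Bochner_Integration.integral_diff[symmetric] integrable_chi \<psi>)
  show ?thesis unfolding eq
  proof (rule abs_integral_leI)
    have "(\<integral>\<^sup>+v. ennreal \<bar>(kin_chi v a - kin_chi v b) * \<psi> v\<bar> \<partial>lborel)
      \<le> (\<integral>\<^sup>+v. ennreal K * ?J v \<partial>lborel)"
    proof (rule nn_integral_mono)
      fix v
      have "ennreal \<bar>(kin_chi v a - kin_chi v b) * \<psi> v\<bar> \<le> ennreal (K * (indicator (I a b) v + indicator (I (- a) (- b)) (- v)))"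
        by (rule ennreal_leI[OF pt])
      also have "\<dots> = ennreal K * ?J v"
        by (auto simp: ennreal_mult[OF K0] indicator_def)
      finally show "ennreal \<bar>(kin_chi v a - kin_chi v b) * \<psi> v\<bar> \<le> ennreal K * ?J v" .
    qed
    also have "\<dots> = ennreal K * ((\<integral>\<^sup>+v. indicator (I a b) v \<partial>lborel) + (\<integral>\<^sup>+v. indicator (I (- a) (- b)) (- v) \<partial>lborel))"
      by (simp add: nn_integral_cmult nn_integral_add)
    also have "(\<integral>\<^sup>+v. indicator (I (- a) (- b)) (- v) \<partial>lborel) = (\<integral>\<^sup>+v. indicator (I (- a) (- b)) v \<partial>lborel :: ennreal)"
      using nn_integral_reflect[of "indicator (I (- a) (- b))" 0] by simp
    finally show "(\<integral>\<^sup>+v. ennreal \<bar>(kin_chi v a - kin_chi v b) * \<psi> v\<bar> \<partial>lborel)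
      \<le> ennreal (K * (\<bar>trunc R a - trunc R b\<bar> + \<bar>trunc R (- a) - trunc R (- b)\<bar>))"
      by (simp add: I ennreal_mult[OF K0] K0 flip: ennreal_plus)
  qed (use K0 in auto)
qed

lemma chi_avg_bound:
  assumes "\<psi> \<in> borel_measurable borel" and K: "\<And>v. \<bar>\<psi> v\<bar> \<le> K" and "\<And>v. R < \<bar>v\<bar> \<Longrightarrow> \<psi> v = 0" and R: "0 \<le> R"
  shows "\<bar>chi_avg \<psi> a\<bar> \<le> K * (R + R)"
proof -
  have "\<bar>chi_avg \<psi> a\<bar> \<le> K * (\<bar>trunc R a - trunc R 0\<bar> + \<bar>trunc R (- a) - trunc R (- 0)\<bar>)"
    using chi_avg_lipschitz[OF assms(1-3), of R a 0] by (simp add: chi_avg_def)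
  also have "\<dots> \<le> K * (R + R)"
    using K[of 0] by (intro mult_left_mono add_mono trunc_diff_le R) linarith
  finally show ?thesis .
qed

lemma ennreal_abs_integral_le: "ennreal \<bar>integral\<^sup>L M f\<bar> \<le> (\<integral>\<^sup>+x. ennreal \<bar>f x\<bar> \<partial>M)" for f :: "'a \<Rightarrow> real"
proof (cases "integrable M f")
  case True
  then show ?thesis using integral_norm_bound_ennreal[OF True] by simp
qed (simp add: not_integrable_integral_eq)

context kinetic_solution
begin

lemma xreg_chi_avg:
  assumes s: "s < min (1 / 3) (1 / (l + 1))" and R: "0 < R"
    and \<psi>: "\<psi> \<in> borel_measurable borel" and K: "\<And>v. \<bar>\<psi> v\<bar> \<le> K" and R0: "\<And>v. R < \<bar>v\<bar> \<Longrightarrow> \<psi> v = 0"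
  shows "xreg T s (\<lambda>z. chi_avg \<psi> (U z))"
proof (rule xreg_lipschitz)
  obtain sp where "half_problem T l sp M0 (\<lambda>z. 1 * U z) (\<lambda>z. 1 * S z) (reflected 1)"
    by (rule reflected_half_problem[of 1]) auto
  from half_problem.xreg_trunc[OF this s R] show "xreg T s (\<lambda>z. trunc R (U z))" by simp
  obtain sn where "half_problem T l sn M0 (\<lambda>z. - 1 * U z) (\<lambda>z. - 1 * S z) (reflected (- 1))"
    by (rule reflected_half_problem[of "- 1"]) auto
  from half_problem.xreg_trunc[OF this s R] show "xreg T s (\<lambda>z. trunc R (- U z))" by simp
  show "0 \<le> K" using K[of 0] by linarith
  show "\<bar>chi_avg \<psi> (U z) - chi_avg \<psi> (U z')\<bar> \<le> K * (\<bar>trunc R (U z) - trunc R (U z')\<bar> + \<bar>trunc R (- U z) - trunc R (- U z')\<bar>)" for z z'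
    by (rule chi_avg_lipschitz[OF \<psi> K R0])
qed measurable

text \<open>The flux that belongs to the average with weight \<phi> is the average with weight
  \<open>deriv A v * \<phi> v\<close>, so \<open>chi_avg_lipschitz\<close> covers both of
  them.\<close>

lemma averaged_equation:
  assumes f: "bump_on ta tb f" "0 < ta" "tb < T" and g: "bump_on xa xb g" and \<phi>: "bump_on (- R) R \<phi>"
    and L: "\<And>v. \<bar>deriv A v * \<phi> v\<bar> \<le> L"
  shows "(\<integral>(t, x). chi_avg \<phi> (U (t, x)) * (deriv f t * g x) + chi_avg (\<lambda>v. deriv A v * \<phi> v) (U (t, x)) * (f t * deriv g x) \<partial>lborel)
    = (LINT (t, x, v)|m. f t * g x * deriv \<phi> v) - (LINT (t, x)|lborel. S (t, x) * f t * g x * \<phi> (U (t, x)))"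
proof -
  note int = bump_on_integrable[OF f(1)] bump_on_integrable[OF g] bump_on_integrable[OF \<phi>]
    bump_on_integrable[OF bump_on_deriv[OF f(1)]] bump_on_integrable[OF bump_on_deriv[OF g]]
  have [measurable]: "f \<in> borel_measurable borel" "deriv f \<in> borel_measurable borel" "g \<in> borel_measurable borel" "deriv g \<in> borel_measurable borel"
    "\<phi> \<in> borel_measurable borel"
    using int by (auto dest: borel_measurable_integrable)
  have \<phi>0: "\<phi> v = 0" if "\<bar>R\<bar> < \<bar>v\<bar>" for v
  proof -
    have "v \<notin> {- R..R}" using that by auto
    then show ?thesis by (rule bump_onD(2)[OF \<phi>])
  qed
  define a\<phi> where "a\<phi> v = deriv A v * \<phi> v" for v
  have a\<phi>_m [measurable]: "a\<phi> \<in> borel_measurable borel" unfolding a\<phi>_def[abs_def] by measurable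
  have a\<phi>: "integrable lborel a\<phi>"
    by (rule integrable_bounded_support[OF a\<phi>_m, of L "\<bar>R\<bar>"]) (use L \<phi>0 in \<open>auto simp: a\<phi>_def\<close>)
  define H where "H = (\<lambda>(t, x, v). kin_chi v (U (t, x)) * (deriv f t * g x * \<phi> v) + kin_chi v (U (t, x)) * (f t * deriv g x * a\<phi> v))"
  have chi_le: "\<bar>kin_chi v w * r\<bar> \<le> 1 * \<bar>r\<bar>" for v w r
    using mult_right_mono[OF kin_chi_abs[of v w], of "\<bar>r\<bar>"] by (simp add: abs_mult)
  have H_int: "integrable lborel H"
  proof -
    have "integrable lborel (\<lambda>(t, x, v). kin_chi v (U (t, x)) * (deriv f t * g x * \<phi> v))"
      by (rule integrable_abs_le[OF integrable_tensor3[OF int(4) int(2) int(3)], of _ 1]) (measurable, auto simp only: split_conv chi_le split: prod.split)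
    moreover have "integrable lborel (\<lambda>(t, x, v). kin_chi v (U (t, x)) * (f t * deriv g x * a\<phi> v))"
      by (rule integrable_abs_le[OF integrable_tensor3[OF int(1) int(5) a\<phi>], of _ 1]) (measurable, auto simp only: split_conv chi_le split: prod.split)
    ultimately show ?thesis unfolding H_def using Bochner_Integration.integrable_add by (fastforce simp: case_prod_unfold)
  qed
  obtain Ag where Ag: "\<And>w. \<bar>chi_avg \<phi> w\<bar> \<le> Ag" "\<And>w. \<bar>chi_avg a\<phi> w\<bar> \<le> Ag"
  proof -
    obtain K where K: "\<And>v. \<bar>\<phi> v\<bar> \<le> K" using bump_on_bounded[OF \<phi>] by metis
    have "\<bar>chi_avg \<phi> w\<bar> \<le> max K L * (\<bar>R\<bar> + \<bar>R\<bar>)" for w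
      by (rule chi_avg_bound) (use K \<phi>0 in \<open>auto simp: le_max_iff_disj\<close>)
    moreover have "\<bar>chi_avg a\<phi> w\<bar> \<le> max K L * (\<bar>R\<bar> + \<bar>R\<bar>)" for w
      by (rule chi_avg_bound) (use L \<phi>0 in \<open>auto simp: a\<phi>_def le_max_iff_disj\<close>)
    ultimately show ?thesis by (rule that)
  qed
  define G where "G = (\<lambda>(t, x). chi_avg \<phi> (U (t, x)) * (deriv f t * g x) + chi_avg a\<phi> (U (t, x)) * (f t * deriv g x))"
  have G_int: "integrable lborel G"
  proof -
    have "integrable lborel (\<lambda>z. chi_avg \<phi> (U z) * (case z of (t, x) \<Rightarrow> deriv f t * g x))"
      by (rule integrable_abs_le[OF integrable_tensor2[OF int(4) int(2)], of _ Ag]) (auto simp: abs_mult intro!: mult_right_mono Ag)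
    moreover have "integrable lborel (\<lambda>z. chi_avg a\<phi> (U z) * (case z of (t, x) \<Rightarrow> f t * deriv g x))"
      by (rule integrable_abs_le[OF integrable_tensor2[OF int(1) int(5)], of _ Ag]) (auto simp: abs_mult intro!: mult_right_mono Ag)
    ultimately show ?thesis unfolding G_def using Bochner_Integration.integrable_add by (fastforce simp: case_prod_unfold)
  qed
  have inner: "integrable lborel (\<lambda>(x, v). H (t, x, v))" for t
  proof -
    have "integrable lborel (\<lambda>z. kin_chi (snd z) (U (t, fst z)) * (case z of (x, v) \<Rightarrow> (deriv f t * g x) * \<phi> v))"
      by (rule integrable_abs_le[OF integrable_tensor2[OF _ int(3)], of "\<lambda>x. deriv f t * g x" _ 1]) (use int(2) in \<open>auto simp only: chi_le integrable_mult_right, auto\<close>)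
    moreover have "integrable lborel (\<lambda>z. kin_chi (snd z) (U (t, fst z)) * (case z of (x, v) \<Rightarrow> (f t * deriv g x) * a\<phi> v))"
      by (rule integrable_abs_le[OF integrable_tensor2[OF _ a\<phi>], of "\<lambda>x. f t * deriv g x" _ 1]) (use int(5) in \<open>auto simp only: chi_le integrable_mult_right, auto\<close>)
    ultimately show ?thesis unfolding H_def using Bochner_Integration.integrable_add by (fastforce simp: case_prod_unfold)
  qed
  have v: "(LINT v|lborel. H (t, x, v)) = G (t, x)" for t x
  proof -
    have "(LINT v|lborel. H (t, x, v)) = (LINT v|lborel. kin_chi v (U (t, x)) * \<phi> v * (deriv f t * g x) + kin_chi v (U (t, x)) * a\<phi> v * (f t * deriv g x))"
      by (intro Bochner_Integration.integral_cong) (auto simp: H_def mult_ac)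
    also have "\<dots> = G (t, x)"
      using integrable_chi[OF _ int(3), of "U (t, x)"] integrable_chi[OF _ a\<phi>, of "U (t, x)"]
      by (subst Bochner_Integration.integral_add) (auto simp: G_def chi_avg_def)
    finally show ?thesis .
  qed
  have "integral\<^sup>L lborel H = (LINT t|lborel. LINT x|lborel. LINT v|lborel. H (t, x, v))"
    unfolding integral_lborel_prod[OF H_int]
    using integral_lborel_prod[OF inner] by (intro Bochner_Integration.integral_cong) (auto simp: case_prod_unfold)
  also have "\<dots> = integral\<^sup>L lborel G" unfolding v integral_lborel_prod[OF G_int] ..
  finally have 1: "integral\<^sup>L lborel G = integral\<^sup>L lborel H" ..
  have "integral\<^sup>L lborel H = (LINT (t, x, v)|m. f t * g x * deriv \<phi> v) - (LINT (t, x)|lborel. S (t, x) * f t * g x * \<phi> (U (t, x)))"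
    using tensor_equation[OF f g smooth_const[of 1] \<phi>, of 1 0] by (simp add: H_def a\<phi>_def algebra_simps)
  then show ?thesis unfolding 1[symmetric] G_def a\<phi>_def .
qed

lemma sobolev_chi_avg:
  assumes \<phi>: "bump_on (- R) R \<phi>" and R: "0 < R" and s: "0 \<le> s" "s < min (1 / 3) (1 / (l + 1))"
  shows "sobolev_W1_loc s ({0<..<T} \<times> UNIV) (\<lambda>z. chi_avg \<phi> (U z))"
proof -
  \<comment> \<open>Halfway to the limit exponent: the shifts must have an exponent that is positive
    and strictly larger than s.\<close>
  define s' where "s' = (s + min (1 / 3) (1 / (l + 1))) / 2"
  have s': "0 < s'" "s < s'" "s' \<le> 1" "s' < min (1 / 3) (1 / (l + 1))" using s by (auto simp: s'_def)
  obtain K where K: "0 \<le> K" "\<And>v. \<bar>\<phi> v\<bar> \<le> K" using bump_on_bounded[OF \<phi>] by metis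
  have \<phi>_m [measurable]: "\<phi> \<in> borel_measurable borel" using \<phi> by measurable
  define a\<phi> where "a\<phi> v = deriv A v * \<phi> v" for v
  have a\<phi>_m [measurable]: "a\<phi> \<in> borel_measurable borel" unfolding a\<phi>_def[abs_def] by measurable
  define L where "L = (l + 1) * R powr l * K"
  have \<phi>0: "\<phi> v = 0" if "R < \<bar>v\<bar>" for v
    using that by (intro bump_onD(2)[OF \<phi>]) (auto simp: abs_if split: if_splits)
  have L: "\<bar>a\<phi> v\<bar> \<le> L" for v
  proof (cases "R < \<bar>v\<bar>")
    case False
    then have "\<bar>deriv A v\<bar> \<le> (l + 1) * R powr l"
      using deriv_A_bound[of v] l_ge_1 by (intro order_trans[OF deriv_A_bound] mult_left_mono powr_mono2) auto
    then show ?thesis unfolding a\<phi>_def L_def abs_mult using K by (intro mult_mono) auto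
  qed (use \<phi>0 K l_ge_1 in \<open>auto simp: a\<phi>_def L_def\<close>)
  have a\<phi>0: "a\<phi> v = 0" if "R < \<bar>v\<bar>" for v using \<phi>0[OF that] by (simp add: a\<phi>_def)
  define G0 where "G0 = max (K * (R + R)) (L * (R + R))"
  have G0: "\<bar>chi_avg \<phi> w\<bar> \<le> G0" "\<bar>chi_avg a\<phi> w\<bar> \<le> G0" for w
    using chi_avg_bound[OF \<phi>_m K(2) \<phi>0, of R w] chi_avg_bound[OF a\<phi>_m L a\<phi>0, of R w] R by (auto simp: G0_def le_max_iff_disj)
  have xr: "xreg T s' (\<lambda>z. chi_avg \<phi> (U z))" "xreg T s' (\<lambda>z. chi_avg a\<phi> (U z))"
    by (rule xreg_chi_avg[OF s'(4) R \<phi>_m K(2) \<phi>0] xreg_chi_avg[OF s'(4) R a\<phi>_m L a\<phi>0]; simp)+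
  have d\<phi> [measurable]: "deriv \<phi> \<in> borel_measurable borel" using bump_on_deriv[OF \<phi>] by measurable
  \<comment> \<open>Finite measures in (t, x) that dominate the two terms on the right of the
    averaged equation: the image of |\<phi>'(v)| m, finite by the marginal bound, and K |S|.\<close>
  define \<nu>1 where "\<nu>1 = distr (density m (\<lambda>(t, x, v). ennreal \<bar>deriv \<phi> v\<bar>)) borel (\<lambda>(t, x, v). (t, x))"
  define \<nu>2 where "\<nu>2 = density lborel (\<lambda>z. ennreal (K * \<bar>S z\<bar>))"
  have \<nu>1: "(\<integral>\<^sup>+z. F z \<partial>\<nu>1) = (\<integral>\<^sup>+(t, x, v). ennreal \<bar>deriv \<phi> v\<bar> * F (t, x) \<partial>m)" if [measurable]: "F \<in> borel_measurable borel" for F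
    unfolding \<nu>1_def by (subst nn_integral_distr, measurable, subst nn_integral_density) (measurable, auto simp: case_prod_unfold)
  have \<nu>2: "(\<integral>\<^sup>+z. F z \<partial>\<nu>2) = (\<integral>\<^sup>+z. ennreal (K * \<bar>S z\<bar>) * F z \<partial>lborel)" if [measurable]: "F \<in> borel_measurable borel" for F
    unfolding \<nu>2_def by (subst nn_integral_density) auto
  have fin1: "finite_measure \<nu>1"
  proof (rule finite_measureI)
    have "emeasure \<nu>1 (space \<nu>1) = (\<integral>\<^sup>+z. 1 \<partial>\<nu>1)" by simp
    also have "\<dots> = (\<integral>\<^sup>+(t, x, v). ennreal \<bar>deriv \<phi> v\<bar> \<partial>m)" by (subst \<nu>1) auto
    also have "\<dots> \<le> ennreal M0 * (\<integral>\<^sup>+v. ennreal \<bar>deriv \<phi> v\<bar> \<partial>lborel)"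
      by (rule marginal_nn_integral[OF marginal sets_m _ M0(2)]) auto
    also have "\<dots> < \<infinity>"
      using bump_on_integrable[OF bump_on_deriv[OF \<phi>]] by (auto simp: integrable_iff_bounded ennreal_mult_less_top)
    finally show "emeasure \<nu>1 (space \<nu>1) \<noteq> \<infinity>" by simp
  qed
  have fin2: "finite_measure \<nu>2"
  proof (rule finite_measureI)
    have "emeasure \<nu>2 (space \<nu>2) = (\<integral>\<^sup>+z. 1 \<partial>\<nu>2)" by simp
    also have "\<dots> = ennreal K * (\<integral>\<^sup>+z. ennreal \<bar>S z\<bar> \<partial>lborel)"
      by (subst \<nu>2) (auto simp: ennreal_mult[OF K(1)] nn_integral_cmult)
    also have "\<dots> < \<infinity>" using S_integrable by (auto simp: integrable_iff_bounded ennreal_mult_less_top)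
    finally show "emeasure \<nu>2 (space \<nu>2) \<noteq> \<infinity>" by simp
  qed
  have "treg T s' (\<lambda>z. chi_avg \<phi> (U z))"
  proof (rule treg_from_equation[OF _ _ G0 xr s'(1,3) fin1 fin2])
    show "sets \<nu>1 = sets borel" "sets \<nu>2 = sets borel" by (simp_all add: \<nu>1_def \<nu>2_def)
    fix a b c d f g assume f: "bump_on a b f" "0 < a" "b < T" and g: "bump_on c d g"
    have [measurable]: "f \<in> borel_measurable borel" "g \<in> borel_measurable borel" using f(1) g by measurable
    have m: "(\<lambda>(t, x). ennreal (\<bar>f t\<bar> * \<bar>g x\<bar>)) \<in> borel_measurable borel" by measurable
    define Y where "Y = (LINT (t, x, v)|m. f t * g x * deriv \<phi> v)"
    define W where "W = (LINT (t, x)|lborel. S (t, x) * f t * g x * \<phi> (U (t, x)))"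
    have "ennreal \<bar>Y\<bar> \<le> (\<integral>\<^sup>+(t, x). ennreal (\<bar>f t\<bar> * \<bar>g x\<bar>) \<partial>\<nu>1)"
      unfolding Y_def \<nu>1[OF m]
      by (rule order_trans[OF ennreal_abs_integral_le]) (auto intro!: nn_integral_mono simp: abs_mult mult_ac simp flip: ennreal_mult)
    moreover have "ennreal \<bar>W\<bar> \<le> (\<integral>\<^sup>+(t, x). ennreal (\<bar>f t\<bar> * \<bar>g x\<bar>) \<partial>\<nu>2)"
      unfolding W_def \<nu>2[OF m]
    proof (rule order_trans[OF ennreal_abs_integral_le], rule nn_integral_mono, clarify)
      fix t x
      have "\<bar>S (t, x) * f t * g x * \<phi> (U (t, x))\<bar> \<le> K * \<bar>S (t, x)\<bar> * (\<bar>f t\<bar> * \<bar>g x\<bar>)"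
        using mult_right_mono[OF K(2)[of "U (t, x)"], of "\<bar>S (t, x)\<bar> * (\<bar>f t\<bar> * \<bar>g x\<bar>)"] by (simp add: abs_mult mult_ac)
      then have "ennreal \<bar>S (t, x) * f t * g x * \<phi> (U (t, x))\<bar> \<le> ennreal (K * \<bar>S (t, x)\<bar> * (\<bar>f t\<bar> * \<bar>g x\<bar>))" by (rule ennreal_leI)
      then show "ennreal \<bar>S (t, x) * f t * g x * \<phi> (U (t, x))\<bar> \<le> ennreal (K * \<bar>S (t, x)\<bar>) * ennreal (\<bar>f t\<bar> * \<bar>g x\<bar>)"
        using K(1) by (simp add: ennreal_mult)
    qed
    moreover have "ennreal \<bar>Y - W\<bar> \<le> ennreal \<bar>Y\<bar> + ennreal \<bar>W\<bar>" by (auto simp flip: ennreal_plus intro!: ennreal_leI)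
    ultimately show "ennreal \<bar>\<integral>(t, x). chi_avg \<phi> (U (t, x)) * (deriv f t * g x) + chi_avg a\<phi> (U (t, x)) * (f t * deriv g x) \<partial>lborel\<bar>
      \<le> (\<integral>\<^sup>+(t, x). ennreal (\<bar>f t\<bar> * \<bar>g x\<bar>) \<partial>\<nu>1) + (\<integral>\<^sup>+(t, x). ennreal (\<bar>f t\<bar> * \<bar>g x\<bar>) \<partial>\<nu>2)"
      unfolding a\<phi>_def[abs_def] averaged_equation[OF f g \<phi> L[unfolded a\<phi>_def]] Y_def[symmetric] W_def[symmetric]
      by (meson add_mono order_trans)
  qed measurable
  then show ?thesis
    by (intro sobolev_from_shifts[OF _ G0(1) xr(1) _ s(1) s'(2,3) T_pos]) measurable
qed

end

section \<open>Boundedness, and the passage between \<open>u\<close> and its Borel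
  representative\<close>

lemma AE_lborel_pair:
  assumes "AE z in (lborel :: ('a::euclidean_space \<times> 'b::euclidean_space) measure). P z"
  shows "AE x in lborel. AE y in lborel. P (x, y)"
proof -
  have "AE z in lborel \<Otimes>\<^sub>M lborel. P z" using assms unfolding lborel_prod .
  then show ?thesis by (rule lborel_pair.AE_pair)
qed

text \<open>In the double integral all pairs with either entry in the exceptional set have to be
  discarded; they form two null cylinders.\<close>

lemma sobolev_W1_loc_cong_AE:
  fixes f g :: "real \<times> real \<Rightarrow> real"
  assumes sob: "sobolev_W1_loc s \<Omega> f" and ae: "AE z in lborel. z \<in> \<Omega> \<longrightarrow> g z = f z"
  shows "sobolev_W1_loc s \<Omega> g"
  unfolding sobolev_W1_loc_def
proof (intro allI impI; elim conjE)
  fix V assume V: "open V" "compact (closure V)" "closure V \<subseteq> \<Omega>"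
  then have W: "sobolev_W1 s V f" using sob unfolding sobolev_W1_loc_def by blast
  obtain N where N: "{z. \<not> (z \<in> \<Omega> \<longrightarrow> g z = f z)} \<subseteq> N" "emeasure lborel N = 0" "N \<in> sets borel"
    using AE_E[OF ae] by auto
  have eq: "g z = f z" if "z \<in> V - N" for z using that N(1) V(3) closure_subset[of V] by blast
  have neg: "negligible N" using N by (auto simp: negligible_iff_null_sets null_sets_def)
  have "N \<times> UNIV \<in> null_sets (lborel \<Otimes>\<^sub>M lborel)" "UNIV \<times> N \<in> null_sets (lborel \<Otimes>\<^sub>M lborel)"
    using N(2,3) lborel.emeasure_pair_measure_Times[of N lborel UNIV] lborel.emeasure_pair_measure_Times[of UNIV lborel N]
    by (auto simp: null_sets_def)
  then have neg2: "negligible (N \<times> UNIV \<union> UNIV \<times> N)"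
    unfolding lborel_prod by (auto intro!: negligible_Un simp: negligible_iff_null_sets intro: null_sets_completionI)
  show "sobolev_W1 s V g"
    unfolding sobolev_W1_def
  proof
    show "g absolutely_integrable_on V"
      using W unfolding sobolev_W1_def by (intro absolutely_integrable_spike[OF _ neg eq]) auto
    show "s = 0 \<or> (\<lambda>(z, w). \<bar>g z - g w\<bar> / norm (z - w) powr (real DIM(real \<times> real) + s)) absolutely_integrable_on V \<times> V"
    proof (cases "s = 0")
      case False
      then have i: "(\<lambda>(z, w). \<bar>f z - f w\<bar> / norm (z - w) powr (real DIM(real \<times> real) + s)) absolutely_integrable_on V \<times> V"
        using W unfolding sobolev_W1_def by blast
      show ?thesis
      proof (rule disjI2, rule absolutely_integrable_spike[OF i neg2])
        fix p assume p: "p \<in> V \<times> V - (N \<times> UNIV \<union> UNIV \<times> N)"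
        obtain z w where zw: "p = (z, w)" by (cases p) auto
        have "g z = f z" "g w = f w" using p unfolding zw by (auto intro: eq)
        then show "(\<lambda>(z, w). \<bar>g z - g w\<bar> / norm (z - w) powr (real DIM(real \<times> real) + s)) p
          = (\<lambda>(z, w). \<bar>f z - f w\<bar> / norm (z - w) powr (real DIM(real \<times> real) + s)) p" unfolding zw by simp
      qed
    qed simp
  qed
qed

lemma kin_chi_integral: "(LINT v|lborel. kin_chi v w) = w"
proof -
  have i: "integrable lborel (\<lambda>v. indicator {a<..<b} v :: real)" for a b :: real
    by (intro integrable_real_indicator emeasure_bounded_finite) auto
  have "(LINT v|lborel. kin_chi v w) = (LINT v|lborel. indicator {0<..<w} v) - (LINT v|lborel. indicator {w<..<0} v)"
    unfolding kin_chi_def by (rule Bochner_Integration.integral_diff[OF i i])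
  also have "\<dots> = measure lborel {0<..<w} - measure lborel {w<..<0}" by simp
  also have "\<dots> = w" by (cases "0 \<le> w") (auto simp: measure_def emeasure_lborel_Ioo)
  finally show ?thesis .
qed

context kinetic_solution
begin

lemma U_bounded:
  assumes S_le: "AE z in lborel. \<bar>S z\<bar> \<le> C1" and C: "0 \<le> C1" "0 < C0"
    and init: "\<And>\<sigma> \<eta>. \<sigma> = 1 \<or> \<sigma> = -1 \<Longrightarrow> 0 < \<eta> \<Longrightarrow>
      \<exists>\<tau>>0. AE t in lborel. 0 < t \<and> t < \<tau> \<longrightarrow> (\<integral>\<^sup>+x. ennreal (\<sigma> * U (t, x) - C0) \<partial>lborel) \<le> ennreal \<eta>"
  shows "AE z in lborel. z \<in> {0<..<T} \<times> UNIV \<longrightarrow> \<bar>U z\<bar> \<le> C0 + C1 * T + 2"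
proof -
  have one_sided: "AE z in lborel. \<theta> < fst z \<and> fst z < T - \<theta> \<longrightarrow> \<sigma> * U z \<le> C0 + C1 * T + 2"
    if \<sigma>: "\<sigma> = 1 \<or> \<sigma> = -1" and \<theta>: "0 < \<theta>" "\<theta> < T / 2" for \<sigma> \<theta>
  proof -
    obtain sg where "half_problem T l sg M0 (\<lambda>z. \<sigma> * U z) (\<lambda>z. \<sigma> * S z) (reflected \<sigma>)"
      by (rule reflected_half_problem[OF \<sigma>])
    then show ?thesis
    proof (rule half_problem.upper_bound_step[OF _ \<theta> _ _ C])
      show "AE z in lborel. \<sigma> * S z \<le> C1" using S_le by eventually_elim (use \<sigma> in auto)
      show "integrable lborel (\<lambda>z. \<sigma> * U z)" using U_integrable by simp
    qed (use reflected_decay[OF \<sigma>] init[OF \<sigma>] in auto)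
  qed
  \<comment> \<open>These margins tend to 0 and are below T/2 for every n, as the one-sided estimate
    requires; applied to \<open>U\<close> and to -\<open>U\<close>, countably many of them exhaust
    (0, T).\<close>
  have "AE z in lborel. T / (real n + 3) < fst z \<and> fst z < T - T / (real n + 3) \<longrightarrow> \<bar>U z\<bar> \<le> C0 + C1 * T + 2" for n
  proof -
    have "T / (real n + 3) < T / 2" by (rule divide_strict_left_mono) (use T_pos in auto)
    moreover have "0 < T / (real n + 3)" using T_pos by simp
    ultimately have "AE z in lborel. T / (real n + 3) < fst z \<and> fst z < T - T / (real n + 3) \<longrightarrow> 1 * U z \<le> C0 + C1 * T + 2"
      "AE z in lborel. T / (real n + 3) < fst z \<and> fst z < T - T / (real n + 3) \<longrightarrow> - 1 * U z \<le> C0 + C1 * T + 2"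
      by (intro one_sided; simp)+
    then show ?thesis by eventually_elim auto
  qed
  then have "AE z in lborel. \<forall>n. T / (real n + 3) < fst z \<and> fst z < T - T / (real n + 3) \<longrightarrow> \<bar>U z\<bar> \<le> C0 + C1 * T + 2"
    by (intro AE_all_countable[THEN iffD2] allI)
  then show ?thesis
  proof eventually_elim
    case (elim z)
    show ?case
    proof
      assume "z \<in> {0<..<T} \<times> UNIV"
      define r where "r = min (fst z) (T - fst z)"
      have r: "0 < r" using \<open>z \<in> {0<..<T} \<times> UNIV\<close> by (auto simp: r_def)
      obtain n where "T / r < real n" using reals_Archimedean2 by blast
      then have "T / r < real n + 3" by linarith
      then have "T / (real n + 3) < r" using r by (simp add: divide_less_eq mult.commute)
      then have "T / (real n + 3) < fst z \<and> fst z < T - T / (real n + 3)" by (auto simp: r_def)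
      then show "\<bar>U z\<bar> \<le> C0 + C1 * T + 2" using elim by blast
    qed
  qed
qed

end

lemma continuous_L1_norm_bounded:
  assumes u: "continuous_L1 T u"
  obtains B where "\<And>t. t \<in> {0..T} \<Longrightarrow> (LINT x|lebesgue. \<bar>u t x\<bar>) \<le> B"
proof -
  have int: "integrable lebesgue (u t)" if "t \<in> {0..T}" for t using u that unfolding continuous_L1_def by blast
  have "continuous_on {0..T} (\<lambda>t. LINT x|lebesgue. \<bar>u t x\<bar>)"
    unfolding continuous_on_def
  proof
    fix t assume t: "t \<in> {0..T}"
    have "((\<lambda>r. LINT x|lebesgue. \<bar>u r x - u t x\<bar>) \<longlongrightarrow> 0) (at t within {0..T})" using u t unfolding continuous_L1_def by blast
    moreover have "\<forall>\<^sub>F r in at t within {0..T}. norm ((LINT x|lebesgue. \<bar>u r x\<bar>) - (LINT x|lebesgue. \<bar>u t x\<bar>)) \<le> (LINT x|lebesgue. \<bar>u r x - u t x\<bar>)"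
      unfolding eventually_at_filter
    proof (rule always_eventually, intro allI impI)
      fix r assume "r \<in> {0..T}"
      then have i: "integrable lebesgue (u r)" "integrable lebesgue (u t)" using int t by auto
      then have "(LINT x|lebesgue. \<bar>u r x\<bar>) - (LINT x|lebesgue. \<bar>u t x\<bar>) = (LINT x|lebesgue. \<bar>u r x\<bar> - \<bar>u t x\<bar>)" by simp
      moreover have "norm (LINT x|lebesgue. \<bar>u r x\<bar> - \<bar>u t x\<bar>) \<le> (LINT x|lebesgue. \<bar>u r x - u t x\<bar>)"
        by (rule Bochner_Integration.integral_norm_bound_integral) (use i in auto)
      ultimately show "norm ((LINT x|lebesgue. \<bar>u r x\<bar>) - (LINT x|lebesgue. \<bar>u t x\<bar>)) \<le> (LINT x|lebesgue. \<bar>u r x - u t x\<bar>)" by metis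
    qed
    ultimately have "((\<lambda>r. (LINT x|lebesgue. \<bar>u r x\<bar>) - (LINT x|lebesgue. \<bar>u t x\<bar>)) \<longlongrightarrow> 0) (at t within {0..T})"
      by (rule Lim_null_comparison[rotated])
    then show "((\<lambda>r. LINT x|lebesgue. \<bar>u r x\<bar>) \<longlongrightarrow> (LINT x|lebesgue. \<bar>u t x\<bar>)) (at t within {0..T})"
      by (rule LIM_zero_cancel)
  qed
  then have "bounded ((\<lambda>t. LINT x|lebesgue. \<bar>u t x\<bar>) ` {0..T})"
    by (intro compact_imp_bounded compact_continuous_image) auto
  then obtain B where B: "\<And>t. t \<in> {0..T} \<Longrightarrow> norm (LINT x|lebesgue. \<bar>u t x\<bar>) \<le> B" unfolding bounded_iff by blast
  show ?thesis by (rule that[of B]) (use B in force)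
qed

lemma nn_integral_lebesgue_real:
  assumes "integrable lebesgue f"
  shows "(\<integral>\<^sup>+x. ennreal \<bar>f x\<bar> \<partial>lborel) = ennreal (LINT x|lebesgue. \<bar>f x :: real\<bar>)"
  using nn_integral_eq_integral[of lebesgue "\<lambda>x. \<bar>f x\<bar>"] assms by (simp add: nn_integral_completion)

lemma continuous_L1_integrable:
  assumes T: "0 < T" and u: "continuous_L1 T u" and [measurable]: "U \<in> borel_measurable borel"
    and U0: "\<And>z. z \<notin> {0<..<T} \<times> UNIV \<Longrightarrow> U z = 0"
    and ae: "AE z in lborel. z \<in> {0<..<T} \<times> UNIV \<longrightarrow> u (fst z) (snd z) = U z"
  shows "integrable lborel U"
proof -
  obtain B where B: "\<And>t. t \<in> {0..T} \<Longrightarrow> (LINT x|lebesgue. \<bar>u t x\<bar>) \<le> B" by (rule continuous_L1_norm_bounded[OF u]) (rule that, blast)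
  have int: "integrable lebesgue (u t)" if "t \<in> {0..T}" for t using u that unfolding continuous_L1_def by blast
  have m: "(\<lambda>z. ennreal \<bar>U z\<bar>) \<in> borel_measurable borel" by measurable
  have B0: "0 \<le> B" using B[of 0] T by (intro order_trans[OF _ B[of 0]]) auto
  have "AE t in lborel. (\<integral>\<^sup>+x. ennreal \<bar>U (t, x)\<bar> \<partial>lborel) \<le> ennreal B * indicator {0..T} t"
    using AE_lborel_pair[OF ae]
  proof eventually_elim
    case (elim t)
    show ?case
    proof (cases "t \<in> {0<..<T}")
      case True
      have "(\<integral>\<^sup>+x. ennreal \<bar>U (t, x)\<bar> \<partial>lborel) = (\<integral>\<^sup>+x. ennreal \<bar>u t x\<bar> \<partial>lborel)"
        by (rule nn_integral_cong_AE) (use elim in \<open>eventually_elim, use True in auto\<close>)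
      also have "\<dots> = ennreal (LINT x|lebesgue. \<bar>u t x\<bar>)"
        by (rule nn_integral_lebesgue_real[OF int]) (use True in auto)
      also have "\<dots> \<le> ennreal B" using B[of t] True by (intro ennreal_leI) auto
      finally show ?thesis using True by (simp add: indicator_def)
    qed (use U0 in simp)
  qed
  then have "(\<integral>\<^sup>+z. ennreal \<bar>U z\<bar> \<partial>lborel) \<le> (\<integral>\<^sup>+t. ennreal B * indicator {0..T} t \<partial>lborel)"
    unfolding nn_integral_lborel_prod[OF m] by (rule nn_integral_mono_AE)
  also have "\<dots> = ennreal (B * T)" using T B0 by (simp add: nn_integral_cmult ennreal_mult)
  finally show ?thesis by (intro integrable_nnI) measurable
qed

text \<open>Restriction to the strip is built into the representatives: outside it \<open>U\<close>
  and \<open>R\<close> vanish, and so does the kinetic function of the value 0. Every integral of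
  the definition then becomes a Borel integral over the whole space.\<close>

lemma entropy_solution_kinetic:
  assumes T: "0 < T" and l: "1 \<le> l" and S: "S absolutely_integrable_on ({0..T} \<times> UNIV)"
    and A: "A = (\<lambda>v. \<bar>v\<bar> powr (l + 1)) \<or> A = (\<lambda>v. sgn v * \<bar>v\<bar> powr (l + 1))"
    and u: "entropy_solution T A S u\<^sub>0 u"
  obtains U R m \<mu> where "kinetic_solution T l A U R m \<mu>"
    "AE z in lborel. z \<in> {0<..<T} \<times> UNIV \<longrightarrow> u (fst z) (snd z) = U z"
    "AE z in lborel. z \<in> {0<..<T} \<times> UNIV \<longrightarrow> S z = R z"
    "\<And>z. z \<notin> {0<..<T} \<times> UNIV \<Longrightarrow> R z = 0"
proof -
  let ?X = "{0<..<T} \<times> (UNIV :: real set)"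
  let ?O = "{0<..<T} \<times> (UNIV :: real set) \<times> (UNIV :: real set)"
  have X [measurable]: "?X \<in> sets borel" by (intro borel_open open_Times) auto
  have O [measurable]: "?O \<in> sets borel" by (intro borel_open open_Times) auto
  have cu: "continuous_L1 T u" using u unfolding entropy_solution_def by blast
  obtain m \<mu> where m: "radon_measure_on ?O m" "L0_infinity \<mu>" "v_marginal_le m \<mu>" "kinetic_equation T A S u m"
    using u unfolding entropy_solution_def by blast
  have "(\<lambda>(t, x). u t x) \<in> borel_measurable (lebesgue_on ({0..T} \<times> UNIV))"
    using cu unfolding continuous_L1_def by blast
  moreover have "?X \<subseteq> {0..T} \<times> UNIV" by auto
  ultimately have uX: "(\<lambda>(t, x). u t x) \<in> borel_measurable (lebesgue_on ?X)" by (rule measurable_restrict_mono)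
  obtain U where U_m [measurable]: "U \<in> borel_measurable borel"
    and U0: "\<And>z. z \<notin> ?X \<Longrightarrow> U z = 0" and U': "AE z in lborel. z \<in> ?X \<longrightarrow> (case z of (t, x) \<Rightarrow> u t x) = U z"
    by (rule borel_version[OF uX X]) (rule that, assumption, blast, assumption)
  have U: "AE z in lborel. z \<in> ?X \<longrightarrow> u (fst z) (snd z) = U z" using U' by (simp add: case_prod_unfold)
  have "set_integrable lebesgue ?X S" by (rule set_integrable_subset[OF S]) auto
  then have S_int: "integrable lebesgue (\<lambda>z. indicator ?X z *\<^sub>R S z)" unfolding set_integrable_def .
  have SX: "integrable (lebesgue_on ?X) S"
    using S_int by (subst integrable_restrict_space) auto
  obtain R where R_m [measurable]: "R \<in> borel_measurable borel"
    and R0: "\<And>z. z \<notin> ?X \<Longrightarrow> R z = 0" and R: "AE z in lborel. z \<in> ?X \<longrightarrow> S z = R z"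
    by (rule borel_version[OF borel_measurable_integrable[OF SX] X]) (rule that, assumption, blast, assumption)
  have SR: "AE z in lborel. indicator ?X z *\<^sub>R S z = R z" using R by eventually_elim (use R0 in \<open>auto simp: indicator_def\<close>)
  have R_int: "integrable lborel R" by (rule integrable_borel_version[OF R_m SR, THEN iffD1, OF S_int])
  have sets_m: "sets m = sets (restrict_space borel ?O)" using m(1) unfolding radon_measure_on_def by blast
  have id: "(\<lambda>p. p) \<in> m \<rightarrow>\<^sub>M borel"
    unfolding measurable_cong_sets[OF sets_m refl] by (rule measurable_restrict_space1) simp
  \<comment> \<open>The measure \<open>m\<close> lives on the trace sigma-algebra of the open strip;
    the inclusion pushes it forward to all Borel sets without changing its marginal in v.\<close>
  define n where "n = distr m borel (\<lambda>p. p)"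
  have snd: "(\<lambda>(t::real, x::real, v::real). v) \<in> borel \<rightarrow>\<^sub>M borel" by measurable
  have "kinetic_solution T l A U R n \<mu>"
  proof
    show "0 < T" "1 \<le> l" "A = (\<lambda>v. \<bar>v\<bar> powr (l + 1)) \<or> A = (\<lambda>v. sgn v * \<bar>v\<bar> powr (l + 1))"
      "U \<in> borel_measurable borel" "integrable lborel R" "L0_infinity \<mu>" by fact+
    show "integrable lborel U" by (rule continuous_L1_integrable[OF T cu U_m U0 U])
    show "sets n = sets borel" by (simp add: n_def)
    have "distr n borel (\<lambda>(t, x, v). v) = distr m borel (\<lambda>(t, x, v). v)"
      unfolding n_def distr_distr[OF snd id] by (simp add: comp_def)
    then show "v_marginal_le n \<mu>" using m(3) unfolding v_marginal_le_def by simp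
    fix \<theta> :: "real \<times> real \<times> real \<Rightarrow> real"
    assume \<theta>: "test_function ?O \<theta>"
    have sm: "smooth \<theta>" using \<theta> unfolding test_function_def smooth_def by blast
    have [measurable]: "(\<lambda>p. frechet_derivative \<theta> (at p) h) \<in> borel_measurable borel" for h
      by (rule smooth_measurable[OF smooth_frechet[OF sm]])
    have [measurable]: "\<theta> \<in> borel_measurable borel" by (rule smooth_measurable[OF sm])
    have dA [measurable]: "deriv A \<in> borel_measurable borel"
    proof -
      have "deriv A = (\<lambda>v. (l + 1) * \<bar>v\<bar> powr l * sgn v) \<or> deriv A = (\<lambda>v. (l + 1) * \<bar>v\<bar> powr l)"
        using A abs_powr_DERIV[OF l, THEN DERIV_imp_deriv] by auto
      then show ?thesis by (elim disjE) simp_all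
    qed
    define F where "F = (\<lambda>p. frechet_derivative \<theta> (at p) (1, 0, 0) + deriv A (snd (snd p)) * frechet_derivative \<theta> (at p) (0, 1, 0))"
    have [measurable]: "F \<in> borel_measurable borel" unfolding F_def by measurable
    define G where "G = (\<lambda>p. kin_chi (snd (snd p)) (U (fst p, fst (snd p))) * F p)"
    have G_m: "G \<in> borel_measurable borel" unfolding G_def by measurable
    have 1: "(LINT (t, x, v):?O|lebesgue. kin_chi v (u t x) *
        (frechet_derivative \<theta> (at (t, x, v)) (1, 0, 0) + deriv A v * frechet_derivative \<theta> (at (t, x, v)) (0, 1, 0))) = integral\<^sup>L lborel G"
      unfolding set_lebesgue_integral_def
    proof (rule lebesgue_integral_borel_version[OF G_m])
      show "AE p in lborel. indicator ?O p *\<^sub>R (case p of (t, x, v) \<Rightarrow> kin_chi v (u t x) *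
        (frechet_derivative \<theta> (at (t, x, v)) (1, 0, 0) + deriv A v * frechet_derivative \<theta> (at (t, x, v)) (0, 1, 0))) = G p"
        using AE_lborel_lift[OF U]
      proof eventually_elim
        case (elim p)
        then show ?case using U0[of "(fst p, fst (snd p))"] by (cases p) (auto simp: G_def F_def indicator_def)
      qed
    qed
    define H where "H = (\<lambda>z. R z * \<theta> (fst z, snd z, U z))"
    have H_m: "H \<in> borel_measurable borel" unfolding H_def by measurable
    have 2: "(LINT (t, x):?X|lebesgue. S (t, x) * \<theta> (t, x, u t x)) = integral\<^sup>L lborel H"
      unfolding set_lebesgue_integral_def
    proof (rule lebesgue_integral_borel_version[OF H_m])
      show "AE z in lborel. indicator ?X z *\<^sub>R (case z of (t, x) \<Rightarrow> S (t, x) * \<theta> (t, x, u t x)) = H z"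
        using U R
      proof eventually_elim
        case (elim z)
        then show ?case using R0[of z] by (cases z) (auto simp: H_def indicator_def)
      qed
    qed
    have 3: "(LINT p|m. frechet_derivative \<theta> (at p) (0, 0, 1)) = (LINT p|n. frechet_derivative \<theta> (at p) (0, 0, 1))"
      unfolding n_def by (rule integral_distr[symmetric, OF id]) measurable
    have "- integral\<^sup>L lborel G = - (LINT p|n. frechet_derivative \<theta> (at p) (0, 0, 1)) + integral\<^sup>L lborel H"
      using m(4) \<theta> unfolding kinetic_equation_def 1[symmetric] 2[symmetric] 3[symmetric] by blast
    then show "(LINT (t, x, v)|lborel. kin_chi v (U (t, x)) *
          (frechet_derivative \<theta> (at (t, x, v)) (1, 0, 0) + deriv A v * frechet_derivative \<theta> (at (t, x, v)) (0, 1, 0)))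
      = (LINT p|n. frechet_derivative \<theta> (at p) (0, 0, 1)) - (LINT (t, x)|lborel. R (t, x) * \<theta> (t, x, U (t, x)))"
      unfolding G_def F_def H_def by (simp add: case_prod_unfold)
  qed
  then show ?thesis by (rule that[OF _ U R R0])
qed

section \<open>Conclusion\<close>

text \<open>The initial condition is stated for kinetic functions. Integrating it in v gives back
  the functions themselves, by \<open>kin_chi_integral\<close>.\<close>

lemma initial_bound:
  assumes u: "entropy_solution T A S u\<^sub>0 u" and b: "ess_bounded_on UNIV u\<^sub>0"
  obtains C where "0 < C" "AE x in lborel. \<bar>u 0 x\<bar> \<le> C"
proof -
  have "AE z in lborel. kin_chi (snd z) (u 0 (fst z)) = kin_chi (snd z) (u\<^sub>0 (fst z))"
    using u unfolding entropy_solution_def AE_lebesgue_iff by (simp add: case_prod_unfold)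
  then have "AE x in lborel. AE v in lborel. kin_chi v (u 0 x) = kin_chi v (u\<^sub>0 x)"
    by (rule AE_lborel_pair[of "\<lambda>z. kin_chi (snd z) (u 0 (fst z)) = kin_chi (snd z) (u\<^sub>0 (fst z))", simplified])
  then have eq: "AE x in lborel. u 0 x = u\<^sub>0 x"
  proof eventually_elim
    case (elim x)
    have "(LINT v|lborel. kin_chi v (u 0 x)) = (LINT v|lborel. kin_chi v (u\<^sub>0 x))"
      by (rule integral_cong_AE[OF _ _ elim]) measurable
    then show ?case by (simp add: kin_chi_integral)
  qed
  obtain C where "AE x in lborel. \<bar>u\<^sub>0 x\<bar> \<le> C"
    using b unfolding ess_bounded_on_def lebesgue_on_UNIV_eq AE_lebesgue_iff by blast
  with eq have "AE x in lborel. \<bar>u 0 x\<bar> \<le> max C 1" by eventually_elim auto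
  then show ?thesis by (rule that[rotated]) simp
qed

text \<open>Where |u(0, x)| \<le> C, the excess of \<sigma> u(t, x) over C is at most |u(t, x) -
  u(0, x)|, whose integral is small by continuity in L1.\<close>

lemma initial_overshoot:
  assumes T: "0 < T" and cu: "continuous_L1 T u" and C: "AE x in lborel. \<bar>u 0 x\<bar> \<le> C"
    and ae: "AE z in lborel. z \<in> {0<..<T} \<times> UNIV \<longrightarrow> u (fst z) (snd z) = U z"
    and \<sigma>: "\<sigma> = 1 \<or> \<sigma> = -1" and \<eta>: "0 < \<eta>"
  shows "\<exists>\<tau>>0. AE t in lborel. 0 < t \<and> t < \<tau> \<longrightarrow> (\<integral>\<^sup>+x. ennreal (\<sigma> * U (t, x) - C) \<partial>lborel) \<le> ennreal \<eta>"
proof -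
  have "((\<lambda>\<tau>. LINT x|lebesgue. \<bar>u \<tau> x - u 0 x\<bar>) \<longlongrightarrow> 0) (at 0 within {0..T})"
    using cu T unfolding continuous_L1_def by auto
  from tendstoD[OF this \<eta>] obtain d where d: "0 < d"
    and d': "\<And>t. t \<in> {0..T} \<Longrightarrow> t \<noteq> 0 \<Longrightarrow> \<bar>t\<bar> < d \<Longrightarrow> \<bar>LINT x|lebesgue. \<bar>u t x - u 0 x\<bar>\<bar> < \<eta>"
    unfolding eventually_at dist_real_def by auto
  have int: "integrable lebesgue (u t)" if "t \<in> {0..T}" for t using cu that unfolding continuous_L1_def by blast
  have "AE t in lborel. 0 < t \<and> t < min d T \<longrightarrow> (\<integral>\<^sup>+x. ennreal (\<sigma> * U (t, x) - C) \<partial>lborel) \<le> ennreal \<eta>"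
    using AE_lborel_pair[OF ae]
  proof eventually_elim
    case (elim t)
    show ?case
    proof
      assume t: "0 < t \<and> t < min d T"
      have i: "integrable lebesgue (\<lambda>x. u t x - u 0 x)" using int[of t] int[of 0] t by auto
      have "(\<integral>\<^sup>+x. ennreal (\<sigma> * U (t, x) - C) \<partial>lborel) \<le> (\<integral>\<^sup>+x. ennreal \<bar>u t x - u 0 x\<bar> \<partial>lborel)"
        by (rule nn_integral_mono_AE) (use elim C in \<open>eventually_elim, use t \<sigma> in \<open>auto intro!: ennreal_leI\<close>\<close>)
      also have "\<dots> = ennreal (LINT x|lebesgue. \<bar>u t x - u 0 x\<bar>)" by (rule nn_integral_lebesgue_real[OF i])
      also have "\<dots> \<le> ennreal \<eta>" using d'[of t] t by (intro ennreal_leI) auto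
      finally show "(\<integral>\<^sup>+x. ennreal (\<sigma> * U (t, x) - C) \<partial>lborel) \<le> ennreal \<eta>" .
    qed
  qed
  then show ?thesis using d T by (intro exI[of _ "min d T"]) auto
qed

lemma test_function_bump_on:
  assumes "test_function UNIV \<phi>"
  obtains R where "0 < R" "bump_on (- R) R \<phi>"
proof -
  have "bounded {z. \<phi> z \<noteq> 0}"
    using assms unfolding test_function_def by (meson bounded_closure_image compact_imp_bounded bounded_subset closure_subset)
  then obtain R where R: "0 < R" "\<And>z. \<phi> z \<noteq> 0 \<Longrightarrow> \<bar>z\<bar> \<le> R" unfolding bounded_pos by auto
  have "bump_on (- R) R \<phi>"
    using assms R(2) unfolding bump_on_def test_function_def smooth_def by force
  with R(1) show ?thesis by (rule that)
qed

text \<open>This is how bounded solutions become velocity averages: the kinetic function of a value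
  in [-M, M] vanishes wherever the weight differs from 1.\<close>

lemma chi_avg_plateau:
  assumes "\<bar>w\<bar> \<le> M"
  shows "chi_avg (plateau (- M) M 1) w = w"
proof -
  have *: "kin_chi v w * plateau (- M) M 1 v = kin_chi v w" for v
  proof (cases "\<bar>v\<bar> \<le> M")
    case True
    then show ?thesis using plateau_eq_1[of 1 "- M" v M] by auto
  next
    case False
    then have "kin_chi v w = 0" using assms by (auto simp: kin_chi_def indicator_def)
    then show ?thesis by simp
  qed
  show ?thesis unfolding chi_avg_def * by (rule kin_chi_integral)
qed

theorem proposition1:
  fixes T l :: real
    and u\<^sub>0 :: "real \<Rightarrow> real"
    and S :: "real \<times> real \<Rightarrow> real"
    and A :: "real \<Rightarrow> real"
    and u :: "real \<Rightarrow> real \<Rightarrow> real"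
  assumes "T > 0" and "l \<ge> 1"
    and "u\<^sub>0 absolutely_integrable_on UNIV"
    and "S absolutely_integrable_on ({0..T} \<times> UNIV)"
    and "A = (\<lambda>v. \<bar>v\<bar> powr (l + 1)) \<or> A = (\<lambda>v. sgn v * \<bar>v\<bar> powr (l + 1))"
    and "entropy_solution T A S u\<^sub>0 u"
  shows "(\<forall>\<phi>. test_function UNIV \<phi> \<longrightarrow>
            (\<forall>s. 0 \<le> s \<and> s < min (1 / 3) (1 / (l + 1)) \<longrightarrow>
               sobolev_W1_loc s ({0<..<T} \<times> UNIV)
                 (\<lambda>(t, x). LINT v|lebesgue. kin_chi v (u t x) * \<phi> v)))
       \<and> (ess_bounded_on UNIV u\<^sub>0 \<and> ess_bounded_on ({0..T} \<times> UNIV) S \<longrightarrow>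
            (\<forall>s. 0 \<le> s \<and> s < min (1 / 3) (1 / (l + 1)) \<longrightarrow>
               sobolev_W1_loc s ({0<..<T} \<times> UNIV) (\<lambda>(t, x). u t x)))"
proof -
  obtain U R m \<mu> where kin: "kinetic_solution T l A U R m \<mu>"
    and U: "AE z in lborel. z \<in> {0<..<T} \<times> UNIV \<longrightarrow> u (fst z) (snd z) = U z"
    and R: "AE z in lborel. z \<in> {0<..<T} \<times> UNIV \<longrightarrow> S z = R z"
    and R0: "\<And>z. z \<notin> {0<..<T} \<times> UNIV \<Longrightarrow> R z = 0"
    by (rule entropy_solution_kinetic[OF assms(1,2,4,5,6)]) (rule that, assumption, assumption, assumption, blast)
  interpret kinetic_solution T l A U R m \<mu> by (rule kin)
  show ?thesis
  proof (intro conjI allI impI; elim conjE)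
    fix \<phi> :: "real \<Rightarrow> real" and s assume \<phi>: "test_function UNIV \<phi>" and s: "0 \<le> s" "s < min (1 / 3) (1 / (l + 1))"
    obtain r where r: "0 < r" "bump_on (- r) r \<phi>" by (rule test_function_bump_on[OF \<phi>])
    have [measurable]: "\<phi> \<in> borel_measurable borel" using r(2) by measurable
    have avg: "(LINT v|lebesgue. kin_chi v w * \<phi> v) = chi_avg \<phi> w" for w
      unfolding chi_avg_def by (rule integral_completion) measurable
    show "sobolev_W1_loc s ({0<..<T} \<times> UNIV) (\<lambda>(t, x). LINT v|lebesgue. kin_chi v (u t x) * \<phi> v)"
      by (rule sobolev_W1_loc_cong_AE[OF sobolev_chi_avg[OF r(2,1) s]])
        (use U in \<open>eventually_elim, auto simp: avg\<close>)
  next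
    fix s assume b: "ess_bounded_on UNIV u\<^sub>0" "ess_bounded_on ({0..T} \<times> UNIV) S"
      and s: "0 \<le> s" "s < min (1 / 3) (1 / (l + 1))"
    obtain C0 where C0: "0 < C0" "AE x in lborel. \<bar>u 0 x\<bar> \<le> C0"
      by (rule initial_bound[OF assms(6) b(1)])
    obtain C1 where "AE z in lebesgue_on ({0..T} \<times> UNIV). \<bar>S z\<bar> \<le> C1"
      using b(2) unfolding ess_bounded_on_def by blast
    moreover have "{0..T} \<times> (UNIV :: real set) \<in> sets borel" by (intro borel_closed closed_Times) auto
    ultimately have "AE z in lborel. z \<in> {0..T} \<times> UNIV \<longrightarrow> \<bar>S z\<bar> \<le> C1"
      by (subst (asm) AE_restrict_space_iff) (auto simp: AE_lebesgue_iff)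
    with R have R_le: "AE z in lborel. \<bar>R z\<bar> \<le> max C1 0"
    proof eventually_elim
      case (elim z)
      then show ?case using R0[of z] by (cases "z \<in> {0<..<T} \<times> UNIV") (auto simp: le_max_iff_disj)
    qed
    define M where "M = C0 + max C1 0 * T + 2"
    have cu: "continuous_L1 T u" using assms(6) unfolding entropy_solution_def by blast
    have M: "AE z in lborel. z \<in> {0<..<T} \<times> UNIV \<longrightarrow> \<bar>U z\<bar> \<le> M"
      unfolding M_def
      by (rule U_bounded[OF R_le _ C0(1)]) (use initial_overshoot[OF assms(1) cu C0(2) U] in auto)
    have "0 \<le> max C1 0 * T" using assms(1) by simp
    then have "0 < M" using C0(1) by (simp add: M_def)
    have "bump_on (- (M + 2)) (M + 2) (plateau (- M) M 1)" using plateau_bump[of 1 "- M" M] by simp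
    from sobolev_chi_avg[OF this _ s] have "sobolev_W1_loc s ({0<..<T} \<times> UNIV) (\<lambda>z. chi_avg (plateau (- M) M 1) (U z))"
      using \<open>0 < M\<close> by simp
    then show "sobolev_W1_loc s ({0<..<T} \<times> UNIV) (\<lambda>(t, x). u t x)"
      by (rule sobolev_W1_loc_cong_AE) (use U M in \<open>eventually_elim, auto simp: chi_avg_plateau\<close>)
  qed
qed

end
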